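(* Let $\overline{N}_2(s,5,n)$ denote the number of overpartitions of $n$ whose $M_2$-rank is congruent to $s$ modulo $5$, and for $s,t\in\{0,1,2,3,4\}$, $d\in\{0,1,2,3,4\}$ set $$R_{st}(d)=\sum_{n\ge 0}\bigl(\overline{N}_2(s,5,5n+d)-\overline{N}_2(t,5,5n+d)\bigr)q^n .$$ Then, as formal power series (equivalently for $0<|q|<1$): $$R_{12}(0) = \frac{10q^2(q^{10};q^{10})_\infty^4 (q,q^2,q^8,q^9;q^{10})_\infty}{(q)_\infty^3(q;q^2)_\infty} + \frac{2q(q^5;q^5)_\infty}{(q;q^2)_\infty^5(q^3,q^4,q^6,q^7;q^{10})_\infty},$$ $$R_{12}(1) = \frac{-6q^3(-q^5;q^5)_\infty}{(q^5;q^5)_\infty}\sum_{n\in\mathbb{Z}}\frac{(-1)^nq^{5n^2+10n}}{1-q^{10n+4}} + \frac{4q(q^{10};q^{10})_\infty^2}{(q;q^2)_\infty^5(q^4,q^6;q^{10})_\infty(q^5;q^5)_\infty} + \frac{20q^3(q^{10};q^{10})_\infty^7(q,q^9;q^{10})_\infty^2(q^2,q^8;q^{10})_\infty^3}{(q)_\infty^4(q^5;q^5)_\infty^2},$$ $$R_{12}(2) = \frac{10q(q^{10};q^{10})_\infty^3}{(q)_\infty^2(q^3,q^7;q^{10})_\infty^3(q,q^2,q^8,q^9;q^{10})_\infty},$$ $$R_{12}(3) = \frac{10(q^{10};q^{10})_\infty^3}{(q)_\infty^2(q^3,q^4,q^6,q^7;q^{10})_\infty(q,q^9;q^{10})_\infty^3}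 - \frac{8(q^5;q^5)_\infty}{(q;q^2)_\infty^5(q^2,q^3,q^7,q^8;q^{10})_\infty},$$ $$R_{12}(4) = \frac{-2q(-q^5;q^5)_\infty}{(q^5;q^5)_\infty}\sum_{n\in\mathbb{Z}}\frac{(-1)^nq^{5n^2+10n}}{1-q^{10n+2}} + \frac{4(q^2;q^2)_\infty}{(q;q^2)_\infty^4(q^2,q^3,q^7,q^8;q^{10})_\infty^3},$$ $$R_{02}(0) = -1 + \frac{(q^5;q^5)_\infty^6}{(q;q^2)_\infty^6(q^3,q^4,q^6,q^7;q^{10})_\infty(q^{10};q^{10})_\infty^5} + \frac{q^2(q)_\infty(q^{10};q^{10})_\infty}{(q^3,q^4,q^6,q^7;q^{10})_\infty^3(q^5;q^5)_\infty} + \frac{4q(q^5;q^5)_\infty^2(q,q^9;q^{10})_\infty}{(q;q^2)_\infty^6(q^4,q^6,q^{10};q^{10})_\infty} - \frac{10q^2(q^{10};q^{10})_\infty^3}{(q)_\infty^2(q^2,q^8;q^{10})_\infty(q^3,q^7;q^{10})_\infty^4},$$ $$R_{02}(1) = \frac{2q^3(-q^5;q^5)_\infty}{(q^5;q^5)_\infty}\sum_{n\in\mathbb{Z}}\frac{(-1)^nq^{5n^2+10n}}{1-q^{10n+4}} + \frac{2(q^5;q^5)_\infty^4}{(q;q^2)_\infty^6(q^4,q^6;q^{10})_\infty(q^{10};q^{10})_\infty^3} + \frac{2q^2(q)_\infty(q^{10};q^{10})_\infty^3}{(q^3,q^7;q^{10})_\infty^2(q^4,q^6;q^{10})_\infty^3(q^5;q^5)_\infty^3},$$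 $$R_{02}(2) = \frac{4(q^3,q^7;q^{10})_\infty(q^5;q^5)_\infty^2}{(q;q^2)_\infty^6(q^4,q^6,q^{10};q^{10})_\infty} - \frac{10q(q^{10};q^{10})_\infty^3}{(q)_\infty^2(q^3,q^7;q^{10})_\infty^3(q,q^2,q^8,q^9;q^{10})_\infty},$$ $$R_{02}(3) = \frac{4(q^5;q^5)_\infty}{(q;q^2)_\infty^5(q^2,q^3,q^7,q^8;q^{10})_\infty},$$ $$R_{02}(4) = \frac{4q(-q^5;q^5)_\infty}{(q^5;q^5)_\infty}\sum_{n\in\mathbb{Z}}\frac{(-1)^nq^{5n^2+10n}}{1-q^{10n+2}} - \frac{10(q^{10};q^{10})_\infty^3(q^5;q^5)_\infty(q^4,q^6;q^{10})_\infty}{(q,q^9;q^{10})_\infty(q)_\infty^3(q^3,q^7;q^{10})_\infty} - \frac{2(q^{10};q^{10})_\infty(-q^2,-q^3;q^5)_\infty}{q(-q,-q^4;q^5)_\infty(q,q^2,q^8,q^9;q^{10})_\infty} + \frac{2(q^5;q^5)_\infty^2(q^2,q^8;q^{10})_\infty^5(q^{10};q^{10})_\infty^2}{q(q;q^2)_\infty^4(q,q^9;q^{10})_\infty^4(q^2;q^2)_\infty^3}.$$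
   Context: Notation: $(a_1,\dots,a_j;q)_\infty=\prod_{k\ge 0}(1-a_1q^k)\cdots(1-a_jq^k)$, and $(q)_\infty=(q;q)_\infty$, $(-q)_\infty=(-q;q)_\infty$. An overpartition of $n$ is a partition of $n$ in which the first occurrence of each distinct part may (or may not) be overlined. For an overpartition $\lambda$, let $\ell(\lambda)$ be its largest part, $n(\lambda)$ its number of parts, $\lambda_o$ the subpartition consisting of the odd non-overlined parts, and $\chi(\lambda)=1$ if the largest part of $\lambda$ is odd and non-overlined, $\chi(\lambda)=0$ otherwise. The $M_2$-rank of $\lambda$ is $\lceil \ell(\lambda)/2\rceil - n(\lambda)+n(\lambda_o)-\chi(\lambda)$. Convention: $\overline{N}_2(s,\ell,0)=0$ for all $s$ (the empty overpartition is not counted), as dictated by the paper's generating function for $M_2$-ranks. *)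

theory Defs
  imports
    "HOL-Analysis.Analysis"
    "HOL-Library.Multiset"
    "HOL-Number_Theory.Cong"
    "HOL-Computational_Algebra.Formal_Power_Series"
begin

(* The q-shifted factorial (a_1, ..., a_j; q)_infinity, with as = [a_1, ..., a_j]. *)
definition qpoch :: "complex list \<Rightarrow> complex \<Rightarrow> complex" where
  "qpoch as q = (\<Prod>k. \<Prod>a\<leftarrow>as. (1 - a * q ^ k))"

(* An overpartition is encoded as a pair (M, S): M is the multiset of all its parts
   (overlined or not), and S is the set of those part sizes whose first occurrence is
   overlined. *)
type_synonym overpartition = "nat multiset \<times> nat set"

definition overpartition_of :: "nat \<Rightarrow> overpartition \<Rightarrow> bool" where
  "overpartition_of n \<pi> \<longleftrightarrow>
     0 \<notin># fst \<pi> \<and> sum_mset (fst \<pi>) = n \<and> snd \<pi> \<subseteq> set_mset (fst \<pi>)"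

(* Only meaningful for nonempty overpartitions. *)
definition largest_part :: "overpartition \<Rightarrow> nat" where
  "largest_part \<pi> = Max (set_mset (fst \<pi>))"

definition num_parts :: "overpartition \<Rightarrow> nat" where
  "num_parts \<pi> = size (fst \<pi>)"

definition odd_nonoverlined :: "overpartition \<Rightarrow> nat multiset" where
  "odd_nonoverlined \<pi> = filter_mset odd (fst \<pi> - mset_set (snd \<pi>))"

(* The overlined occurrence of a part precedes the other occurrences of the same size, so
   the largest part counts as non-overlined iff no occurrence of its size is overlined. *)
definition chi :: "overpartition \<Rightarrow> nat" where
  "chi \<pi> = (if odd (largest_part \<pi>) \<and> largest_part \<pi> \<notin> snd \<pi> then 1 else 0)"

definition M2_rank :: "overpartition \<Rightarrow> int" where
  "M2_rank \<pi> = \<lceil>real (largest_part \<pi>) / 2\<rceil> - int (num_parts \<pi>)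
     + int (size (odd_nonoverlined \<pi>)) - int (chi \<pi>)"

(* The empty overpartition is not counted, so N2_bar s l 0 = 0. *)
definition N2_bar :: "int \<Rightarrow> nat \<Rightarrow> nat \<Rightarrow> nat" where
  "N2_bar s l n =
     card {\<pi>. overpartition_of n \<pi> \<and> fst \<pi> \<noteq> {#} \<and> [M2_rank \<pi> = s] (mod int l)}"

definition R :: "int \<Rightarrow> int \<Rightarrow> nat \<Rightarrow> complex fps" where
  "R s t d = Abs_fps (\<lambda>n. of_nat (N2_bar s 5 (5 * n + d)) - of_nat (N2_bar t 5 (5 * n + d)))"

definition bilateral_sum :: "int \<Rightarrow> complex \<Rightarrow> complex" where
  "bilateral_sum c q =
     (\<Sum>\<^sub>\<infinity>n\<in>(UNIV :: int set).
        (-1) powi n * q powi (5 * n ^ 2 + 10 * n) / (1 - q powi (10 * n + c)))"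

definition fps_value :: "complex fps \<Rightarrow> complex \<Rightarrow> complex \<Rightarrow> bool" where
  "fps_value f q v \<longleftrightarrow> (\<lambda>n. fps_nth f n * q ^ n) sums v"

end

theory Submission
  imports Defs
begin

text \<open>Splitting overpartitions by their largest part turns the two-variable generating function of
  the M2-rank into a single series, which satisfies a first-order q-difference equation in the
  rank variable. Comparing Laurent coefficients gives a two-term recurrence for tail sums over the
  rank; it has only one bounded solution, and so the rank classes modulo 5 are expressed by the
  Lambert series with terms \<open>(-1)^n p^(n^2 + 2kn) / (1 - p^(10n))\<close>, \<open>n \<noteq> 0\<close>, divided by
  \<open>phi p = \<Sum> (-1)^n p^(n^2)\<close>.

  Put \<open>q = p^5\<close>. Splitting \<open>n\<close> modulo 5 writes \<open>phi p\<close> and the Lambert series as polynomials in \<open>p\<close> over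
  theta functions and Appell sums in \<open>q\<close>, and a change-of-argument formula reduces the Appell sums
  to the two bilateral sums of the theorem plus theta quotients. Comparing coefficients of powers
  of \<open>p\<close> leaves identities between products of theta functions of nome \<open>q^10\<close>. Three-term relations
  parametrise all quotients involved by \<open>u = q J_1 J_2 / (J_3 J_4)\<close>, and each identity becomes a
  polynomial identity in \<open>u\<close>.\<close>

section \<open>Theta functions and the triple product\<close>

text \<open>The stated right-hand sides are verified, not derived: with \<open>p^5 = q\<close>, the
  sum over \<open>d\<close> of \<open>p^d\<close> times the theta part of the claimed value is
  multiplied by \<open>phi p\<close> and compared with the combination of Lambert series; modulo
  \<open>p^5 = q\<close> this is a circulant system of five equations for each pair of classes.
  Boundedness singles out one solution of the tail recurrence because nonzero solutions of its
  homogeneous form grow like \<open>q^(-k^2)\<close>. The Lambert series have a hole at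
  \<open>n = 0\<close>, so their residue class 0 is an Appell sum at the pole \<open>t = 1\<close>,
  reached as a limit; this limit produces logarithmic derivatives of theta functions, and just two
  combinations of them survive, both theta quotients. The change of argument is linear algebra:
  \<open>j(t)\<close> times an Appell sum lies in a fixed two-dimensional space of theta functions,
  so its values at three points are linked by 2 by 2 minors, and its value at \<open>t = 1\<close>
  is explicit. All Appell sums are moved to the point where \<open>c t = q^5\<close>: there the
  summands take the shape of the two bilateral sums, and one logarithmic derivative
  vanishes.\<close>

lemma infsum_tendsto_dominated:
  fixes f :: "'b \<Rightarrow> 'a \<Rightarrow> 'c::banach"
  assumes lim: "\<And>k. k \<in> A \<Longrightarrow> ((\<lambda>x. f x k) \<longlongrightarrow> g k) F"
    and bound: "eventually (\<lambda>x. \<forall>k\<in>A. norm (f x k) \<le> h k) F"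
    and h: "h summable_on A" and F: "F \<noteq> bot"
  shows "((\<lambda>x. infsum (f x) A) \<longlongrightarrow> infsum g A) F"
proof -
  have gb: "norm (g k) \<le> h k" if "k \<in> A" for k
    using bound that by (intro tendsto_upperbound[OF tendsto_norm[OF lim[OF that]] _ F])
      (auto elim: eventually_mono)
  have h0: "h k \<ge> 0" if "k \<in> A" for k using gb[OF that] norm_ge_zero order_trans by blast
  have gs: "(\<lambda>k. norm (g k)) summable_on A"
    by (rule Infinite_Sum.abs_summable_on_comparison_test'[OF h gb])
  have fs: "eventually (\<lambda>x. (\<lambda>k. norm (f x k)) summable_on A) F"
    using bound by eventually_elim (rule Infinite_Sum.abs_summable_on_comparison_test'[OF h], auto)
  show ?thesis
  proof (rule tendstoI)
    fix e :: real assume "e > 0"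
    then have e: "e/4 > 0" by simp
    \<comment> \<open>Outside \<open>S\<close> the majorant has mass at most \<open>e/4\<close>,
      which bounds the tails of \<open>f x\<close> and of \<open>g\<close> alike; the finite part
      over \<open>S\<close> supplies the third error term.\<close>
    obtain S where S: "finite S" "S \<subseteq> A" "dist (sum h S) (infsum h A) \<le> e/4"
      using infsum_finite_approximation[OF h e] by blast
    have hs: "h summable_on (A - S)" using h by (rule summable_on_subset_banach) auto
    have "infsum h A = sum h S + infsum h (A - S)"
      using S infsum_Un_disjoint[of h S "A - S"] hs
      by (simp add: Un_absorb1 Int_Diff)
    then have tail: "infsum h (A - S) \<le> e/4" using S(3) by (simp add: dist_real_def)
    have tailb: "norm (infsum u (A - S)) \<le> e/4" if "\<forall>k\<in>A. norm (u k) \<le> h k" for u :: "'a \<Rightarrow> 'c"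
    proof -
      have "norm (infsum u (A - S)) \<le> infsum h (A - S)"
        by (rule norm_infsum_le[OF _ has_sum_infsum[OF hs]])
          (use that in \<open>auto intro!: has_sum_infsum abs_summable_summable
             Infinite_Sum.abs_summable_on_comparison_test'[OF hs]\<close>)
      then show ?thesis using tail by linarith
    qed
    have split: "infsum u A = sum u S + infsum u (A - S)" if "(\<lambda>k. norm (u k)) summable_on A" for u :: "'a \<Rightarrow> 'c"
    proof -
      have "u summable_on (A - S)"
        using abs_summable_summable[OF that] by (rule summable_on_subset_banach) auto
      then show ?thesis
        using S infsum_Un_disjoint[of u S "A - S"] by (simp add: Un_absorb1 Int_Diff)
    qed
    have "((\<lambda>x. sum (f x) S) \<longlongrightarrow> sum g S) F"
      using S(2) by (intro tendsto_sum lim) auto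
    from tendstoD[OF this e]
    show "eventually (\<lambda>x. dist (infsum (f x) A) (infsum g A) < e) F"
      using fs bound
    proof eventually_elim
      case (elim x)
      have "dist (infsum (f x) A) (infsum g A)
          = norm ((sum (f x) S - sum g S) + infsum (f x) (A - S) - infsum g (A - S))"
        using split[OF elim(2)] split[OF gs] by (simp add: dist_norm algebra_simps)
      also have "\<dots> \<le> norm (sum (f x) S - sum g S) + norm (infsum (f x) (A - S)) + norm (infsum g (A - S))"
        by (meson norm_triangle_ineq norm_triangle_ineq4 add_right_mono order_trans)
      also have "\<dots> < e"
        using elim(1) tailb[of "f x"] tailb[of g] gb elim(3) \<open>e > 0\<close> by (auto simp: dist_norm)
      finally show ?case .
    qed
  qed
qed

lemma abs_summable_on_int:
  fixes f :: "int \<Rightarrow> 'a::banach"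
  assumes "summable (\<lambda>k. norm (f (int k)))" "summable (\<lambda>k. norm (f (- int k - 1)))"
  shows "(\<lambda>n. norm (f n)) summable_on UNIV"
proof -
  have 1: "(\<lambda>n. norm (f n)) summable_on range int"
    by (subst summable_on_reindex) (use assms(1) in \<open>auto intro!: norm_summable_imp_summable_on simp: o_def\<close>)
  have 2: "(\<lambda>n. norm (f n)) summable_on range (\<lambda>k. - int k - 1)"
    by (subst summable_on_reindex)
      (use assms(2) in \<open>auto intro!: norm_summable_imp_summable_on injI simp: o_def\<close>)
  have "UNIV = range int \<union> range (\<lambda>k. - int k - 1)"
  proof -
    have "n \<in> range int \<or> n \<in> range (\<lambda>k. - int k - 1)" for n :: int
    proof (cases "n \<ge> 0")
      case False
      then have "n = - int (nat (- n - 1)) - 1" by simp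
      then show ?thesis by blast
    qed (metis nat_0_le rangeI)
    then show ?thesis by auto
  qed
  then show ?thesis using summable_on_union[OF 1 2] by simp
qed

section \<open>Gaussian sums and theta series with the integer exponents n(n-1)/2\<close>

definition tri :: "int \<Rightarrow> int" where "tri n = n * (n - 1) div 2"

lemma two_tri: "2 * tri n = n * (n - 1)"
proof -
  have "even (n * (n - 1))" by auto
  then show ?thesis unfolding tri_def by auto
qed

lemma tri_add: "tri (m + n) = tri m + tri n + m * n"
proof -
  have "2 * tri (m + n) = 2 * (tri m + tri n + m * n)"
    unfolding distrib_left two_tri by (simp add: algebra_simps)
  then show ?thesis by simp
qed

lemma tri_simps [simp]: "tri 0 = 0" "tri 1 = 0" "tri 2 = 1" "tri (-1) = 1"
  by (auto simp: tri_def)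

lemma tri_minus: "tri (- n) = tri n + n"
proof -
  have "2 * tri (- n) = 2 * (tri n + n)"
    unfolding distrib_left two_tri by (simp add: algebra_simps)
  then show ?thesis by simp
qed

lemma tri_Suc: "tri (n + 1) = tri n + n" by (simp add: tri_add)

lemma gauss_summable_nat:
  fixes Q :: complex
  assumes "norm Q < 1"
  shows "summable (\<lambda>k. norm (Q powi tri (int k) * w powi int k))"
\<comment> \<open>\<open>0 powi n\<close> vanishes unless \<open>n = 0\<close>, and
  \<open>tri k = 0\<close> only for \<open>k\<close> in {0, 1}; so at most two terms are nonzero in
  this degenerate case.\<close>
proof (cases "Q = 0 \<or> w = 0")
  case True
  have "norm (Q powi tri (int k) * w powi int k) = 0" if "k \<notin> {0, 1}" for k
  proof -
    have "tri (int k) \<noteq> 0"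
    proof
      assume "tri (int k) = 0"
      with two_tri[of "int k"] show False using that by simp
    qed
    with True that show ?thesis by (auto simp: power_int_0_left_if)
  qed
  then show ?thesis
    by (intro summable_finite[of "{0, 1}"]) blast+
next
  case False
  define f where "f = (\<lambda>k. norm (Q powi tri (int k) * w powi int k))"
  have step: "f (Suc k) = norm Q ^ k * norm w * f k" for k
    using False unfolding f_def
    by (simp add: norm_mult norm_power_int tri_Suc add.commute[of 1] power_int_add power_int_mult_distrib norm_power)
  have "(\<lambda>k. norm Q ^ k * norm w) \<longlonglongrightarrow> 0 * norm w"
    by (intro tendsto_intros LIMSEQ_power_zero) (use assms in auto)
  then have "eventually (\<lambda>k. norm Q ^ k * norm w < 1/2) sequentially"
    by (rule order_tendstoD) simp
  then obtain N where N: "\<And>k. k \<ge> N \<Longrightarrow> norm Q ^ k * norm w < 1/2"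
    by (auto simp: eventually_sequentially)
  have f0: "f k \<ge> 0" for k by (simp add: f_def)
  have "summable f"
  proof (rule summable_ratio_test[of "1/2" N])
    fix n assume "n \<ge> N"
    then show "norm (f (Suc n)) \<le> 1/2 * norm (f n)"
      using N[of n] f0[of n] f0[of "Suc n"] mult_right_mono[of "norm Q ^ n * norm w" "1/2" "f n"]
      by (simp add: step)
  qed simp
  then show ?thesis by (simp add: f_def)
qed

lemma gauss_abs_summable:
  fixes Q :: complex
  assumes "0 < norm Q" "norm Q < 1" "w \<noteq> 0"
  shows "(\<lambda>n. norm (Q powi tri n * w powi n)) summable_on UNIV"
proof (rule abs_summable_on_int)
  show "summable (\<lambda>k. norm (Q powi tri (int k) * w powi int k))"
    by (rule gauss_summable_nat) fact
  \<comment> \<open>The negative half is again a sum of the same type, with \<open>w\<close>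
    replaced by \<open>Q^2 / w\<close>.\<close>
  have *: "Q powi tri (- int k - 1) * w powi (- int k - 1)
      = (Q / w) * (Q powi tri (int k) * (Q\<^sup>2 / w) powi int k)" for k
  proof -
    have "tri (- int k - 1) = tri (int k) + 2 * int k + 1"
      using tri_minus[of "int k + 1"] tri_Suc[of "int k"] by simp
    then show ?thesis using assms
      by (simp add: power_int_add power_int_diff power_int_minus power_int_divide_distrib field_simps
          power_int_mult power2_eq_square power_mult)
  qed
  show "summable (\<lambda>k. norm (Q powi tri (- int k - 1) * w powi (- int k - 1)))"
    unfolding * norm_mult[of "Q / w"]
    by (intro summable_mult gauss_summable_nat) fact
qed

text \<open>Jacobi's theta function \<open>j(w; Q)\<close>. The series is taken as the definition
  because all rearrangements below act on exponents; the product form is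
  \<open>jacobi_triple_product\<close>.\<close>

definition jtheta :: "complex \<Rightarrow> complex \<Rightarrow> complex" where
  "jtheta Q w = (\<Sum>\<^sub>\<infinity>n. (-1) powi n * Q powi tri n * w powi n)"

lemma jtheta_abs_summable:
  fixes Q w :: complex
  assumes "0 < norm Q" "norm Q < 1" "w \<noteq> 0"
  shows "(\<lambda>n. norm ((-1) powi n * Q powi tri n * w powi n)) summable_on (UNIV :: int set)"
proof -
  have *: "norm ((-1) powi n * Q powi tri n * w powi n) = norm (Q powi tri n * w powi n)" for n :: int
    by (simp add: norm_mult norm_power_int)
  show ?thesis
    unfolding * using gauss_abs_summable[OF assms] .
qed

lemma jtheta_has_sum:
  assumes "0 < norm Q" "norm Q < 1" "w \<noteq> 0"
  shows "((\<lambda>n. (-1) powi n * Q powi tri n * w powi n) has_sum jtheta Q w) (UNIV :: int set)"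
  unfolding jtheta_def
  using jtheta_abs_summable[OF assms] by (intro has_sum_infsum) (rule abs_summable_summable)

text \<open>The substitution \<open>n -> 1 - n\<close> leaves \<open>tri n\<close> unchanged and
  flips the sign.\<close>

lemma jtheta_inverse:
  assumes "w \<noteq> 0"
  shows "jtheta Q (1 / w) = - jtheta Q w / w"
proof -
  have "jtheta Q (1 / w) = (\<Sum>\<^sub>\<infinity>n. (-1) powi (1 - n) * Q powi tri (1 - n) * (1 / w) powi (1 - n))"
    unfolding jtheta_def
    by (rule infsum_reindex_bij_witness[of _ "\<lambda>n. 1 - n" "\<lambda>n. 1 - n"]) auto
  also have "\<dots> = (\<Sum>\<^sub>\<infinity>n. (- 1 / w) * ((-1) powi n * Q powi tri n * w powi n))"
  proof (rule infsum_cong)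
    fix n :: int
    have "tri (1 - n) = tri n" using tri_minus[of "n - 1"] tri_Suc[of "n - 1"] by simp
    then show "(-1) powi (1 - n) * Q powi tri (1 - n) * (1 / w) powi (1 - n)
        = (- 1 / w) * ((-1) powi n * Q powi tri n * w powi n)"
      using assms by (simp add: power_int_diff power_int_divide_distrib field_simps)
  qed
  also have "\<dots> = - jtheta Q w / w"
    unfolding infsum_cmult_right' jtheta_def by simp
  finally show ?thesis .
qed

lemma jtheta_shift:
  assumes "Q \<noteq> 0" "w \<noteq> 0"
  shows "jtheta Q (Q powi m * w) = (-1) powi m * Q powi (- tri m) * w powi (- m) * jtheta Q w"
proof -
  have "jtheta Q w = (\<Sum>\<^sub>\<infinity>n. (-1) powi (n + m) * Q powi tri (n + m) * w powi (n + m))"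
    unfolding jtheta_def
    by (rule infsum_reindex_bij_witness[of _ "\<lambda>n. n + m" "\<lambda>n. n - m"]) auto
  also have "\<dots> = (\<Sum>\<^sub>\<infinity>n. ((-1) powi m * Q powi tri m * w powi m)
      * ((-1) powi n * Q powi tri n * (Q powi m * w) powi n))"
  proof (rule infsum_cong)
    fix n :: int
    have "Q powi (n * m) = (Q powi m) powi n"
      by (simp add: power_int_mult [symmetric] mult.commute)
    then show "(-1) powi (n + m) * Q powi tri (n + m) * w powi (n + m)
      = ((-1) powi m * Q powi tri m * w powi m)
        * ((-1) powi n * Q powi tri n * (Q powi m * w) powi n)"
      using assms by (simp add: tri_add power_int_add power_int_mult_distrib)
  qed
  also have "\<dots> = ((-1) powi m * Q powi tri m * w powi m) * jtheta Q (Q powi m * w)"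
    unfolding infsum_cmult_right' jtheta_def ..
  finally show ?thesis
    using assms by (simp add: power_int_minus field_simps)
qed

lemma jtheta_Q: "Q \<noteq> 0 \<Longrightarrow> w \<noteq> 0 \<Longrightarrow> jtheta Q (Q * w) = - jtheta Q w / w"
  using jtheta_shift[of Q w 1] by (simp add: power_int_minus field_simps)

lemma jtheta_reflect: "Q \<noteq> 0 \<Longrightarrow> w \<noteq> 0 \<Longrightarrow> jtheta Q (Q / w) = jtheta Q w"
  using jtheta_Q[of Q "1 / w"] jtheta_inverse[of w Q] by simp

text \<open>The point 1 is fixed under \<open>w -> 1 / w\<close>, where \<open>j\<close> is
  antisymmetric by \<open>jtheta_inverse\<close>.\<close>

lemma jtheta_1 [simp]: "jtheta Q 1 = 0"
proof -
  have "2 * jtheta Q 1 = 0" using jtheta_inverse[of 1 Q] by simp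
  then show ?thesis by simp
qed

section \<open>Infinite q-products\<close>

lemma qpoch_factors_convergent:
  assumes "norm q < 1"
  shows "convergent_prod (\<lambda>k. 1 - a * q ^ k :: complex)"
proof -
  have "summable (\<lambda>k. norm a * norm q ^ k)"
    by (intro summable_mult summable_geometric) (use assms in auto)
  then show ?thesis
    by (intro abs_convergent_prod_imp_convergent_prod summable_imp_abs_convergent_prod)
      (simp add: norm_mult norm_power)
qed

lemma qpoch_single: "qpoch [a] q = (\<Prod>k. 1 - a * q ^ k)"
  by (simp add: qpoch_def)

lemma qpoch_LIMSEQ:
  assumes "norm q < 1"
  shows "(\<lambda>n. \<Prod>k<n. 1 - a * q ^ k) \<longlonglongrightarrow> qpoch [a] q"
  unfolding qpoch_single LIMSEQ_lessThan_iff_atMost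
  by (rule convergent_prod_LIMSEQ[OF qpoch_factors_convergent[OF assms]])

lemma qpoch_Nil [simp]: "qpoch [] q = 1"
  by (simp add: qpoch_def)

lemma qpoch_Cons:
  assumes "norm q < 1"
  shows "qpoch (a # as) q = qpoch [a] q * qpoch as q"
proof -
  have "convergent_prod (\<lambda>k. \<Prod>a\<leftarrow>as. (1 - a * q ^ k))" for as
    by (induction as) (auto intro!: convergent_prod_mult qpoch_factors_convergent assms)
  then show ?thesis
    unfolding qpoch_def
    by (simp add: prodinf_mult qpoch_factors_convergent assms)
qed

lemma qpoch_nonzero:
  assumes "norm q < 1" "\<And>k. a * q ^ k \<noteq> 1"
  shows "qpoch [a] q \<noteq> 0"
  unfolding qpoch_single
  by (intro prodinf_nonzero qpoch_factors_convergent assms) (use assms(2) in \<open>metis eq_iff_diff_eq_0\<close>)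

lemma qpoch_power_nonzero:
  assumes "norm q < 1" "n > 0" "m > 0"
  shows "qpoch [q ^ n] (q ^ m) \<noteq> 0"
proof (rule qpoch_nonzero)
  show "norm (q ^ m) < 1" using assms by (simp add: norm_power power_less_one_iff)
  fix k
  have "norm (q ^ n * (q ^ m) ^ k) < 1"
    using assms by (simp add: norm_power power_less_one_iff flip: power_mult power_add)
  then show "q ^ n * (q ^ m) ^ k \<noteq> 1" by auto
qed

lemma prod_lessThan_add:
  fixes f :: "nat \<Rightarrow> 'a::comm_monoid_mult"
  shows "prod f {..<a + b} = prod f {..<a} * (\<Prod>i<b. f (a + i))"
  by (induction b) (auto simp: mult_ac)

text \<open>The factors are sorted by the residue of \<open>k\<close> modulo \<open>m\<close>; for
  the partial products of length \<open>n * m\<close> this is an exact identity.\<close>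

lemma qpoch_dissect:
  assumes "norm q < 1" "m > 0"
  shows "qpoch [a] q = (\<Prod>i<m. qpoch [a * q ^ i] (q ^ m))"
proof (rule LIMSEQ_unique)
  have qm: "norm (q ^ m) < 1" using assms by (simp add: norm_power power_less_one_iff)
  have "(\<lambda>n. \<Prod>k<n*m. 1 - a * q ^ k) \<longlonglongrightarrow> qpoch [a] q"
    by (rule LIMSEQ_subseq_LIMSEQ[OF qpoch_LIMSEQ[OF assms(1)], of "\<lambda>n. n * m", unfolded o_def])
      (use assms in \<open>auto simp: strict_mono_def\<close>)
  moreover have "(\<Prod>k<n*m. 1 - a * q ^ k) = (\<Prod>i<m. \<Prod>k<n. 1 - a * q ^ i * (q ^ m) ^ k)" for n
  proof (induction n)
    case (Suc n)
    have "(\<Prod>k<Suc n*m. 1 - a * q ^ k) = (\<Prod>k<n*m. 1 - a * q ^ k) * (\<Prod>i<m. 1 - a * q ^ (n*m + i))"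
      using prod_lessThan_add[of "\<lambda>k. 1 - a * q ^ k" "n * m" m] by (simp add: add.commute)
    moreover have "(\<Prod>i<m. 1 - a * q ^ (n*m + i)) = (\<Prod>i<m. 1 - a * q ^ i * (q ^ m) ^ n)"
      by (intro prod.cong) (auto simp: power_add power_mult[symmetric] mult_ac)
    ultimately show ?case
      by (simp only: Suc prod.lessThan_Suc prod.distrib)
  qed simp
  ultimately show "(\<lambda>n. \<Prod>i<m. \<Prod>k<n. 1 - a * q ^ i * (q ^ m) ^ k) \<longlonglongrightarrow> qpoch [a] q" by simp
  show "(\<lambda>n. \<Prod>i<m. \<Prod>k<n. 1 - a * q ^ i * (q ^ m) ^ k) \<longlonglongrightarrow> (\<Prod>i<m. qpoch [a * q ^ i] (q ^ m))"
    by (intro tendsto_prod qpoch_LIMSEQ qm)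
qed

lemma qpoch_square:
  assumes "norm q < 1"
  shows "qpoch [a\<^sup>2] (q\<^sup>2) = qpoch [a] q * qpoch [- a] q"
proof (rule LIMSEQ_unique)
  show "(\<lambda>n. \<Prod>k<n. 1 - a\<^sup>2 * (q\<^sup>2) ^ k) \<longlonglongrightarrow> qpoch [a\<^sup>2] (q\<^sup>2)"
    using assms by (intro qpoch_LIMSEQ) (simp add: norm_power power_less_one_iff)
  have "(\<lambda>n. (\<Prod>k<n. 1 - a * q ^ k) * (\<Prod>k<n. 1 - (- a) * q ^ k)) \<longlonglongrightarrow> qpoch [a] q * qpoch [- a] q"
    by (intro tendsto_mult qpoch_LIMSEQ assms)
  moreover have "(\<Prod>k<n. 1 - a * q ^ k) * (\<Prod>k<n. 1 - (- a) * q ^ k) = (\<Prod>k<n. 1 - a\<^sup>2 * (q\<^sup>2) ^ k)" for n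
    unfolding prod.distrib[symmetric]
    by (intro prod.cong) (auto simp: algebra_simps power2_eq_square power_mult_distrib)
  ultimately show "(\<lambda>n. \<Prod>k<n. 1 - a\<^sup>2 * (q\<^sup>2) ^ k) \<longlonglongrightarrow> qpoch [a] q * qpoch [- a] q"
    by simp
qed

lemma qpoch_rec:
  assumes "norm q < 1"
  shows "qpoch [a] q = (1 - a) * qpoch [a * q] q"
proof (rule LIMSEQ_unique)
  show "(\<lambda>n. \<Prod>k<Suc n. 1 - a * q ^ k) \<longlonglongrightarrow> qpoch [a] q"
    using qpoch_LIMSEQ[OF assms, THEN LIMSEQ_Suc] .
  show "(\<lambda>n. \<Prod>k<Suc n. 1 - a * q ^ k) \<longlonglongrightarrow> (1 - a) * qpoch [a * q] q"
    unfolding prod.lessThan_Suc_shift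
    using tendsto_mult_left[OF qpoch_LIMSEQ[OF assms, of "a * q"], of "1 - a"]
    by (simp add: mult_ac)
qed

text \<open>Needed to evaluate \<open>j(u) / (1 - u)\<close> at \<open>u = 1\<close> as a limit of
  products. The products converge uniformly on the unit ball around \<open>a0\<close>.\<close>

lemma isCont_qpoch:
  assumes "norm q < 1"
  shows "isCont (\<lambda>a. qpoch [a] q) a0"
proof -
  let ?A = "cball a0 1"
  have "uniformly_convergent_on ?A (\<lambda>N x. \<Prod>n<N. 1 - x * q ^ n)"
  proof (rule uniformly_convergent_on_prod')
    show "uniformly_convergent_on ?A (\<lambda>N x. \<Sum>n<N. norm (1 - x * q ^ n - 1))"
    proof (rule Weierstrass_m_test'[where M = "\<lambda>n. (norm a0 + 1) * norm q ^ n"])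
      show "summable (\<lambda>n. (norm a0 + 1) * norm q ^ n)"
        by (intro summable_mult summable_geometric) (use assms in auto)
      fix n x assume "x \<in> ?A"
      then have "norm x \<le> norm a0 + 1"
        by (metis dist_commute dist_norm mem_cball norm_triangle_sub add.commute add_right_mono order_trans)
      then show "norm (norm (1 - x * q ^ n - 1)) \<le> (norm a0 + 1) * norm q ^ n"
        by (simp add: norm_mult norm_power mult_right_mono)
    qed
  qed (auto intro!: continuous_intros)
  then obtain l where l: "uniform_limit ?A (\<lambda>N x. \<Prod>n<N. 1 - x * q ^ n) l sequentially"
    unfolding uniformly_convergent_on_def by blast
  have "l x = qpoch [x] q" if "x \<in> ?A" for x
    using tendsto_uniform_limitI[OF l that] qpoch_LIMSEQ[OF assms, of x] LIMSEQ_unique by blast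
  moreover have "continuous_on ?A l"
    by (rule uniform_limit_theorem[OF _ l]) (auto intro!: continuous_intros always_eventually)
  ultimately have "continuous_on ?A (\<lambda>a. qpoch [a] q)"
    using continuous_on_cong[of ?A ?A l "\<lambda>a. qpoch [a] q"] by blast
  then show ?thesis
    by (rule continuous_on_interior) simp
qed

section \<open>The triple product from its finite form\<close>

definition qfin :: "complex \<Rightarrow> nat \<Rightarrow> complex" where
  "qfin Q n = (\<Prod>k<n. 1 - Q * Q ^ k)"

text \<open>The value 0 at negative indices makes the finite triple product a sum over all integers,
  so that index shifts need no boundary terms.\<close>

definition qinv :: "complex \<Rightarrow> int \<Rightarrow> complex" where
  "qinv Q n = (if n < 0 then 0 else 1 / qfin Q (nat n))"

lemma qfin_nonzero:
  assumes "norm Q < 1"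
  shows "qfin Q n \<noteq> 0"
proof -
  have "Q * Q ^ k \<noteq> 1" for k
  proof
    assume "Q * Q ^ k = 1"
    then have "norm Q ^ Suc k = 1" by (metis norm_one norm_power power_Suc)
    moreover have "norm Q ^ Suc k < 1" using assms by (simp add: power_less_one_iff del: power_Suc)
    ultimately show False by simp
  qed
  then show ?thesis by (auto simp: qfin_def)
qed

text \<open>Valid for every integer: at \<open>n = 0\<close> the factor \<open>1 - Q powi 0\<close>
  vanishes, in agreement with \<open>qinv Q (-1) = 0\<close>.\<close>

lemma qinv_rec:
  assumes "norm Q < 1" "Q \<noteq> 0"
  shows "qinv Q (n - 1) = (1 - Q powi n) * qinv Q n"
proof (cases "n > 0")
  case True
  then obtain k where k: "n = int (Suc k)" by (metis gr0_implies_Suc zero_less_imp_eq_int of_nat_0_less_iff)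
  have "qfin Q (Suc k) = qfin Q k * (1 - Q ^ Suc k)" by (simp add: qfin_def)
  then show ?thesis
    using qfin_nonzero[OF assms(1), of k] qfin_nonzero[OF assms(1), of "Suc k"]
    unfolding k power_int_of_nat by (auto simp: qinv_def nat_add_distrib field_simps simp del: power_Suc)
qed (auto simp: qinv_def)

text \<open>The coefficient is the Gaussian binomial of \<open>2N\<close> over \<open>N - n\<close>.
  Going from \<open>N\<close> to \<open>N + 1\<close> multiplies by
  \<open>(1 - w Q^N) (1 - Q^(N+1) / w)\<close>, whose expansion has a constant part, a term in
  \<open>w\<close> and a term in \<open>1 / w\<close>; these give the unshifted sum \<open>C\<close>
  and the two shifted sums \<open>A\<close> and \<open>B\<close>.\<close>

lemma triple_product_finite:
  assumes Q: "0 < norm Q" "norm Q < 1" and w: "w \<noteq> 0"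
  shows "((\<lambda>n. qfin Q (2 * N) * qinv Q (int N - n) * qinv Q (int N + n)
            * ((-1) powi n * Q powi tri n * w powi n))
     has_sum ((\<Prod>k<N. 1 - w * Q ^ k) * (\<Prod>k<N. 1 - Q / w * Q ^ k))) UNIV"
proof (induction N)
  case 0
  show ?case
    by (rule has_sum_finite_neutralI[of "{0}"]) (auto simp: qinv_def qfin_def)
next
  case (Suc N)
  have Q0: "Q \<noteq> 0" using Q by auto
  let ?t = "\<lambda>n. (-1) powi n * Q powi tri n * w powi n"
  let ?c = "\<lambda>N n. qfin Q (2 * N) * qinv Q (int N - n) * qinv Q (int N + n)"
  let ?S = "(\<Prod>k<N. 1 - w * Q ^ k) * (\<Prod>k<N. 1 - Q / w * Q ^ k)"
  have t1: "?t (n + 1) = - (Q powi n * w) * ?t n" for n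
    using w Q0 by (simp add: tri_Suc power_int_add)
  have "((\<lambda>n. ?c N (n - 1) * ?t (n - 1)) has_sum ?S) UNIV"
    using Suc by (subst has_sum_reindex_bij_witness[of _ "\<lambda>n. n + 1" "\<lambda>n. n - 1" UNIV "\<lambda>n. ?c N n * ?t n" _ ?S]) auto
  from has_sum_cmult_right[OF this, of "- w * Q ^ N"]
  have A: "((\<lambda>n. Q ^ N * Q powi (1 - n) * ?c N (n - 1) * ?t n) has_sum (- w * Q ^ N * ?S)) UNIV"
    by (rule has_sum_cong[THEN iffD1, rotated])
      (use t1[of "n - 1" for n] w Q0 in \<open>simp add: power_int_diff field_simps\<close>)
  have "((\<lambda>n. ?c N (n + 1) * ?t (n + 1)) has_sum ?S) UNIV"
    using Suc by (subst has_sum_reindex_bij_witness[of _ "\<lambda>n. n - 1" "\<lambda>n. n + 1" UNIV "\<lambda>n. ?c N n * ?t n" _ ?S]) auto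
  from has_sum_cmult_right[OF this, of "- (Q ^ Suc N / w)"]
  have B: "((\<lambda>n. Q ^ Suc N * Q powi n * ?c N (n + 1) * ?t n) has_sum (- (Q ^ Suc N / w) * ?S)) UNIV"
    by (rule has_sum_cong[THEN iffD1, rotated]) (use w Q0 in \<open>simp only: t1, simp add: field_simps\<close>)
  note C = has_sum_cmult_right[OF Suc, of "1 + Q ^ (2 * N + 1)"]
  \<comment> \<open>The Gaussian binomial recurrence. All four values of \<open>qinv\<close> are
    reduced by \<open>qinv_rec\<close> to the same two, after which it is a rational identity in
    \<open>Q^N\<close> and \<open>Q powi n\<close>.\<close>
  have key: "?c (Suc N) n * ?t n
      = (1 + Q ^ (2 * N + 1)) * (?c N n * ?t n) + Q ^ N * Q powi (1 - n) * ?c N (n - 1) * ?t n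
        + Q ^ Suc N * Q powi n * ?c N (n + 1) * ?t n" for n
  proof -
    define X where "X = Q ^ N"
    define Y where "Y = Q powi n"
    define A where "A = qinv Q (int N + 1 - n)"
    define B where "B = qinv Q (int N + 1 + n)"
    have Y0: "Y \<noteq> 0" using Q0 by (simp add: Y_def)
    have pa: "Q powi (int N + k - n) = X * Q powi k / Y" "Q powi (int N + k + n) = X * Q powi k * Y" for k
      using Q0 by (simp_all add: X_def Y_def power_int_add power_int_diff)
    have a1: "qinv Q (int N - n) = (1 - Q * X / Y) * A"
      using qinv_rec[OF Q(2) Q0, of "int N + 1 - n"] pa[of 1] by (simp add: A_def algebra_simps)
    have a2: "qinv Q (int N - 1 - n) = (1 - X / Y) * (1 - Q * X / Y) * A"
    proof -
      have "qinv Q (int N - 1 - n) = (1 - X / Y) * qinv Q (int N - n)"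
        using qinv_rec[OF Q(2) Q0, of "int N - n"] pa(1)[of 0] by (simp add: algebra_simps)
      then show ?thesis unfolding a1 by simp
    qed
    have b1: "qinv Q (int N + n) = (1 - Q * X * Y) * B"
      using qinv_rec[OF Q(2) Q0, of "int N + 1 + n"] pa[of 1] by (simp add: B_def algebra_simps)
    have b2: "qinv Q (int N - 1 + n) = (1 - X * Y) * (1 - Q * X * Y) * B"
    proof -
      have "qinv Q (int N - 1 + n) = (1 - X * Y) * qinv Q (int N + n)"
        using qinv_rec[OF Q(2) Q0, of "int N + n"] pa(2)[of 0] by (simp add: algebra_simps)
      then show ?thesis unfolding b1 by simp
    qed
    have q2: "qfin Q (2 * Suc N) = qfin Q (2 * N) * (1 - Q * X\<^sup>2) * (1 - Q\<^sup>2 * X\<^sup>2)"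
    proof -
      have "Q ^ (2 * N) = X\<^sup>2" by (simp add: X_def power_mult[symmetric] mult_ac)
      moreover have "qfin Q (2 * Suc N) = qfin Q (2 * N) * (1 - Q * Q ^ (2 * N)) * (1 - Q * (Q * Q ^ (2 * N)))"
        unfolding qfin_def by simp
      ultimately show ?thesis by (simp add: power2_eq_square mult.assoc)
    qed
    have q3: "Q ^ (2 * N + 1) = Q * X\<^sup>2"
      by (simp add: X_def power_mult[symmetric] mult_ac)
    have q4: "Q powi (1 - n) = Q / Y" using Q0 by (simp add: Y_def power_int_diff)
    have e: "int (Suc N) - n = int N + 1 - n" "int (Suc N) + n = int N + 1 + n"
      "int N - (n - 1) = int N + 1 - n" "int N + (n - 1) = int N - 1 + n"
      "int N - (n + 1) = int N - 1 - n" "int N + (n + 1) = int N + 1 + n" by auto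
    have "?c (Suc N) n = (1 + Q ^ (2 * N + 1)) * ?c N n + Q ^ N * Q powi (1 - n) * ?c N (n - 1)
        + Q ^ Suc N * Q powi n * ?c N (n + 1)"
      unfolding q2 q3 q4 e a1 a2 b1 b2 A_def[symmetric] B_def[symmetric] power_Suc X_def[symmetric] Y_def[symmetric]
      using Y0 by (simp add: divide_simps) algebra
    then show ?thesis by (simp add: algebra_simps)
  qed
  have "(1 + Q ^ (2 * N + 1)) * ?S + (- w * Q ^ N * ?S) + (- (Q ^ Suc N / w) * ?S)
     = (\<Prod>k<Suc N. 1 - w * Q ^ k) * (\<Prod>k<Suc N. 1 - Q / w * Q ^ k)"
    using w by (simp add: field_simps power_add mult_2 mult_2_right)
  with has_sum_add[OF has_sum_add[OF C A] B] show ?case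
    by (simp only: key)
qed

text \<open>Limit \<open>N -> infinity\<close> of the finite form. Since \<open>qfin\<close>
  converges to a nonzero limit, it and its reciprocal are bounded, so a multiple of the theta series
  itself is a majorant.\<close>

theorem jacobi_triple_product:
  assumes Q: "0 < norm Q" "norm Q < 1" and w: "w \<noteq> 0"
  shows "jtheta Q w = qpoch [w] Q * qpoch [Q / w] Q * qpoch [Q] Q"
proof -
  let ?t = "\<lambda>n. (-1) powi n * Q powi tri n * w powi n"
  have E0: "qpoch [Q] Q \<noteq> 0" using qpoch_power_nonzero[of Q 1 1] Q by simp
  have lim: "qfin Q \<longlonglongrightarrow> qpoch [Q] Q" unfolding qfin_def[abs_def] by (rule qpoch_LIMSEQ[OF Q(2)])
  have liminv: "(\<lambda>n. 1 / qfin Q n) \<longlonglongrightarrow> 1 / qpoch [Q] Q"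
    by (intro tendsto_intros lim E0)
  obtain K1 where K1: "K1 > 0" "\<And>n. norm (qfin Q n) \<le> K1"
    using convergent_imp_Bseq[OF convergentI[OF lim]] by (auto elim: BseqE)
  obtain K2 where K2: "K2 > 0" "\<And>n. norm (1 / qfin Q n) \<le> K2"
    using convergent_imp_Bseq[OF convergentI[OF liminv]] by (auto elim: BseqE)
  have K2': "norm (qinv Q n) \<le> K2" for n
    using K2(2)[of "nat n"] K2(1) by (simp add: qinv_def)
  have "((\<lambda>N. \<Sum>\<^sub>\<infinity>n. qfin Q (2 * N) * qinv Q (int N - n) * qinv Q (int N + n) * ?t n)
      \<longlongrightarrow> (\<Sum>\<^sub>\<infinity>n. qpoch [Q] Q * (1 / qpoch [Q] Q) * (1 / qpoch [Q] Q) * ?t n)) sequentially"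
  proof (rule infsum_tendsto_dominated)
    have sh: "(\<lambda>N. qinv Q (int N + m)) \<longlonglongrightarrow> 1 / qpoch [Q] Q" for m
    proof -
      have "filterlim (\<lambda>N. nat (int N + m)) sequentially sequentially"
        unfolding filterlim_at_top eventually_sequentially
        by (metis (no_types, opaque_lifting) nat_le_iff nat_int le_nat_iff add.commute diff_le_eq nle_le of_nat_le_iff order_trans nat_mono)
      from filterlim_compose[OF liminv this]
      have "(\<lambda>N. 1 / qfin Q (nat (int N + m))) \<longlonglongrightarrow> 1 / qpoch [Q] Q" .
      moreover have "eventually (\<lambda>N. 1 / qfin Q (nat (int N + m)) = qinv Q (int N + m)) sequentially"
        using eventually_ge_at_top[of "nat (- m)"] by eventually_elim (auto simp: qinv_def)
      ultimately show ?thesis by (rule Lim_transform_eventually)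
    qed
    fix n
    have "(\<lambda>N. qfin Q (2 * N)) \<longlonglongrightarrow> qpoch [Q] Q"
      by (rule LIMSEQ_subseq_LIMSEQ[OF lim, of "\<lambda>N. 2 * N", unfolded o_def]) (auto simp: strict_mono_def)
    then show "(\<lambda>N. qfin Q (2 * N) * qinv Q (int N - n) * qinv Q (int N + n) * ?t n)
        \<longlonglongrightarrow> qpoch [Q] Q * (1 / qpoch [Q] Q) * (1 / qpoch [Q] Q) * ?t n"
      using sh[of "- n"] sh[of n] by (intro tendsto_mult tendsto_const) auto
  next
    show "\<forall>\<^sub>F N in sequentially. \<forall>n\<in>UNIV. norm (qfin Q (2 * N) * qinv Q (int N - n) * qinv Q (int N + n) * ?t n)
        \<le> K1 * K2 * K2 * norm (?t n)"
      unfolding norm_mult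
      by (intro always_eventually allI ballI mult_mono K1(2) K2')
        (use K1(1) K2(1) in \<open>auto intro!: mult_nonneg_nonneg simp: norm_mult\<close>)
    show "(\<lambda>n. K1 * K2 * K2 * norm (?t n)) summable_on UNIV"
      by (intro summable_on_cmult_right jtheta_abs_summable Q w)
  qed auto
  then have "(\<lambda>N. (\<Prod>k<N. 1 - w * Q ^ k) * (\<Prod>k<N. 1 - Q / w * Q ^ k))
      \<longlonglongrightarrow> (\<Sum>\<^sub>\<infinity>n. (1 / qpoch [Q] Q) * ?t n)"
    using E0 by (simp add: infsumI[OF triple_product_finite[OF Q w]])
  moreover have "(\<lambda>N. (\<Prod>k<N. 1 - w * Q ^ k) * (\<Prod>k<N. 1 - Q / w * Q ^ k))
      \<longlonglongrightarrow> qpoch [w] Q * qpoch [Q / w] Q"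
    by (intro tendsto_mult qpoch_LIMSEQ Q)
  ultimately have "(\<Sum>\<^sub>\<infinity>n. (1 / qpoch [Q] Q) * ?t n) = qpoch [w] Q * qpoch [Q / w] Q"
    using LIMSEQ_unique by blast
  then show ?thesis
    unfolding infsum_cmult_right' jtheta_def using E0 by (simp add: field_simps)
qed

text \<open>The product shows that the zeros of \<open>j\<close> are exactly the integer powers of
  \<open>Q\<close>.\<close>

lemma jtheta_nonzero:
  assumes Q: "0 < norm Q" "norm Q < 1" and w: "w \<noteq> 0" and *: "\<And>m. w \<noteq> Q powi m"
  shows "jtheta Q w \<noteq> 0"
proof -
  have Q0: "Q \<noteq> 0" using Q by auto
  have "w * Q ^ k \<noteq> 1" for k
    using *[of "- int k"] Q0 w by (simp add: power_int_minus field_simps)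
  moreover have "Q / w * Q ^ k \<noteq> 1" for k
    using *[of "int (Suc k)"] Q0 w unfolding power_int_of_nat by (simp add: field_simps)
  moreover have "qpoch [Q] Q \<noteq> 0" using qpoch_power_nonzero[of Q 1 1] Q by simp
  ultimately show ?thesis
    unfolding jacobi_triple_product[OF Q w] using qpoch_nonzero[OF Q(2)] by simp
qed

section \<open>Three-term relations and the quotient j(u)/(1 - u)\<close>

lemma powi_double:
  "(x :: 'a :: field) powi (2 * k) = (x powi k)\<^sup>2" "x powi (k * 2) = (x powi k)\<^sup>2"
  by (metis mult.commute power_int_mult power_int_numeral)+

lemma powi_square: "((x :: 'a :: field)\<^sup>2) powi k = (x powi k)\<^sup>2"
  by (metis power_int_power powi_double(1) of_nat_numeral)

text \<open>Summands of double series are compared factor by factor: sign, nome and argument each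
  have their own identity, and this regroups the three pairs.\<close>

lemma mult_six:
  "a * b = x \<Longrightarrow> c * d = y \<Longrightarrow> e * f = z \<Longrightarrow> (a * c * e) * (b * d * f) = x * y * (z :: 'a :: comm_monoid_mult)"
  by (metis mult.assoc mult.left_commute)

lemma has_sum_times:
  fixes f :: "'a \<Rightarrow> complex" and g :: "'b \<Rightarrow> complex"
  assumes f: "(\<lambda>x. norm (f x)) summable_on A" and g: "(\<lambda>y. norm (g y)) summable_on B"
  shows "((\<lambda>(x, y). f x * g y) has_sum (infsum f A * infsum g B)) (A \<times> B)"
    and "(\<lambda>(x, y). norm (f x * g y)) summable_on (A \<times> B)"
proof -
  have g': "((\<lambda>y. norm (g y)) has_sum infsum (\<lambda>y. norm (g y)) B) B"
    by (rule has_sum_infsum[OF g])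
  show *: "(\<lambda>(x, y). norm (f x * g y)) summable_on (A \<times> B)"
  proof (rule summable_on_SigmaI[where g = "\<lambda>x. norm (f x) * infsum (\<lambda>y. norm (g y)) B"])
    show "((\<lambda>y. case (x, y) of (x, y) \<Rightarrow> norm (f x * g y)) has_sum
        norm (f x) * infsum (\<lambda>y. norm (g y)) B) B" for x
      using has_sum_cmult_right[OF g', of "norm (f x)"] by (simp add: norm_mult)
    show "(\<lambda>x. norm (f x) * infsum (\<lambda>y. norm (g y)) B) summable_on A"
      by (rule summable_on_cmult_left[OF f])
  qed auto
  have "(\<lambda>p. norm (case p of (x, y) \<Rightarrow> f x * g y)) summable_on (A \<times> B)"
    using * by (simp add: case_prod_unfold)
  then have S: "(\<lambda>(x, y). f x * g y) summable_on (A \<times> B)"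
    by (rule abs_summable_summable)
  have gs: "(g has_sum infsum g B) B" by (rule has_sum_infsum[OF abs_summable_summable[OF g]])
  have fs: "(f has_sum infsum f A) A" by (rule has_sum_infsum[OF abs_summable_summable[OF f]])
  show "((\<lambda>(x, y). f x * g y) has_sum (infsum f A * infsum g B)) (A \<times> B)"
  proof (rule has_sum_SigmaI[OF _ _ S])
    show "((\<lambda>y. case (x, y) of (x, y) \<Rightarrow> f x * g y) has_sum f x * infsum g B) B" for x
      using has_sum_cmult_right[OF gs, of "f x"] by simp
    show "((\<lambda>x. f x * infsum g B) has_sum infsum f A * infsum g B) A"
      by (rule has_sum_cmult_left[OF fs])
  qed
qed

text \<open>Every rearrangement of a double theta series below is a change of variables on each of
  two complementary subsets of the plane lattice, separated by a parity.\<close>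

lemma has_sum_parity_split:
  fixes f :: "int \<times> int \<Rightarrow> complex"
  assumes e: "inj e" and d: "inj d" and disj: "range e \<inter> range d = {}" and un: "range e \<union> range d = UNIV"
    and E: "((\<lambda>x. f (e x)) has_sum S) UNIV" and D: "((\<lambda>x. f (d x)) has_sum T) UNIV"
  shows "(f has_sum (S + T)) UNIV"
proof -
  have "(f has_sum S) (range e)" using has_sum_reindex[OF e, of f S] E by (simp add: o_def)
  moreover have "(f has_sum T) (range d)" using has_sum_reindex[OF d, of f T] D by (simp add: o_def)
  ultimately show ?thesis using has_sum_Un_disjoint[OF _ _ disj] un by metis
qed

text \<open>Write \<open>j\<close> for \<open>jtheta Q\<close>. For fixed \<open>c\<close> and \<open>s\<close>, the function \<open>t \<mapsto> j(t/s) j(cts)\<close> lies in the span of the two functions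
  \<open>theta_even\<close>, \<open>theta_odd\<close>; it is a 2 by 2 minor in their values, so that the three-term
  relation of theta functions is a Pluecker relation.\<close>

definition theta_even :: "complex \<Rightarrow> complex \<Rightarrow> complex \<Rightarrow> complex" where
  "theta_even Q c t = (\<Sum>\<^sub>\<infinity>k. c powi k * Q powi (2 * tri k) * t powi (2 * k))"

definition theta_odd :: "complex \<Rightarrow> complex \<Rightarrow> complex \<Rightarrow> complex" where
  "theta_odd Q c t = (\<Sum>\<^sub>\<infinity>k. c powi k * Q powi (k * k) * t powi (2 * k + 1))"

lemma sq_eq_tri: "k * k = 2 * tri k + k"
  unfolding two_tri by (simp add: algebra_simps)

context
  fixes Q c :: complex
  assumes Q: "0 < norm Q" "norm Q < 1" and c: "c \<noteq> 0"
begin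

lemma Q_nonzero: "Q \<noteq> 0" using Q by auto

lemma theta_even_summable:
  assumes "t \<noteq> 0"
  shows "(\<lambda>k. norm (c powi k * Q powi (2 * tri k) * t powi (2 * k))) summable_on UNIV"
proof -
  have "c powi k * Q powi (2 * tri k) * t powi (2 * k) = (Q\<^sup>2) powi tri k * (c * t\<^sup>2) powi k" for k
    by (simp add: powi_double powi_square power_int_mult_distrib mult_ac)
  then show ?thesis
    using gauss_abs_summable[of "Q\<^sup>2" "c * t\<^sup>2"] Q c assms
    by (simp add: norm_power power_less_one_iff)
qed

lemma theta_odd_summable:
  assumes "t \<noteq> 0"
  shows "(\<lambda>k. norm (c powi k * Q powi (k * k) * t powi (2 * k + 1))) summable_on UNIV"
proof -
  have "c powi k * Q powi (k * k) * t powi (2 * k + 1) = t * ((Q\<^sup>2) powi tri k * (c * Q * t\<^sup>2) powi k)" for k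
    using Q_nonzero assms unfolding sq_eq_tri
    by (simp add: power_int_add powi_double powi_square power_int_mult_distrib mult_ac)
  then show ?thesis
    using gauss_abs_summable[of "Q\<^sup>2" "c * Q * t\<^sup>2"] Q c assms
    by (simp add: norm_power power_less_one_iff norm_mult[of t] summable_on_cmult_right)
qed

definition theta_minor :: "complex \<Rightarrow> complex \<Rightarrow> complex" where
  "theta_minor t s = theta_even Q c t * theta_odd Q c s - theta_odd Q c t * theta_even Q c s"

text \<open>The index pairs \<open>(m, n)\<close> are split by the parity of \<open>m + n\<close>:
  \<open>m = k - l\<close> or \<open>m = k - l + 1\<close>, and \<open>n = k + l\<close>. In both
  cases the quadratic exponent separates into a function of \<open>k\<close> plus one of
  \<open>l\<close>, and the sign \<open>(-1)^(m + n)\<close> is the sign of the corresponding term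
  of the minor.\<close>

lemma theta_minor_eq:
  assumes t: "t \<noteq> 0" and s: "s \<noteq> 0"
  shows "theta_minor t s = s * jtheta Q (t / s) * jtheta Q (c * t * s)"
proof -
  let ?f = "\<lambda>(m, n). ((-1) powi m * Q powi tri m * (t / s) powi m) * ((-1) powi n * Q powi tri n * (c * t * s) powi n)"
  let ?A = "\<lambda>t k. c powi k * Q powi (2 * tri k) * t powi (2 * k)"
  let ?B = "\<lambda>t k. c powi k * Q powi (k * k) * t powi (2 * k + 1)"
  note Q0 = Q_nonzero
  have P: "(?f has_sum (jtheta Q (t / s) * jtheta Q (c * t * s))) (UNIV \<times> UNIV)"
    unfolding jtheta_def
    by (rule has_sum_times(1)) (intro jtheta_abs_summable, use Q t s c in auto)+
  have "(?f has_sum (theta_even Q c t * (1 / s * theta_odd Q c s) + theta_odd Q c t * (- 1 / s * theta_even Q c s))) UNIV"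
  proof (rule has_sum_parity_split)
    show "inj (\<lambda>(k, l). (k - l, k + l) :: int \<times> int)" "inj (\<lambda>(k, l). (k - l + 1, k + l) :: int \<times> int)"
      by (auto simp: inj_on_def)
    show "range (\<lambda>(k, l). (k - l, k + l) :: int \<times> int) \<inter> range (\<lambda>(k, l). (k - l + 1, k + l)) = {}"
      by auto presburger
    have "(m, n) \<in> range (\<lambda>(k, l). (k - l, k + l)) \<union> range (\<lambda>(k, l). (k - l + 1, k + l))" for m n :: int
    proof (cases "even (m + n)")
      case True
      then obtain k where "m + n = 2 * k" by blast
      then have "(m, n) = (case (k, n - k) of (k, l) \<Rightarrow> (k - l, k + l))" by auto
      then show ?thesis by blast
    next
      case False
      then obtain k where "m + n = 2 * k + 1" by (elim oddE)
      then have "(m, n) = (case (k, n - k) of (k, l) \<Rightarrow> (k - l + 1, k + l))" by auto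
      then show ?thesis by blast
    qed
    then show "range (\<lambda>(k, l). (k - l, k + l) :: int \<times> int) \<union> range (\<lambda>(k, l). (k - l + 1, k + l)) = UNIV"
      by (metis (no_types, lifting) UNIV_eq_I surj_pair)
    have e1: "?f (k - l, k + l) = ?A t k * (1 / s * ?B s l)" for k l
    proof -
      have "tri (k - l) + tri (k + l) = 2 * tri k + l * l"
        using tri_add[of k l] tri_add[of k "- l"] tri_minus[of l] sq_eq_tri[of l] by simp
      then have 1: "Q powi tri (k - l) * Q powi tri (k + l) = Q powi (2 * tri k) * Q powi (l * l)"
        using Q0 by (simp flip: power_int_add)
      have 2: "(-1 :: complex) powi (k - l) * (-1) powi (k + l) = 1"
        by (simp flip: power_int_add)
      have 3: "(t / s) powi (k - l) * (c * t * s) powi (k + l)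
          = c powi k * t powi (2 * k) * (1 / s * (c powi l * s powi (2 * l + 1)))"
        using t s c by (simp add: power_int_add power_int_diff power_int_mult_distrib power_int_divide_distrib powi_double power2_eq_square)
      show ?thesis unfolding prod.case mult_six[OF 2 1 3] by simp
    qed
    have e2: "?f (k - l + 1, k + l) = ?B t k * (- 1 / s * ?A s l)" for k l
    proof -
      have "tri (k - l + 1) + tri (k + l) = k * k + 2 * tri l"
        using tri_add[of k l] tri_add[of k "- l"] tri_minus[of l] sq_eq_tri[of l] sq_eq_tri[of k] tri_Suc[of "k - l"] by simp
      then have 1: "Q powi tri (k - l + 1) * Q powi tri (k + l) = Q powi (k * k) * Q powi (2 * tri l)"
        using Q0 by (simp flip: power_int_add)
      have 2: "(-1 :: complex) powi (k - l + 1) * (-1) powi (k + l) = -1"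
        by (simp flip: power_int_add)
      have 3: "(t / s) powi (k - l + 1) * (c * t * s) powi (k + l)
          = c powi k * t powi (2 * k + 1) * (1 / s * (c powi l * s powi (2 * l)))"
        using t s c by (simp add: power_int_add power_int_diff power_int_mult_distrib power_int_divide_distrib powi_double power2_eq_square)
      show ?thesis unfolding prod.case mult_six[OF 2 1 3] by simp
    qed
    have "((\<lambda>(k, l). ?A t k * (1 / s * ?B s l)) has_sum (theta_even Q c t * (\<Sum>\<^sub>\<infinity>l. 1 / s * ?B s l))) (UNIV \<times> UNIV)"
      unfolding theta_even_def
      by (rule has_sum_times(1)[OF theta_even_summable[OF t]])
        (unfold norm_mult[of "1 / s"], rule summable_on_cmult_right[OF theta_odd_summable[OF s]])
    then have "((\<lambda>(k, l). ?A t k * (1 / s * ?B s l)) has_sum (theta_even Q c t * (1 / s * theta_odd Q c s))) UNIV"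
      by (simp only: infsum_cmult_right' theta_odd_def UNIV_Times_UNIV)
    moreover have "?f (case x of (k, l) \<Rightarrow> (k - l, k + l)) = (case x of (k, l) \<Rightarrow> ?A t k * (1 / s * ?B s l))" for x
      by (cases x) (simp only: prod.case e1[simplified prod.case])
    ultimately show "((\<lambda>x. ?f (case x of (k, l) \<Rightarrow> (k - l, k + l))) has_sum theta_even Q c t * (1 / s * theta_odd Q c s)) UNIV"
      by (simp only:)
    have "((\<lambda>(k, l). ?B t k * (- 1 / s * ?A s l)) has_sum (theta_odd Q c t * (\<Sum>\<^sub>\<infinity>l. - 1 / s * ?A s l))) (UNIV \<times> UNIV)"
      unfolding theta_odd_def
      by (rule has_sum_times(1)[OF theta_odd_summable[OF t]])
        (unfold norm_mult[of "- 1 / s"], rule summable_on_cmult_right[OF theta_even_summable[OF s]])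
    then have "((\<lambda>(k, l). ?B t k * (- 1 / s * ?A s l)) has_sum (theta_odd Q c t * (- 1 / s * theta_even Q c s))) UNIV"
      by (simp only: infsum_cmult_right' theta_even_def UNIV_Times_UNIV)
    moreover have "?f (case x of (k, l) \<Rightarrow> (k - l + 1, k + l)) = (case x of (k, l) \<Rightarrow> ?B t k * (- 1 / s * ?A s l))" for x
      by (cases x) (simp only: prod.case e2[simplified prod.case])
    ultimately show "((\<lambda>x. ?f (case x of (k, l) \<Rightarrow> (k - l + 1, k + l))) has_sum theta_odd Q c t * (- 1 / s * theta_even Q c s)) UNIV"
      by (simp only:)
  qed
  then have "jtheta Q (t / s) * jtheta Q (c * t * s)
      = theta_even Q c t * (1 / s * theta_odd Q c s) + theta_odd Q c t * (- 1 / s * theta_even Q c s)"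
    by (rule has_sum_unique[OF P[unfolded UNIV_Times_UNIV]])
  then show ?thesis using s by (simp add: theta_minor_def field_simps)
qed

text \<open>Expansion of a 3 by 3 determinant whose first column is a combination of the other two.
  It applies to any function in the span of \<open>theta_even\<close> and \<open>theta_odd\<close>,
  in particular to numerators of Appell sums.\<close>

lemma theta_minor_cyclic:
  "(x * theta_even Q c t + y * theta_odd Q c t) * theta_minor s r + (x * theta_even Q c s + y * theta_odd Q c s) * theta_minor r t
    + (x * theta_even Q c r + y * theta_odd Q c r) * theta_minor t s = 0"
  by (simp add: theta_minor_def algebra_simps)

lemma theta_minor_plucker: "theta_minor t x * theta_minor s r + theta_minor s x * theta_minor r t + theta_minor r x * theta_minor t s = 0"
  by (simp add: theta_minor_def algebra_simps)

end

text \<open>Partial sums of the coefficients of \<open>j\<close>: they vanish at both ends because \<open>j(1) = 0\<close>, which makes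
  \<open>j(u) / (1 - u)\<close> a Laurent series converging also at \<open>u = 1\<close>.\<close>

definition quotient_coeff :: "complex \<Rightarrow> int \<Rightarrow> complex" where
  "quotient_coeff Q i = (\<Sum>\<^sub>\<infinity>n\<in>{\<bar>i\<bar><..}. (-1) powi (n + 1) * Q powi tri n)"

lemma quotient_coeff_minus [simp]: "quotient_coeff Q (- i) = quotient_coeff Q i"
  by (simp add: quotient_coeff_def)

context
  fixes Q :: complex
  assumes Q: "0 < norm Q" "norm Q < 1"
begin

lemma quotient_coeff_summable: "(\<lambda>n. norm ((-1) powi (n + 1) * Q powi tri n)) summable_on A"
proof -
  have "(\<lambda>n. norm ((-1) powi (n + 1) * Q powi tri n)) summable_on UNIV"
    using gauss_abs_summable[OF Q, of 1] by (simp add: norm_mult norm_power_int)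
  then show ?thesis by (rule summable_on_subset_banach) auto
qed

text \<open>For \<open>i <= 0\<close> the index that enters the tail is \<open>1 - i\<close>, and
  \<open>tri (1 - i) = tri i\<close>; hence one formula in the absolute value of \<open>i\<close>
  yields the coefficients of \<open>j\<close> on both sides.\<close>

lemma quotient_coeff_rec: "quotient_coeff Q i - quotient_coeff Q (i - 1) = (-1) powi i * Q powi tri i"
proof -
  have step: "quotient_coeff Q k = (-1) powi k * Q powi tri (k + 1) + quotient_coeff Q (k + 1)" if "k \<ge> 0" for k
  proof -
    have "{\<bar>k\<bar><..} = insert (k + 1) {\<bar>k + 1\<bar><..}" using that by auto
    then have "quotient_coeff Q k = (\<Sum>\<^sub>\<infinity>n\<in>insert (k + 1) {\<bar>k + 1\<bar><..}. (-1) powi (n + 1) * Q powi tri n)"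
      by (simp only: quotient_coeff_def)
    also have "\<dots> = (-1) powi (k + 1 + 1) * Q powi tri (k + 1) + quotient_coeff Q (k + 1)"
      unfolding quotient_coeff_def
      by (rule infsum_insert) (use that abs_summable_summable[OF quotient_coeff_summable] in auto)
    finally show ?thesis by (simp add: power_int_add)
  qed
  show ?thesis
  proof (cases "i \<ge> 1")
    case True
    then show ?thesis using step[of "i - 1"] by (simp add: power_int_diff)
  next
    case False
    have "tri (- i + 1) = tri i" using tri_minus[of "i"] tri_Suc[of "- i"] by simp
    moreover have "quotient_coeff Q (- i + 1) = quotient_coeff Q (i - 1)" using quotient_coeff_minus[of Q "i - 1"] by (simp add: algebra_simps del: quotient_coeff_minus)
    ultimately show ?thesis using step[of "- i"] False by (simp add: power_int_minus_one_minus)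
  qed
qed

text \<open>A tail is comparable with its first term, because
  \<open>tri (n + m) >= tri i + tri n\<close> for \<open>n >= 1\<close> and \<open>m\<close> the
  absolute value of \<open>i\<close>. This makes the Laurent series converge for all
  \<open>u \<noteq> 0\<close>.\<close>

lemma norm_quotient_coeff_le:
  obtains K where "\<And>i. norm (quotient_coeff Q i) \<le> K * norm (Q powi tri i)"
proof
  let ?K = "\<Sum>\<^sub>\<infinity>n\<in>{0<..}. norm ((-1) powi (n + 1) * Q powi tri n)"
  have Q0: "Q \<noteq> 0" using Q by auto
  fix i :: int
  have qi: "norm Q powi m \<le> 1" if "m \<ge> 0" for m
    using Q that by (intro power_int_le_one) auto
  have "norm (quotient_coeff Q i) \<le> (\<Sum>\<^sub>\<infinity>n\<in>{\<bar>i\<bar><..}. norm ((-1) powi (n + 1) * Q powi tri n))"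
    unfolding quotient_coeff_def by (rule norm_infsum_bound[OF quotient_coeff_summable])
  also have "\<dots> = (\<Sum>\<^sub>\<infinity>n\<in>{0<..}. norm ((-1) powi (n + \<bar>i\<bar> + 1) * Q powi tri (n + \<bar>i\<bar>)))"
    by (rule infsum_reindex_bij_witness[of _ "\<lambda>n. n + \<bar>i\<bar>" "\<lambda>n. n - \<bar>i\<bar>"]) auto
  also have "\<dots> \<le> (\<Sum>\<^sub>\<infinity>n\<in>{0<..}. norm (Q powi tri i) * norm ((-1) powi (n + 1) * Q powi tri n))"
  proof (rule infsum_mono)
    have "(\<lambda>n. norm ((-1) powi (n + 1) * Q powi tri n)) summable_on (\<lambda>n. n + \<bar>i\<bar>) ` {0<..}"
      by (rule quotient_coeff_summable)
    then show "(\<lambda>n. norm ((-1) powi (n + \<bar>i\<bar> + 1) * Q powi tri (n + \<bar>i\<bar>))) summable_on {0<..}"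
      by (subst (asm) summable_on_reindex) (auto simp: o_def)
    show "(\<lambda>n. norm (Q powi tri i) * norm ((-1) powi (n + 1) * Q powi tri n)) summable_on {0<..}"
      by (intro summable_on_cmult_right quotient_coeff_summable)
    fix n :: int assume n: "n \<in> {0<..}"
    have "tri \<bar>i\<bar> + \<bar>i\<bar> \<ge> tri i"
      using tri_minus[of i] by (cases "i \<ge> 0") auto
    then have "tri (n + \<bar>i\<bar>) \<ge> tri i + tri n"
      using tri_add[of n "\<bar>i\<bar>"] n mult_right_mono[of 1 n "\<bar>i\<bar>"] by simp
    then have "norm Q powi tri (n + \<bar>i\<bar>) = norm Q powi tri i * norm Q powi tri n * norm Q powi (tri (n + \<bar>i\<bar>) - tri i - tri n)"
      using Q0 by (simp flip: power_int_add)
    also have "\<dots> \<le> norm Q powi tri i * norm Q powi tri n * 1"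
      by (intro mult_left_mono qi) (use \<open>tri (n + \<bar>i\<bar>) \<ge> tri i + tri n\<close> in auto)
    finally show "norm ((-1) powi (n + \<bar>i\<bar> + 1) * Q powi tri (n + \<bar>i\<bar>))
       \<le> norm (Q powi tri i) * norm ((-1) powi (n + 1) * Q powi tri n)"
      by (simp add: norm_mult norm_power_int)
  qed
  also have "\<dots> = ?K * norm (Q powi tri i)"
    by (simp add: infsum_cmult_right')
  finally show "norm (quotient_coeff Q i) \<le> ?K * norm (Q powi tri i)" .
qed

definition theta_quotient :: "complex \<Rightarrow> complex" where
  "theta_quotient u = (\<Sum>\<^sub>\<infinity>i. quotient_coeff Q i * u powi i)"

lemma theta_quotient_summable:
  assumes "u \<noteq> 0"
  shows "(\<lambda>i. norm (quotient_coeff Q i * u powi i)) summable_on UNIV"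
proof -
  obtain K where K: "\<And>i. norm (quotient_coeff Q i) \<le> K * norm (Q powi tri i)" using norm_quotient_coeff_le by blast
  show ?thesis
  proof (rule Infinite_Sum.abs_summable_on_comparison_test')
    show "(\<lambda>i. K * norm (Q powi tri i * u powi i)) summable_on UNIV"
      by (intro summable_on_cmult_right gauss_abs_summable Q assms)
    show "norm (quotient_coeff Q i * u powi i) \<le> K * norm (Q powi tri i * u powi i)" for i
      using mult_right_mono[OF K[of i], of "norm (u powi i)"] by (simp add: norm_mult mult_ac)
  qed
qed

lemma theta_quotient_has_sum:
  assumes "u \<noteq> 0"
  shows "((\<lambda>i. quotient_coeff Q i * u powi i) has_sum theta_quotient u) UNIV"
  unfolding theta_quotient_def using theta_quotient_summable[OF assms] by (intro has_sum_infsum) (rule abs_summable_summable)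

text \<open>Multiplication by \<open>1 - u\<close> takes differences of neighbouring coefficients,
  which \<open>quotient_coeff_rec\<close> identifies.\<close>

lemma theta_quotient_mult:
  assumes u: "u \<noteq> 0"
  shows "(1 - u) * theta_quotient u = jtheta Q u"
proof -
  have "((\<lambda>i. quotient_coeff Q (i - 1) * u powi (i - 1)) has_sum theta_quotient u) UNIV"
    using theta_quotient_has_sum[OF u]
    by (subst has_sum_reindex_bij_witness[of _ "\<lambda>n. n + 1" "\<lambda>n. n - 1" UNIV "\<lambda>i. quotient_coeff Q i * u powi i" _ "theta_quotient u"]) auto
  from has_sum_cmult_right[OF this, of "- u"]
  have "((\<lambda>i. - quotient_coeff Q (i - 1) * u powi i) has_sum - u * theta_quotient u) UNIV"
    using u by (simp add: power_int_diff)
  from has_sum_add[OF theta_quotient_has_sum[OF u] this]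
  have "((\<lambda>i. (quotient_coeff Q i - quotient_coeff Q (i - 1)) * u powi i) has_sum ((1 - u) * theta_quotient u)) UNIV"
    by (simp add: algebra_simps)
  then show ?thesis
    unfolding quotient_coeff_rec using has_sum_unique[OF _ jtheta_has_sum[OF Q u]] by blast
qed

lemma theta_quotient_inverse: "theta_quotient (1 / u) = theta_quotient u"
proof -
  have "theta_quotient (1 / u) = (\<Sum>\<^sub>\<infinity>i. quotient_coeff Q (- i) * (1 / u) powi (- i))"
    unfolding theta_quotient_def by (rule infsum_reindex_bij_witness[of _ "\<lambda>n. - n" "\<lambda>n. - n"]) auto
  then show ?thesis by (simp add: theta_quotient_def power_int_minus power_int_divide_distrib)
qed

end

text \<open>The two halves are power series in \<open>w\<close> and in \<open>1 / w\<close>; both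
  have infinite radius of convergence.\<close>

lemma laurent_field_differentiable:
  fixes a :: "int \<Rightarrow> complex"
  assumes S: "\<And>w. w \<noteq> 0 \<Longrightarrow> (\<lambda>n. norm (a n * w powi n)) summable_on UNIV" and w: "w \<noteq> 0"
  shows "(\<lambda>w. \<Sum>\<^sub>\<infinity>n. a n * w powi n) field_differentiable (at w)"
proof -
  let ?p = "\<lambda>x. \<Sum>n. a (int n) * x ^ n" and ?n = "\<lambda>x. \<Sum>n. a (- int n - 1) * x ^ n"
  have S': "(\<lambda>n. a n * x powi n) summable_on A" if "x \<noteq> 0" for x A
    using abs_summable_summable[OF S[OF that]] by (rule summable_on_subset_banach) auto
  have inj: "inj (\<lambda>k. - int k - 1)" by (auto simp: inj_on_def)
  have P: "((\<lambda>n. a (int n) * x ^ n) has_sum (\<Sum>\<^sub>\<infinity>n\<in>range int. a n * x powi n)) UNIV" if "x \<noteq> 0" for x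
    using has_sum_infsum[OF S'[OF that, of "range int"]]
    by (subst (asm) has_sum_reindex) (auto simp: o_def)
  have N: "((\<lambda>n. a (- int n - 1) * x powi (- int n - 1)) has_sum (\<Sum>\<^sub>\<infinity>n\<in>range (\<lambda>k. - int k - 1). a n * x powi n)) UNIV" if "x \<noteq> 0" for x
    using has_sum_infsum[OF S'[OF that, of "range (\<lambda>k. - int k - 1)"]]
    by (subst (asm) has_sum_reindex) (auto simp: o_def inj)
  have N': "((\<lambda>n. a (- int n - 1) * (1 / x) ^ n) has_sum (x * (\<Sum>\<^sub>\<infinity>n\<in>range (\<lambda>k. - int k - 1). a n * x powi n))) UNIV" if "x \<noteq> 0" for x
    using has_sum_cmult_right[OF N[OF that], of x] that
    by (simp add: power_int_diff power_int_minus power_divide field_simps)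
  have Ps: "summable (\<lambda>n. a (int n) * y ^ n)" for y
    using P[of y] has_sum_imp_sums sums_summable by (cases "y = 0") (auto simp: summable_zero_power')
  have Ns: "summable (\<lambda>n. a (- int n - 1) * y ^ n)" for y
    using N'[of "1 / y"] has_sum_imp_sums sums_summable by (cases "y = 0") (auto simp: summable_zero_power')
  have U: "(UNIV :: int set) = range int \<union> range (\<lambda>k. - int k - 1)"
  proof -
    have "n \<in> range int \<or> n \<in> range (\<lambda>k. - int k - 1)" for n :: int
    proof (cases "n \<ge> 0")
      case False
      then have "n = - int (nat (- n - 1)) - 1" by simp
      then show ?thesis by blast
    qed (metis nat_0_le rangeI)
    then show ?thesis by auto
  qed
  have eq: "(\<Sum>\<^sub>\<infinity>n. a n * x powi n) = ?p x + (1 / x) * ?n (1 / x)" if "x \<noteq> 0" for x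
  proof -
    have "(\<Sum>\<^sub>\<infinity>n. a n * x powi n)
      = (\<Sum>\<^sub>\<infinity>n\<in>range int. a n * x powi n) + (\<Sum>\<^sub>\<infinity>n\<in>range (\<lambda>k. - int k - 1). a n * x powi n)"
      unfolding U by (rule infsum_Un_disjoint) (use S'[OF that] in auto)
    also have "(\<Sum>\<^sub>\<infinity>n\<in>range int. a n * x powi n) = ?p x"
      using has_sum_imp_sums[OF P[OF that]] by (simp add: sums_iff)
    also have "(\<Sum>\<^sub>\<infinity>n\<in>range (\<lambda>k. - int k - 1). a n * x powi n) = (1 / x) * ?n (1 / x)"
      using has_sum_imp_sums[OF N'[OF that]] that by (simp add: sums_iff)
    finally show ?thesis .
  qed
  note dp = termdiffs_strong_converges_everywhere[OF Ps]
  note dn = termdiffs_strong_converges_everywhere[OF Ns]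
  have "(\<lambda>x. ?p x + (1 / x) * ?n (1 / x)) field_differentiable (at w)"
  proof -
    have "((\<lambda>x. ?n (1 / x)) has_field_derivative (\<Sum>n. diffs (\<lambda>n. a (- int n - 1)) n * (1 / w) ^ n) * (- 1 / w\<^sup>2)) (at w)"
      by (rule DERIV_chain2[OF dn]) (use w in \<open>auto intro!: derivative_eq_intros simp: power2_eq_square\<close>)
    then have 1: "(\<lambda>x. ?n (1 / x)) field_differentiable (at w)"
      unfolding field_differentiable_def by blast
    have 2: "?p field_differentiable (at w)" unfolding field_differentiable_def using dp by blast
    have 3: "(\<lambda>x. 1 / x) field_differentiable (at w)"
      using w by (intro field_differentiable_divide) auto
    show ?thesis
      by (rule field_differentiable_add[OF 2 field_differentiable_mult[OF 3 1]])
  qed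
  then obtain d where "((\<lambda>x. ?p x + (1 / x) * ?n (1 / x)) has_field_derivative d) (at w)"
    unfolding field_differentiable_def by blast
  then have "((\<lambda>x. \<Sum>\<^sub>\<infinity>n. a n * x powi n) has_field_derivative d) (at w)"
    by (rule has_field_derivative_transform_within_open[of _ _ _ "- {0}"]) (use w eq in auto)
  then show ?thesis unfolding field_differentiable_def by blast
qed

context
  fixes Q :: complex
  assumes Q: "0 < norm Q" "norm Q < 1"
begin

lemma jtheta_DERIV: "w \<noteq> 0 \<Longrightarrow> (jtheta Q has_field_derivative deriv (jtheta Q) w) (at w)"
  using laurent_field_differentiable[of "\<lambda>n. (-1) powi n * Q powi tri n" w]
    jtheta_abs_summable[OF Q] unfolding jtheta_def[abs_def]
  by (simp add: DERIV_deriv_iff_field_differentiable)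

lemma theta_quotient_DERIV: "w \<noteq> 0 \<Longrightarrow> (theta_quotient Q has_field_derivative deriv (theta_quotient Q) w) (at w)"
  using laurent_field_differentiable[of "quotient_coeff Q" w] theta_quotient_summable[OF Q]
  unfolding theta_quotient_def[OF Q, abs_def]
  by (simp add: DERIV_deriv_iff_field_differentiable)

text \<open>Minus the derivative of \<open>j\<close> at 1. Away from \<open>u = 1\<close> the factor
  \<open>1 - u\<close> cancels from the triple product, and both sides are continuous there.\<close>

lemma theta_quotient_1: "theta_quotient Q 1 = qpoch [Q] Q ^ 3"
proof -
  have A: "(theta_quotient Q \<longlongrightarrow> theta_quotient Q 1) (at 1)"
    using DERIV_isCont[OF theta_quotient_DERIV[of 1]] by (simp add: isCont_def)
  have "((\<lambda>u. qpoch [u * Q] Q * qpoch [Q / u] Q * qpoch [Q] Q)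
      \<longlongrightarrow> qpoch [1 * Q] Q * qpoch [Q / 1] Q * qpoch [Q] Q) (at 1)"
    by (intro tendsto_mult tendsto_const isCont_tendsto_compose[OF isCont_qpoch[OF Q(2)]] tendsto_intros) auto
  moreover have "eventually (\<lambda>u. qpoch [u * Q] Q * qpoch [Q / u] Q * qpoch [Q] Q = theta_quotient Q u) (at 1)"
  proof -
    have "eventually (\<lambda>u::complex. u \<in> - {0}) (at 1)"
      by (intro eventually_at_in_open') auto
    moreover have "eventually (\<lambda>u::complex. u \<noteq> 1) (at 1)" by (rule eventually_neq_at_within)
    ultimately show ?thesis
    proof eventually_elim
      case (elim u)
      have "(1 - u) * theta_quotient Q u = qpoch [u] Q * qpoch [Q / u] Q * qpoch [Q] Q"
        using theta_quotient_mult[OF Q] jacobi_triple_product[OF Q] elim by auto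
      also have "\<dots> = (1 - u) * (qpoch [u * Q] Q * qpoch [Q / u] Q * qpoch [Q] Q)"
        using qpoch_rec[OF Q(2), of u] by simp
      finally show ?case using elim by simp
    qed
  qed
  ultimately have "(theta_quotient Q \<longlongrightarrow> qpoch [1 * Q] Q * qpoch [Q / 1] Q * qpoch [Q] Q) (at 1)"
    by (rule Lim_transform_eventually)
  from tendsto_unique[OF at_neq_bot A this]
  have "theta_quotient Q 1 = qpoch [1 * Q] Q * qpoch [Q / 1] Q * qpoch [Q] Q" .
  then show ?thesis by (simp add: power3_eq_cube)
qed

lemma deriv_jtheta_1: "(jtheta Q has_field_derivative - theta_quotient Q 1) (at 1)"
proof -
  have "((\<lambda>u. (1 - u) * theta_quotient Q u) has_field_derivative - theta_quotient Q 1) (at 1)"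
    using theta_quotient_DERIV[of 1] by (auto intro!: derivative_eq_intros)
  then show ?thesis
    by (rule has_field_derivative_transform_within_open[of _ _ _ "- {0}"]) (auto simp: theta_quotient_mult[OF Q])
qed

text \<open>The invariance under \<open>u -> 1 / u\<close> makes the fixed point 1 a critical
  point.\<close>

lemma deriv_theta_quotient_1: "(theta_quotient Q has_field_derivative 0) (at 1)"
proof -
  define d where "d = deriv (theta_quotient Q) 1"
  have d: "(theta_quotient Q has_field_derivative d) (at 1)" using theta_quotient_DERIV[of 1] by (simp add: d_def)
  have "((\<lambda>u. theta_quotient Q (1 / u)) has_field_derivative d * (- 1)) (at 1)"
    by (rule DERIV_chain2[of "theta_quotient Q"]) (use d in \<open>auto intro!: derivative_eq_intros\<close>)
  then have "(theta_quotient Q has_field_derivative d * (- 1)) (at 1)"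
    by (simp add: theta_quotient_inverse[OF Q])
  with d have "d = d * (- 1)" by (rule DERIV_unique)
  then have "2 * d = 0" by simp
  with d show ?thesis by simp
qed

section \<open>Logarithmic derivatives of theta functions\<close>

definition logder :: "complex \<Rightarrow> complex" where
  "logder w = w * deriv (jtheta Q) w / jtheta Q w"

lemma logder_inverse:
  assumes w: "w \<noteq> 0" "jtheta Q w \<noteq> 0"
  shows "logder (1 / w) = 1 - logder w"
proof -
  have "((\<lambda>u. jtheta Q (1 / u)) has_field_derivative deriv (jtheta Q) (1 / w) * (- 1 / w\<^sup>2)) (at w)"
    by (rule DERIV_chain2[OF jtheta_DERIV]) (use w in \<open>auto intro!: derivative_eq_intros simp: power2_eq_square\<close>)
  moreover have "((\<lambda>u. - jtheta Q u / u) has_field_derivative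
      - ((deriv (jtheta Q) w * w - jtheta Q w) / w\<^sup>2)) (at w)"
    using w by (auto intro!: derivative_eq_intros jtheta_DERIV simp: power2_eq_square field_simps)
  then have "((\<lambda>u. jtheta Q (1 / u)) has_field_derivative
      - ((deriv (jtheta Q) w * w - jtheta Q w) / w\<^sup>2)) (at w)"
    by (rule has_field_derivative_transform_within_open[of _ _ _ "- {0}"]) (use w in \<open>auto simp: jtheta_inverse\<close>)
  ultimately have "deriv (jtheta Q) (1 / w) * (- 1 / w\<^sup>2) = - ((deriv (jtheta Q) w * w - jtheta Q w) / w\<^sup>2)"
    by (rule DERIV_unique)
  then have "deriv (jtheta Q) (1 / w) = deriv (jtheta Q) w * w - jtheta Q w"
    using w by (simp add: field_simps)
  then show ?thesis using w by (simp add: logder_def jtheta_inverse field_simps)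
qed

lemma logder_shift:
  assumes w: "w \<noteq> 0" "jtheta Q w \<noteq> 0"
  shows "logder (Q * w) = logder w - 1"
proof -
  have Q0: "Q \<noteq> 0" using Q by auto
  have "((\<lambda>u. jtheta Q (Q * u)) has_field_derivative deriv (jtheta Q) (Q * w) * Q) (at w)"
    by (rule DERIV_chain2[OF jtheta_DERIV]) (use w Q0 in \<open>auto intro!: derivative_eq_intros\<close>)
  moreover have "((\<lambda>u. - jtheta Q u / u) has_field_derivative
      - ((deriv (jtheta Q) w * w - jtheta Q w) / w\<^sup>2)) (at w)"
    using w by (auto intro!: derivative_eq_intros jtheta_DERIV simp: power2_eq_square field_simps)
  then have "((\<lambda>u. jtheta Q (Q * u)) has_field_derivative
      - ((deriv (jtheta Q) w * w - jtheta Q w) / w\<^sup>2)) (at w)"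
    by (rule has_field_derivative_transform_within_open[of _ _ _ "- {0}"]) (use w Q0 in \<open>auto simp: jtheta_Q\<close>)
  ultimately have "deriv (jtheta Q) (Q * w) * Q = - ((deriv (jtheta Q) w * w - jtheta Q w) / w\<^sup>2)"
    by (rule DERIV_unique)
  then show ?thesis using w Q0 by (simp add: logder_def jtheta_Q field_simps power2_eq_square)
qed

text \<open>Inversion followed by the shift by \<open>Q\<close> fixes \<open>v\<close> and turns
  \<open>logder v\<close> into its negative.\<close>

lemma logder_Q_half:
  assumes "v\<^sup>2 = Q" "jtheta Q v \<noteq> 0"
  shows "logder v = 0"
proof -
  have v0: "v \<noteq> 0" using assms Q by auto
  have "jtheta Q (1 / v) \<noteq> 0" using assms v0 by (simp add: jtheta_inverse)
  then have "logder (Q * (1 / v)) = logder (1 / v) - 1"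
    using v0 by (intro logder_shift) auto
  moreover have "Q * (1 / v) = v" using assms(1) v0 by (auto simp: power2_eq_square)
  ultimately have "2 * logder v = 0" using logder_inverse[OF v0 assms(2)] by simp
  then show ?thesis by simp
qed

context
  fixes c :: complex
  assumes c: "c \<noteq> 0"
begin

lemma theta_minor_DERIV:
  assumes s: "s \<noteq> 0" and n: "jtheta Q s \<noteq> 0" "jtheta Q (c * s) \<noteq> 0"
  shows "((\<lambda>t. theta_minor Q c t s) has_field_derivative theta_minor Q c 1 s * (logder (1 / s) + logder (c * s))) (at 1)"
proof -
  have n': "jtheta Q (1 / s) \<noteq> 0" using n s by (simp add: jtheta_inverse)
  have "((\<lambda>t. jtheta Q (t / s)) has_field_derivative deriv (jtheta Q) (1 / s) * (1 / s)) (at 1)"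
    by (rule DERIV_chain2[OF jtheta_DERIV]) (use s in \<open>auto intro!: derivative_eq_intros\<close>)
  moreover have "((\<lambda>t. jtheta Q (c * t * s)) has_field_derivative deriv (jtheta Q) (c * 1 * s) * (c * s)) (at 1)"
    by (rule DERIV_chain2[OF jtheta_DERIV]) (use s c in \<open>auto intro!: derivative_eq_intros\<close>)
  ultimately have "((\<lambda>t. s * jtheta Q (t / s) * jtheta Q (c * t * s)) has_field_derivative
      theta_minor Q c 1 s * (logder (1 / s) + logder (c * s))) (at 1)"
    using n n' s by (auto intro!: derivative_eq_intros simp: theta_minor_eq[OF Q c] logder_def field_simps)
  then show ?thesis
    by (rule has_field_derivative_transform_within_open[of _ _ _ "- {0}"]) (use s in \<open>auto simp: theta_minor_eq[OF Q c]\<close>)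
qed

text \<open>At \<open>s = 1\<close> the factor \<open>j(t)\<close> of the minor vanishes for
  \<open>t = 1\<close>, so only its derivative survives.\<close>

lemma theta_minor_1_DERIV: "((\<lambda>t. theta_minor Q c t 1) has_field_derivative - theta_quotient Q 1 * jtheta Q c) (at 1)"
proof -
  have "((\<lambda>t. jtheta Q (c * t)) has_field_derivative deriv (jtheta Q) (c * 1) * c) (at 1)"
    by (rule DERIV_chain2[OF jtheta_DERIV]) (use c in \<open>auto intro!: derivative_eq_intros\<close>)
  with deriv_jtheta_1 have "((\<lambda>t. jtheta Q t * jtheta Q (c * t)) has_field_derivative - theta_quotient Q 1 * jtheta Q c) (at 1)"
    by (auto intro!: derivative_eq_intros)
  then show ?thesis
    by (rule has_field_derivative_transform_within_open[of _ _ _ "- {0}"]) (auto simp: theta_minor_eq[OF Q c])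
qed

text \<open>The three-term relation at the four points \<open>t\<close>, 1, \<open>a\<close>,
  \<open>b\<close>, differentiated at \<open>t = 1\<close>. It is the counterpart of the addition
  formula for the Weierstrass zeta function.\<close>

lemma logder_relation:
  assumes a: "a \<noteq> 0" "jtheta Q a \<noteq> 0" "jtheta Q (c * a) \<noteq> 0"
    and b: "b \<noteq> 0" "jtheta Q b \<noteq> 0" "jtheta Q (c * b) \<noteq> 0"
  shows "logder (1 / b) + logder (c * b) - logder (1 / a) - logder (c * a)
    = theta_quotient Q 1 * jtheta Q c * b * jtheta Q (a / b) * jtheta Q (c * a * b)
      / (jtheta Q a * jtheta Q (c * a) * jtheta Q b * jtheta Q (c * b))"
proof -
  let ?a = "logder (1 / a) + logder (c * a)" and ?b = "logder (1 / b) + logder (c * b)"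
  have D: "((\<lambda>t. theta_minor Q c t 1 * theta_minor Q c a b + theta_minor Q c a 1 * theta_minor Q c b t + theta_minor Q c b 1 * theta_minor Q c t a)
      has_field_derivative
      - theta_quotient Q 1 * jtheta Q c * theta_minor Q c a b - theta_minor Q c a 1 * (theta_minor Q c 1 b * ?b) + theta_minor Q c b 1 * (theta_minor Q c 1 a * ?a)) (at 1)"
  proof -
    have sw: "theta_minor Q c b t = - theta_minor Q c t b" for t by (simp add: theta_minor_def[OF Q c])
    show ?thesis
      unfolding sw
      by (auto intro!: derivative_eq_intros theta_minor_1_DERIV theta_minor_DERIV a b)
  qed
  \<comment> \<open>The function differentiated in \<open>D\<close> vanishes identically, so its
    derivative gives a linear relation between the logarithmic derivatives.\<close>
  have Z: "(\<lambda>t. theta_minor Q c t 1 * theta_minor Q c a b + theta_minor Q c a 1 * theta_minor Q c b t + theta_minor Q c b 1 * theta_minor Q c t a) = (\<lambda>_. 0)"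
    using theta_minor_plucker[OF Q c, of _ 1 a b] by (simp add: fun_eq_iff mult_ac)
  have "- theta_quotient Q 1 * jtheta Q c * theta_minor Q c a b - theta_minor Q c a 1 * (theta_minor Q c 1 b * ?b) + theta_minor Q c b 1 * (theta_minor Q c 1 a * ?a) = 0"
    by (rule DERIV_unique[OF D[unfolded Z] DERIV_const])
  moreover have "theta_minor Q c 1 b = - theta_minor Q c b 1" "theta_minor Q c 1 a = - theta_minor Q c a 1"
    by (simp_all add: theta_minor_def[OF Q c])
  moreover have "theta_minor Q c a 1 = jtheta Q a * jtheta Q (c * a)" "theta_minor Q c b 1 = jtheta Q b * jtheta Q (c * b)"
    "theta_minor Q c a b = b * jtheta Q (a / b) * jtheta Q (c * a * b)"
    using theta_minor_eq[OF Q c] a b by auto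
  ultimately have "theta_minor Q c a 1 * theta_minor Q c b 1 * (?b - ?a)
      = theta_quotient Q 1 * jtheta Q c * (b * jtheta Q (a / b) * jtheta Q (c * a * b))"
    by (simp add: algebra_simps)
  then show ?thesis
    using a b \<open>theta_minor Q c a 1 = _\<close> \<open>theta_minor Q c b 1 = _\<close> by (simp add: field_simps)
qed

text \<open>Coordinates of \<open>j(t)\<close> times the Appell sum with respect to
  \<open>theta_even\<close> and \<open>theta_odd\<close>; they come out of the rearrangement in
  \<open>appell_numerator_has_sum\<close>. Despite the negative powers of \<open>Q\<close> they
  converge, as the decay of \<open>quotient_coeff\<close> at index \<open>2 l\<close> is of order
  \<open>4 * tri l\<close>.\<close>

definition numerator_even :: complex where "numerator_even = (\<Sum>\<^sub>\<infinity>l. c powi (- l) * Q powi (- (2 * tri l)) * quotient_coeff Q (2 * l))"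
definition numerator_odd :: complex where "numerator_odd = (\<Sum>\<^sub>\<infinity>l. c powi (- l) * Q powi (- (l * l)) * quotient_coeff Q (2 * l + 1))"
definition appell_numerator :: "complex \<Rightarrow> complex" where "appell_numerator t = numerator_even * theta_even Q c t + numerator_odd * theta_odd Q c t"

lemma numerator_even_summable: "(\<lambda>l. norm (c powi (- l) * Q powi (- (2 * tri l)) * quotient_coeff Q (2 * l))) summable_on UNIV"
proof -
  have Q0: "Q \<noteq> 0" using Q by auto
  obtain K where K: "\<And>i. norm (quotient_coeff Q i) \<le> K * norm (Q powi tri i)" using norm_quotient_coeff_le[OF Q] by blast
  show ?thesis
  proof (rule Infinite_Sum.abs_summable_on_comparison_test')
    show "(\<lambda>l. K * norm ((Q\<^sup>2) powi tri l * (Q / c) powi l)) summable_on UNIV"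
      by (intro summable_on_cmult_right gauss_abs_summable) (use Q c in \<open>auto simp: norm_power power_less_one_iff\<close>)
    fix l :: int
    have "tri (2 * l) = 2 * tri l + (2 * tri l + l)"
      using tri_add[of l l] sq_eq_tri[of l] by simp
    then have "Q powi (- (2 * tri l)) * Q powi tri (2 * l) = Q powi (2 * tri l) * Q powi l"
      using Q0 by (simp flip: power_int_add)
    then have "c powi (- l) * Q powi (- (2 * tri l)) * Q powi tri (2 * l) = c powi (- l) * (Q powi (2 * tri l) * Q powi l)"
      by (simp only: mult.assoc)
    also have "\<dots> = (Q\<^sup>2) powi tri l * (Q / c) powi l"
      by (simp add: powi_double powi_square power_int_minus power_int_divide_distrib field_simps)
    finally have "c powi (- l) * Q powi (- (2 * tri l)) * Q powi tri (2 * l) = (Q\<^sup>2) powi tri l * (Q / c) powi l" .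
    moreover have "norm (c powi (- l) * Q powi (- (2 * tri l)) * quotient_coeff Q (2 * l))
        \<le> norm (c powi (- l) * Q powi (- (2 * tri l))) * (K * norm (Q powi tri (2 * l)))"
      unfolding norm_mult[of _ "quotient_coeff Q _"] by (intro mult_left_mono K) auto
    ultimately show "norm (c powi (- l) * Q powi (- (2 * tri l)) * quotient_coeff Q (2 * l))
        \<le> K * norm ((Q\<^sup>2) powi tri l * (Q / c) powi l)"
      by (metis norm_mult mult.left_commute)
  qed
qed

lemma numerator_odd_summable: "(\<lambda>l. norm (c powi (- l) * Q powi (- (l * l)) * quotient_coeff Q (2 * l + 1))) summable_on UNIV"
proof -
  have Q0: "Q \<noteq> 0" using Q by auto
  obtain K where K: "\<And>i. norm (quotient_coeff Q i) \<le> K * norm (Q powi tri i)" using norm_quotient_coeff_le[OF Q] by blast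
  show ?thesis
  proof (rule Infinite_Sum.abs_summable_on_comparison_test')
    show "(\<lambda>l. K * norm ((Q\<^sup>2) powi tri l * (Q\<^sup>2 / c) powi l)) summable_on UNIV"
      by (intro summable_on_cmult_right gauss_abs_summable) (use Q c in \<open>auto simp: norm_power power_less_one_iff\<close>)
    fix l :: int
    have "tri (2 * l + 1) = l * l + (2 * tri l + 2 * l)"
      using tri_add[of l l] tri_Suc[of "2 * l"] by simp
    then have "c powi (- l) * Q powi (- (l * l)) * Q powi tri (2 * l + 1) = (Q\<^sup>2) powi tri l * (Q\<^sup>2 / c) powi l"
      using Q0 c by (simp add: power_int_add power_int_minus powi_double powi_square power_int_divide_distrib field_simps)
    moreover have "norm (c powi (- l) * Q powi (- (l * l)) * quotient_coeff Q (2 * l + 1))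
        \<le> norm (c powi (- l) * Q powi (- (l * l))) * (K * norm (Q powi tri (2 * l + 1)))"
      unfolding norm_mult[of _ "quotient_coeff Q _"] by (intro mult_left_mono K) auto
    ultimately show "norm (c powi (- l) * Q powi (- (l * l)) * quotient_coeff Q (2 * l + 1))
        \<le> K * norm ((Q\<^sup>2) powi tri l * (Q\<^sup>2 / c) powi l)"
      by (metis norm_mult mult.left_commute)
  qed
qed

text \<open>Each \<open>theta_quotient (t * Q powi m)\<close> is expanded in powers with index
  \<open>i\<close>. With \<open>i = 2 l\<close> or \<open>i = 2 l + 1\<close> and
  \<open>k = m + l\<close>, the exponent \<open>2 m + i\<close> of \<open>t\<close> depends on
  \<open>k\<close> alone, and the exponents of \<open>Q\<close> and \<open>c\<close> separate. The
  sum is therefore a combination of just two theta functions of \<open>t\<close>.\<close>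

lemma appell_numerator_has_sum:
  assumes t: "t \<noteq> 0"
  shows "((\<lambda>m. Q powi (2 * tri m) * c powi m * t powi (2 * m) * theta_quotient Q (t * Q powi m)) has_sum appell_numerator t) UNIV"
proof -
  have Q0: "Q \<noteq> 0" using Q by auto
  let ?f = "\<lambda>(m, i). Q powi (2 * tri m) * c powi m * t powi (2 * m) * (quotient_coeff Q i * (t * Q powi m) powi i)"
  let ?A = "\<lambda>k. c powi k * Q powi (2 * tri k) * t powi (2 * k)"
  let ?B = "\<lambda>k. c powi k * Q powi (k * k) * t powi (2 * k + 1)"
  let ?C = "\<lambda>l. c powi (- l) * Q powi (- (2 * tri l)) * quotient_coeff Q (2 * l)"
  let ?D = "\<lambda>l. c powi (- l) * Q powi (- (l * l)) * quotient_coeff Q (2 * l + 1)"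
  have "(?f has_sum (theta_even Q c t * numerator_even + theta_odd Q c t * numerator_odd)) UNIV"
  proof (rule has_sum_parity_split)
    show "inj (\<lambda>(k, l). (k - l, 2 * l) :: int \<times> int)" "inj (\<lambda>(k, l). (k - l, 2 * l + 1) :: int \<times> int)"
      by (auto simp: inj_on_def)
    show "range (\<lambda>(k, l). (k - l, 2 * l) :: int \<times> int) \<inter> range (\<lambda>(k, l). (k - l, 2 * l + 1)) = {}"
      by auto presburger
    have "(m, n) \<in> range (\<lambda>(k, l). (k - l, 2 * l)) \<union> range (\<lambda>(k, l). (k - l, 2 * l + 1))" for m n :: int
    proof (cases "even n")
      case True
      then obtain k where "n = 2 * k" by blast
      then have "(m, n) = (case (m + k, k) of (k, l) \<Rightarrow> (k - l, 2 * l))" by auto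
      then show ?thesis by blast
    next
      case False
      then obtain k where "n = 2 * k + 1" by (elim oddE)
      then have "(m, n) = (case (m + k, k) of (k, l) \<Rightarrow> (k - l, 2 * l + 1))" by auto
      then show ?thesis by blast
    qed
    then show "range (\<lambda>(k, l). (k - l, 2 * l) :: int \<times> int) \<union> range (\<lambda>(k, l). (k - l, 2 * l + 1)) = UNIV"
      by (metis (no_types, lifting) UNIV_eq_I surj_pair)
    have e1: "?f (k - l, 2 * l) = ?A k * ?C l" for k l
    proof -
      have "2 * tri (k - l) + (k - l) * (2 * l) = 2 * tri k + - (2 * tri l)"
        using tri_add[of k "- l"] tri_minus[of l] sq_eq_tri[of l] by (simp add: algebra_simps)
      then have 1: "Q powi (2 * tri (k - l)) * (Q powi (k - l)) powi (2 * l) = Q powi (2 * tri k) * Q powi (- (2 * tri l))"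
        using Q0 by (simp flip: power_int_add power_int_mult)
      have 2: "c powi (k - l) * 1 = c powi k * c powi (- l)"
        using c by (simp flip: power_int_add)
      have 3: "t powi (2 * (k - l)) * t powi (2 * l) = t powi (2 * k)"
        using t by (simp flip: power_int_add)
      have "?f (k - l, 2 * l) = quotient_coeff Q (2 * l) * ((Q powi (2 * tri (k - l)) * c powi (k - l) * t powi (2 * (k - l)))
          * ((Q powi (k - l)) powi (2 * l) * 1 * t powi (2 * l)))"
        by (simp add: power_int_mult_distrib mult_ac)
      then show ?thesis unfolding mult_six[OF 1 2 3] by (simp only: mult_ac)
    qed
    have e2: "?f (k - l, 2 * l + 1) = ?B k * ?D l" for k l
    proof -
      have "2 * tri (k - l) + (k - l) * (2 * l + 1) = k * k + - (l * l)"
        using tri_add[of k "- l"] tri_minus[of l] sq_eq_tri[of l] sq_eq_tri[of k] by (simp add: algebra_simps)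
      then have 1: "Q powi (2 * tri (k - l)) * (Q powi (k - l)) powi (2 * l + 1) = Q powi (k * k) * Q powi (- (l * l))"
        using Q0 by (simp flip: power_int_add power_int_mult)
      have 2: "c powi (k - l) * 1 = c powi k * c powi (- l)"
        using c by (simp flip: power_int_add)
      have 3: "t powi (2 * (k - l)) * t powi (2 * l + 1) = t powi (2 * k + 1)"
        using t by (simp flip: power_int_add)
      have "?f (k - l, 2 * l + 1) = quotient_coeff Q (2 * l + 1) * ((Q powi (2 * tri (k - l)) * c powi (k - l) * t powi (2 * (k - l)))
          * ((Q powi (k - l)) powi (2 * l + 1) * 1 * t powi (2 * l + 1)))"
        by (simp add: power_int_mult_distrib mult_ac)
      then show ?thesis unfolding mult_six[OF 1 2 3] by (simp only: mult_ac)
    qed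
    have "((\<lambda>(k, l). ?A k * ?C l) has_sum (theta_even Q c t * numerator_even)) (UNIV \<times> UNIV)"
      unfolding theta_even_def numerator_even_def
      by (rule has_sum_times(1)[OF theta_even_summable[OF Q c t] numerator_even_summable])
    moreover have "?f (case x of (k, l) \<Rightarrow> (k - l, 2 * l)) = (case x of (k, l) \<Rightarrow> ?A k * ?C l)" for x
      by (cases x) (simp only: prod.case e1[simplified prod.case])
    ultimately show "((\<lambda>x. ?f (case x of (k, l) \<Rightarrow> (k - l, 2 * l))) has_sum (theta_even Q c t * numerator_even)) UNIV"
      by (simp only: UNIV_Times_UNIV)
    have "((\<lambda>(k, l). ?B k * ?D l) has_sum (theta_odd Q c t * numerator_odd)) (UNIV \<times> UNIV)"
      unfolding theta_odd_def numerator_odd_def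
      by (rule has_sum_times(1)[OF theta_odd_summable[OF Q c t] numerator_odd_summable])
    moreover have "?f (case x of (k, l) \<Rightarrow> (k - l, 2 * l + 1)) = (case x of (k, l) \<Rightarrow> ?B k * ?D l)" for x
      by (cases x) (simp only: prod.case e2[simplified prod.case])
    ultimately show "((\<lambda>x. ?f (case x of (k, l) \<Rightarrow> (k - l, 2 * l + 1))) has_sum (theta_odd Q c t * numerator_odd)) UNIV"
      by (simp only: UNIV_Times_UNIV)
  qed
  then have "(?f has_sum appell_numerator t) (UNIV \<times> UNIV)" by (simp add: appell_numerator_def mult_ac)
  then show ?thesis
  proof (rule has_sum_SigmaD)
    fix m :: int
    have "t * Q powi m \<noteq> 0" using t Q0 by simp
    from has_sum_cmult_right[OF theta_quotient_has_sum[OF Q this], of "Q powi (2 * tri m) * c powi m * t powi (2 * m)"]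
    show "((\<lambda>i. ?f (m, i)) has_sum Q powi (2 * tri m) * c powi m * t powi (2 * m) * theta_quotient Q (t * Q powi m)) UNIV"
      by simp
  qed
qed

end

end

section \<open>Appell sums\<close>

text \<open>An Appell-Lerch sum, not normalised: in the Hickerson-Mortensen notation it is
  \<open>j(c t) m(Q / c, Q, c t)\<close>. The parameter \<open>c\<close> stays fixed while
  \<open>t\<close> moves, so that changing \<open>t\<close> is a change of their third
  argument.\<close>

definition appell :: "complex \<Rightarrow> complex \<Rightarrow> complex \<Rightarrow> complex" where
  "appell Q c t = (\<Sum>\<^sub>\<infinity>m. (-1) powi m * Q powi tri m * (c * t) powi m / (1 - t * Q powi m))"

definition appell_punctured :: "complex \<Rightarrow> complex \<Rightarrow> complex \<Rightarrow> complex" where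
  "appell_punctured Q c t = (\<Sum>\<^sub>\<infinity>m\<in>-{0}. (-1) powi m * Q powi tri m * (c * t) powi m / (1 - t * Q powi m))"

context
  fixes Q c :: complex
  assumes Q: "0 < norm Q" "norm Q < 1" and c: "c \<noteq> 0"
begin

text \<open>Quasi-periodicity of \<open>j\<close> turns \<open>j(t) / (1 - t Q^m)\<close> into a
  multiple of \<open>theta_quotient (t Q^m)\<close>, which has no pole.\<close>

lemma appell_term:
  assumes t: "t \<noteq> 0" "1 - t * Q powi m \<noteq> 0"
  shows "Q powi (2 * tri m) * c powi m * t powi (2 * m) * theta_quotient Q (t * Q powi m)
    = jtheta Q t * ((-1) powi m * Q powi tri m * (c * t) powi m / (1 - t * Q powi m))"
proof -
  have Q0: "Q \<noteq> 0" using Q by auto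
  have "(1 - t * Q powi m) * theta_quotient Q (t * Q powi m) = (-1) powi m * Q powi (- tri m) * t powi (- m) * jtheta Q t"
    using jtheta_shift[OF Q0 t(1), of m] theta_quotient_mult[OF Q, of "t * Q powi m"] t Q0 by (simp add: mult.commute)
  then have "theta_quotient Q (t * Q powi m) = (-1) powi m * Q powi (- tri m) * t powi (- m) * jtheta Q t / (1 - t * Q powi m)"
    using t(2) by (simp add: eq_divide_eq mult.commute)
  then have "Q powi (2 * tri m) * c powi m * t powi (2 * m) * theta_quotient Q (t * Q powi m)
    = jtheta Q t * ((-1) powi m * (Q powi (2 * tri m) * Q powi (- tri m)) * (c powi m * (t powi (2 * m) * t powi (- m)))
        / (1 - t * Q powi m))"
    by simp
  also have "Q powi (2 * tri m) * Q powi (- tri m) = Q powi tri m"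
    using Q0 by (simp flip: power_int_add)
  also have "t powi (2 * m) * t powi (- m) = t powi m"
    using t(1) by (simp flip: power_int_add)
  finally show ?thesis by (simp add: power_int_mult_distrib)
qed

lemma jtheta_mult_appell:
  assumes t: "t \<noteq> 0" "\<And>m. t * Q powi m \<noteq> 1"
  shows "jtheta Q t * appell Q c t = appell_numerator Q c t"
proof -
  have "((\<lambda>m. jtheta Q t * ((-1) powi m * Q powi tri m * (c * t) powi m / (1 - t * Q powi m))) has_sum appell_numerator Q c t) UNIV"
    using appell_numerator_has_sum[OF Q c t(1)] appell_term[OF t(1)] t(2) by simp
  from infsumI[OF this] show ?thesis
    unfolding infsum_cmult_right' appell_def .
qed

text \<open>The omitted term \<open>m = 0\<close> is \<open>j(t) / (1 - t)\<close>, that is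
  \<open>theta_quotient Q t\<close>; unlike the full sum this makes sense at
  \<open>t = 1\<close>.\<close>

lemma jtheta_mult_appell_punctured:
  assumes t: "t \<noteq> 0" "\<And>m. m \<noteq> 0 \<Longrightarrow> t * Q powi m \<noteq> 1"
  shows "jtheta Q t * appell_punctured Q c t = appell_numerator Q c t - theta_quotient Q t"
proof -
  let ?g = "\<lambda>m. Q powi (2 * tri m) * c powi m * t powi (2 * m) * theta_quotient Q (t * Q powi m)"
  have S: "?g summable_on -{0}"
    using has_sum_imp_summable[OF appell_numerator_has_sum[OF Q c t(1)]] by (rule summable_on_subset_banach) auto
  have "appell_numerator Q c t = infsum ?g UNIV" using infsumI[OF appell_numerator_has_sum[OF Q c t(1)]] by simp
  also have "UNIV = insert (0::int) (-{0})" by auto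
  also have "infsum ?g (insert 0 (-{0})) = ?g 0 + infsum ?g (-{0})"
    by (rule infsum_insert[OF S]) simp
  also have "?g 0 = theta_quotient Q t" by simp
  also have "infsum ?g (-{0}) = (\<Sum>\<^sub>\<infinity>m\<in>-{0}. jtheta Q t * ((-1) powi m * Q powi tri m * (c * t) powi m / (1 - t * Q powi m)))"
    using t(2) by (intro infsum_cong appell_term t(1)) auto
  also have "\<dots> = jtheta Q t * appell_punctured Q c t"
    unfolding infsum_cmult_right' appell_punctured_def ..
  finally show ?thesis by simp
qed

text \<open>At \<open>t = 1\<close> the punctured identity loses its left side, since
  \<open>j(1) = 0\<close>. This is the known value that anchors all changes of argument.\<close>

lemma appell_numerator_1: "appell_numerator Q c 1 = theta_quotient Q 1"
proof -
  have Q0: "Q \<noteq> 0" using Q by auto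
  have "Q powi m \<noteq> 1" if "m \<noteq> 0" for m
  proof
    assume "Q powi m = 1"
    then have "norm Q powi m = norm Q powi 0" by (metis norm_one norm_power_int power_int_0_right)
    then show False using that Q power_int_strict_decreasing[of m 0 "norm Q"] power_int_strict_decreasing[of 0 m "norm Q"]
      by (cases "m > 0") auto
  qed
  then show ?thesis using jtheta_mult_appell_punctured[of 1] by simp
qed

text \<open>\<open>theta_minor_cyclic\<close> at the points \<open>t\<close>, \<open>s\<close> and
  1, with the value at 1 inserted.\<close>

lemma appell_change:
  assumes t: "t \<noteq> 0" "\<And>m. t * Q powi m \<noteq> 1" and s: "s \<noteq> 0" "\<And>m. s * Q powi m \<noteq> 1"
    and n: "jtheta Q t \<noteq> 0" "jtheta Q s \<noteq> 0" "jtheta Q (c * s) \<noteq> 0"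
  shows "appell Q c t = (appell Q c s * jtheta Q (c * t)
      - s * theta_quotient Q 1 * jtheta Q (t / s) * jtheta Q (c * t * s) / (jtheta Q t * jtheta Q s)) / jtheta Q (c * s)"
proof -
  have "appell_numerator Q c t * theta_minor Q c s 1 + appell_numerator Q c s * theta_minor Q c 1 t + appell_numerator Q c 1 * theta_minor Q c t s = 0"
    unfolding appell_numerator_def[OF Q c] using theta_minor_cyclic[OF Q c, of "numerator_even Q c" t "numerator_odd Q c" s 1] by simp
  moreover have "theta_minor Q c 1 t = - theta_minor Q c t 1" by (simp add: theta_minor_def[OF Q c])
  ultimately have "(jtheta Q t * appell Q c t) * (jtheta Q s * jtheta Q (c * s))
      - (jtheta Q s * appell Q c s) * (jtheta Q t * jtheta Q (c * t))
      + theta_quotient Q 1 * (s * jtheta Q (t / s) * jtheta Q (c * t * s)) = 0"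
    using t s by (simp add: jtheta_mult_appell appell_numerator_1 theta_minor_eq[OF Q c])
  then show ?thesis using n by (simp add: field_simps)
qed

lemma appell_punctured_tendsto: "((\<lambda>t. appell_punctured Q c t) \<longlongrightarrow> appell_punctured Q c 1) (at 1)"
  and appell_punctured_ev: "eventually (\<lambda>t. t \<noteq> 0 \<and> (\<forall>m. m \<noteq> 0 \<longrightarrow> t * Q powi m \<noteq> 1)) (at 1)"
proof -
  have Q0: "Q \<noteq> 0" using Q by auto
  define a where "a = norm Q"
  have a: "0 < a" "a < 1" using Q by (auto simp: a_def)
  \<comment> \<open>The radius keeps \<open>norm t\<close> within \<open>(1 - a) / 2\<close> of 1.
    The two entries of \<open>d\<close> are the resulting lower bounds for the distance of
    \<open>t Q^m\<close> from 1, for \<open>m >= 1\<close> and for \<open>m <= -1\<close>.\<close>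
  define r where "r = min (1 / 2) ((1 - a) / 2)"
  have r: "r > 0" "r \<le> 1 / 2" "r \<le> (1 - a) / 2" using a by (auto simp: r_def)
  define d where "d = min ((1 - a) * (2 - a) / 2) ((1 - a) / (2 * a))"
  have d: "d > 0" using a by (auto simp: d_def)
  have lower: "norm (1 - t * Q powi m) \<ge> d" if t: "t \<in> ball 1 r" and m: "m \<noteq> 0" for t m
  proof -
    have nt: "norm t \<le> 1 + (1 - a) / 2" "norm t \<ge> 1 - (1 - a) / 2"
    proof -
      have "\<bar>1 - norm t\<bar> < r" using t norm_triangle_ineq3[of 1 t] by (auto simp: dist_norm)
      then show "norm t \<le> 1 + (1 - a) / 2" "norm t \<ge> 1 - (1 - a) / 2" using r unfolding abs_less_iff by linarith+
    qed
    show ?thesis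
    proof (cases "m > 0")
      case True
      have "norm Q powi m \<le> norm Q powi 1" using True a by (intro power_int_decreasing) (auto simp: a_def)
      then have "norm (t * Q powi m) \<le> (1 + (1 - a) / 2) * a"
        unfolding norm_mult norm_power_int a_def[symmetric] using nt a by (intro mult_mono) (auto simp: a_def)
      then have "norm (1 - t * Q powi m) \<ge> 1 - (1 + (1 - a) / 2) * a"
        using norm_triangle_ineq2[of 1 "t * Q powi m"] by simp
      also have "1 - (1 + (1 - a) / 2) * a = (1 - a) * (2 - a) / 2" by (simp add: field_simps)
      finally show ?thesis by (simp add: d_def)
    next
      case False
      have "norm Q powi (-1) \<le> norm Q powi m" using False m a by (intro power_int_decreasing) (auto simp: a_def)
      then have "(1 - (1 - a) / 2) * (1 / a) \<le> norm (t * Q powi m)"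
        unfolding norm_mult norm_power_int using nt a
        by (intro mult_mono) (auto simp: a_def power_int_minus inverse_eq_divide)
      then have "norm (1 - t * Q powi m) \<ge> (1 - (1 - a) / 2) * (1 / a) - 1"
        using norm_triangle_ineq3[of 1 "t * Q powi m"] by simp
      also have "(1 - (1 - a) / 2) * (1 / a) - 1 = (1 - a) / (2 * a)" using a by (simp add: field_simps)
      finally show ?thesis by (simp add: d_def)
    qed
  qed
  have B: "eventually (\<lambda>t. t \<in> ball 1 r) (at (1::complex))"
    by (rule eventually_at_in_open') (use r in auto)
  show "eventually (\<lambda>t. t \<noteq> 0 \<and> (\<forall>m. m \<noteq> 0 \<longrightarrow> t * Q powi m \<noteq> 1)) (at 1)"
    using B
  proof eventually_elim
    case (elim t)
    then have "t \<noteq> 0" using r by (auto simp: dist_norm)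
    moreover have "t * Q powi m \<noteq> 1" if "m \<noteq> 0" for m
      using lower[OF elim that] d by auto
    ultimately show ?case by blast
  qed
  show "((\<lambda>t. appell_punctured Q c t) \<longlongrightarrow> appell_punctured Q c 1) (at 1)"
    unfolding appell_punctured_def
  proof (rule infsum_tendsto_dominated)
    fix m :: int assume m: "m \<in> -{0}"
    have "1 - 1 * Q powi m \<noteq> 0" using lower[of 1 m] d m r by auto
    then show "((\<lambda>t. (-1) powi m * Q powi tri m * (c * t) powi m / (1 - t * Q powi m))
        \<longlongrightarrow> (-1) powi m * Q powi tri m * (c * 1) powi m / (1 - 1 * Q powi m)) (at 1)"
      using c by (intro tendsto_intros) auto
  next
    \<comment> \<open>From \<open>1/2 <= norm t <= 2\<close> follows
      \<open>norm t powi m <= 2 powi m + (1/2) powi m\<close> for either sign of \<open>m\<close>;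
      hence the arguments \<open>2 * c\<close> and \<open>c / 2\<close>.\<close>
    let ?h = "\<lambda>m. (1 / d) * (norm (Q powi tri m * (2 * c) powi m) + norm (Q powi tri m * (c / 2) powi m))"
    show "?h summable_on -{0}"
    proof (rule summable_on_subset_banach)
      show "?h summable_on UNIV"
        by (intro summable_on_cmult_right summable_on_add gauss_abs_summable Q) (use c in auto)
    qed auto
    show "\<forall>\<^sub>F t in at 1. \<forall>m\<in>-{0}. norm ((-1) powi m * Q powi tri m * (c * t) powi m / (1 - t * Q powi m)) \<le> ?h m"
      using B
    proof eventually_elim
      case (elim t)
      have nt: "norm t \<le> 2" "norm t \<ge> 1 / 2"
      proof -
        have "\<bar>1 - norm t\<bar> < r" using elim norm_triangle_ineq3[of 1 t] by (auto simp: dist_norm)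
        then show "norm t \<le> 2" "norm t \<ge> 1 / 2" using r unfolding abs_less_iff by linarith+
      qed
      show ?case
      proof
        fix m :: int assume "m \<in> -{0}"
        then have l: "norm (1 - t * Q powi m) \<ge> d" using lower[OF elim] by auto
        have "norm t powi m \<le> 2 powi m + (1 / 2) powi m"
        proof (cases "m \<ge> 0")
          case True
          then have "norm t powi m \<le> 2 powi m" using nt by (intro power_int_mono) auto
          then show ?thesis by (simp add: add_increasing2)
        next
          case False
          then have "norm t powi m \<le> (1 / 2) powi m" using nt by (intro power_int_antimono) auto
          then show ?thesis by (simp add: add_increasing)
        qed
        then have "norm (Q powi tri m) * norm (c powi m) * norm t powi m
          \<le> norm (Q powi tri m) * norm (c powi m) * (2 powi m + (1 / 2) powi m)"
          by (intro mult_left_mono) auto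
        also have "\<dots> = norm (Q powi tri m * (2 * c) powi m) + norm (Q powi tri m * (c / 2) powi m)"
          by (simp add: norm_mult norm_power_int norm_divide power_int_mult_distrib power_int_divide_distrib algebra_simps)
        finally have "norm ((-1) powi m * Q powi tri m * (c * t) powi m)
          \<le> norm (Q powi tri m * (2 * c) powi m) + norm (Q powi tri m * (c / 2) powi m)"
          by (simp add: norm_mult norm_power_int power_int_mult_distrib mult_ac)
        then have "norm ((-1) powi m * Q powi tri m * (c * t) powi m) / norm (1 - t * Q powi m)
          \<le> (norm (Q powi tri m * (2 * c) powi m) + norm (Q powi tri m * (c / 2) powi m)) / d"
          using l d by (intro frac_le) auto
        then show "norm ((-1) powi m * Q powi tri m * (c * t) powi m / (1 - t * Q powi m)) \<le> ?h m"
          by (simp add: norm_divide)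
      qed
    qed
  qed simp
qed

text \<open>The limit \<open>t -> 1\<close> of the change of argument with the polar term removed.
  The function \<open>?R\<close> equals \<open>j(t)\<close> times the punctured sum times the minor
  \<open>?K\<close>, and \<open>j\<close> has a simple zero at 1, so the punctured sum is read off
  from the derivative of \<open>?R\<close>; the derivatives of the minors bring in
  \<open>logder\<close>.\<close>

lemma appell_punctured_1:
  assumes s: "s \<noteq> 0" "\<And>m. s * Q powi m \<noteq> 1" and n: "jtheta Q s \<noteq> 0" "jtheta Q (c * s) \<noteq> 0"
  shows "appell_punctured Q c 1 = appell Q c s * jtheta Q c / jtheta Q (c * s) - (logder Q (1 / s) + logder Q (c * s))"
proof -
  let ?K = "theta_minor Q c s 1"
  let ?R = "\<lambda>t. appell_numerator Q c s * theta_minor Q c t 1 - theta_quotient Q 1 * theta_minor Q c t s - theta_quotient Q t * ?K"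
  have K: "?K = jtheta Q s * jtheta Q (c * s)" using theta_minor_eq[OF Q c] s by simp
  have W1s: "theta_minor Q c 1 s = - ?K" by (simp add: theta_minor_def[OF Q c])
  have W11: "theta_minor Q c 1 1 = 0" by (simp add: theta_minor_def[OF Q c])
  have D: "(?R has_field_derivative
      appell_numerator Q c s * (- theta_quotient Q 1 * jtheta Q c) - theta_quotient Q 1 * (theta_minor Q c 1 s * (logder Q (1 / s) + logder Q (c * s))) - 0 * ?K) (at 1)"
    by (intro DERIV_diff DERIV_cmult DERIV_cmult_right deriv_theta_quotient_1 theta_minor_1_DERIV theta_minor_DERIV Q c s n)
  have "((\<lambda>t. (?R t - ?R 1) / (t - 1)) \<longlongrightarrow>
      appell_numerator Q c s * (- theta_quotient Q 1 * jtheta Q c) - theta_quotient Q 1 * (theta_minor Q c 1 s * (logder Q (1 / s) + logder Q (c * s))) - 0 * ?K) (at 1)"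
    using D unfolding has_field_derivative_iff .
  moreover have "((\<lambda>t. (?R t - ?R 1) / (t - 1)) \<longlongrightarrow> - theta_quotient Q 1 * appell_punctured Q c 1 * ?K) (at 1)"
  proof (rule Lim_transform_eventually)
    have "(theta_quotient Q \<longlongrightarrow> theta_quotient Q 1) (at 1)"
      using DERIV_isCont[OF deriv_theta_quotient_1[OF Q]] by (simp add: isCont_def)
    then show "((\<lambda>t. - theta_quotient Q t * appell_punctured Q c t * ?K) \<longlongrightarrow> - theta_quotient Q 1 * appell_punctured Q c 1 * ?K) (at 1)"
      by (intro tendsto_intros appell_punctured_tendsto)
    show "\<forall>\<^sub>F t in at 1. - theta_quotient Q t * appell_punctured Q c t * ?K = (?R t - ?R 1) / (t - 1)"
      using appell_punctured_ev eventually_neq_at_within[of 1 1 UNIV]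
    proof eventually_elim
      case (elim t)
      have "appell_numerator Q c t * ?K + appell_numerator Q c s * theta_minor Q c 1 t + appell_numerator Q c 1 * theta_minor Q c t s = 0"
        unfolding appell_numerator_def[OF Q c] using theta_minor_cyclic[OF Q c, of "numerator_even Q c" t "numerator_odd Q c" s 1] by simp
      moreover have "theta_minor Q c 1 t = - theta_minor Q c t 1" by (simp add: theta_minor_def[OF Q c])
      ultimately have "?R t = (appell_numerator Q c t - theta_quotient Q t) * ?K"
        by (simp add: appell_numerator_1 algebra_simps)
      also have "\<dots> = jtheta Q t * appell_punctured Q c t * ?K"
        using jtheta_mult_appell_punctured[of t] elim by simp
      also have "jtheta Q t = (1 - t) * theta_quotient Q t" using theta_quotient_mult[OF Q] elim by simp
      finally have "?R t = (t - 1) * (- theta_quotient Q t * appell_punctured Q c t * ?K)" by (simp add: algebra_simps)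
      moreover have "?R 1 = 0" using W1s W11 by simp
      ultimately show ?case using elim by simp
    qed
  qed
  ultimately have "appell_numerator Q c s * (- theta_quotient Q 1 * jtheta Q c) - theta_quotient Q 1 * (theta_minor Q c 1 s * (logder Q (1 / s) + logder Q (c * s))) - 0 * ?K
     = - theta_quotient Q 1 * appell_punctured Q c 1 * ?K"
    by (rule tendsto_unique[OF at_neq_bot])
  moreover have "theta_quotient Q 1 \<noteq> 0"
    unfolding theta_quotient_1[OF Q] using qpoch_power_nonzero[of Q 1 1] Q by simp
  moreover have "appell_numerator Q c s = jtheta Q s * appell Q c s" using jtheta_mult_appell[OF s] by simp
  ultimately have "theta_quotient Q 1 * (jtheta Q s * (appell_punctured Q c 1 * jtheta Q (c * s)))
      = theta_quotient Q 1 * (jtheta Q s * (appell Q c s * jtheta Q c - jtheta Q (c * s) * (logder Q (1 / s) + logder Q (c * s))))"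
    unfolding W1s K by (simp add: algebra_simps)
  then have "appell_punctured Q c 1 * jtheta Q (c * s)
      = appell Q c s * jtheta Q c - jtheta Q (c * s) * (logder Q (1 / s) + logder Q (c * s))"
    using n \<open>theta_quotient Q 1 \<noteq> 0\<close> by simp
  then show ?thesis using n by (simp add: field_simps)
qed

end

section \<open>Five-dissections\<close>

lemma power_int_nontrivial:
  fixes q :: complex
  assumes "0 < norm q" "norm q < 1"
  shows "q powi m = q powi n \<longleftrightarrow> m = n"
proof
  assume "q powi m = q powi n"
  then have "norm q powi m = norm q powi n" by (metis norm_power_int)
  then show "m = n"
    using assms power_int_strict_decreasing[of m n "norm q"] power_int_strict_decreasing[of n m "norm q"]
    by (cases m n rule: linorder_cases) auto
qed auto

context
  fixes Q c :: complex
  assumes Q: "0 < norm Q" "norm Q < 1" and c: "c \<noteq> 0"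
begin

lemma appell_has_sum:
  assumes t: "t \<noteq> 0" "\<And>m. t * Q powi m \<noteq> 1" "jtheta Q t \<noteq> 0"
  shows "((\<lambda>m. (-1) powi m * Q powi tri m * (c * t) powi m / (1 - t * Q powi m)) has_sum appell Q c t) UNIV"
proof -
  have "((\<lambda>m. jtheta Q t * ((-1) powi m * Q powi tri m * (c * t) powi m / (1 - t * Q powi m))) has_sum appell_numerator Q c t) UNIV"
    using appell_numerator_has_sum[OF Q c t(1)] appell_term[OF Q c t(1)] t(2) by simp
  from has_sum_imp_summable[OF this]
  have "(\<lambda>m. (-1) powi m * Q powi tri m * (c * t) powi m / (1 - t * Q powi m)) summable_on UNIV"
    using t(3) by (rule summable_on_cmult_right'[THEN iffD1, rotated])
  then show ?thesis unfolding appell_def by (rule has_sum_infsum)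
qed

lemma appell_punctured_has_sum:
  "((\<lambda>m. (-1) powi m * Q powi tri m * (c * 1) powi m / (1 - 1 * Q powi m)) has_sum appell_punctured Q c 1) (-{0})"
proof -
  \<comment> \<open>The bound covers both signs: for \<open>m < 0\<close> it follows from
    \<open>1 / norm Q >= 2 - norm Q\<close>, that is from
    \<open>(1 - norm Q)^2 >= 0\<close>.\<close>
  have l: "norm (1 - 1 * Q powi m) \<ge> 1 - norm Q" if "m \<noteq> 0" for m
  proof (cases "m > 0")
    case True
    have "norm Q powi m \<le> norm Q powi 1" using True Q by (intro power_int_decreasing) auto
    then show ?thesis using norm_triangle_ineq2[of 1 "Q powi m"] by (simp add: norm_power_int)
  next
    case False
    have "norm Q powi (-1) \<le> norm Q powi m" using False that Q by (intro power_int_decreasing) auto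
    moreover have "norm Q powi (-1) \<ge> 2 - norm Q"
    proof -
      have "(2 - norm Q) * norm Q \<le> 1" using sum_squares_ge_zero[of "1 - norm Q" 0] by (simp add: algebra_simps)
      then show ?thesis using Q by (simp add: power_int_minus field_simps)
    qed
    ultimately show ?thesis using norm_triangle_ineq3[of 1 "Q powi m"] by (simp add: norm_power_int)
  qed
  have "(\<lambda>m. norm ((-1) powi m * Q powi tri m * (c * 1) powi m / (1 - 1 * Q powi m))) summable_on -{0}"
  proof (rule Infinite_Sum.abs_summable_on_comparison_test')
    have "(\<lambda>m. (1 / (1 - norm Q)) * norm (Q powi tri m * c powi m)) summable_on UNIV"
      by (intro summable_on_cmult_right gauss_abs_summable Q c)
    then show "(\<lambda>m. (1 / (1 - norm Q)) * norm (Q powi tri m * c powi m)) summable_on -{0}"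
      by (rule summable_on_subset_banach) auto
    fix m :: int assume "m \<in> -{0}"
    then have "norm (Q powi tri m * c powi m) / norm (1 - 1 * Q powi m) \<le> norm (Q powi tri m * c powi m) / (1 - norm Q)"
      using l[of m] Q by (intro divide_left_mono mult_pos_pos) auto
    then show "norm ((-1) powi m * Q powi tri m * (c * 1) powi m / (1 - 1 * Q powi m)) \<le> (1 / (1 - norm Q)) * norm (Q powi tri m * c powi m)"
      by (simp add: norm_mult norm_divide norm_power_int)
  qed
  then show ?thesis unfolding appell_punctured_def by (intro has_sum_infsum) (rule abs_summable_summable)
qed

end

text \<open>Symmetric residues are used because \<open>r\<close> and \<open>-r\<close> give theta
  functions with reflected subscripts \<open>5 + 2 r\<close> and \<open>5 - 2 r\<close>.\<close>

lemma has_sum_mod_5: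
  fixes f :: "int \<Rightarrow> complex"
  assumes "\<And>r. r \<in> {-2..2} \<Longrightarrow> ((\<lambda>m. f (5 * m + r)) has_sum S r) UNIV"
  shows "(f has_sum (S (-2) + S (-1) + S 0 + S 1 + S 2)) UNIV"
proof -
  have "(f has_sum (\<Sum>r\<in>{-2..2::int}. S r)) (\<Union>r\<in>{-2..2}. range (\<lambda>m. 5 * m + r))"
  proof (rule sum_has_sum)
    fix r :: int assume r: "r \<in> {-2..2}"
    have "inj (\<lambda>m. 5 * m + r)" by (auto simp: inj_on_def)
    from has_sum_reindex[OF this, of f "S r"] assms[OF r]
    show "(f has_sum S r) (range (\<lambda>m. 5 * m + r))" by (simp add: o_def)
  next
    fix r s :: int assume "r \<in> {-2..2}" "s \<in> {-2..2}" "r \<noteq> s"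
    then show "range (\<lambda>m. 5 * m + r) \<inter> range (\<lambda>m. 5 * m + s) = {}" by auto presburger
  qed auto
  moreover have "(\<Union>r\<in>{-2..2::int}. range (\<lambda>m. 5 * m + r)) = UNIV"
  proof -
    have "n \<in> (\<Union>r\<in>{-2..2}. range (\<lambda>m. 5 * m + r))" for n :: int
    proof -
      have "n = 5 * ((n + 2) div 5) + ((n + 2) mod 5 - 2)"
        using mult_div_mod_eq[of 5 "n + 2"] by linarith
      moreover have "(n + 2) mod 5 - 2 \<in> {-2..2}" by auto
      ultimately show ?thesis by blast
    qed
    then show ?thesis by blast
  qed
  moreover have "{-2..2::int} = {-2,-1,0,1,2}" by auto
  ultimately show ?thesis by (simp add: add.assoc)
qed

text \<open>The subscript of \<open>J\<close> is the exponent of \<open>q\<close>; the nome is \<open>q^10\<close> throughout.\<close>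

definition phi :: "complex \<Rightarrow> complex" where "phi p = jtheta (p\<^sup>2) p"

definition J :: "complex \<Rightarrow> int \<Rightarrow> complex" where "J q i = jtheta (q ^ 10) (q powi i)"

text \<open>The exponent \<open>n^2 + 2 k n\<close> grows by \<open>10 n\<close> when
  \<open>k\<close> grows by 5; the denominator is thus a geometric series over one residue class of
  \<open>k\<close> modulo 5.\<close>

definition lambert :: "int \<Rightarrow> complex \<Rightarrow> complex" where
  "lambert k p = (\<Sum>\<^sub>\<infinity>n\<in>-{0}. (-1) powi n * p powi (n\<^sup>2 + 2 * k * n) / (1 - p powi (10 * n)))"

lemma powi_five_sign: "(-1 :: complex) powi (5 * m + r) = (-1) powi m * (-1) powi r"
  by (cases "even m"; cases "even r") auto

context
  fixes q :: complex
  assumes q: "0 < norm q" "norm q < 1"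
begin

lemma q_nonzero: "q \<noteq> 0" using q by auto

lemma q10: "0 < norm (q ^ 10)" "norm (q ^ 10) < 1"
  using q by (auto simp: norm_power power_less_one_iff)

lemma q10_powi: "(q ^ 10) powi m = q powi (10 * m)"
  by (metis power_int_power of_nat_numeral)

lemma J_nonzero: "\<not> 10 dvd i \<Longrightarrow> J q i \<noteq> 0"
  unfolding J_def
  by (rule jtheta_nonzero[OF q10]) (use q_nonzero in \<open>auto simp: q10_powi power_int_nontrivial[OF q]\<close>)

lemma J_reflect: "J q (10 - i) = J q i"
  using jtheta_reflect[of "q ^ 10" "q powi i"] q_nonzero by (simp add: J_def power_int_diff)

lemma J_minus: "J q (- i) = - (q powi (- i) * J q i)"
  using jtheta_inverse[of "q powi i" "q ^ 10"] q_nonzero by (simp add: J_def power_int_minus field_simps)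

lemma J_shift: "J q (i + 10) = - (q powi (- i) * J q i)"
  using jtheta_Q[of "q ^ 10" "q powi i"] q_nonzero
  by (simp add: J_def power_int_minus power_int_add field_simps)

lemma J_values:
  "J q 6 = J q 4" "J q 7 = J q 3" "J q 8 = J q 2" "J q 9 = J q 1"
  "J q 11 = - J q 1 / q" "J q 12 = - J q 2 / q ^ 2" "J q 13 = - J q 3 / q ^ 3"
  "J q (-1) = - J q 1 / q" "J q (-2) = - J q 2 / q ^ 2" "J q (-3) = - J q 3 / q ^ 3" "J q (-4) = - J q 4 / q ^ 4"
  "J q (-8) = - J q 2 / q ^ 8"
  using J_reflect[of 4] J_reflect[of 3] J_reflect[of 2] J_reflect[of 1]
    J_shift[of 1] J_shift[of 2] J_shift[of 3] J_minus[of 1] J_minus[of 2] J_minus[of 3] J_minus[of 4] J_minus[of 8]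
  by (auto simp: power_int_minus field_simps)

lemma J_has_sum:
  "((\<lambda>m. (-1) powi m * q powi (5 * m\<^sup>2 + (i - 5) * m)) has_sum J q i) UNIV"
proof -
  have "(-1) powi m * (q ^ 10) powi tri m * (q powi i) powi m = (-1) powi m * q powi (5 * m\<^sup>2 + (i - 5) * m)" for m
  proof -
    have "10 * tri m + i * m = 5 * m\<^sup>2 + (i - 5) * m"
      using two_tri[of m] by (simp add: power2_eq_square algebra_simps)
    then show ?thesis using q_nonzero
      by (simp add: q10_powi mult.assoc flip: power_int_add power_int_mult)
  qed
  with jtheta_has_sum[OF q10, of "q powi i"] q_nonzero show ?thesis by (simp add: J_def)
qed

lemma phi_has_sum: "((\<lambda>n. (-1) powi n * q powi (n\<^sup>2)) has_sum phi q) UNIV"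
proof -
  have "(-1) powi n * (q\<^sup>2) powi tri n * q powi n = (-1) powi n * q powi (n\<^sup>2)" for n
  proof -
    have "(q\<^sup>2) powi tri n * q powi n = q powi (2 * tri n + n)"
      using q_nonzero by (simp add: powi_square powi_double power_int_add)
    also have "2 * tri n + n = n\<^sup>2" using sq_eq_tri[of n] by (simp add: power2_eq_square)
    finally show ?thesis by simp
  qed
  with jtheta_has_sum[of "q\<^sup>2" q] q show ?thesis
    by (simp add: phi_def norm_power power_less_one_iff)
qed

lemma phi_product: "phi q = qpoch [q] (q\<^sup>2) ^ 2 * qpoch [q\<^sup>2] (q\<^sup>2)"
proof -
  have "0 < norm (q\<^sup>2)" "norm (q\<^sup>2) < 1" using q by (auto simp: norm_power power_less_one_iff)
  from jacobi_triple_product[OF this q_nonzero] have "phi q = qpoch [q] (q\<^sup>2) * qpoch [q\<^sup>2 / q] (q\<^sup>2) * qpoch [q\<^sup>2] (q\<^sup>2)"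
    by (simp only: phi_def)
  also have "q\<^sup>2 / q = q" by (simp add: power2_eq_square)
  finally show ?thesis by (simp only: power2_eq_square[of "qpoch _ _"])
qed

lemma phi_nonzero: "phi q \<noteq> 0"
  unfolding phi_product using qpoch_power_nonzero[of q 1 2] qpoch_power_nonzero[of q 2 2] q by simp

text \<open>The square of \<open>phi\<close> is a sum over \<open>\<int>\<^sup>2\<close>, which is split into the five cosets of the sublattice
  generated by \<open>(2, 1)\<close> and \<open>(-1, 2)\<close>.\<close>

lemma phi_coset_has_sum:
  "((\<lambda>(x, y). ((-1) powi (2 * x - y + a) * q powi ((2 * x - y + a)\<^sup>2)) *
       ((-1) powi (x + 2 * y + b) * q powi ((x + 2 * y + b)\<^sup>2)))
    has_sum (-1) powi (a + b) * q powi (a\<^sup>2 + b\<^sup>2) * (J q (5 + 4 * a + 2 * b) * J q (5 - 2 * a + 4 * b))) UNIV"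
proof -
  let ?g = "\<lambda>(x, y). ((-1) powi x * q powi (5 * x\<^sup>2 + ((5 + 4 * a + 2 * b) - 5) * x)) *
        ((-1) powi y * q powi (5 * y\<^sup>2 + ((5 - 2 * a + 4 * b) - 5) * y))"
  have nJ: "(\<lambda>m. norm ((-1) powi m * q powi (5 * m\<^sup>2 + (i - 5) * m))) summable_on UNIV" for i
    using has_sum_imp_summable[OF J_has_sum] by (simp only: summable_on_iff_abs_summable_on_complex)
  have "(?g has_sum (J q (5 + 4 * a + 2 * b) * J q (5 - 2 * a + 4 * b))) (UNIV \<times> UNIV)"
    using has_sum_times(1)[OF nJ nJ, of "5 + 4 * a + 2 * b" "5 - 2 * a + 4 * b"]
    by (simp only: infsumI[OF J_has_sum])
  from has_sum_cmult_right[OF this, of "(-1) powi (a + b) * q powi (a\<^sup>2 + b\<^sup>2)"]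
  have H: "((\<lambda>z. (-1) powi (a + b) * q powi (a\<^sup>2 + b\<^sup>2) * ?g z) has_sum
      (-1) powi (a + b) * q powi (a\<^sup>2 + b\<^sup>2) * (J q (5 + 4 * a + 2 * b) * J q (5 - 2 * a + 4 * b))) UNIV"
    by (simp only: UNIV_Times_UNIV)
  have "(-1) powi (a + b) * q powi (a\<^sup>2 + b\<^sup>2) * ?g z =
     (case z of (x, y) \<Rightarrow> ((-1) powi (2 * x - y + a) * q powi ((2 * x - y + a)\<^sup>2)) *
       ((-1) powi (x + 2 * y + b) * q powi ((x + 2 * y + b)\<^sup>2)))" for z
  proof -
    obtain x y where z: "z = (x, y)" by force
    have 1: "q powi (a\<^sup>2 + b\<^sup>2) * (q powi (5 * x\<^sup>2 + (5 + 4 * a + 2 * b - 5) * x) * q powi (5 * y\<^sup>2 + (5 - 2 * a + 4 * b - 5) * y))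
       = q powi ((2 * x - y + a)\<^sup>2) * q powi ((x + 2 * y + b)\<^sup>2)"
    proof -
      have "a\<^sup>2 + b\<^sup>2 + (5 * x\<^sup>2 + (5 + 4 * a + 2 * b - 5) * x + (5 * y\<^sup>2 + (5 - 2 * a + 4 * b - 5) * y))
        = (2 * x - y + a)\<^sup>2 + (x + 2 * y + b)\<^sup>2"
        by (simp add: power2_eq_square algebra_simps)
      then show ?thesis using q_nonzero by (simp only: power_int_add[symmetric] simp_thms)
    qed
    have 2: "(-1 :: complex) powi (a + b) * ((-1) powi x * (-1) powi y) = (-1) powi (2 * x - y + a) * (-1) powi (x + 2 * y + b)"
    proof -
      have "even (a + b + (x + y)) \<longleftrightarrow> even ((2 * x - y + a) + (x + 2 * y + b))" by auto
      then have "(-1 :: complex) powi (a + b + (x + y)) = (-1) powi ((2 * x - y + a) + (x + 2 * y + b))"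
        by (simp only: power_int_minus_left power_int_1_left)
      then show ?thesis by (simp only: power_int_add zero_neq_neg_one simp_thms neg_equal_0_iff_equal one_neq_zero)
    qed
    show ?thesis
      using arg_cong2[OF 1 2, of "(*)"] unfolding z prod.case by (simp only: mult_ac)
  qed
  then show ?thesis using H by (simp only:)
qed

text \<open>The lattice itself contributes the square of \<open>J q 5\<close>; the other four cosets
  are permuted by the quarter turn and contribute equally. This is the one relation among the theta
  functions below that is not an instance of \<open>J_plucker\<close>.\<close>

lemma phi_square: "phi q ^ 2 = J q 5 ^ 2 - 4 * q * J q 1 * J q 3"
proof -
  let ?f = "\<lambda>(m, n). ((-1) powi m * q powi (m\<^sup>2)) * ((-1) powi n * q powi (n\<^sup>2))"
  let ?e = "\<lambda>(a, b). \<lambda>(x, y). (2 * x - y + a, x + 2 * y + b) :: int \<times> int"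
  let ?V = "{(0, 0), (1, 0), (-1, 0), (0, 1), (0, -1)} :: (int \<times> int) set"
  let ?S = "\<lambda>(a, b). (-1) powi (a + b) * q powi (a\<^sup>2 + b\<^sup>2) * (J q (5 + 4 * a + 2 * b) * J q (5 - 2 * a + 4 * b))"
  have ns: "(\<lambda>n. norm ((-1) powi n * q powi (n\<^sup>2))) summable_on UNIV"
    using has_sum_imp_summable[OF phi_has_sum] by (simp only: summable_on_iff_abs_summable_on_complex)
  have P: "(?f has_sum (phi q * phi q)) UNIV"
    using has_sum_times(1)[OF ns ns] by (simp only: infsumI[OF phi_has_sum] UNIV_Times_UNIV)
  have "(?f has_sum (\<Sum>v\<in>?V. ?S v)) (\<Union>v\<in>?V. range (?e v))"
  proof (rule sum_has_sum)
    fix v assume "v \<in> ?V"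
    obtain a b where v: "v = (a, b)" by force
    have inj: "inj (?e v)" by (auto simp: inj_on_def v)
    have "?f (?e v z) = (case z of (x, y) \<Rightarrow> ((-1) powi (2 * x - y + a) * q powi ((2 * x - y + a)\<^sup>2)) *
       ((-1) powi (x + 2 * y + b) * q powi ((x + 2 * y + b)\<^sup>2)))" for z
      by (cases z) (simp only: v prod.case)
    then have "((\<lambda>x. ?f (?e v x)) has_sum ?S v) UNIV"
      using phi_coset_has_sum[of a b] by (simp only: v prod.case)
    then show "(?f has_sum ?S v) (range (?e v))"
      using has_sum_reindex[OF inj, of ?f "?S v"] by (simp only: o_def)
  next
    fix v w assume h: "v \<in> ?V" "w \<in> ?V" "v \<noteq> w"
    \<comment> \<open>First coordinate minus twice the second, modulo 5, distinguishes the five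
      cosets: the representatives in \<open>?V\<close> have the values 0, 1, -1, -2, 2.\<close>
    have d: "fst (?e u z) - 2 * snd (?e u z) = fst u - 2 * snd u - 5 * snd z" for u z
      by (cases u; cases z) auto
    have ne: "?e v z \<noteq> ?e w z'" for z z'
    proof
      assume "?e v z = ?e w z'"
      then have "fst (?e v z) - 2 * snd (?e v z) = fst (?e w z') - 2 * snd (?e w z')" by (simp only:)
      then have "\<exists>k. (fst v - 2 * snd v) - (fst w - 2 * snd w) = 5 * k"
        unfolding d by (intro exI[of _ "snd z - snd z'"]) simp
      then obtain k where "(fst v - 2 * snd v) - (fst w - 2 * snd w) = 5 * k" by blast
      then show False using h by (elim insertE emptyE; simp; presburger)
    qed
    show "range (?e v) \<inter> range (?e w) = {}"
    proof (rule equals0I)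
      fix u assume "u \<in> range (?e v) \<inter> range (?e w)"
      then obtain z z' where "u = ?e v z" "u = ?e w z'" by (elim IntE imageE)
      then show False using ne[of z z'] by (simp only: simp_thms)
    qed
  qed auto
  moreover have "(\<Union>v\<in>?V. range (?e v)) = UNIV"
  proof -
    have "(m, n) \<in> (\<Union>v\<in>?V. range (?e v))" for m n
    proof -
      have wit: "(a, b) \<in> ?V \<Longrightarrow> (m, n) = ?e (a, b) (x, k) \<Longrightarrow> ?thesis" for a b x k by blast
      define k where "k = (m - 2 * n) div 5"
      have k: "m - 2 * n = 5 * k + (m - 2 * n) mod 5" by (simp add: k_def)
      have "(m - 2 * n) mod 5 \<in> {0..<5}" by auto
      then consider "(m - 2 * n) mod 5 = 0" | "(m - 2 * n) mod 5 = 1" | "(m - 2 * n) mod 5 = 2"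
        | "(m - 2 * n) mod 5 = 3" | "(m - 2 * n) mod 5 = 4" by fastforce
      then show ?thesis
      proof cases
        case 1 then show ?thesis using k by (intro wit[of 0 0 "n + 2 * k" "- k"]) auto
      next
        case 2 then show ?thesis using k by (intro wit[of 1 0 "n + 2 * k" "- k"]) auto
      next
        case 3 then show ?thesis using k by (intro wit[of 0 "-1" "n + 1 + 2 * k" "- k"]) auto
      next
        case 4 then show ?thesis using k by (intro wit[of 0 1 "n - 1 + 2 * (k + 1)" "- k - 1"]) auto
      next
        case 5 then show ?thesis using k by (intro wit[of "-1" 0 "n + 2 * (k + 1)" "- k - 1"]) auto
      qed
    qed
    then show ?thesis by auto
  qed
  ultimately have "(?f has_sum (\<Sum>v\<in>?V. ?S v)) UNIV" by (simp only:)
  with P have "phi q * phi q = (\<Sum>v\<in>?V. ?S v)" by (rule has_sum_unique)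
  also have "\<dots> = J q 5 ^ 2 - 4 * q * J q 1 * J q 3"
    using J_values by (simp add: power2_eq_square)
  finally show ?thesis by (simp add: power2_eq_square)
qed

lemma J_product: "J q i = qpoch [q powi i] (q ^ 10) * qpoch [q powi (10 - i)] (q ^ 10) * qpoch [q ^ 10] (q ^ 10)"
  using jacobi_triple_product[OF q10, of "q powi i"] q_nonzero by (simp add: J_def power_int_diff)

lemma theta_minor_J:
  "theta_minor (q ^ 10) (q powi e) (q powi i) (q powi j) = q powi j * J q (i - j) * J q (e + i + j)"
  using theta_minor_eq[OF q10, of "q powi e" "q powi i" "q powi j"] q_nonzero
  by (simp add: J_def power_int_diff power_int_add)

lemma J_plucker:
  "q powi x * J q (t - x) * J q (e + t + x) * (q powi r * J q (s - r) * J q (e + s + r))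
   + q powi x * J q (s - x) * J q (e + s + x) * (q powi t * J q (r - t) * J q (e + r + t))
   + q powi x * J q (r - x) * J q (e + r + x) * (q powi s * J q (t - s) * J q (e + t + s)) = 0"
  using theta_minor_plucker[OF q10, of "q powi e" "q powi t" "q powi x" "q powi s" "q powi r"] q_nonzero
  by (simp add: theta_minor_J)

text \<open>Here and in the next two lemmas \<open>J_plucker\<close> is taken at exponents
  \<open>x = 0\<close>, \<open>r = 1\<close>, \<open>s = 2\<close> with \<open>t = 3\<close>,
  \<open>t = 4\<close>, \<open>t = 3\<close> and \<open>e = 1\<close>, \<open>e = 1\<close>,
  \<open>e = 0\<close>; all subscripts then reduce to 1, ..., 5.\<close>

lemma J_rel1: "J q 2 ^ 2 * J q 3 * J q 5 = J q 1 * J q 3 * J q 4 ^ 2 + q * J q 1 ^ 2 * J q 2 * J q 4"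
proof -
  have "q * (J q 1 * J q 3 * J q 4 ^ 2 + q * J q 1 ^ 2 * J q 2 * J q 4 - J q 2 ^ 2 * J q 3 * J q 5) = 0"
    using J_plucker[of 0 3 1 1 2] q_nonzero by (simp add: J_values power2_eq_square field_simps power3_eq_cube)
  then show ?thesis by (metis mult_eq_0_iff q_nonzero eq_iff_diff_eq_0)
qed

lemma J_rel2: "J q 2 * J q 3 ^ 2 * J q 4 = J q 1 * J q 4 ^ 2 * J q 5 + q * J q 1 * J q 2 ^ 2 * J q 3"
proof -
  have "q * (J q 1 * J q 4 ^ 2 * J q 5 + q * J q 1 * J q 2 ^ 2 * J q 3 - J q 2 * J q 3 ^ 2 * J q 4) = 0"
    using J_plucker[of 0 4 1 1 2] q_nonzero by (simp add: J_values power2_eq_square field_simps power3_eq_cube power4_eq_xxxx)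
  then show ?thesis by (metis mult_eq_0_iff q_nonzero eq_iff_diff_eq_0)
qed

lemma J_rel3: "J q 2 ^ 3 * J q 4 = J q 1 * J q 3 ^ 3 + q * J q 1 ^ 3 * J q 5"
proof -
  have "q * (J q 1 * J q 3 ^ 3 + q * J q 1 ^ 3 * J q 5 - J q 2 ^ 3 * J q 4) = 0"
    using J_plucker[of 0 3 0 1 2] q_nonzero by (simp add: J_values power2_eq_square field_simps power3_eq_cube)
  then show ?thesis by (metis mult_eq_0_iff q_nonzero eq_iff_diff_eq_0)
qed

end

section \<open>Appell sums and logarithmic derivatives at powers of q\<close>

definition logder10 :: "complex \<Rightarrow> int \<Rightarrow> complex" where "logder10 q i = logder (q ^ 10) (q powi i)"

definition appell10 :: "complex \<Rightarrow> int \<Rightarrow> int \<Rightarrow> complex" where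
  "appell10 q e i = appell (q ^ 10) (q powi e) (q powi i)"

definition appell10_punctured :: "complex \<Rightarrow> int \<Rightarrow> complex" where "appell10_punctured q e = appell_punctured (q ^ 10) (q powi e) 1"

definition E3 :: "complex \<Rightarrow> complex" where "E3 q = theta_quotient (q ^ 10) 1"

context
  fixes q :: complex
  assumes q: "0 < norm q" "norm q < 1"
begin

lemma q_powi_shift_neq: "\<not> 10 dvd i \<Longrightarrow> q powi i * (q ^ 10) powi m \<noteq> 1"
proof
  assume "\<not> 10 dvd i" "q powi i * (q ^ 10) powi m = 1"
  then have "q powi (i + 10 * m) = q powi 0"
    using q_nonzero[OF q] by (simp add: q10_powi[OF q] power_int_add)
  then have "i + 10 * m = 0" using power_int_nontrivial[OF q] by blast
  then have "i = 10 * (- m)" by simp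
  with \<open>\<not> 10 dvd i\<close> show False by (metis dvd_triv_left)
qed

lemma appell_term_powi:
  "(-1) powi m * (q ^ 10) powi tri m * (q powi e * q powi i) powi m / (1 - q powi i * (q ^ 10) powi m)
    = (-1) powi m * q powi (5 * m\<^sup>2 + (e + i - 5) * m) / (1 - q powi (10 * m + i))"
proof -
  have "10 * tri m + (e + i) * m = 5 * m\<^sup>2 + (e + i - 5) * m"
    using two_tri[of m] by (simp add: power2_eq_square algebra_simps)
  then have "(q ^ 10) powi tri m * (q powi e * q powi i) powi m = q powi (5 * m\<^sup>2 + (e + i - 5) * m)"
    using q_nonzero[OF q] by (simp add: q10_powi[OF q] flip: power_int_add power_int_mult)
  moreover have "q powi i * (q ^ 10) powi m = q powi (10 * m + i)"
    using q_nonzero[OF q] by (simp add: q10_powi[OF q] add.commute flip: power_int_add)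
  ultimately show ?thesis by (simp only: mult.assoc)
qed

lemma appell_has_sum_powi:
  assumes "\<not> 10 dvd i"
  shows "((\<lambda>m. (-1) powi m * q powi (5 * m\<^sup>2 + (e + i - 5) * m) / (1 - q powi (10 * m + i)))
    has_sum appell10 q e i) UNIV"
  using appell_has_sum[OF q10[OF q], of "q powi e" "q powi i"] q_powi_shift_neq[OF assms] J_nonzero[OF q assms]
    q_nonzero[OF q]
  by (simp only: appell_term_powi J_def appell10_def) simp

lemma appell_punctured_has_sum_powi:
  "((\<lambda>m. (-1) powi m * q powi (5 * m\<^sup>2 + (e - 5) * m) / (1 - q powi (10 * m)))
    has_sum appell10_punctured q e) (-{0})"
  using appell_punctured_has_sum[OF q10[OF q], of "q powi e"] appell_term_powi[of _ e 0] q_nonzero[OF q] by (simp add: appell10_punctured_def)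

lemma appell_J:
  assumes "\<not> 10 dvd i" "\<not> 10 dvd j" "\<not> 10 dvd (e + j)"
  shows "appell10 q e i
    = (appell10 q e j * J q (e + i)
       - q powi j * E3 q * J q (i - j) * J q (e + i + j) / (J q i * J q j)) / J q (e + j)"
proof -
  have e: "q powi e * q powi i = q powi (e + i)" "q powi e * q powi j = q powi (e + j)"
    "q powi (e + i) * q powi j = q powi (e + i + j)" "q powi i / q powi j = q powi (i - j)"
    using q_nonzero[OF q] by (auto simp: power_int_add power_int_diff)
  show ?thesis
    using appell_change[OF q10[OF q], of "q powi e" "q powi i" "q powi j"]
      q_powi_shift_neq[OF assms(1)] q_powi_shift_neq[OF assms(2)]
      J_nonzero[OF q assms(1)] J_nonzero[OF q assms(2)] J_nonzero[OF q assms(3)] q_nonzero[OF q]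
    unfolding e J_def logder10_def E3_def appell10_def appell10_punctured_def by simp
qed

lemma appell_punctured_J:
  assumes "\<not> 10 dvd j" "\<not> 10 dvd (e + j)"
  shows "appell10_punctured q e
    = appell10 q e j * J q e / J q (e + j)
      - (logder10 q (- j) + logder10 q (e + j))"
proof -
  have e: "q powi e * q powi j = q powi (e + j)" "1 / q powi j = q powi (- j)"
    using q_nonzero[OF q] by (auto simp: power_int_add power_int_minus field_simps)
  show ?thesis
    using appell_punctured_1[OF q10[OF q], of "q powi e" "q powi j"]
      q_powi_shift_neq[OF assms(1)]
      J_nonzero[OF q assms(1)] J_nonzero[OF q assms(2)] q_nonzero[OF q]
    unfolding e J_def logder10_def E3_def appell10_def appell10_punctured_def by simp
qed

lemma logder10_minus: "\<not> 10 dvd i \<Longrightarrow> logder10 q (- i) = 1 - logder10 q i"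
  using logder_inverse[OF q10[OF q], of "q powi i"] J_nonzero[OF q, of i] q_nonzero[OF q]
  by (simp add: J_def logder10_def power_int_minus field_simps)

lemma logder10_shift: "\<not> 10 dvd i \<Longrightarrow> logder10 q (i + 10) = logder10 q i - 1"
  using logder_shift[OF q10[OF q], of "q powi i"] J_nonzero[OF q, of i] q_nonzero[OF q]
  by (simp add: J_def logder10_def power_int_add mult.commute)

lemma logder10_5: "logder10 q 5 = 0"
  using logder_Q_half[OF q10[OF q], of "q powi 5"] J_nonzero[OF q, of 5]
  by (simp add: J_def logder10_def power_mult[symmetric])

lemma logder10_relation:
  assumes "\<not> 10 dvd i" "\<not> 10 dvd (e + i)" "\<not> 10 dvd j" "\<not> 10 dvd (e + j)"
  shows "logder10 q (- j) + logder10 q (e + j) - logder10 q (- i) - logder10 q (e + i)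
    = E3 q * J q e * q powi j * J q (i - j) * J q (e + i + j) / (J q i * J q (e + i) * J q j * J q (e + j))"
proof -
  have e: "q powi e * q powi i = q powi (e + i)" "q powi e * q powi j = q powi (e + j)"
    "q powi (e + i) * q powi j = q powi (e + i + j)" "q powi i / q powi j = q powi (i - j)"
    "1 / q powi i = q powi (- i)" "1 / q powi j = q powi (- j)"
    using q_nonzero[OF q] by (auto simp: power_int_add power_int_diff power_int_minus field_simps)
  show ?thesis
    using logder_relation[OF q10[OF q], of "q powi e" "q powi i" "q powi j"]
      J_nonzero[OF q assms(1)] J_nonzero[OF q assms(2)] J_nonzero[OF q assms(3)] J_nonzero[OF q assms(4)] q_nonzero[OF q]
    unfolding e J_def logder10_def E3_def appell10_def appell10_punctured_def by simp
qed

text \<open>With \<open>i = -2\<close>, \<open>e = 4\<close>, \<open>j = 2\<close> the points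
  \<open>e + i\<close> and \<open>j\<close> coincide, so only \<open>logder10\<close> at 2 and 4
  remains. This combination and that of \<open>logder10_rel2\<close> are the ones that occur in
  \<open>class_gf_value_02\<close> and \<open>class_gf_value_12\<close>.\<close>

lemma logder10_rel1: "3 * logder10 q 2 + logder10 q 4 - 1 = - (E3 q * J q 4 ^ 2 / J q 2 ^ 3)"
proof -
  have 1: "logder10 q (-2) = 1 - logder10 q 2" using logder10_minus[of 2] by simp
  have 2: "logder10 q 6 = - logder10 q 4"
    using logder10_minus[of 4] logder10_shift[of "-4"] by simp
  have "logder10 q (-2) + logder10 q 6 - logder10 q 2 - logder10 q 2
    = E3 q * J q 4 * q powi 2 * J q (-4) * J q 4 / (J q (-2) * J q 2 * J q 2 * J q 6)"
    using logder10_relation[of "-2" 4 2] by simp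
  also have "\<dots> = E3 q * J q 4 ^ 2 / J q 2 ^ 3"
    using J_nonzero[OF q, of 2] J_nonzero[OF q, of 4] q_nonzero[OF q]
    by (simp add: J_values[OF q] divide_simps; simp add: algebra_simps eval_nat_numeral)
  finally show ?thesis using 1 2 by (simp add: algebra_simps)
qed

lemma logder10_rel2: "3 * logder10 q 4 - logder10 q 2 = q ^ 2 * E3 q * J q 2 ^ 2 / J q 4 ^ 3"
proof -
  have 1: "logder10 q (-4) = 1 - logder10 q 4" using logder10_minus[of 4] by simp
  have 2: "logder10 q 12 = logder10 q 2 - 1" using logder10_shift[of 2] by simp
  have "logder10 q (-4) + logder10 q 12 - logder10 q 4 - logder10 q 4
    = E3 q * J q 8 * q powi 4 * J q (-8) * J q 8 / (J q (-4) * J q 4 * J q 4 * J q 12)"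
    using logder10_relation[of "-4" 8 4] by simp
  also have "\<dots> = - (q ^ 2 * E3 q * J q 2 ^ 2 / J q 4 ^ 3)"
    using J_nonzero[OF q, of 2] J_nonzero[OF q, of 4] q_nonzero[OF q]
    by (simp add: J_values[OF q] divide_simps; simp add: algebra_simps eval_nat_numeral)
  finally show ?thesis using 1 2 by (simp add: algebra_simps)
qed

text \<open>The sums of \<open>lambert 1\<close> and \<open>lambert 2\<close> have
  \<open>e = 7\<close> and \<open>e = 9\<close>. The base point is \<open>i = 5 - e\<close>: then
  the linear term of the exponent disappears, and \<open>e + i = 5\<close> is the half period where
  \<open>logder10\<close> vanishes.\<close>

definition "mock_2 = appell10 q 7 (-2)"
definition "mock_4 = appell10 q 9 (-4)"

text \<open>Reflect \<open>m -> -m\<close>, then extend each fraction by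
  \<open>q^(10 m + 2)\<close>: this produces the term \<open>10 m\<close> of the exponent and the
  factor \<open>q^2\<close>.\<close>

lemma bilateral_2: "q ^ 2 * bilateral_sum 2 q = - mock_2"
proof -
  have "mock_2 = (\<Sum>\<^sub>\<infinity>m. (-1) powi m * q powi (5 * m\<^sup>2) / (1 - q powi (10 * m - 2)))"
    using infsumI[OF appell_has_sum_powi[of "-2" 7]] by (simp add: mock_2_def)
  also have "\<dots> = (\<Sum>\<^sub>\<infinity>m. (-1) powi (- m) * q powi (5 * (- m)\<^sup>2) / (1 - q powi (10 * (- m) - 2)))"
    by (rule infsum_reindex_bij_witness[of _ "\<lambda>n. - n" "\<lambda>n. - n"]) auto
  also have "\<dots> = (\<Sum>\<^sub>\<infinity>m. - (q ^ 2) * ((-1) powi m * q powi (5 * m\<^sup>2 + 10 * m) / (1 - q powi (10 * m + 2))))"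
  proof (rule infsum_cong)
    fix m :: int
    have z: "q powi (10 * m + 2) \<noteq> 0" using q_nonzero[OF q] by simp
    have "q powi (10 * (- m) - 2) = 1 / q powi (10 * m + 2)"
      using q_nonzero[OF q] by (simp add: power_int_minus power_int_diff power_int_add field_simps)
    \<comment> \<open>At \<open>x = 1\<close> both sides are 0, since division by zero gives
      0.\<close>
    moreover have "1 / (1 - 1 / x) = - (x / (1 - x))" if "x \<noteq> 0" for x :: complex
      using that by (cases "x = 1") (auto simp: field_simps)
    ultimately have "1 / (1 - q powi (10 * (- m) - 2)) = - (q powi (10 * m + 2) / (1 - q powi (10 * m + 2)))"
      using z by simp
    note A = this
    have B: "q powi (10 * m + 2) * q powi (5 * m\<^sup>2) = q ^ 2 * q powi (5 * m\<^sup>2 + 10 * m)"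
      using q_nonzero[OF q] by (simp add: power_int_add)
    have "(-1) powi (- m) * q powi (5 * (- m)\<^sup>2) / (1 - q powi (10 * (- m) - 2))
        = (-1) powi m * q powi (5 * m\<^sup>2) * (1 / (1 - q powi (10 * (- m) - 2)))"
      by (simp add: power_int_minus_one_minus)
    also have "\<dots> = - ((-1) powi m * (q powi (10 * m + 2) * q powi (5 * m\<^sup>2)) / (1 - q powi (10 * m + 2)))"
      unfolding A by simp
    finally show "(-1) powi (- m) * q powi (5 * (- m)\<^sup>2) / (1 - q powi (10 * (- m) - 2))
        = - (q ^ 2) * ((-1) powi m * q powi (5 * m\<^sup>2 + 10 * m) / (1 - q powi (10 * m + 2)))"
      unfolding B by simp
  qed
  also have "\<dots> = - (q ^ 2) * bilateral_sum 2 q"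
    unfolding infsum_cmult_right' bilateral_sum_def ..
  finally show ?thesis by simp
qed

lemma bilateral_4: "q ^ 4 * bilateral_sum 4 q = - mock_4"
proof -
  have "mock_4 = (\<Sum>\<^sub>\<infinity>m. (-1) powi m * q powi (5 * m\<^sup>2) / (1 - q powi (10 * m - 4)))"
    using infsumI[OF appell_has_sum_powi[of "-4" 9]] by (simp add: mock_4_def)
  also have "\<dots> = (\<Sum>\<^sub>\<infinity>m. (-1) powi (- m) * q powi (5 * (- m)\<^sup>2) / (1 - q powi (10 * (- m) - 4)))"
    by (rule infsum_reindex_bij_witness[of _ "\<lambda>n. - n" "\<lambda>n. - n"]) auto
  also have "\<dots> = (\<Sum>\<^sub>\<infinity>m. - (q ^ 4) * ((-1) powi m * q powi (5 * m\<^sup>2 + 10 * m) / (1 - q powi (10 * m + 4))))"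
  proof (rule infsum_cong)
    fix m :: int
    have z: "q powi (10 * m + 4) \<noteq> 0" using q_nonzero[OF q] by simp
    have "q powi (10 * (- m) - 4) = 1 / q powi (10 * m + 4)"
      using q_nonzero[OF q] by (simp add: power_int_minus power_int_diff power_int_add field_simps)
    moreover have "1 / (1 - 1 / x) = - (x / (1 - x))" if "x \<noteq> 0" for x :: complex
      using that by (cases "x = 1") (auto simp: field_simps)
    ultimately have "1 / (1 - q powi (10 * (- m) - 4)) = - (q powi (10 * m + 4) / (1 - q powi (10 * m + 4)))"
      using z by simp
    note A = this
    have B: "q powi (10 * m + 4) * q powi (5 * m\<^sup>2) = q ^ 4 * q powi (5 * m\<^sup>2 + 10 * m)"
      using q_nonzero[OF q] by (simp add: power_int_add)
    have "(-1) powi (- m) * q powi (5 * (- m)\<^sup>2) / (1 - q powi (10 * (- m) - 4))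
        = (-1) powi m * q powi (5 * m\<^sup>2) * (1 / (1 - q powi (10 * (- m) - 4)))"
      by (simp add: power_int_minus_one_minus)
    also have "\<dots> = - ((-1) powi m * (q powi (10 * m + 4) * q powi (5 * m\<^sup>2)) / (1 - q powi (10 * m + 4)))"
      unfolding A by simp
    finally show "(-1) powi (- m) * q powi (5 * (- m)\<^sup>2) / (1 - q powi (10 * (- m) - 4))
        = - (q ^ 4) * ((-1) powi m * q powi (5 * m\<^sup>2 + 10 * m) / (1 - q powi (10 * m + 4)))"
      unfolding B by simp
  qed
  also have "\<dots> = - (q ^ 4) * bilateral_sum 4 q"
    unfolding infsum_cmult_right' bilateral_sum_def ..
  finally show ?thesis by simp
qed

end

section \<open>Five-dissection of phi and of the Lambert series\<close>

context
  fixes p q :: complex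
  assumes p: "0 < norm p" "norm p < 1" and pq: "q = p ^ 5"
begin

lemma q_bounds: "0 < norm q" "norm q < 1"
  using p by (auto simp: pq norm_power power_less_one_iff)

lemma q_powi_eq: "q powi m = p powi (5 * m)"
  unfolding pq by (metis power_int_power of_nat_numeral)

text \<open>The residues \<open>r\<close> and \<open>-r\<close> give the same theta function by
  \<open>J_reflect\<close>, hence the factors 2.\<close>

lemma phi_dissect: "phi p = J q 5 - 2 * p * J q 3 + 2 * p ^ 4 * J q 1"
proof -
  have p0: "p \<noteq> 0" using p by auto
  let ?S = "\<lambda>r. (-1) powi r * p powi (r\<^sup>2) * J q (5 + 2 * r)"
  have "((\<lambda>n. (-1) powi n * p powi (n\<^sup>2)) has_sum (?S (-2) + ?S (-1) + ?S 0 + ?S 1 + ?S 2)) UNIV"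
  proof (rule has_sum_mod_5)
    fix r :: int
    have "(-1) powi r * p powi (r\<^sup>2) * ((-1) powi m * q powi (5 * m\<^sup>2 + (5 + 2 * r - 5) * m))
        = (-1) powi (5 * m + r) * p powi ((5 * m + r)\<^sup>2)" for m
    proof -
      have "r\<^sup>2 + 5 * (5 * m\<^sup>2 + (5 + 2 * r - 5) * m) = (5 * m + r)\<^sup>2"
        by (simp add: power2_eq_square algebra_simps)
      then have "p powi (r\<^sup>2) * q powi (5 * m\<^sup>2 + (5 + 2 * r - 5) * m) = p powi ((5 * m + r)\<^sup>2)"
        using p0 unfolding q_powi_eq by (simp only: power_int_add[symmetric] simp_thms)
      then show ?thesis unfolding powi_five_sign by (simp add: mult_ac)
    qed
    with has_sum_cmult_right[OF J_has_sum[OF q_bounds, of "5 + 2 * r"], of "(-1) powi r * p powi (r\<^sup>2)"]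
    show "((\<lambda>m. (-1) powi (5 * m + r) * p powi ((5 * m + r)\<^sup>2)) has_sum ?S r) UNIV"
      by (simp only: )
  qed
  from has_sum_unique[OF phi_has_sum[OF p] this] show ?thesis
    by (simp add: J_values[OF q_bounds])
qed

lemma lambert_dissect:
  "(\<lambda>n. (-1) powi n * p powi (n\<^sup>2 + 2 * k * n) / (1 - p powi (10 * n))) summable_on -{0}"
  "lambert k p = appell10_punctured q (5 + 2 * k)
     - p powi (1 + 2 * k) * appell10 q (5 + 2 * k) 2
     - p powi (1 - 2 * k) * appell10 q (5 + 2 * k) (-2)
     + p powi (4 + 4 * k) * appell10 q (5 + 2 * k) 4
     + p powi (4 - 4 * k) * appell10 q (5 + 2 * k) (-4)"
proof -
  have p0: "p \<noteq> 0" using p by auto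
  let ?t = "\<lambda>n. (-1) powi n * p powi (n\<^sup>2 + 2 * k * n) / (1 - p powi (10 * n))"
  \<comment> \<open>Extended by 0 at the omitted index, so that the residue classes can be taken
    over all integers; only \<open>r = 0\<close> feels the hole.\<close>
  let ?f = "\<lambda>n. if n = 0 then 0 else ?t n"
  let ?A = "\<lambda>r. if r = 0 then appell10_punctured q (5 + 2 * k) else appell10 q (5 + 2 * k) (2 * r)"
  let ?S = "\<lambda>r. (-1) powi r * p powi (r\<^sup>2 + 2 * k * r) * ?A r"
  have tt: "(-1) powi r * p powi (r\<^sup>2 + 2 * k * r) *
       ((-1) powi m * q powi (5 * m\<^sup>2 + (5 + 2 * k + 2 * r - 5) * m) / (1 - q powi (10 * m + 2 * r))) = ?t (5 * m + r)" for m r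
  proof -
    have "r\<^sup>2 + 2 * k * r + 5 * (5 * m\<^sup>2 + (5 + 2 * k + 2 * r - 5) * m) = (5 * m + r)\<^sup>2 + 2 * k * (5 * m + r)"
      by (simp add: power2_eq_square algebra_simps)
    then have "p powi (r\<^sup>2 + 2 * k * r) * q powi (5 * m\<^sup>2 + (5 + 2 * k + 2 * r - 5) * m) = p powi ((5 * m + r)\<^sup>2 + 2 * k * (5 * m + r))"
      using p0 unfolding q_powi_eq by (simp only: power_int_add[symmetric] simp_thms)
    moreover have "q powi (10 * m + 2 * r) = p powi (10 * (5 * m + r))"
      unfolding q_powi_eq by (simp add: algebra_simps)
    ultimately show ?thesis unfolding powi_five_sign by (simp add: mult_ac)
  qed
  have F: "(?f has_sum (?S (-2) + ?S (-1) + ?S 0 + ?S 1 + ?S 2)) UNIV"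
  proof (rule has_sum_mod_5)
    fix r :: int assume r: "r \<in> {-2..2}"
    show "((\<lambda>m. ?f (5 * m + r)) has_sum ?S r) UNIV"
    proof (cases "r = 0")
      case True
      have "((\<lambda>m. ?t (5 * m)) has_sum ?S 0) (-{0})"
        using has_sum_cmult_right[OF appell_punctured_has_sum_powi[OF q_bounds, of "5 + 2 * k"], of 1] tt[of 0] by simp
      also have "?this \<longleftrightarrow> ((\<lambda>m. ?f (5 * m)) has_sum ?S 0) UNIV"
        by (rule has_sum_cong_neutral) auto
      finally show ?thesis by (simp only: True add_0_right)
    next
      case False
      have "\<not> 10 dvd 2 * r" using r False by auto
      from has_sum_cmult_right[OF appell_has_sum_powi[OF q_bounds this, of "5 + 2 * k"], of "(-1) powi r * p powi (r\<^sup>2 + 2 * k * r)"]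
      have "((\<lambda>m. ?t (5 * m + r)) has_sum ?S r) UNIV"
        using False by (simp only: tt if_False simp_thms)
      moreover have "5 * m + r \<noteq> 0" for m
        using r False unfolding atLeastAtMost_iff by presburger
      then have "?f (5 * m + r) = ?t (5 * m + r)" for m by (simp only: if_False)
      ultimately show ?thesis by (simp only:)
    qed
  qed
  have "(?f has_sum (?S (-2) + ?S (-1) + ?S 0 + ?S 1 + ?S 2)) UNIV \<longleftrightarrow>
    (?t has_sum (?S (-2) + ?S (-1) + ?S 0 + ?S 1 + ?S 2)) (-{0})"
    by (rule has_sum_cong_neutral) auto
  with F have G: "(?t has_sum (?S (-2) + ?S (-1) + ?S 0 + ?S 1 + ?S 2)) (-{0})" by blast
  show "?t summable_on -{0}" using has_sum_imp_summable[OF G] .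
  show "lambert k p = appell10_punctured q (5 + 2 * k)
     - p powi (1 + 2 * k) * appell10 q (5 + 2 * k) 2
     - p powi (1 - 2 * k) * appell10 q (5 + 2 * k) (-2)
     + p powi (4 + 4 * k) * appell10 q (5 + 2 * k) 4
     + p powi (4 - 4 * k) * appell10 q (5 + 2 * k) (-4)"
    using infsumI[OF G] by (simp add: lambert_def)
qed

text \<open>All Appell sums are moved to the base point. The resulting multiples of
  \<open>mock_2\<close> reproduce the dissection of \<open>phi p\<close>, so that after division by
  \<open>phi p\<close> the mock part is a single power of \<open>p\<close>. The remaining theta
  quotients carry only \<open>p^0\<close> and \<open>p^3\<close>; in \<open>lambert_2\<close> the
  powers are \<open>p^0\<close> and \<open>p^2\<close>.\<close>

lemma lambert_1:
  "lambert 1 p = - (mock_2 q * phi p / (p * J q 5))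
    + (q ^ 2 * E3 q * J q 1 / (J q 4 * J q 5) - logder10 q 2)
    + p ^ 3 * (q * E3 q * J q 1 / (J q 2 * J q 5) - E3 q * J q 3 * J q 4 / (J q 2 ^ 2 * J q 5))"
proof -
  note nz = J_nonzero[OF q_bounds, of 1] J_nonzero[OF q_bounds, of 2] J_nonzero[OF q_bounds, of 3]
    J_nonzero[OF q_bounds, of 4] J_nonzero[OF q_bounds, of 5]
  have p0: "p \<noteq> 0" "q \<noteq> 0" using p pq by auto
  note jv = J_values[OF q_bounds]
  note mock_2 = mock_2_def[OF q_bounds, symmetric]
  have a0: "appell10_punctured q 7 = mock_2 q * J q 3 / J q 5 - logder10 q 2"
    using appell_punctured_J[OF q_bounds, of "-2" 7] by (simp add: jv mock_2 logder10_5[OF q_bounds])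
  have a1: "appell10 q 7 2 = (mock_2 q * J q 1 + E3 q * J q 3 * J q 4 / J q 2 ^ 2) / J q 5"
    using appell_J[OF q_bounds, of 2 "-2" 7, simplified, unfolded jv mock_2] nz p0
    by (simp add: power_int_minus divide_simps; simp add: algebra_simps eval_nat_numeral)
  have a2: "appell10 q 7 4 = (- (mock_2 q * J q 1) / q + E3 q * J q 1 / J q 2) / J q 5"
    using appell_J[OF q_bounds, of 4 "-2" 7, simplified, unfolded jv mock_2] nz p0
    by (simp add: power_int_minus divide_simps; simp add: algebra_simps eval_nat_numeral)
  have "appell10 q 7 (-4) = (mock_2 q * J q 3 - q powi (-2) * E3 q * J q (-2) * J q 1 / (J q (-4) * J q (-2))) / J q 5"
    using appell_J[OF q_bounds, of "-4" "-2" 7] jv(2) by (simp only: mock_2) simp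
  also have "q powi (-2) * E3 q * J q (-2) * J q 1 / (J q (-4) * J q (-2)) = - (q ^ 2 * E3 q * J q 1 / J q 4)"
    unfolding jv using nz p0
    by (simp add: power_int_minus divide_simps; simp add: algebra_simps eval_nat_numeral)
  finally have a3: "appell10 q 7 (-4) = (mock_2 q * J q 3 + q ^ 2 * E3 q * J q 1 / J q 4) / J q 5" by simp
  have "lambert 1 p = (mock_2 q * J q 3 / J q 5 - logder10 q 2)
     - p ^ 3 * ((mock_2 q * J q 1 + E3 q * J q 3 * J q 4 / J q 2 ^ 2) / J q 5)
     - (1 / p) * mock_2 q
     + p ^ 8 * ((- (mock_2 q * J q 1) / q + E3 q * J q 1 / J q 2) / J q 5)
     + (mock_2 q * J q 3 + q ^ 2 * E3 q * J q 1 / J q 4) / J q 5"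
    using lambert_dissect(2)[of 1] by (simp add: a0 a1 a2 a3 mock_2 power_int_minus inverse_eq_divide)
  also have "p ^ 8 = p ^ 3 * q" by (simp add: pq flip: power_add)
  also have "p ^ 3 * q * ((- (mock_2 q * J q 1) / q + E3 q * J q 1 / J q 2) / J q 5)
     = p ^ 3 * (- (mock_2 q * J q 1) + q * E3 q * J q 1 / J q 2) / J q 5"
    using p0 nz by (simp add: field_simps)
  finally have L: "lambert 1 p = (mock_2 q * J q 3 / J q 5 - logder10 q 2)
     - p ^ 3 * ((mock_2 q * J q 1 + E3 q * J q 3 * J q 4 / J q 2 ^ 2) / J q 5)
     - (1 / p) * mock_2 q
     + p ^ 3 * (- (mock_2 q * J q 1) + q * E3 q * J q 1 / J q 2) / J q 5
     + (mock_2 q * J q 3 + q ^ 2 * E3 q * J q 1 / J q 4) / J q 5" .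
  have ph: "mock_2 q * phi p / (p * J q 5) = mock_2 q / p - 2 * mock_2 q * J q 3 / J q 5 + 2 * p ^ 3 * mock_2 q * J q 1 / J q 5"
    using p0 nz unfolding phi_dissect by (simp add: field_simps eval_nat_numeral)
  show ?thesis unfolding L ph by (simp add: algebra_simps add_divide_distrib diff_divide_distrib)
qed

lemma lambert_2:
  "lambert 2 p = mock_4 q * phi p / (p ^ 4 * J q 5)
    + (- (q * E3 q * J q 3 / (J q 2 * J q 5)) - logder10 q 4)
    + p ^ 2 * (q * E3 q * J q 3 / (J q 4 * J q 5) + q ^ 2 * E3 q * J q 1 * J q 2 / (J q 4 ^ 2 * J q 5))"
proof -
  note nz = J_nonzero[OF q_bounds, of 1] J_nonzero[OF q_bounds, of 2] J_nonzero[OF q_bounds, of 3]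
    J_nonzero[OF q_bounds, of 4] J_nonzero[OF q_bounds, of 5]
  have p0: "p \<noteq> 0" "q \<noteq> 0" using p pq by auto
  note jv = J_values[OF q_bounds]
  note mock_4 = mock_4_def[OF q_bounds, symmetric]
  have a0: "appell10_punctured q 9 = mock_4 q * J q 1 / J q 5 - logder10 q 4"
    using appell_punctured_J[OF q_bounds, of "-4" 9] by (simp add: jv mock_4 logder10_5[OF q_bounds])
  have a1: "appell10 q 9 2 = (- (mock_4 q * J q 1) / q + E3 q * J q 3 / J q 2) / J q 5"
    using appell_J[OF q_bounds, of 2 "-4" 9, simplified, unfolded jv mock_4] nz p0
    by (simp add: power_int_minus divide_simps; simp add: algebra_simps eval_nat_numeral)
  have a2: "appell10 q 9 4 = (- (mock_4 q * J q 3) / q ^ 3 + E3 q * J q 1 * J q 2 / J q 4 ^ 2) / J q 5"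
    using appell_J[OF q_bounds, of 4 "-4" 9, simplified, unfolded jv mock_4] nz p0
    by (simp add: power_int_minus divide_simps; simp add: algebra_simps eval_nat_numeral)
  have "appell10 q 9 (-2) = (mock_4 q * J q 3 - q powi (-4) * E3 q * J q 2 * J q 3 / (J q (-2) * J q (-4))) / J q 5"
    using appell_J[OF q_bounds, of "-2" "-4" 9] jv(2) by (simp only: mock_4) simp
  also have "q powi (-4) * E3 q * J q 2 * J q 3 / (J q (-2) * J q (-4)) = q ^ 2 * E3 q * J q 3 / J q 4"
    unfolding jv using nz p0
    by (simp add: power_int_minus divide_simps; simp add: algebra_simps eval_nat_numeral)
  finally have a3: "appell10 q 9 (-2) = (mock_4 q * J q 3 - q ^ 2 * E3 q * J q 3 / J q 4) / J q 5" .
  have pw: "p ^ 5 = q" "p ^ 12 = p ^ 2 * q ^ 2" "1 / p ^ 3 = p ^ 2 / q" "p / p ^ 4 = p ^ 2 / q"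
    using p0 by (simp_all add: pq divide_simps flip: power_add power_mult power_Suc)
  have "lambert 2 p = (mock_4 q * J q 1 / J q 5 - logder10 q 4)
     - p ^ 5 * ((- (mock_4 q * J q 1) / q + E3 q * J q 3 / J q 2) / J q 5)
     - 1 / p ^ 3 * ((mock_4 q * J q 3 - q ^ 2 * E3 q * J q 3 / J q 4) / J q 5)
     + p ^ 12 * ((- (mock_4 q * J q 3) / q ^ 3 + E3 q * J q 1 * J q 2 / J q 4 ^ 2) / J q 5)
     + 1 / p ^ 4 * mock_4 q"
    using lambert_dissect(2)[of 2] by (simp add: a0 a1 a2 a3 mock_4 power_int_minus inverse_eq_divide)
  also have "p ^ 5 * ((- (mock_4 q * J q 1) / q + E3 q * J q 3 / J q 2) / J q 5)
      = (- (mock_4 q * J q 1) + q * E3 q * J q 3 / J q 2) / J q 5"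
    unfolding pw using p0 nz by (simp add: field_simps)
  also have "1 / p ^ 3 * ((mock_4 q * J q 3 - q ^ 2 * E3 q * J q 3 / J q 4) / J q 5)
      = p ^ 2 * ((mock_4 q * J q 3 / q - q * E3 q * J q 3 / J q 4) / J q 5)"
    unfolding pw using p0 nz by (simp add: field_simps power2_eq_square)
  also have "p ^ 12 * ((- (mock_4 q * J q 3) / q ^ 3 + E3 q * J q 1 * J q 2 / J q 4 ^ 2) / J q 5)
      = p ^ 2 * ((- (mock_4 q * J q 3) / q + q ^ 2 * E3 q * J q 1 * J q 2 / J q 4 ^ 2) / J q 5)"
    unfolding pw using p0 nz by (simp add: field_simps eval_nat_numeral)
  finally have L: "lambert 2 p = (mock_4 q * J q 1 / J q 5 - logder10 q 4)
     - (- (mock_4 q * J q 1) + q * E3 q * J q 3 / J q 2) / J q 5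
     - p ^ 2 * ((mock_4 q * J q 3 / q - q * E3 q * J q 3 / J q 4) / J q 5)
     + p ^ 2 * ((- (mock_4 q * J q 3) / q + q ^ 2 * E3 q * J q 1 * J q 2 / J q 4 ^ 2) / J q 5)
     + 1 / p ^ 4 * mock_4 q" .
  have "mock_4 q * phi p / (p ^ 4 * J q 5)
      = 1 / p ^ 4 * mock_4 q - (p / p ^ 4) * (2 * mock_4 q * J q 3 / J q 5) + 2 * mock_4 q * J q 1 / J q 5"
    using p0 nz unfolding phi_dissect by (simp add: field_simps)
  then have ph: "mock_4 q * phi p / (p ^ 4 * J q 5)
      = 1 / p ^ 4 * mock_4 q - (p ^ 2 / q) * (2 * mock_4 q * J q 3 / J q 5) + 2 * mock_4 q * J q 1 / J q 5"
    unfolding pw .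
  show ?thesis unfolding L ph by (simp add: algebra_simps add_divide_distrib diff_divide_distrib)
qed

end

section \<open>Overpartitions by largest part\<close>

lemma has_sum_geometric:
  fixes x :: complex
  assumes "norm x < 1"
  shows "((\<lambda>j. x ^ j) has_sum (1 / (1 - x))) UNIV"
proof (rule norm_summable_imp_has_sum)
  show "summable (\<lambda>n. norm (x ^ n))" using assms by (simp add: norm_power)
  show "(\<lambda>n. x ^ n) sums (1 / (1 - x))" using assms by (rule geometric_sums)
qed

definition overpartitions_upto :: "nat \<Rightarrow> overpartition set" where
  "overpartitions_upto l = {\<pi>. snd \<pi> \<subseteq> set_mset (fst \<pi>) \<and> set_mset (fst \<pi>) \<subseteq> {1..l}}"

text \<open>The contribution \<open>n(pi) - n(pi_o)\<close> to the rank. It is additive over the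
  part sizes, whereas the remaining terms depend on the largest part only; the subtraction is exact
  by \<open>size_odd_nonoverlined_le\<close>.\<close>

definition num_even_or_overlined :: "overpartition \<Rightarrow> nat" where
  "num_even_or_overlined \<pi> = num_parts \<pi> - size (odd_nonoverlined \<pi>)"

definition part_sum :: "overpartition \<Rightarrow> nat" where "part_sum \<pi> = sum_mset (fst \<pi>)"

definition overpartition_weight :: "complex \<Rightarrow> complex \<Rightarrow> overpartition \<Rightarrow> complex" where
  "overpartition_weight y q \<pi> = y ^ num_even_or_overlined \<pi> * q ^ part_sum \<pi>"

text \<open>Adds \<open>j\<close> parts of size \<open>k\<close>; the flag \<open>b\<close> says whether the first of them is overlined.\<close>

definition add_parts :: "nat \<Rightarrow> overpartition \<times> nat \<times> bool \<Rightarrow> overpartition" where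
  "add_parts k = (\<lambda>(\<pi>, j, b). (fst \<pi> + replicate_mset j k, if b then insert k (snd \<pi>) else snd \<pi>))"

definition remove_parts :: "nat \<Rightarrow> overpartition \<Rightarrow> overpartition \<times> nat \<times> bool" where
  "remove_parts k \<pi> = ((filter_mset (\<lambda>x. x \<noteq> k) (fst \<pi>), snd \<pi> - {k}), count (fst \<pi>) k, k \<in> snd \<pi>)"

text \<open>An overline needs an occurrence that carries it, so the flag forces
  \<open>j > 0\<close>.\<close>

definition multiplicities :: "(nat \<times> bool) set" where "multiplicities = {(j, b). b \<longrightarrow> j > 0}"
definition positive_multiplicities :: "(nat \<times> bool) set" where "positive_multiplicities = {(j, b). j > 0}"

lemma positive_multiplicities_subset: "positive_multiplicities \<subseteq> multiplicities" by (auto simp: multiplicities_def positive_multiplicities_def)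

lemma overpartitions_upto_0: "overpartitions_upto 0 = {({#}, {})}"
  by (auto simp: overpartitions_upto_def)

lemma remove_parts_add_parts:
  assumes "x \<in> overpartitions_upto l \<times> multiplicities"
  shows "remove_parts (Suc l) (add_parts (Suc l) x) = x"
proof -
  obtain M S j b where x: "x = ((M, S), j, b)" by (metis surj_pair)
  have k: "Suc l \<notin># M" "Suc l \<notin> S" using assms by (auto simp: x overpartitions_upto_def)
  have "filter_mset (\<lambda>x. x \<noteq> Suc l) M = M"
    using k by (intro multiset_eqI) (auto simp: not_in_iff)
  then show ?thesis using k by (auto simp: x add_parts_def remove_parts_def not_in_iff multiset_eq_iff)
qed

lemma add_parts_remove_parts: "add_parts k (remove_parts k \<pi>) = \<pi>"
proof -
  obtain M S where "\<pi> = (M, S)" by (metis surj_pair)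
  then show ?thesis by (auto simp: add_parts_def remove_parts_def multiset_eq_iff)
qed

lemma add_parts_in: "x \<in> overpartitions_upto l \<times> multiplicities \<Longrightarrow> add_parts (Suc l) x \<in> overpartitions_upto (Suc l)"
  by (fastforce simp: overpartitions_upto_def add_parts_def multiplicities_def split: if_splits)

lemma remove_parts_in: "\<pi> \<in> overpartitions_upto (Suc l) \<Longrightarrow> remove_parts (Suc l) \<pi> \<in> overpartitions_upto l \<times> multiplicities"
  by (fastforce simp: overpartitions_upto_def remove_parts_def multiplicities_def Suc_le_eq le_Suc_eq)

lemma part_sum_add_parts: "part_sum (add_parts k (\<pi>, j, b)) = part_sum \<pi> + k * j"
  by (simp add: part_sum_def add_parts_def sum_mset_replicate_mset mult.commute)

lemma filter_odd_replicate:
  "filter_mset odd (replicate_mset n k) = (if odd k then replicate_mset n k else {#})"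
  by (induction n) auto

lemma odd_nonoverlined_add_parts:
  assumes "\<pi> \<in> overpartitions_upto l" "(j, b) \<in> multiplicities"
  shows "odd_nonoverlined (add_parts (Suc l) (\<pi>, j, b))
    = odd_nonoverlined \<pi> + (if odd (Suc l) then replicate_mset (j - of_bool b) (Suc l) else {#})"
proof -
  obtain M S where p: "\<pi> = (M, S)" by (metis surj_pair)
  have k: "Suc l \<notin># M" "Suc l \<notin> S" and sub: "S \<subseteq> set_mset M" using assms by (auto simp: p overpartitions_upto_def)
  have fin: "finite S" using sub by (rule finite_subset) simp
  have "(M + replicate_mset j (Suc l)) - mset_set (if b then insert (Suc l) S else S)
    = (M - mset_set S) + replicate_mset (j - of_bool b) (Suc l)"
  proof (rule multiset_eqI)
    fix x
    have "count (mset_set S) x \<le> count M x"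
      using fin sub by (cases "x \<in> S") (auto simp: Suc_le_eq)
    then show "count ((M + replicate_mset j (Suc l)) - mset_set (if b then insert (Suc l) S else S)) x
      = count ((M - mset_set S) + replicate_mset (j - of_bool b) (Suc l)) x"
      using k fin assms(2) by (auto simp: multiplicities_def not_in_iff)
  qed
  then have "odd_nonoverlined (add_parts (Suc l) (\<pi>, j, b))
    = filter_mset odd ((M - mset_set S) + replicate_mset (j - of_bool b) (Suc l))"
    by (simp only: odd_nonoverlined_def add_parts_def p prod.case fst_conv snd_conv)
  also have "\<dots> = odd_nonoverlined \<pi> + (if odd (Suc l) then replicate_mset (j - of_bool b) (Suc l) else {#})"
    by (auto simp: odd_nonoverlined_def p filter_odd_replicate)
  finally show ?thesis .
qed

lemma size_odd_nonoverlined_le: "size (odd_nonoverlined \<pi>) \<le> num_parts \<pi>"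
  unfolding odd_nonoverlined_def num_parts_def
  by (meson diff_subset_eq_self multiset_filter_subset order_trans size_mset_mono)

lemma num_even_or_overlined_add_parts:
  assumes "\<pi> \<in> overpartitions_upto l" "(j, b) \<in> multiplicities"
  shows "num_even_or_overlined (add_parts (Suc l) (\<pi>, j, b)) = num_even_or_overlined \<pi> + (if even (Suc l) then j else of_bool b)"
proof -
  have "num_parts (add_parts (Suc l) (\<pi>, j, b)) = num_parts \<pi> + j"
    by (simp add: num_parts_def add_parts_def)
  moreover have "of_bool b \<le> j" using assms(2) by (auto simp: multiplicities_def)
  ultimately show ?thesis
    using size_odd_nonoverlined_le[of \<pi>] unfolding num_even_or_overlined_def odd_nonoverlined_add_parts[OF assms] by auto
qed

definition part_weight :: "complex \<Rightarrow> complex \<Rightarrow> nat \<Rightarrow> nat \<times> bool \<Rightarrow> complex" where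
  "part_weight y q k = (\<lambda>(j, b). y ^ (if even k then j else of_bool b) * q ^ (k * j))"

lemma overpartition_weight_add_parts:
  assumes "\<pi> \<in> overpartitions_upto l" "jb \<in> multiplicities"
  shows "overpartition_weight y q (add_parts (Suc l) (\<pi>, jb)) = overpartition_weight y q \<pi> * part_weight y q (Suc l) jb"
proof -
  obtain j b where jb: "jb = (j, b)" by force
  have "(j, b) \<in> multiplicities" using assms jb by simp
  from num_even_or_overlined_add_parts[OF assms(1) this] show ?thesis
    by (simp add: jb overpartition_weight_def part_weight_def part_sum_add_parts power_add)
qed

text \<open>Even parts count for \<open>y\<close> each, odd parts only when overlined. So the
  overline gives \<open>1 + y q^k\<close> for either parity, but \<open>y\<close> enters the
  geometric series only for even \<open>k\<close>.\<close>

definition part_factor :: "complex \<Rightarrow> complex \<Rightarrow> nat \<Rightarrow> complex" where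
  "part_factor y q k = (1 + y * q ^ k) / (1 - (if even k then y else 1) * q ^ k)"

lemma power_lt_1:
  assumes "norm q < 1" "norm (y * q\<^sup>2) < 1" "k > 0"
  shows "norm ((if even k then y else 1) * q ^ k :: complex) < 1"
proof (cases "even k")
  case True
  with assms(3) have "k \<ge> 2" by presburger
  then have "norm q ^ k \<le> norm q ^ 2" using assms(1) by (intro power_decreasing) auto
  then have "norm y * norm q ^ k \<le> norm y * norm q ^ 2" by (intro mult_left_mono) auto
  also have "\<dots> < 1" using assms(2) by (simp add: norm_mult norm_power)
  finally show ?thesis using True by (simp add: norm_mult norm_power)
next
  case False
  then show ?thesis using assms by (simp add: norm_power power_less_one_iff)
qed

lemma geo_flag_has_sum:
  assumes "norm q < 1" "norm (y * q\<^sup>2) < 1" "k > 0"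
  defines "x \<equiv> (if even k then y else 1) * q ^ k"
  shows "((\<lambda>j. part_weight y q k (j, False)) has_sum (1 / (1 - x))) UNIV"
    "((\<lambda>j. part_weight y q k (Suc j, False)) has_sum (x / (1 - x))) UNIV"
    "((\<lambda>j. part_weight y q k (Suc j, True)) has_sum (y * q ^ k / (1 - x))) UNIV"
proof -
  have x: "norm x < 1" unfolding x_def by (rule power_lt_1[OF assms(1-3)])
  note G = has_sum_geometric[OF x]
  have l: "part_weight y q k (j, False) = x ^ j" for j
    by (auto simp: part_weight_def x_def power_mult_distrib power_mult)
  have l': "part_weight y q k (Suc j, True) = y * q ^ k * x ^ j" for j
    by (auto simp: part_weight_def x_def power_mult_distrib power_mult power_add)
  show "((\<lambda>j. part_weight y q k (j, False)) has_sum (1 / (1 - x))) UNIV" using G by (simp only: l)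
  show "((\<lambda>j. part_weight y q k (Suc j, False)) has_sum (x / (1 - x))) UNIV"
    using has_sum_cmult_right[OF G, of x] by (simp add: l)
  show "((\<lambda>j. part_weight y q k (Suc j, True)) has_sum (y * q ^ k / (1 - x))) UNIV"
    using has_sum_cmult_right[OF G, of "y * q ^ k"] by (simp add: l')
qed

lemma multiplicities_union:
  "multiplicities = range (\<lambda>j. (j, False)) \<union> range (\<lambda>j. (Suc j, True))"
  "positive_multiplicities = range (\<lambda>j. (Suc j, False)) \<union> range (\<lambda>j. (Suc j, True))"
  by (auto simp: multiplicities_def positive_multiplicities_def image_iff gr0_conv_Suc)

lemma has_sum_flag:
  fixes f :: "nat \<times> bool \<Rightarrow> complex"
  assumes "((\<lambda>j. f (g j, False)) has_sum A) UNIV" "((\<lambda>j. f (Suc j, True)) has_sum B) UNIV" "inj g"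
  shows "(f has_sum (A + B)) (range (\<lambda>j. (g j, False)) \<union> range (\<lambda>j. (Suc j, True)))"
proof (rule has_sum_Un_disjoint)
  have "inj (\<lambda>j. (g j, False))" "inj (\<lambda>j::nat. (Suc j, True))"
    using assms(3) by (auto simp: inj_on_def)
  then show "(f has_sum A) (range (\<lambda>j. (g j, False)))" "(f has_sum B) (range (\<lambda>j. (Suc j, True)))"
    using assms(1,2) by (auto simp: has_sum_reindex o_def)
qed auto

context
  fixes y q :: complex
  assumes q: "norm q < 1" and yq: "norm (y * q\<^sup>2) < 1"
begin

lemma part_factor_denom: "k > 0 \<Longrightarrow> 1 - (if even k then y else 1) * q ^ k \<noteq> 0"
  using power_lt_1[OF q yq, of k] by (metis eq_iff_diff_eq_0 less_irrefl norm_one)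

lemma part_weight_has_sum:
  assumes "k > 0"
  shows "(part_weight y q k has_sum part_factor y q k) multiplicities"
proof -
  have "(part_weight y q k has_sum (1 / (1 - (if even k then y else 1) * q ^ k) + y * q ^ k / (1 - (if even k then y else 1) * q ^ k))) multiplicities"
    unfolding multiplicities_union by (rule has_sum_flag) (use geo_flag_has_sum[OF q yq assms] in auto)
  then show ?thesis by (simp add: part_factor_def add_divide_distrib)
qed

lemma overpartitions_upto_has_sum: "(overpartition_weight y q has_sum (\<Prod>k=1..l. part_factor y q k)) (overpartitions_upto l)"
proof (induction l)
  case 0
  show ?case by (rule has_sum_finiteI) (auto simp: overpartitions_upto_0 overpartition_weight_def num_even_or_overlined_def num_parts_def part_sum_def)
next
  case (Suc l)
  have n1: "(\<lambda>\<pi>. norm (overpartition_weight y q \<pi>)) summable_on overpartitions_upto l"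
    using has_sum_imp_summable[OF Suc] by (simp only: summable_on_iff_abs_summable_on_complex)
  have L: "(part_weight y q (Suc l) has_sum part_factor y q (Suc l)) multiplicities" by (rule part_weight_has_sum) simp
  have n2: "(\<lambda>jb. norm (part_weight y q (Suc l) jb)) summable_on multiplicities"
    using has_sum_imp_summable[OF L] by (simp only: summable_on_iff_abs_summable_on_complex)
  have "((\<lambda>(\<pi>, jb). overpartition_weight y q \<pi> * part_weight y q (Suc l) jb) has_sum ((\<Prod>k=1..l. part_factor y q k) * part_factor y q (Suc l))) (overpartitions_upto l \<times> multiplicities)"
    using has_sum_times(1)[OF n1 n2] by (simp only: infsumI[OF Suc] infsumI[OF L])
  also have "?this \<longleftrightarrow> (overpartition_weight y q has_sum ((\<Prod>k=1..l. part_factor y q k) * part_factor y q (Suc l))) (overpartitions_upto (Suc l))"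
    by (rule has_sum_reindex_bij_witness[of _ "remove_parts (Suc l)" "add_parts (Suc l)"])
      (auto simp: remove_parts_add_parts add_parts_remove_parts add_parts_in remove_parts_in overpartition_weight_add_parts)
  finally show ?case by simp
qed

end


section \<open>Generating function of the M2-rank\<close>

definition rank_weight :: "complex \<Rightarrow> complex \<Rightarrow> overpartition \<Rightarrow> complex" where
  "rank_weight z q \<pi> = z powi M2_rank \<pi> * q ^ part_sum \<pi>"

text \<open>Meant for overpartitions with largest part \<open>l + 1\<close>: the power of
  \<open>z\<close> is the rounded-up half of it, the product accounts for smaller parts, the last
  factor for the copies of the largest part.\<close>

definition largest_part_gf :: "complex \<Rightarrow> complex \<Rightarrow> nat \<Rightarrow> complex" where
  "largest_part_gf z q l = z ^ ((l + 2) div 2) * (\<Prod>k=1..l. part_factor (1 / z) q k)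
     * (2 * (1 / z * q ^ Suc l) / (1 - (if even (Suc l) then 1 / z else 1) * q ^ Suc l))"

lemma ceiling_half: "\<lceil>real (Suc l) / 2\<rceil> = int ((l + 2) div 2)"
proof (cases "even l")
  case True
  then obtain m where "l = 2 * m" by blast
  then show ?thesis by (auto simp: ceiling_eq_iff)
next
  case False
  then obtain m where "l = 2 * m + 1" by (elim oddE)
  then show ?thesis by (auto simp: ceiling_eq_iff)
qed

lemma largest_part_add_parts:
  assumes "\<pi> \<in> overpartitions_upto l" "j > 0"
  shows "largest_part (add_parts (Suc l) (\<pi>, j, b)) = Suc l"
  unfolding largest_part_def
  by (rule Max_eqI) (use assms in \<open>fastforce simp: add_parts_def overpartitions_upto_def split: if_splits\<close>)+

lemma M2_rank_add_parts:
  assumes "\<pi> \<in> overpartitions_upto l" "(j, b) \<in> positive_multiplicities"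
  shows "M2_rank (add_parts (Suc l) (\<pi>, j, b))
    = int ((l + 2) div 2) - int (num_even_or_overlined (add_parts (Suc l) (\<pi>, j, b))) - of_bool (odd (Suc l) \<and> \<not> b)"
proof -
  have j: "j > 0" using assms by (auto simp: positive_multiplicities_def)
  have "Suc l \<notin> snd \<pi>" using assms(1) by (auto simp: overpartitions_upto_def)
  then have "int (chi (add_parts (Suc l) (\<pi>, j, b))) = of_bool (odd (Suc l) \<and> \<not> b)"
    unfolding chi_def largest_part_add_parts[OF assms(1) j] by (auto simp: add_parts_def)
  then show ?thesis
    using size_odd_nonoverlined_le[of "add_parts (Suc l) (\<pi>, j, b)"]
    unfolding M2_rank_def largest_part_add_parts[OF assms(1) j] ceiling_half num_even_or_overlined_def by simp
qed

context
  fixes z q :: complex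
  assumes q: "0 < norm q" "norm q < 1" and z: "norm q ^ 2 < norm z"
begin

lemma z_nonzero: "z \<noteq> 0" using z by auto

lemma yq: "norm (1 / z * q\<^sup>2) < 1"
  using z z_nonzero by (simp add: norm_divide norm_mult norm_power field_simps)

lemma rank_weight_add_parts:
  assumes "\<pi> \<in> overpartitions_upto l" "jb \<in> positive_multiplicities"
  shows "rank_weight z q (add_parts (Suc l) (\<pi>, jb)) = z ^ ((l + 2) div 2) * (overpartition_weight (1 / z) q \<pi>
     * (part_weight (1 / z) q (Suc l) jb * (if odd (Suc l) \<and> \<not> snd jb then 1 / z else 1)))"
proof -
  obtain j b where jb: "jb = (j, b)" by force
  have m: "jb \<in> multiplicities" using assms positive_multiplicities_subset by blast
  have "rank_weight z q (add_parts (Suc l) (\<pi>, jb)) = z powi (int ((l + 2) div 2) - int (num_even_or_overlined (add_parts (Suc l) (\<pi>, jb))) - of_bool (odd (Suc l) \<and> \<not> b))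
     * q ^ part_sum (add_parts (Suc l) (\<pi>, jb))"
    using M2_rank_add_parts[OF assms(1), of j b] assms(2) by (simp only: jb rank_weight_def)
  also have "\<dots> = z ^ ((l + 2) div 2) * overpartition_weight (1 / z) q (add_parts (Suc l) (\<pi>, jb)) * (if odd (Suc l) \<and> \<not> b then 1 / z else 1)"
  proof -
    have "z powi (int n - int N - of_bool c) = z ^ n * (1 / z) ^ N * (if c then 1 / z else 1)" for n N c
      using z_nonzero by (cases c) (auto simp: power_int_diff power_divide)
    then show ?thesis by (simp only: overpartition_weight_def mult_ac)
  qed
  also have "overpartition_weight (1 / z) q (add_parts (Suc l) (\<pi>, jb)) = overpartition_weight (1 / z) q \<pi> * part_weight (1 / z) q (Suc l) jb"
    by (rule overpartition_weight_add_parts[OF assms(1) m])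
  finally show ?thesis by (simp only: jb snd_conv mult.assoc)
qed

text \<open>Both flags contribute equally, hence the 2. For an even largest part this is immediate;
  for an odd one the non-overlined case lacks the factor \<open>1 / z\<close> of an overline, and
  \<open>chi\<close> supplies it.\<close>

lemma flags_has_sum:
  "((\<lambda>jb. part_weight (1 / z) q (Suc l) jb * (if odd (Suc l) \<and> \<not> snd jb then 1 / z else 1))
     has_sum (2 * (1 / z * q ^ Suc l) / (1 - (if even (Suc l) then 1 / z else 1) * q ^ Suc l))) positive_multiplicities"
proof -
  let ?x = "(if even (Suc l) then 1 / z else 1) * q ^ Suc l"
  let ?y = "1 / z * q ^ Suc l"
  let ?f = "\<lambda>jb. part_weight (1 / z) q (Suc l) jb * (if odd (Suc l) \<and> \<not> snd jb then 1 / z else 1)"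
  note G = geo_flag_has_sum[OF q(2) yq, of "Suc l", OF zero_less_Suc]
  have "(?f has_sum (?y / (1 - ?x) + ?y / (1 - ?x))) positive_multiplicities"
    unfolding multiplicities_union
  proof (rule has_sum_flag)
    have "((\<lambda>j. ?f (Suc j, False)) has_sum (?x / (1 - ?x) * (if odd (Suc l) then 1 / z else 1))) UNIV"
      using has_sum_cmult_left[OF G(2), of "if odd (Suc l) then 1 / z else 1"] by simp
    moreover have "?x / (1 - ?x) * (if odd (Suc l) then 1 / z else 1) = ?y / (1 - ?x)" by simp
    ultimately show "((\<lambda>j. ?f (Suc j, False)) has_sum (?y / (1 - ?x))) UNIV" by (simp only:)
    show "((\<lambda>j. ?f (Suc j, True)) has_sum (?y / (1 - ?x))) UNIV"
      using G(3) by simp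
  qed auto
  moreover have "?y / (1 - ?x) + ?y / (1 - ?x) = 2 * ?y / (1 - ?x)" by simp
  ultimately show ?thesis by (simp only:)
qed

lemma largest_part_gf_has_sum:
  "((\<lambda>x. rank_weight z q (add_parts (Suc l) x)) has_sum largest_part_gf z q l) (overpartitions_upto l \<times> positive_multiplicities)"
proof -
  let ?f = "\<lambda>jb. part_weight (1 / z) q (Suc l) jb * (if odd (Suc l) \<and> \<not> snd jb then 1 / z else 1)"
  have n1: "(\<lambda>\<pi>. norm (overpartition_weight (1 / z) q \<pi>)) summable_on overpartitions_upto l"
    using has_sum_imp_summable[OF overpartitions_upto_has_sum[OF q(2) yq]] by (simp only: summable_on_iff_abs_summable_on_complex)
  have n2: "(\<lambda>jb. norm (?f jb)) summable_on positive_multiplicities"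
    using has_sum_imp_summable[OF flags_has_sum] by (simp only: summable_on_iff_abs_summable_on_complex)
  have "((\<lambda>x. z ^ ((l + 2) div 2) * (case x of (\<pi>, jb) \<Rightarrow> overpartition_weight (1 / z) q \<pi> * ?f jb)) has_sum largest_part_gf z q l) (overpartitions_upto l \<times> positive_multiplicities)"
    using has_sum_cmult_right[OF has_sum_times(1)[OF n1 n2], of "z ^ ((l + 2) div 2)"]
    by (simp only: infsumI[OF overpartitions_upto_has_sum[OF q(2) yq]] infsumI[OF flags_has_sum] largest_part_gf_def mult.assoc)
  also have "?this \<longleftrightarrow> ?thesis"
    by (rule has_sum_cong) (use rank_weight_add_parts in \<open>auto simp del: power_Suc\<close>)
  finally show ?thesis .
qed

end

definition nonempty_overpartitions :: "overpartition set" where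
  "nonempty_overpartitions = {\<pi>. 0 \<notin># fst \<pi> \<and> snd \<pi> \<subseteq> set_mset (fst \<pi>) \<and> fst \<pi> \<noteq> {#}}"

text \<open>Unique decomposition by the largest part \<open>l + 1\<close>, its positive multiplicity
  with flag, and an overpartition into parts at most \<open>l\<close>.\<close>

lemma nonempty_overpartitions_reindex:
  fixes f :: "overpartition \<Rightarrow> complex"
  shows "(f has_sum S) nonempty_overpartitions \<longleftrightarrow> ((\<lambda>(l, x). f (add_parts (Suc l) x)) has_sum S) (Sigma UNIV (\<lambda>l. overpartitions_upto l \<times> positive_multiplicities))"
proof (rule sym, rule has_sum_reindex_bij_witness[of _ "\<lambda>\<pi>. (largest_part \<pi> - 1, remove_parts (largest_part \<pi>) \<pi>)" "\<lambda>(l, x). add_parts (Suc l) x"])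
  fix a assume "a \<in> Sigma UNIV (\<lambda>l. overpartitions_upto l \<times> positive_multiplicities)"
  then obtain l \<pi> j b where a: "a = (l, \<pi>, j, b)" "\<pi> \<in> overpartitions_upto l" "(j, b) \<in> positive_multiplicities"
    by (cases a) auto
  then have j: "j > 0" by (auto simp: positive_multiplicities_def)
  have m: "(\<pi>, j, b) \<in> overpartitions_upto l \<times> multiplicities" using a positive_multiplicities_subset by auto
  show "(largest_part (case a of (l, x) \<Rightarrow> add_parts (Suc l) x) - 1, remove_parts (largest_part (case a of (l, x) \<Rightarrow> add_parts (Suc l) x)) (case a of (l, x) \<Rightarrow> add_parts (Suc l) x)) = a"
    using remove_parts_add_parts[OF m] largest_part_add_parts[OF a(2) j, of b] by (simp add: a)
  have "add_parts (Suc l) (\<pi>, j, b) \<in> overpartitions_upto (Suc l)" by (rule add_parts_in[OF m])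
  moreover have "fst (add_parts (Suc l) (\<pi>, j, b)) \<noteq> {#}" using j by (auto simp: add_parts_def)
  ultimately show "(case a of (l, x) \<Rightarrow> add_parts (Suc l) x) \<in> nonempty_overpartitions"
    by (auto simp: a nonempty_overpartitions_def overpartitions_upto_def)
  show "f (case a of (l, x) \<Rightarrow> add_parts (Suc l) x) = (case a of (l, x) \<Rightarrow> f (add_parts (Suc l) x))"
    by (simp add: a)
next
  fix \<pi> :: overpartition assume pi: "\<pi> \<in> nonempty_overpartitions"
  define L where "L = largest_part \<pi>"
  have L: "L \<in># fst \<pi>" "\<And>x. x \<in># fst \<pi> \<Longrightarrow> x \<le> L"
    using pi by (auto simp: L_def largest_part_def nonempty_overpartitions_def)
  then have L0: "L > 0" using pi by (auto simp: nonempty_overpartitions_def intro!: Nat.gr0I)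
  have o: "\<pi> \<in> overpartitions_upto (Suc (L - 1))"
    using pi L L0 by (auto simp: overpartitions_upto_def nonempty_overpartitions_def Suc_le_eq intro!: Nat.gr0I)
  from remove_parts_in[OF o] L0 have u: "remove_parts L \<pi> \<in> overpartitions_upto (L - 1) \<times> multiplicities" by simp
  show "(case (largest_part \<pi> - 1, remove_parts (largest_part \<pi>) \<pi>) of (l, x) \<Rightarrow> add_parts (Suc l) x) = \<pi>"
    unfolding L_def[symmetric] using L0 by (simp add: add_parts_remove_parts)
  have "snd (remove_parts L \<pi>) \<in> positive_multiplicities" using L by (auto simp: remove_parts_def positive_multiplicities_def)
  with u show "(largest_part \<pi> - 1, remove_parts (largest_part \<pi>) \<pi>) \<in> Sigma UNIV (\<lambda>l. overpartitions_upto l \<times> positive_multiplicities)"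
    unfolding L_def[symmetric] by (auto simp: mem_Times_iff)
qed simp

lemma summable_ratio_limit:
  fixes f :: "nat \<Rightarrow> complex"
  assumes rec: "\<And>n. f (Suc n) = g n * f n" and g: "g \<longlonglongrightarrow> L" and L: "norm L < 1"
  shows "summable (\<lambda>n. norm (f n))"
proof -
  obtain r where r: "norm L < r" "r < 1" using L dense by blast
  have "eventually (\<lambda>n. norm (g n) < r) sequentially"
    using tendsto_norm[OF g] r(1) by (rule order_tendstoD)
  then obtain N where N: "\<And>n. n \<ge> N \<Longrightarrow> norm (g n) < r" by (auto simp: eventually_sequentially)
  show ?thesis
  proof (rule summable_ratio_test[OF r(2)])
    fix n assume "n \<ge> N"
    then show "norm (norm (f (Suc n))) \<le> r * norm (norm (f n))"
      using N[of n] by (simp add: rec norm_mult mult_right_mono)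
  qed
qed

text \<open>Common factor of the contributions with largest parts \<open>2 m + 1\<close> and
  \<open>2 m + 2\<close>; as a q-hypergeometric term it is
  \<open>(-y q; q)_(2m) / ((q; q^2)_(m+1) (y q^2; q^2)_(m+1))\<close>.\<close>

definition series_term :: "complex \<Rightarrow> complex \<Rightarrow> nat \<Rightarrow> complex" where
  "series_term y q m = (\<Prod>k=1..2*m. part_factor y q k) / ((1 - q ^ (2 * m + 1)) * (1 - y * q ^ (2 * m + 2)))"

context
  fixes y q :: complex
  assumes q: "norm q < 1" and yq: "norm (y * q\<^sup>2) < 1"
begin

lemma denom_odd: "1 - q ^ (2 * m + 1) \<noteq> 0"
  using part_factor_denom[OF q yq, of "2 * m + 1"] by simp

lemma denom_even: "1 - y * q ^ (2 * m + 2) \<noteq> 0"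
  using part_factor_denom[OF q yq, of "2 * m + 2"] by simp

lemma series_term_0: "series_term y q 0 = 1 / ((1 - q) * (1 - y * q ^ 2))"
  by (simp add: series_term_def power2_eq_square)

lemma prod_part_factor_even: "(\<Prod>k=1..2*m. part_factor y q k) = series_term y q m * ((1 - q ^ (2 * m + 1)) * (1 - y * q ^ (2 * m + 2)))"
  unfolding series_term_def using denom_odd[of m] denom_even[of m] by (simp del: power_Suc)

lemma prod_part_factor_odd: "(\<Prod>k=1..2*m+1. part_factor y q k) = series_term y q m * ((1 + y * q ^ (2 * m + 1)) * (1 - y * q ^ (2 * m + 2)))"
proof -
  have "(\<Prod>k=1..2*m+1. part_factor y q k) = (\<Prod>k=1..2*m. part_factor y q k) * part_factor y q (2 * m + 1)" by simp
  also have "part_factor y q (2 * m + 1) = (1 + y * q ^ (2 * m + 1)) / (1 - q ^ (2 * m + 1))" by (simp add: part_factor_def)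
  finally show ?thesis unfolding prod_part_factor_even using denom_odd[of m] by (simp del: power_Suc)
qed

lemma series_term_Suc:
  "series_term y q (Suc m) = series_term y q m * ((1 + y * q ^ (2 * m + 1)) * (1 + y * q ^ (2 * m + 2)))
     / ((1 - q ^ (2 * m + 3)) * (1 - y * q ^ (2 * m + 4)))"
proof -
  have "(\<Prod>k=1..2*Suc m. part_factor y q k) = (\<Prod>k=1..2*m+1. part_factor y q k) * part_factor y q (2 * m + 2)" by simp
  also have "part_factor y q (2 * m + 2) = (1 + y * q ^ (2 * m + 2)) / (1 - y * q ^ (2 * m + 2))" by (simp add: part_factor_def)
  finally have "(\<Prod>k=1..2*Suc m. part_factor y q k) = series_term y q m * ((1 + y * q ^ (2 * m + 1)) * (1 + y * q ^ (2 * m + 2)))"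
    unfolding prod_part_factor_odd using denom_even[of m] by (simp del: power_Suc)
  moreover have "2 * Suc m + 1 = 2 * m + 3" "2 * Suc m + 2 = 2 * m + 4" by auto
  ultimately show ?thesis unfolding series_term_def[of _ _ "Suc m"] by (simp only:)
qed

end

text \<open>Replacing \<open>y\<close> by \<open>y / q^2\<close> moves the products that contain
  \<open>y\<close> by one step and leaves the others; this is the origin of the q-difference
  equation in \<open>z = 1 / y\<close>.\<close>

lemma series_term_shift:
  assumes q: "0 < norm q" "norm q < 1" and y: "norm y < 1"
  shows "series_term (y / q\<^sup>2) q (Suc m) = (1 + y / q) * (1 + y) / (1 - y) * series_term y q m / (1 - q ^ (2 * m + 3))"
proof -
  have q0: "q \<noteq> 0" using q by auto
  have q2: "norm q ^ 2 < 1" using q by (simp add: power_less_one_iff)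
  have yq: "norm (y * q\<^sup>2) < 1"
    using y q2 mult_strict_mono[of "norm y" 1 "norm q ^ 2" 1] by (simp add: norm_mult norm_power)
  have yq': "norm (y / q\<^sup>2 * q\<^sup>2) < 1" using y q0 by simp
  have y1: "1 - y \<noteq> 0" using y by auto
  have e: "y / q\<^sup>2 * q ^ (n + 2) = y * q ^ n" for n
    using q0 by (simp add: power_add power2_eq_square)
  have e1: "y / q\<^sup>2 * q ^ 1 = y / q" "y / q\<^sup>2 * q ^ 2 = y" "y / q\<^sup>2 * q ^ 4 = y * q ^ 2"
    using q0 e[of 2] by (simp_all add: power2_eq_square)
  have x0: "series_term (y / q\<^sup>2) q 0 = 1 / ((1 - q) * (1 - y))"
    using series_term_0[OF q(2) yq'] q0 by simp
  note R = series_term_Suc[OF q(2) yq'] and R' = series_term_Suc[OF q(2) yq]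
  note D1 = denom_odd[OF q(2) yq] and D2 = denom_even[OF q(2) yq]
  show ?thesis
  proof (induction m)
    case 0
    have "series_term (y / q\<^sup>2) q (Suc 0) = series_term (y / q\<^sup>2) q 0 * ((1 + y / q\<^sup>2 * q ^ 1) * (1 + y / q\<^sup>2 * q ^ 2))
        / ((1 - q ^ 3) * (1 - y / q\<^sup>2 * q ^ 4))"
    proof -
      have "2 * 0 + (1 :: nat) = 1" "2 * 0 + (2 :: nat) = 2" "2 * 0 + (3 :: nat) = 3" "2 * 0 + (4 :: nat) = 4" by auto
      then show ?thesis using R[of 0] by (simp only:)
    qed
    also have "\<dots> = 1 / ((1 - q) * (1 - y)) * ((1 + y / q) * (1 + y)) / ((1 - q ^ 3) * (1 - y * q ^ 2))"
      unfolding e1 x0 ..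
    finally have "series_term (y / q\<^sup>2) q (Suc 0) = 1 / ((1 - q) * (1 - y)) * ((1 + y / q) * (1 + y)) / ((1 - q ^ 3) * (1 - y * q ^ 2))" .
    then show ?case by (simp add: series_term_0[OF q(2) yq])
  next
    case (Suc m)
    have "series_term (y / q\<^sup>2) q (Suc (Suc m)) = series_term (y / q\<^sup>2) q (Suc m) * ((1 + y * q ^ (2 * m + 1)) * (1 + y * q ^ (2 * m + 2)))
      / ((1 - q ^ (2 * m + 5)) * (1 - y * q ^ (2 * m + 4)))"
      using R[of "Suc m"] e[of "2 * m + 1"] e[of "2 * m + 2"] e[of "2 * m + 4"]
      by (simp add: eval_nat_numeral del: power_Suc)
    also have "\<dots> = (1 + y / q) * (1 + y) / (1 - y) * (series_term y q m * ((1 + y * q ^ (2 * m + 1)) * (1 + y * q ^ (2 * m + 2)))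
       / ((1 - q ^ (2 * m + 3)) * (1 - y * q ^ (2 * m + 4)))) / (1 - q ^ (2 * Suc m + 3))"
    proof -
      have "2 * Suc m + 3 = 2 * m + 5" by simp
      then show ?thesis unfolding Suc by (simp only: times_divide_eq_left times_divide_eq_right divide_divide_eq_left mult_ac)
    qed
    also have "\<dots> = (1 + y / q) * (1 + y) / (1 - y) * series_term y q (Suc m) / (1 - q ^ (2 * Suc m + 3))"
      unfolding R' by simp
    finally show ?case .
  qed
qed

lemma power_seq_0:
  assumes "norm (q :: complex) < 1"
  shows "(\<lambda>m. q ^ (2 * m + k)) \<longlonglongrightarrow> 0"
proof -
  have "(\<lambda>m. (q\<^sup>2) ^ m * q ^ k) \<longlonglongrightarrow> 0 * q ^ k"
    by (intro tendsto_intros LIMSEQ_power_zero) (use assms in \<open>simp add: norm_power power_less_one_iff\<close>)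
  then show ?thesis by (simp add: power_add power_mult)
qed

definition series_sum :: "complex \<Rightarrow> complex \<Rightarrow> complex" where
  "series_sum z q = (\<Sum>m. z ^ m * q ^ (2 * m) * series_term (1 / z) q m)"

definition rank_gf :: "complex \<Rightarrow> complex \<Rightarrow> complex" where
  "rank_gf z q = 1 + 2 * (1 + q) * q * series_sum z q"

context
  fixes z q :: complex
  assumes q: "0 < norm q" "norm q < 1" and z: "norm q ^ 2 < norm z" "norm z * norm q ^ 2 < 1"
begin

lemma series_term_summable: "summable (\<lambda>m. norm (z ^ m * q ^ (2 * m) * series_term (1 / z) q m))"
proof (rule summable_ratio_limit)
  let ?y = "1 / z"
  let ?g = "\<lambda>m. z * q\<^sup>2 * (((1 + ?y * q ^ (2 * m + 1)) * (1 + ?y * q ^ (2 * m + 2)))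
     / ((1 - q ^ (2 * m + 3)) * (1 - ?y * q ^ (2 * m + 4))))"
  show "z ^ Suc m * q ^ (2 * Suc m) * series_term ?y q (Suc m) = ?g m * (z ^ m * q ^ (2 * m) * series_term ?y q m)" for m
    unfolding series_term_Suc[OF q(2) yq[OF q z(1)]] by (simp add: power2_eq_square)
  have "?g \<longlonglongrightarrow> z * q\<^sup>2 * (((1 + ?y * 0) * (1 + ?y * 0)) / ((1 - 0) * (1 - ?y * 0)))"
    by (intro tendsto_intros power_seq_0 q) auto
  then show "?g \<longlonglongrightarrow> z * q\<^sup>2" by simp
  show "norm (z * q\<^sup>2) < 1" using z(2) by (simp add: norm_mult norm_power)
qed

lemma largest_part_gf_even_odd:
  "largest_part_gf z q (2 * m) = z ^ m * q ^ (2 * m) * series_term (1 / z) q m * (2 * q * (1 - 1 / z * q ^ (2 * m + 2)))"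
  "largest_part_gf z q (2 * m + 1) = z ^ m * q ^ (2 * m) * series_term (1 / z) q m * (2 * q\<^sup>2 * (1 + 1 / z * q ^ (2 * m + 1)))"
proof -
  note z0 = z_nonzero[OF q z(1)]
  note yq = yq[OF q z(1)]
  have "largest_part_gf z q (2 * m) = z ^ (m + 1) * (series_term (1 / z) q m * ((1 - q ^ (2 * m + 1)) * (1 - 1 / z * q ^ (2 * m + 2))))
     * (2 * (1 / z * q ^ (2 * m + 1)) / (1 - q ^ (2 * m + 1)))"
    unfolding largest_part_gf_def prod_part_factor_even[OF q(2) yq] by simp
  also have "\<dots> = z ^ m * q ^ (2 * m) * series_term (1 / z) q m * (2 * q * (1 - 1 / z * q ^ (2 * m + 2)))"
    using denom_odd[OF q(2) yq, of m] z0 by simp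
  finally show "largest_part_gf z q (2 * m) = z ^ m * q ^ (2 * m) * series_term (1 / z) q m * (2 * q * (1 - 1 / z * q ^ (2 * m + 2)))" .
  have "largest_part_gf z q (2 * m + 1) = z ^ (m + 1) * (series_term (1 / z) q m * ((1 + 1 / z * q ^ (2 * m + 1)) * (1 - 1 / z * q ^ (2 * m + 2))))
     * (2 * (1 / z * q ^ (2 * m + 2)) / (1 - 1 / z * q ^ (2 * m + 2)))"
    unfolding largest_part_gf_def prod_part_factor_odd[OF q(2) yq] by simp
  also have "\<dots> = z ^ m * q ^ (2 * m) * series_term (1 / z) q m * (2 * q\<^sup>2 * (1 + 1 / z * q ^ (2 * m + 1)))"
    using denom_even[OF q(2) yq, of m] z0 by (simp add: power2_eq_square)
  finally show "largest_part_gf z q (2 * m + 1) = z ^ m * q ^ (2 * m) * series_term (1 / z) q m * (2 * q\<^sup>2 * (1 + 1 / z * q ^ (2 * m + 1)))" .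
qed

lemma bounded_mult_summable:
  fixes f s :: "nat \<Rightarrow> complex"
  assumes "summable (\<lambda>m. norm (f m))" "s \<longlonglongrightarrow> L"
  shows "summable (\<lambda>m. norm (f m * s m))"
proof -
  obtain K where K: "K > 0" "\<And>n. norm (s n) \<le> K"
    using convergent_imp_Bseq[OF convergentI[OF assms(2)]] by (auto elim: BseqE)
  show ?thesis
  proof (rule summable_comparison_test'[OF summable_mult[OF assms(1), of K]])
    fix n
    show "norm (norm (f n * s n)) \<le> K * norm (f n)"
      using mult_right_mono[OF K(2)[of n], of "norm (f n)"] by (simp add: norm_mult mult.commute)
  qed
qed

lemma largest_part_gf_total: "(largest_part_gf z q has_sum (rank_gf z q - 1)) UNIV" "(\<lambda>l. norm (largest_part_gf z q l)) summable_on UNIV"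
proof -
  let ?a = "\<lambda>m. z ^ m * q ^ (2 * m) * series_term (1 / z) q m"
  let ?e = "\<lambda>m. 2 * q * (1 - 1 / z * q ^ (2 * m + 2))"
  let ?o = "\<lambda>m. 2 * q\<^sup>2 * (1 + 1 / z * q ^ (2 * m + 1))"
  have "?e \<longlonglongrightarrow> 2 * q * (1 - 1 / z * 0)" "?o \<longlonglongrightarrow> 2 * q\<^sup>2 * (1 + 1 / z * 0)"
    by (intro tendsto_intros power_seq_0 q)+
  note S = this[THEN bounded_mult_summable[OF series_term_summable]]
  have s: "(\<lambda>m. largest_part_gf z q (2 * m)) = (\<lambda>m. ?a m * ?e m)" "(\<lambda>m. largest_part_gf z q (2 * m + 1)) = (\<lambda>m. ?a m * ?o m)"
    using largest_part_gf_even_odd by auto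
  have "(largest_part_gf z q has_sum (suminf (\<lambda>m. ?a m * ?e m) + suminf (\<lambda>m. ?a m * ?o m))) (range (\<lambda>m. 2 * m) \<union> range (\<lambda>m. 2 * m + 1))"
  proof (rule has_sum_Un_disjoint)
    have "inj (\<lambda>m::nat. 2 * m)" "inj (\<lambda>m::nat. 2 * m + 1)" by (auto simp: inj_on_def)
    moreover have "((\<lambda>m. ?a m * ?e m) has_sum suminf (\<lambda>m. ?a m * ?e m)) UNIV"
      "((\<lambda>m. ?a m * ?o m) has_sum suminf (\<lambda>m. ?a m * ?o m)) UNIV"
      by (rule norm_summable_imp_has_sum[OF S(1) summable_sums[OF summable_norm_cancel[OF S(1)]]],
          rule norm_summable_imp_has_sum[OF S(2) summable_sums[OF summable_norm_cancel[OF S(2)]]])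
    ultimately show "(largest_part_gf z q has_sum suminf (\<lambda>m. ?a m * ?e m)) (range (\<lambda>m. 2 * m))"
      "(largest_part_gf z q has_sum suminf (\<lambda>m. ?a m * ?o m)) (range (\<lambda>m. 2 * m + 1))"
      by (simp_all only: has_sum_reindex o_def s)
  qed (auto, presburger)
  also have "range (\<lambda>m::nat. 2 * m) \<union> range (\<lambda>m. 2 * m + 1) = UNIV"
  proof -
    have "n \<in> range (\<lambda>m::nat. 2 * m) \<union> range (\<lambda>m. 2 * m + 1)" for n
      by (cases "even n") (auto elim!: evenE oddE)
    then show ?thesis by blast
  qed
  \<comment> \<open>In \<open>2 q (1 - q^(2m+2) / z) + 2 q^2 (1 + q^(2m+1) / z)\<close> the terms
    with \<open>1 / z\<close> cancel, leaving the constant \<open>2 q (1 + q)\<close>.\<close>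
  also have "suminf (\<lambda>m. ?a m * ?e m) + suminf (\<lambda>m. ?a m * ?o m) = (\<Sum>m. (2 * (1 + q) * q) * ?a m)"
    by (subst suminf_add[OF summable_norm_cancel[OF S(1)] summable_norm_cancel[OF S(2)]])
      (intro suminf_cong, simp add: algebra_simps power2_eq_square)
  also have "\<dots> = rank_gf z q - 1"
    unfolding rank_gf_def series_sum_def using suminf_mult[OF summable_norm_cancel[OF series_term_summable], of "2 * (1 + q) * q"] by simp
  finally show *: "(largest_part_gf z q has_sum (rank_gf z q - 1)) UNIV" .
  show "(\<lambda>l. norm (largest_part_gf z q l)) summable_on UNIV"
    using has_sum_imp_summable[OF *] by (simp only: summable_on_iff_abs_summable_on_complex)
qed

end

lemma nonempty_overpartitions_has_sum:
  fixes z q :: complex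
  assumes q: "0 < norm q" "norm q < 1" and z: "norm q ^ 2 < norm z" "norm z * norm q ^ 2 < 1"
  shows "(rank_weight z q has_sum (rank_gf z q - 1)) nonempty_overpartitions" "(\<lambda>\<pi>. norm (rank_weight z q \<pi>)) summable_on nonempty_overpartitions"
proof -
  \<comment> \<open>With \<open>z\<close> and \<open>q\<close> replaced by their norms every weight
    becomes its own absolute value, and the same closed forms provide the convergent
    majorant.\<close>
  define z' where "z' = complex_of_real (norm z)"
  define q' where "q' = complex_of_real (norm q)"
  have a: "0 < norm q'" "norm q' < 1" "norm q' ^ 2 < norm z'" "norm z' * norm q' ^ 2 < 1"
    using assms by (auto simp: z'_def q'_def)
  have n: "rank_weight z' q' \<pi> = of_real (norm (rank_weight z q \<pi>))" for \<pi>
    by (simp add: rank_weight_def z'_def q'_def norm_mult norm_power norm_power_int of_real_power_int)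
  let ?S = "Sigma UNIV (\<lambda>l. overpartitions_upto l \<times> positive_multiplicities)"
  have 1: "((\<lambda>x. norm (rank_weight z q (add_parts (Suc l) x))) has_sum Re (largest_part_gf z' q' l)) (overpartitions_upto l \<times> positive_multiplicities)" for l
    using has_sum_Re[OF largest_part_gf_has_sum[OF a(1-3), of l]] by (simp add: n)
  have 2: "(\<lambda>l. Re (largest_part_gf z' q' l)) summable_on UNIV"
    using summable_on_Re[OF has_sum_imp_summable[OF largest_part_gf_total(1)[OF a]]] .
  have "(\<lambda>(l, x). norm (rank_weight z q (add_parts (Suc l) x))) summable_on ?S"
    by (rule summable_on_SigmaI[where g = "\<lambda>l. Re (largest_part_gf z' q' l)"]) (use 1 2 in auto)
  then have S: "(\<lambda>(l, x). rank_weight z q (add_parts (Suc l) x)) summable_on ?S"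
  proof -
    assume "(\<lambda>(l, x). norm (rank_weight z q (add_parts (Suc l) x))) summable_on ?S"
    then have "(\<lambda>p. norm (case p of (l, x) \<Rightarrow> rank_weight z q (add_parts (Suc l) x))) summable_on ?S"
      by (simp only: case_prod_unfold)
    then show ?thesis by (rule abs_summable_summable)
  qed
  have "((\<lambda>(l, x). rank_weight z q (add_parts (Suc l) x)) has_sum (rank_gf z q - 1)) ?S"
    by (rule has_sum_SigmaI[OF _ largest_part_gf_total(1)[OF q z] S]) (use largest_part_gf_has_sum[OF q z(1)] in simp)
  then show *: "(rank_weight z q has_sum (rank_gf z q - 1)) nonempty_overpartitions" unfolding nonempty_overpartitions_reindex .
  show "(\<lambda>\<pi>. norm (rank_weight z q \<pi>)) summable_on nonempty_overpartitions"
    using has_sum_imp_summable[OF *] by (simp only: summable_on_iff_abs_summable_on_complex)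
qed

text \<open>\<open>B\<close> is the series that \<open>series_term_shift\<close> produces from
  \<open>series_sum (z * q^2)\<close>. A telescoping sum links it to
  \<open>series_sum z\<close>.\<close>

lemma series_sum_telescope:
  fixes z q :: complex
  assumes q: "0 < norm q" "norm q < 1" and z: "norm q ^ 2 < norm z" "norm z * norm q ^ 2 < 1"
  defines "y \<equiv> 1 / z"
  defines "B \<equiv> (\<Sum>m. z ^ m * q ^ (4 * m) * series_term y q m / (1 - q ^ (2 * m + 3)))"
  shows "(q\<^sup>2 * z - 1) * series_sum z q + q\<^sup>2 * y * (1 + q * z) * (1 + q\<^sup>2 * z) * B = - (1 / (1 - q))"
    "summable (\<lambda>m. z ^ m * q ^ (4 * m) * series_term y q m / (1 - q ^ (2 * m + 3)))"
proof -
  note z0 = z_nonzero[OF q z(1)]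
  have q0: "q \<noteq> 0" using q by auto
  have zy: "z * y = 1" using z0 by (simp add: y_def)
  note yq = yq[OF q z(1), folded y_def]
  let ?a = "\<lambda>m. z ^ m * q ^ (2 * m) * series_term y q m"
  let ?b = "\<lambda>m. z ^ m * q ^ (4 * m) * series_term y q m / (1 - q ^ (2 * m + 3))"
  have sa: "summable (\<lambda>m. norm (?a m))" using series_term_summable[OF q z] by (simp add: y_def)
  have d3: "1 - q ^ (2 * m + 3) \<noteq> 0" for m using denom_odd[OF q(2) yq, of "Suc m"] by (simp add: eval_nat_numeral)
  have d4: "1 - y * q ^ (2 * m + 4) \<noteq> 0" for m using denom_even[OF q(2) yq, of "Suc m"] by (simp add: eval_nat_numeral)
  have "(\<lambda>m. q ^ (2 * m + 0) / (1 - q ^ (2 * m + 3))) \<longlonglongrightarrow> 0 / (1 - 0)"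
    by (intro tendsto_intros power_seq_0 q) auto
  from bounded_mult_summable[OF q z sa this]
  have sb': "summable (\<lambda>m. norm (?a m * (q ^ (2 * m + 0) / (1 - q ^ (2 * m + 3)))))" .
  have ab: "?a m * (q ^ (2 * m + 0) / (1 - q ^ (2 * m + 3))) = ?b m" for m
    by (simp add: power_add[symmetric])
  have sb: "summable ?b" using summable_norm_cancel[OF sb'] by (simp only: ab)
  then show "summable ?b" .
  \<comment> \<open>By \<open>series_term_Suc\<close> the difference of consecutive values is a
    combination of \<open>?a m\<close> and \<open>?b m\<close> with coefficients free of
    \<open>m\<close>; the initial value is \<open>1 / (1 - q)\<close> and the limit is 0.\<close>
  let ?T = "\<lambda>m. ?a m * (1 - q ^ (2 * m + 2) * y)"
  have "(\<lambda>m. ?a m) \<longlonglongrightarrow> 0" using summable_LIMSEQ_zero[OF summable_norm_cancel[OF sa]] .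
  then have "?T \<longlonglongrightarrow> 0 * (1 - 0 * y)"
    by (intro tendsto_intros power_seq_0 q)
  then have T0: "?T \<longlonglongrightarrow> 0" by simp
  have step: "?T (Suc m) - ?T m = (q\<^sup>2 * z - 1) * ?a m + q\<^sup>2 * y * (1 + q * z) * (1 + q\<^sup>2 * z) * ?b m" for m
  proof -
    define u where "u = q ^ (2 * m)"
    have p: "q ^ (2 * m + 1) = u * q" "q ^ (2 * m + 2) = u * q ^ 2" "q ^ (2 * m + 3) = u * q ^ 3" "q ^ (2 * m + 4) = u * q ^ 4"
      "q ^ (4 * m) = u * u" "q ^ (2 * Suc m) = u * q ^ 2" "q ^ (2 * Suc m + 2) = u * q ^ 4"
    proof -
      show "q ^ (2 * m + 1) = u * q" "q ^ (2 * m + 2) = u * q ^ 2" "q ^ (2 * m + 3) = u * q ^ 3" "q ^ (2 * m + 4) = u * q ^ 4"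
        by (simp_all only: u_def power_add power_one_right)
      show "q ^ (4 * m) = u * u" by (simp add: u_def flip: power_add)
      have "2 * Suc m = 2 * m + 2" "2 * Suc m + 2 = 2 * m + 4" by auto
      then show "q ^ (2 * Suc m) = u * q ^ 2" "q ^ (2 * Suc m + 2) = u * q ^ 4"
        by (simp_all only: u_def power_add)
    qed
    note d = d3[of m, unfolded p] d4[of m, unfolded p]
    have 1: "?T (Suc m) = z ^ m * u * series_term y q m * (z * q ^ 2 * ((1 + y * (u * q)) * (1 + y * (u * q ^ 2))) / (1 - u * q ^ 3))"
      unfolding series_term_Suc[OF q(2) yq] p using d by (simp add: mult.commute[of "u * q ^ 4" y])
    have 2: "z * q ^ 2 * ((1 + y * (u * q)) * (1 + y * (u * q ^ 2))) / (1 - u * q ^ 3) - (1 - u * q ^ 2 * y)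
        = (q\<^sup>2 * z - 1) + q\<^sup>2 * y * (1 + q * z) * (1 + q\<^sup>2 * z) * (u / (1 - u * q ^ 3))"
    proof -
      have "z * q ^ 2 * ((1 + y * (u * q)) * (1 + y * (u * q ^ 2))) - (1 - u * q ^ 2 * y) * (1 - u * q ^ 3)
         = (q\<^sup>2 * z - 1) * (1 - u * q ^ 3) + q\<^sup>2 * y * (1 + q * z) * (1 + q\<^sup>2 * z) * u"
        using zy by algebra
      then show ?thesis using d(1) by (simp add: field_simps)
    qed
    have "K * X - K * D = a * K + b * (K * W)" if "X - D = a + b * W" for K X D a b W :: complex
      using that by algebra
    from this[OF 2, of "z ^ m * u * series_term y q m"]
    show ?thesis unfolding 1 unfolding p u_def[symmetric] by (simp only: mult_ac times_divide_eq_left times_divide_eq_right)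
  qed
  have "(\<lambda>m. ?T (Suc m) - ?T m) sums (0 - ?T 0)" by (rule telescope_sums[OF T0])
  moreover have "?T 0 = 1 / (1 - q)"
    using denom_even[OF q(2) yq, of 0] by (simp add: series_term_0[OF q(2) yq] power2_eq_square mult_ac)
  ultimately have "(\<lambda>m. (q\<^sup>2 * z - 1) * ?a m + q\<^sup>2 * y * (1 + q * z) * (1 + q\<^sup>2 * z) * ?b m) sums (- (1 / (1 - q)))"
    unfolding step by simp
  moreover have "(\<lambda>m. (q\<^sup>2 * z - 1) * ?a m + q\<^sup>2 * y * (1 + q * z) * (1 + q\<^sup>2 * z) * ?b m) sums
     ((q\<^sup>2 * z - 1) * series_sum z q + q\<^sup>2 * y * (1 + q * z) * (1 + q\<^sup>2 * z) * B)"
    unfolding series_sum_def B_def y_def[symmetric]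
    by (intro sums_add sums_mult summable_sums sb summable_norm_cancel[OF sa])
  ultimately show "(q\<^sup>2 * z - 1) * series_sum z q + q\<^sup>2 * y * (1 + q * z) * (1 + q\<^sup>2 * z) * B = - (1 / (1 - q))"
    using sums_unique2 by blast
qed

text \<open>For \<open>1 < norm z < norm q ^ -2\<close> both \<open>z\<close> and
  \<open>z q^2\<close> lie in the annulus of convergence. The factors
  \<open>(1 + z) / (1 - z)\<close> make the two terms of the equation have the same shape at
  \<open>z\<close> and at \<open>z q^2\<close>.\<close>

lemma rank_gf_functional_equation:
  fixes z q :: complex
  assumes q: "0 < norm q" "norm q < 1" and z: "1 < norm z" "norm z * norm q ^ 2 < 1"
  shows "(1 + z * q\<^sup>2) / (1 - z * q\<^sup>2) * rank_gf (z * q\<^sup>2) q + q * z * ((1 + z) / (1 - z) * rank_gf z q) = 1 - q * z"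
proof -
  define y where "y = 1 / z"
  define A where "A = series_sum z q"
  define B where "B = (\<Sum>m. z ^ m * q ^ (4 * m) * series_term y q m / (1 - q ^ (2 * m + 3)))"
  have q0: "q \<noteq> 0" using q by auto
  have z0: "z \<noteq> 0" using z by auto
  have zy: "z * y = 1" using z0 by (simp add: y_def)
  have zq: "norm q ^ 2 < norm z" using q z power_less_one_iff[of "norm q" 2] by simp
  have y: "norm y < 1" unfolding y_def norm_divide using z(1) by (subst divide_less_eq_1_pos) auto
  have T: "(q\<^sup>2 * z - 1) * A + q\<^sup>2 * y * (1 + q * z) * (1 + q\<^sup>2 * z) * B = - (1 / (1 - q))"
    "summable (\<lambda>m. z ^ m * q ^ (4 * m) * series_term y q m / (1 - q ^ (2 * m + 3)))"
    using series_sum_telescope[OF q zq z(2)] by (simp_all only: A_def B_def y_def)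
  have yq': "norm (y / q\<^sup>2 * q\<^sup>2) < 1" using y q0 by simp
  have zq': "norm q ^ 2 < norm (z * q\<^sup>2)" "norm (z * q\<^sup>2) * norm q ^ 2 < 1"
  proof -
    have "norm q ^ 2 * 1 < norm q ^ 2 * norm z" by (rule mult_strict_left_mono) (use z q in auto)
    then show "norm q ^ 2 < norm (z * q\<^sup>2)" by (simp add: norm_mult norm_power mult.commute)
    have "norm z * norm q ^ 2 * norm q ^ 2 < 1 * 1"
      by (rule mult_strict_mono) (use z q power_less_one_iff[of "norm q" 2] in auto)
    then show "norm (z * q\<^sup>2) * norm q ^ 2 < 1" by (simp add: norm_mult norm_power)
  qed
  have y': "1 / (z * q\<^sup>2) = y / q\<^sup>2" by (simp add: y_def)
  let ?c = "\<lambda>m. (z * q\<^sup>2) ^ m * q ^ (2 * m) * series_term (y / q\<^sup>2) q m"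
  have S: "summable ?c" using summable_norm_cancel[OF series_term_summable[OF q zq']] by (simp add: y')
  have "series_sum (z * q\<^sup>2) q = ?c 0 + (\<Sum>m. ?c (Suc m))"
    unfolding series_sum_def y' using suminf_split_head[OF S] by simp
  also have "(\<Sum>m. ?c (Suc m)) = (\<Sum>m. ((1 + y / q) * (1 + y) / (1 - y) * (z * q ^ 4)) * (z ^ m * q ^ (4 * m) * series_term y q m / (1 - q ^ (2 * m + 3))))"
  proof (rule suminf_cong)
    fix m
    have "(z * q\<^sup>2) ^ Suc m * q ^ (2 * Suc m) = (z * q ^ 4) * (z ^ m * q ^ (4 * m))"
    proof -
      have "q ^ 4 = q\<^sup>2 * q\<^sup>2" by (simp add: eval_nat_numeral)
      then show ?thesis unfolding power_mult power_mult_distrib power_Suc by (simp only: power_mult_distrib mult_ac)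
    qed
    then show "?c (Suc m) = ((1 + y / q) * (1 + y) / (1 - y) * (z * q ^ 4)) * (z ^ m * q ^ (4 * m) * series_term y q m / (1 - q ^ (2 * m + 3)))"
      unfolding series_term_shift[OF q y] by (simp only:) simp
  qed
  also have "\<dots> = ((1 + y / q) * (1 + y) / (1 - y) * (z * q ^ 4)) * B"
    unfolding B_def by (rule suminf_mult[OF T(2)])
  also have "?c 0 = 1 / ((1 - q) * (1 - y))" using q0 by (simp add: series_term_0[OF q(2) yq'])
  finally have C: "series_sum (z * q\<^sup>2) q = 1 / ((1 - q) * (1 - y)) + ((1 + y / q) * (1 + y) / (1 - y) * (z * q ^ 4)) * B" .
  have n1: "1 - q \<noteq> 0" "1 - z \<noteq> 0" "1 - y \<noteq> 0" using q z y by auto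
  have n2: "1 - z * q\<^sup>2 \<noteq> 0" using z(2) by (metis eq_iff_diff_eq_0 less_irrefl norm_mult norm_one norm_power)
  define C' where "C' = series_sum (z * q\<^sup>2) q"
  have "C' * ((1 - q) * (1 - y)) = 1 + (1 - q) * ((1 + y / q) * (1 + y) * (z * q ^ 4)) * B"
  proof -
    have "(1 / (a * b) + s / b * w * B) * (a * b) = 1 + a * (s * w) * B" if "a \<noteq> 0" "b \<noteq> 0" for a b s w :: complex
      using that by (simp add: field_simps)
    then show ?thesis unfolding C'_def C using n1(1,3) by blast
  qed
  also have "(1 + y / q) * (1 + y) * (z * q ^ 4) = (q + y) * (1 + y) * (z * q ^ 3)"
    using q0 by (simp add: field_simps eval_nat_numeral)
  finally have c0: "C' * ((1 - q) * (1 - y)) = 1 + (1 - q) * ((q + y) * (1 + y) * (z * q ^ 3)) * B" .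
  have c1: "C' * ((1 - q) * (z - 1)) = z + (1 - q) * (q ^ 3 * (1 + q * z) * (1 + z)) * B"
    using c0 zy by algebra
  have "(1 - q) * ((q\<^sup>2 * z - 1) * A + q\<^sup>2 * y * (1 + q * z) * (1 + q\<^sup>2 * z) * B) = - 1"
    unfolding T(1) using n1 by simp
  then have t1: "(1 - q) * ((q\<^sup>2 * z - 1) * A * z + q\<^sup>2 * (1 + q * z) * (1 + q\<^sup>2 * z) * B) = - z"
    using zy by algebra
  \<comment> \<open>\<open>B\<close> is eliminated between \<open>c1\<close>, which expresses the
    shifted sum, and \<open>t1\<close>, the telescoped relation multiplied by
    \<open>z\<close>.\<close>
  have "(1 - q) * ((1 + z * q\<^sup>2) * (1 - z) * (1 + 2 * (1 + q) * q * C') + q * z * (1 + z) * (1 - z * q\<^sup>2) * (1 + 2 * (1 + q) * q * A))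
     = (1 - q) * ((1 - q * z) * (1 - z * q\<^sup>2) * (1 - z))"
    using c1 t1 by algebra
  then have "(1 + z * q\<^sup>2) * (1 - z) * (1 + 2 * (1 + q) * q * C') + q * z * (1 + z) * (1 - z * q\<^sup>2) * (1 + 2 * (1 + q) * q * A)
     = (1 - q * z) * (1 - z * q\<^sup>2) * (1 - z)"
    using n1(1) by (simp only: mult_cancel_left simp_thms)
  moreover have "u / w * c + b * (v / x * d) = e" if "u * x * c + b * v * w * d = e * w * x" "w \<noteq> 0" "x \<noteq> 0"
    for u v w x b c d e :: complex
    using that by (simp add: field_simps)
  ultimately show ?thesis
    unfolding rank_gf_def C'_def[symmetric] A_def[symmetric] using n1 n2 by blast
qed

section \<open>Laurent coefficients and tail sums in the rank variable\<close>

lemma has_sum_finite_sum: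
  fixes f :: "'i \<Rightarrow> 'a \<Rightarrow> complex"
  assumes "finite I" "\<And>i. i \<in> I \<Longrightarrow> (f i has_sum s i) A"
  shows "((\<lambda>x. \<Sum>i\<in>I. f i x) has_sum (\<Sum>i\<in>I. s i)) A"
  using assms by (induction I rule: finite_induct) (auto intro!: has_sum_add)

lemma sum_roots_of_unity:
  fixes m :: int
  assumes "N > 0"
  shows "(\<Sum>j<N. exp (2 * pi * \<i> * of_nat j / of_nat N) powi m) = (if int N dvd m then of_nat N else 0)"
proof -
  define x where "x = exp (2 * pi * \<i> * of_int m / of_nat N)"
  have p: "exp (2 * pi * \<i> * of_nat j / of_nat N) powi m = x ^ j" for j
    unfolding x_def exp_of_nat_mult[symmetric] exp_power_int by (simp add: field_simps)
  have "x ^ N = exp (2 * pi * \<i> * of_int m)"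
    unfolding x_def exp_of_nat_mult[symmetric] using assms by simp
  also have "\<dots> = 1" using exp_integer_2pi[of "of_int m"] by (simp add: mult_ac)
  finally have xN: "x ^ N = 1" .
  have x1: "x = 1 \<longleftrightarrow> int N dvd m"
  proof
    assume "x = 1"
    then obtain n :: int where "2 * pi * of_int m / of_nat N = of_int (2 * n) * pi"
      unfolding x_def exp_eq_1 by auto
    then have "of_int m = (of_int n * of_nat N :: real)" using assms by (simp add: field_simps)
    then have "m = n * int N" by (metis of_int_eq_iff of_int_mult of_int_of_nat_eq)
    then show "int N dvd m" by simp
  next
    assume "int N dvd m"
    then obtain n where m: "m = int N * n" by blast
    have "2 * pi * \<i> * of_int m / of_nat N = (2 * of_int n * pi) * \<i>" using assms by (simp add: m)
    then show "x = 1" unfolding x_def using exp_integer_2pi[of "of_int n"] by (simp add: mult_ac)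
  qed
  show ?thesis
  proof (cases "x = 1")
    case True
    then show ?thesis unfolding p using x1 by simp
  next
    case False
    then show ?thesis unfolding p using x1 xN by (simp add: geometric_sum)
  qed
qed

text \<open>Uniqueness of Laurent coefficients, by averaging over finitely many rotations of the
  circle instead of a contour integral.\<close>

lemma laurent_zero:
  fixes a :: "int \<Rightarrow> complex"
  assumes r: "r > 0" and h: "\<And>z. norm z = r \<Longrightarrow> ((\<lambda>k. a k * z powi k) has_sum 0) UNIV"
  shows "a n = 0"
proof -
  let ?r = "complex_of_real r"
  let ?b = "\<lambda>k. a k * ?r powi k"
  have r0: "?r \<noteq> 0" using r by simp
  have sb: "(\<lambda>k. norm (?b k)) summable_on UNIV"
    using has_sum_imp_summable[OF h[of ?r]] r by (simp only: summable_on_iff_abs_summable_on_complex) simp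
  \<comment> \<open>The average over the \<open>N + 1\<close>-st roots of unity keeps the exponents
    congruent to \<open>n\<close>; as \<open>N\<close> grows only \<open>k = n\<close> remains, by
    dominated convergence.\<close>
  let ?f = "\<lambda>N k. if int (Suc N) dvd (k - n) then ?b k else 0"
  have z: "(?f N has_sum 0) UNIV" for N
  proof -
    let ?w = "\<lambda>j. exp (2 * pi * \<i> * of_nat j / of_nat (Suc N))"
    have w: "norm (?w j) = 1" "?w j \<noteq> 0" for j by (simp_all add: norm_exp_eq_Re)
    have "((\<lambda>k. ?b k * ?w j powi (k - n)) has_sum 0) UNIV" for j
    proof -
      have "norm (?r * ?w j) = r" using w r by (simp add: norm_mult)
      from has_sum_cmult_left[OF h[OF this], of "?w j powi (- n)"]
      show ?thesis using w(2)[of j] by (simp add: power_int_mult_distrib power_int_diff power_int_minus divide_inverse mult_ac)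
    qed
    then have "((\<lambda>k. \<Sum>j<Suc N. ?b k * ?w j powi (k - n)) has_sum (\<Sum>j<Suc N. 0)) UNIV"
      by (intro has_sum_finite_sum) auto
    moreover have "(\<Sum>j<Suc N. ?b k * ?w j powi (k - n)) = of_nat (Suc N) * ?f N k" for k
      unfolding sum_distrib_left[symmetric] sum_roots_of_unity[OF zero_less_Suc] by simp
    ultimately have "((\<lambda>k. of_nat (Suc N) * ?f N k) has_sum of_nat (Suc N) * 0) UNIV" by (simp only: sum.neutral_const mult_zero_right)
    then show ?thesis by (subst (asm) has_sum_cmult_right_iff) (simp_all del: of_nat_Suc)
  qed
  have "((\<lambda>N. infsum (?f N) UNIV) \<longlongrightarrow> (\<Sum>\<^sub>\<infinity>k. if k = n then ?b k else 0)) sequentially"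
  proof (rule infsum_tendsto_dominated[OF _ _ sb])
    fix k
    show "(\<lambda>N. ?f N k) \<longlonglongrightarrow> (if k = n then ?b k else 0)"
    proof (cases "k = n")
      case False
      have "eventually (\<lambda>N. ?f N k = 0) sequentially"
        using eventually_ge_at_top[of "nat \<bar>k - n\<bar>"]
      proof eventually_elim
        case (elim N)
        have "\<not> int (Suc N) dvd (k - n)"
        proof
          assume "int (Suc N) dvd (k - n)"
          with False have "\<bar>int (Suc N)\<bar> \<le> \<bar>k - n\<bar>" by (intro dvd_imp_le_int) auto
          with elim show False by linarith
        qed
        then show ?case by simp
      qed
      then show ?thesis using False tendsto_eventually by auto
    qed simp
    show "\<forall>\<^sub>F N in sequentially. \<forall>k\<in>UNIV. norm (?f N k) \<le> norm (?b k)"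
      by (intro always_eventually) auto
  qed simp
  then have "(\<lambda>N. 0) \<longlonglongrightarrow> (\<Sum>\<^sub>\<infinity>k. if k = n then ?b k else 0)" by (simp only: infsumI[OF z])
  moreover have "(\<Sum>\<^sub>\<infinity>k. if k = n then ?b k else 0) = ?b n"
  proof -
    have "((\<lambda>k. if k = n then ?b k else 0) has_sum ?b n) UNIV"
      by (rule has_sum_finite_neutralI[of "{n}"]) auto
    then show ?thesis by (rule infsumI)
  qed
  ultimately have "?b n = 0" using LIMSEQ_unique tendsto_const by metis
  then show ?thesis using r0 by simp
qed

text \<open>The empty overpartition is given rank 0, because the q-difference equation holds for the generating
  function with constant term 1.\<close>

definition rank0 :: "overpartition \<Rightarrow> int" where
  "rank0 \<pi> = (if fst \<pi> = {#} then 0 else M2_rank \<pi>)"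

definition all_overpartitions :: "overpartition set" where "all_overpartitions = insert ({#}, {}) nonempty_overpartitions"

definition rank_fiber :: "int \<Rightarrow> overpartition set" where "rank_fiber k = {\<pi> \<in> all_overpartitions. rank0 \<pi> = k}"

definition rank_coeff :: "complex \<Rightarrow> int \<Rightarrow> complex" where
  "rank_coeff q k = (\<Sum>\<^sub>\<infinity>\<pi>\<in>rank_fiber k. q ^ part_sum \<pi>)"

text \<open>The coefficients of \<open>(1 + z) / (1 - z)\<close>: multiplying by this factor in the q-difference equation
  turns rank coefficients into the tail sums below.\<close>

definition tail_weight :: "nat \<Rightarrow> complex" where "tail_weight i = (if i = 0 then 1 else 2)"

text \<open>The sign \<open>s\<close> is the direction of expansion of
  \<open>(1 + z^(-s)) / (1 - z^(-s))\<close>: outside the unit circle for \<open>s = 1\<close>,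
  inside for \<open>s = -1\<close>.\<close>

definition tail_sum :: "complex \<Rightarrow> int \<Rightarrow> int \<Rightarrow> complex" where
  "tail_sum q s k = (\<Sum>\<^sub>\<infinity>i. tail_weight i * rank_coeff q (k + s * int i))"

lemma tail_weight_has_sum:
  fixes x :: complex
  assumes "norm x < 1"
  shows "((\<lambda>i. tail_weight i * x ^ i) has_sum ((1 + x) / (1 - x))) UNIV"
proof -
  have x1: "1 - x \<noteq> 0" using assms by auto
  have "((\<lambda>i. if i = 0 then 1 else 0 :: complex) has_sum 1) UNIV"
    by (rule has_sum_finite_neutralI[of "{0}"]) auto
  from has_sum_add[OF has_sum_cmult_right[OF has_sum_geometric[OF assms], of 2] has_sum_uminusI[OF this]]
  have "((\<lambda>i. 2 * x ^ i + - (if i = 0 then 1 else 0)) has_sum (2 * (1 / (1 - x)) + - 1)) UNIV" .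
  moreover have "2 * x ^ i + - (if i = 0 then 1 else 0) = tail_weight i * x ^ i" for i by (simp add: tail_weight_def)
  moreover have "2 * (1 / (1 - x)) + - 1 = (1 + x) / (1 - x)" using x1 by (simp add: field_simps)
  ultimately show ?thesis by simp
qed

context
  fixes q :: complex
  assumes q: "0 < norm q" "norm q < 1"
begin

lemma all_overpartitions_has_sum:
  assumes z: "norm q ^ 2 < norm z" "norm z * norm q ^ 2 < 1"
  shows "((\<lambda>\<pi>. z powi rank0 \<pi> * q ^ part_sum \<pi>) has_sum rank_gf z q) all_overpartitions"
proof -
  have "((\<lambda>\<pi>. z powi rank0 \<pi> * q ^ part_sum \<pi>) has_sum (rank_gf z q - 1)) nonempty_overpartitions"
    using nonempty_overpartitions_has_sum(1)[OF q z]
    by (rule has_sum_cong[THEN iffD1, rotated]) (auto simp: rank_weight_def rank0_def nonempty_overpartitions_def)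
  from has_sum_insert[OF _ this, of "({#}, {})"] show ?thesis
    by (simp add: all_overpartitions_def nonempty_overpartitions_def rank0_def part_sum_def)
qed

lemma all_overpartitions_Sigma:
  "(f has_sum S) all_overpartitions \<longleftrightarrow> ((\<lambda>(k, \<pi>). f \<pi>) has_sum S) (Sigma UNIV rank_fiber)"
  by (rule has_sum_reindex_bij_witness[of _ snd "\<lambda>\<pi>. (rank0 \<pi>, \<pi>)"]) (auto simp: rank_fiber_def)

lemma rank_fiber_summable: "(\<lambda>\<pi>. q ^ part_sum \<pi>) summable_on rank_fiber k"
proof -
  have "norm q ^ 2 < 1" using q by (simp add: power_less_one_iff)
  then have "((\<lambda>\<pi>. 1 powi rank0 \<pi> * q ^ part_sum \<pi>) has_sum rank_gf 1 q) all_overpartitions"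
    by (intro all_overpartitions_has_sum) auto
  from has_sum_imp_summable[OF this] have "(\<lambda>\<pi>. q ^ part_sum \<pi>) summable_on all_overpartitions" by simp
  then show ?thesis by (rule summable_on_subset_banach) (auto simp: rank_fiber_def)
qed

lemma rank_coeff_has_sum:
  assumes z: "norm q ^ 2 < norm z" "norm z * norm q ^ 2 < 1"
  shows "((\<lambda>k. rank_coeff q k * z powi k) has_sum rank_gf z q) UNIV"
proof (rule has_sum_SigmaD)
  show "((\<lambda>(k, \<pi>). z powi rank0 \<pi> * q ^ part_sum \<pi>) has_sum rank_gf z q) (Sigma UNIV rank_fiber)"
    using all_overpartitions_has_sum[OF z] by (simp only: all_overpartitions_Sigma)
  fix k
  have "((\<lambda>\<pi>. q ^ part_sum \<pi>) has_sum rank_coeff q k) (rank_fiber k)"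
    unfolding rank_coeff_def by (rule has_sum_infsum[OF rank_fiber_summable])
  from has_sum_cmult_right[OF this, of "z powi k"]
  show "((\<lambda>\<pi>. case (k, \<pi>) of (k, \<pi>) \<Rightarrow> z powi rank0 \<pi> * q ^ part_sum \<pi>) has_sum rank_coeff q k * z powi k) (rank_fiber k)"
  proof -
    assume "((\<lambda>\<pi>. z powi k * q ^ part_sum \<pi>) has_sum z powi k * rank_coeff q k) (rank_fiber k)"
    also have "?this \<longleftrightarrow> ((\<lambda>\<pi>. z powi rank0 \<pi> * q ^ part_sum \<pi>) has_sum z powi k * rank_coeff q k) (rank_fiber k)"
      by (rule has_sum_cong) (auto simp: rank_fiber_def)
    finally show ?thesis by (simp add: mult.commute)
  qed
qed

lemma one_in: "norm q ^ 2 < norm (1 :: complex)" "norm (1 :: complex) * norm q ^ 2 < 1"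
  using q by (auto simp: power_less_one_iff)

lemma rank_coeff_summable: "(\<lambda>k. norm (rank_coeff q k)) summable_on A"
proof -
  have "rank_coeff q summable_on UNIV" using has_sum_imp_summable[OF rank_coeff_has_sum[OF one_in]] by simp
  then have "(\<lambda>k. norm (rank_coeff q k)) summable_on UNIV" by (simp only: summable_on_iff_abs_summable_on_complex)
  then show ?thesis by (rule summable_on_subset_banach) auto
qed

lemma tail_sum_terms_summable:
  assumes s: "s = 1 \<or> s = -1"
  shows "(\<lambda>i. norm (tail_weight i * rank_coeff q (k + s * int i))) summable_on UNIV"
proof (rule Infinite_Sum.abs_summable_on_comparison_test')
  have "inj (\<lambda>i. k + s * int i)" using s by (auto simp: inj_on_def)
  from summable_on_reindex[OF this, of "\<lambda>k. norm (rank_coeff q k)"]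
  have "(\<lambda>i. norm (rank_coeff q (k + s * int i))) summable_on UNIV" using rank_coeff_summable by (simp add: o_def)
  then show "(\<lambda>i. 2 * norm (rank_coeff q (k + s * int i))) summable_on UNIV" by (rule summable_on_cmult_right)
qed (auto simp: tail_weight_def norm_mult)

lemma tail_sum_has_sum:
  assumes s: "s = 1 \<or> s = -1" and z: "norm q ^ 2 < norm z" "norm z * norm q ^ 2 < 1" "norm (z powi (- s)) < 1"
  shows "((\<lambda>k. tail_sum q s k * z powi k) has_sum ((1 + z powi (- s)) / (1 - z powi (- s)) * rank_gf z q)) UNIV"
proof (rule has_sum_SigmaD)
  let ?x = "z powi (- s)"
  have z0: "z \<noteq> 0" using z by auto
  have n1: "(\<lambda>i. norm (tail_weight i * ?x ^ i)) summable_on UNIV"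
    using has_sum_imp_summable[OF tail_weight_has_sum[OF z(3)]] by (simp only: summable_on_iff_abs_summable_on_complex)
  have n2: "(\<lambda>k. norm (rank_coeff q k * z powi k)) summable_on UNIV"
    using has_sum_imp_summable[OF rank_coeff_has_sum[OF z(1,2)]] by (simp only: summable_on_iff_abs_summable_on_complex)
  have "((\<lambda>(i, k). tail_weight i * ?x ^ i * (rank_coeff q k * z powi k)) has_sum ((1 + ?x) / (1 - ?x) * rank_gf z q)) (UNIV \<times> UNIV)"
    using has_sum_times(1)[OF n1 n2] by (simp only: infsumI[OF tail_weight_has_sum[OF z(3)]] infsumI[OF rank_coeff_has_sum[OF z(1,2)]])
  also have "?this \<longleftrightarrow> ((\<lambda>(k, i). tail_weight i * rank_coeff q (k + s * int i) * z powi k) has_sum ((1 + ?x) / (1 - ?x) * rank_gf z q)) (UNIV \<times> UNIV)"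
  proof (rule has_sum_reindex_bij_witness[of _ "\<lambda>(k, i). (i, k + s * int i)" "\<lambda>(i, k). (k - s * int i, i)"])
    fix a :: "nat \<times> int"
    obtain i k where a: "a = (i, k)" by force
    have "?x ^ i * z powi k = z powi (k - s * int i)"
      using z0 by (simp add: power_int_diff power_int_minus power_int_power' power_inverse divide_inverse mult.commute)
    then show "(case case a of (i, k) \<Rightarrow> (k - s * int i, i) of (k, i) \<Rightarrow> tail_weight i * rank_coeff q (k + s * int i) * z powi k) =
         (case a of (i, k) \<Rightarrow> tail_weight i * ?x ^ i * (rank_coeff q k * z powi k))"
      by (simp add: a mult_ac)
  qed auto
  finally show "((\<lambda>(k, i). tail_weight i * rank_coeff q (k + s * int i) * z powi k) has_sum ((1 + ?x) / (1 - ?x) * rank_gf z q)) (UNIV \<times> UNIV)" .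
  fix k
  have "((\<lambda>i. tail_weight i * rank_coeff q (k + s * int i)) has_sum tail_sum q s k) UNIV"
    unfolding tail_sum_def using tail_sum_terms_summable[OF s] by (intro has_sum_infsum) (rule abs_summable_summable)
  from has_sum_cmult_left[OF this, of "z powi k"]
  show "((\<lambda>i. case (k, i) of (k, i) \<Rightarrow> tail_weight i * rank_coeff q (k + s * int i) * z powi k) has_sum tail_sum q s k * z powi k) UNIV"
    by simp
qed

text \<open>Coefficient of \<open>z^k\<close> in \<open>rank_gf_functional_equation\<close>; the
  right side comes from \<open>1 - q z\<close>.\<close>

lemma tail_sum_recurrence:
  "tail_sum q (-1) k * q powi (2 * k) - q * tail_sum q 1 (k - 1) = (if k = 0 then 1 else 0) - (if k = 1 then q else 0)"
proof -
  have q0: "q \<noteq> 0" using q by auto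
  define a where "a = (\<lambda>k. tail_sum q (-1) k * q powi (2 * k) - q * tail_sum q 1 (k - 1) - ((if k = 0 then 1 else 0) - (if k = 1 then q else 0)))"
  have q2: "norm q ^ 2 < 1" using q by (simp add: power_less_one_iff)
  \<comment> \<open>On the circle \<open>norm z = 1 / norm q\<close> the point \<open>z\<close> lies
    outside and \<open>z q^2\<close> inside the unit circle. Thus the two terms are expanded in
    opposite directions.\<close>
  define r where "r = 1 / norm q"
  have r: "r > 1" "r * norm q ^ 2 < 1" using q by (auto simp: r_def power2_eq_square)
  have "a k = 0"
  proof (rule laurent_zero)
    show "r > 0" using r by simp
    fix z :: complex assume nz: "norm z = r"
    then have z0: "z \<noteq> 0" using r by auto
    have c1: "norm q ^ 2 < norm z" "norm z * norm q ^ 2 < 1" "norm (z powi (- 1)) < 1"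
      using r q2 nz by (auto simp: norm_power_int power_int_minus norm_inverse inverse_less_1_iff)
    have "norm q ^ 2 * 1 < norm q ^ 2 * r" by (rule mult_strict_left_mono) (use r q in auto)
    moreover have "r * norm q ^ 2 * norm q ^ 2 < 1 * 1"
      by (rule mult_strict_mono) (use r q2 in auto)
    ultimately have c2: "norm q ^ 2 < norm (z * q\<^sup>2)" "norm (z * q\<^sup>2) * norm q ^ 2 < 1" "norm ((z * q\<^sup>2) powi (- (- 1))) < 1"
      using nz r by (auto simp: norm_mult norm_power mult.commute)
    from tail_sum_has_sum[OF _ c2] have 1: "((\<lambda>k. tail_sum q (-1) k * (z * q\<^sup>2) powi k) has_sum ((1 + z * q\<^sup>2) / (1 - z * q\<^sup>2) * rank_gf (z * q\<^sup>2) q)) UNIV"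
      by simp
    from tail_sum_has_sum[OF _ c1] have "((\<lambda>k. tail_sum q 1 k * z powi k) has_sum ((1 + 1 / z) / (1 - 1 / z) * rank_gf z q)) UNIV"
      by (simp add: power_int_minus inverse_eq_divide)
    moreover have "(1 + 1 / z) / (1 - 1 / z) = - ((1 + z) / (1 - z))"
    proof -
      have "z \<noteq> 1" using nz r by auto
      then show ?thesis using z0 by (simp add: field_simps)
    qed
    ultimately have "((\<lambda>k. tail_sum q 1 k * z powi k) has_sum (- ((1 + z) / (1 - z)) * rank_gf z q)) UNIV" by simp
    then have "((\<lambda>k. tail_sum q 1 (k - 1) * z powi (k - 1)) has_sum (- ((1 + z) / (1 - z)) * rank_gf z q)) UNIV"
      by (subst has_sum_reindex_bij_witness[of _ "\<lambda>n. n + 1" "\<lambda>n. n - 1" UNIV "\<lambda>k. tail_sum q 1 k * z powi k"]) auto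
    from has_sum_cmult_right[OF this, of "- (q * z)"]
    have 2: "((\<lambda>k. - (q * tail_sum q 1 (k - 1)) * z powi k) has_sum (q * z * ((1 + z) / (1 - z) * rank_gf z q))) UNIV"
      using z0 by (simp add: power_int_diff mult.assoc)
    have 3: "((\<lambda>k. - ((if k = 0 then 1 else 0) - (if k = 1 then q else 0)) * z powi k) has_sum - (1 - q * z)) UNIV"
      by (rule has_sum_finite_neutralI[of "{0, 1}"]) (auto simp: algebra_simps)
    have "((\<lambda>k. tail_sum q (-1) k * (z * q\<^sup>2) powi k + - (q * tail_sum q 1 (k - 1)) * z powi k + - ((if k = 0 then 1 else 0) - (if k = 1 then q else 0)) * z powi k)
       has_sum ((1 + z * q\<^sup>2) / (1 - z * q\<^sup>2) * rank_gf (z * q\<^sup>2) q + q * z * ((1 + z) / (1 - z) * rank_gf z q) + - (1 - q * z))) UNIV"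
      by (intro has_sum_add 1 2 3)
    moreover have "(1 + z * q\<^sup>2) / (1 - z * q\<^sup>2) * rank_gf (z * q\<^sup>2) q + q * z * ((1 + z) / (1 - z) * rank_gf z q) + - (1 - q * z) = 0"
      using rank_gf_functional_equation[OF q, of z] nz r by simp
    moreover have "tail_sum q (-1) k * (z * q\<^sup>2) powi k + - (q * tail_sum q 1 (k - 1)) * z powi k + - ((if k = 0 then 1 else 0) - (if k = 1 then q else 0)) * z powi k
       = a k * z powi k" for k
      by (simp add: a_def power_int_mult_distrib powi_square powi_double algebra_simps)
    ultimately show "((\<lambda>k. a k * z powi k) has_sum 0) UNIV" by simp
  qed
  then show ?thesis by (simp add: a_def)
qed

text \<open>Twice the generating function of all overpartitions; \<open>T_phi\<close> evaluates it
  as \<open>2 / phi q\<close>.\<close>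

definition total_gf :: complex where "total_gf = 2 * infsum (rank_coeff q) UNIV"

text \<open>The two tails share the index \<open>k\<close>, which each counts with weight 1; all
  other indices have weight 2 in exactly one of them. This turns the recurrence into one for a
  single sequence.\<close>

lemma tail_sum_complement: "tail_sum q (-1) k = total_gf - tail_sum q 1 k"
proof -
  have 1: "((\<lambda>i. tail_weight i * rank_coeff q (k + s * int i)) has_sum tail_sum q s k) UNIV" if "s = 1 \<or> s = -1" for s
    unfolding tail_sum_def using tail_sum_terms_summable[OF that] by (intro has_sum_infsum) (rule abs_summable_summable)
  have S: "(f has_sum infsum f A) A" if "f = rank_coeff q" for f A
    using abs_summable_summable[OF rank_coeff_summable] that by (auto intro: has_sum_infsum)
  have half: "infsum (rank_coeff q) (range (\<lambda>i. k + s * int i)) = (tail_sum q s k + rank_coeff q k) / 2" if s: "s = 1 \<or> s = -1" for s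
  proof -
    have "((\<lambda>i::nat. if i = 0 then rank_coeff q k else 0) has_sum rank_coeff q k) UNIV"
      by (rule has_sum_finite_neutralI[of "{0::nat}"]) auto
    from has_sum_add[OF 1[OF s] this]
    have "((\<lambda>i. tail_weight i * rank_coeff q (k + s * int i) + (if i = 0 then rank_coeff q k else 0)) has_sum (tail_sum q s k + rank_coeff q k)) UNIV" .
    also have "(\<lambda>i. tail_weight i * rank_coeff q (k + s * int i) + (if i = 0 then rank_coeff q k else 0)) = (\<lambda>i. 2 * rank_coeff q (k + s * int i))"
      by (auto simp: tail_weight_def fun_eq_iff)
    finally have 2: "((\<lambda>i. 2 * rank_coeff q (k + s * int i)) has_sum (tail_sum q s k + rank_coeff q k)) UNIV" .
    have inj: "inj (\<lambda>i. k + s * int i)" using s by (auto simp: inj_on_def)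
    have "(rank_coeff q has_sum infsum (rank_coeff q) (range (\<lambda>i. k + s * int i))) (range (\<lambda>i. k + s * int i))" by (rule S) simp
    then have "((\<lambda>i. rank_coeff q (k + s * int i)) has_sum infsum (rank_coeff q) (range (\<lambda>i. k + s * int i))) UNIV"
      by (simp add: has_sum_reindex[OF inj] o_def)
    from has_sum_unique[OF has_sum_cmult_right[OF this, of 2] 2]
    have "2 * infsum (rank_coeff q) (range (\<lambda>i. k + s * int i)) / 2 = (tail_sum q s k + rank_coeff q k) / 2" by (simp only:)
    then show ?thesis by simp
  qed
  let ?U = "range (\<lambda>i. k + 1 * int i)" and ?D = "range (\<lambda>i. k + (-1) * int i)"
  have sum: "infsum (rank_coeff q) (?U \<union> ?D) = infsum (rank_coeff q) ?U + infsum (rank_coeff q) ?D - infsum (rank_coeff q) (?U \<inter> ?D)"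
    using infsum_Un_Int[of "rank_coeff q" ?U ?D] abs_summable_summable[OF rank_coeff_summable] by auto
  have i: "?U \<inter> ?D = {k}" by (auto simp: image_iff)
  have u: "?U \<union> ?D = UNIV"
  proof -
    have "n \<in> ?U \<union> ?D" for n
    proof (cases "n \<ge> k")
      case True then have "n = k + 1 * int (nat (n - k))" by simp then show ?thesis by blast
    next
      case False then have "n = k + (-1) * int (nat (k - n))" by simp then show ?thesis by blast
    qed
    then show ?thesis by blast
  qed
  have "infsum (rank_coeff q) UNIV = (tail_sum q 1 k + rank_coeff q k) / 2 + (tail_sum q (-1) k + rank_coeff q k) / 2 - infsum (rank_coeff q) {k}"
    using sum unfolding i u half[of 1, OF disjI1[OF refl]] half[of "-1", OF disjI2[OF refl]] .
  then have "4 * infsum (rank_coeff q) UNIV = 2 * (tail_sum q 1 k + tail_sum q (-1) k)" by (simp add: field_simps)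
  then have "2 * (2 * infsum (rank_coeff q) UNIV) = 2 * (tail_sum q 1 k + tail_sum q (-1) k)" by simp
  then have "2 * infsum (rank_coeff q) UNIV = tail_sum q 1 k + tail_sum q (-1) k" by (simp only: mult_cancel_left) simp
  then show ?thesis by (simp add: total_gf_def)
qed

lemma tail_sum_bounded: obtains D where "\<And>k. norm (tail_sum q 1 k) \<le> D"
proof
  fix k
  have "norm (tail_sum q 1 k) \<le> (\<Sum>\<^sub>\<infinity>i. norm (tail_weight i * rank_coeff q (k + 1 * int i)))"
    unfolding tail_sum_def by (rule norm_infsum_bound[OF tail_sum_terms_summable]) simp
  also have "\<dots> \<le> (\<Sum>\<^sub>\<infinity>i::nat. 2 * norm (rank_coeff q (k + int i)))"
  proof (rule infsum_mono[OF tail_sum_terms_summable])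
    have "inj (\<lambda>i. k + int i)" by (auto simp: inj_on_def)
    from summable_on_reindex[OF this, of "\<lambda>k. norm (rank_coeff q k)"]
    show "(\<lambda>i. 2 * norm (rank_coeff q (k + int i))) summable_on UNIV" using rank_coeff_summable by (intro summable_on_cmult_right) (simp add: o_def)
  qed (auto simp: tail_weight_def norm_mult)
  also have "\<dots> = 2 * (\<Sum>\<^sub>\<infinity>n\<in>range (\<lambda>i. k + int i). norm (rank_coeff q n))"
  proof -
    have "inj (\<lambda>i. k + int i)" by (auto simp: inj_on_def)
    from infsum_reindex[OF this, of "\<lambda>n. norm (rank_coeff q n)"] show ?thesis by (simp add: o_def infsum_cmult_right')
  qed
  also have "\<dots> \<le> 2 * (\<Sum>\<^sub>\<infinity>n. norm (rank_coeff q n))"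
    by (intro mult_left_mono infsum_mono2 rank_coeff_summable) auto
  finally show "norm (tail_sum q 1 k) \<le> 2 * (\<Sum>\<^sub>\<infinity>n. norm (rank_coeff q n))" .
qed

text \<open>Read backwards, the recurrence is \<open>d j = - q^(2 j + 1) d (j + 1)\<close>, a
  contraction for \<open>j >= 0\<close>; iterating it pushes a bounded sequence to 0.\<close>

lemma bounded_recurrence_zero:
  fixes d :: "int \<Rightarrow> complex"
  assumes rec: "\<And>k. k > K \<Longrightarrow> q powi (2 * k) * d k = - q * d (k - 1)" and "K \<ge> 0"
    and bnd: "\<And>k. norm (d k) \<le> D" and "k \<ge> K"
  shows "d k = 0"
proof -
  have q0: "q \<noteq> 0" using q by auto
  have st: "norm (d j) \<le> norm q * norm (d (j + 1))" if "j \<ge> K" for j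
  proof -
    have "q powi (2 * (j + 1)) * d (j + 1) = - q * d j" using rec[of "j + 1"] that by simp
    then have "q * d j = q * (- (q powi (2 * j + 1) * d (j + 1)))"
      using q0 by (simp add: power_int_add distrib_left power2_eq_square mult_ac)
    then have "d j = - (q powi (2 * j + 1) * d (j + 1))"
      using q0 by (simp only: mult_cancel_left simp_thms)
    moreover have "norm q powi (2 * j + 1) \<le> norm q powi 1"
      using q that \<open>K \<ge> 0\<close> by (intro power_int_decreasing) auto
    ultimately show ?thesis by (simp add: norm_mult norm_power_int mult_right_mono)
  qed
  have "norm (d k) \<le> norm q ^ n * norm (d (k + int n))" for n
  proof (induction n)
    case (Suc n)
    have "norm q ^ n * norm (d (k + int n)) \<le> norm q ^ n * (norm q * norm (d (k + int n + 1)))"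
      by (intro mult_left_mono st) (use \<open>k \<ge> K\<close> in auto)
    then show ?case using Suc by (simp add: algebra_simps)
  qed simp
  then have "norm (d k) \<le> norm q ^ n * D" for n
    using bnd[of "k + int n"] by (meson mult_left_mono norm_ge_zero order_trans zero_le_power)
  moreover have "(\<lambda>n. norm q ^ n * D) \<longlonglongrightarrow> 0 * D"
    by (intro tendsto_intros LIMSEQ_power_zero) (use q in auto)
  ultimately have "norm (d k) \<le> 0 * D" by (intro LIMSEQ_le_const) auto
  then show ?thesis by simp
qed

lemma tail_sum_rec: "q powi (2 * k) * (total_gf - tail_sum q 1 k) = q * tail_sum q 1 (k - 1) + (if k = 0 then 1 else 0) - (if k = 1 then q else 0)"
  using tail_sum_recurrence[of k] unfolding tail_sum_complement by (simp add: algebra_simps)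

text \<open>The recurrence with its inhomogeneous terms is invariant under this reflection, so the
  defect \<open>d\<close> is a bounded solution of the homogeneous recurrence. The symmetry of the
  rank follows from it without a bijection.\<close>

lemma tail_sum_symmetric: "tail_sum q 1 (- k) = total_gf - tail_sum q 1 k"
proof -
  define d where "d = (\<lambda>k. tail_sum q 1 k - (total_gf - tail_sum q 1 (- k)))"
  have q0: "q \<noteq> 0" using q by auto
  obtain D where D: "\<And>k. norm (tail_sum q 1 k) \<le> D" using tail_sum_bounded by blast
  have "norm (d k) \<le> D + (norm total_gf + D)" for k
    unfolding d_def using D[of k] D[of "- k"]
    by (meson norm_triangle_ineq4 add_mono order_trans order_refl)
  moreover have "q powi (2 * k) * d k = - q * d (k - 1)" for k
  proof -
    have "q powi (2 * k) * (q powi (2 * (1 - k)) * (total_gf - tail_sum q 1 (1 - k)))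
        = q powi (2 * k) * (q * tail_sum q 1 (- k) + (if k = 1 then 1 else 0) - (if k = 0 then q else 0))"
      using tail_sum_rec[of "1 - k"] by simp
    moreover have "q powi (2 * k) * q powi (2 * (1 - k)) = q * q"
      using q0 by (simp add: power_int_add[symmetric] power2_eq_square)
    ultimately have "(q * q) * (total_gf - tail_sum q 1 (1 - k))
        = q powi (2 * k) * (q * tail_sum q 1 (- k) + (if k = 1 then 1 else 0) - (if k = 0 then q else 0))"
      by (simp only: mult.assoc[symmetric])
    then have "q * (q * (total_gf - tail_sum q 1 (1 - k))) = q * (q powi (2 * k) * tail_sum q 1 (- k) + (if k = 1 then q else 0) - (if k = 0 then 1 else 0))"
      by (cases "k = 0"; cases "k = 1") (simp_all add: algebra_simps power2_eq_square)
    then have e: "q * (total_gf - tail_sum q 1 (1 - k)) = q powi (2 * k) * tail_sum q 1 (- k) + (if k = 1 then q else 0) - (if k = 0 then 1 else 0)"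
      using q0 by (simp only: mult_cancel_left simp_thms)
    have "q powi (2 * k) * d k = q powi (2 * k) * tail_sum q 1 (- k) - q powi (2 * k) * (total_gf - tail_sum q 1 k)"
      by (simp add: d_def algebra_simps)
    also have "\<dots> = - q * d (k - 1)"
      unfolding tail_sum_rec using e by (auto simp: d_def algebra_simps)
    finally show ?thesis .
  qed
  ultimately have z: "d j = 0" if "j \<ge> 0" for j
    using bounded_recurrence_zero[of 0 d] that by blast
  have "d k = 0"
  proof (cases "k \<ge> 0")
    case False
    then have "d (- k) = 0" by (intro z) simp
    then show ?thesis by (simp add: d_def)
  qed (rule z)
  then show ?thesis by (simp add: d_def algebra_simps)
qed

end

section \<open>Rank classes modulo 5\<close>

lemma has_sum_int_split:
  fixes f :: "int \<Rightarrow> complex"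
  assumes "((\<lambda>n. f (int n)) has_sum A) UNIV" "((\<lambda>n. f (- int n - 1)) has_sum B) UNIV"
  shows "(f has_sum (A + B)) UNIV"
proof -
  have "inj int" "inj (\<lambda>n. - int n - 1)" by (auto simp: inj_on_def)
  then have "(f has_sum A) (range int)" "(f has_sum B) (range (\<lambda>n. - int n - 1))"
    using assms by (auto simp: has_sum_reindex o_def)
  then have "(f has_sum (A + B)) (range int \<union> range (\<lambda>n. - int n - 1))"
    by (rule has_sum_Un_disjoint) auto
  moreover have "range int \<union> range (\<lambda>n. - int n - 1) = UNIV"
  proof -
    have "n \<in> range int \<union> range (\<lambda>n. - int n - 1)" for n :: int
    proof (cases "n \<ge> 0")
      case True then have "n = int (nat n)" by simp then show ?thesis by blast
    next
      case False then have "n = - int (nat (- n - 1)) - 1" by simp then show ?thesis by blast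
    qed
    then show ?thesis by blast
  qed
  ultimately show ?thesis by simp
qed

lemma has_sum_Suc:
  fixes f :: "nat \<Rightarrow> complex"
  assumes "((\<lambda>n. f (Suc n)) has_sum A) UNIV"
  shows "(f has_sum (f 0 + A)) UNIV"
proof -
  have "(f has_sum A) (range Suc)" using assms by (simp add: has_sum_reindex o_def)
  then have "(f has_sum (f 0 + A)) (insert 0 (range Suc))" by (intro has_sum_insert) auto
  then show ?thesis by (simp only: UNIV_nat_eq[symmetric])
qed

section \<open>Partial theta functions and Lambert series\<close>

context
  fixes q :: complex
  assumes q: "0 < norm q" "norm q < 1"
begin

text \<open>Result of iterating the tail recurrence from infinity:
  \<open>1 - partial_theta k\<close> satisfies the same recurrence as the tail sum divided by
  \<open>T\<close>.\<close>

definition partial_theta :: "nat \<Rightarrow> complex" where "partial_theta k = (\<Sum>\<^sub>\<infinity>m::nat. (-1) ^ m * q ^ (m\<^sup>2 + 2 * m * k))"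

lemma partial_theta_summable: "(\<lambda>m. norm ((-1) ^ m * q ^ (m\<^sup>2 + 2 * m * k))) summable_on UNIV"
  and norm_partial_theta: "norm (partial_theta k) \<le> 1 / (1 - norm q)"
proof -
  have g: "((\<lambda>m. norm q ^ m) has_sum (1 / (1 - norm q))) UNIV"
    by (rule norm_summable_imp_has_sum) (use q in \<open>auto intro!: geometric_sums\<close>)
  have b: "norm ((-1) ^ m * q ^ (m\<^sup>2 + 2 * m * k)) \<le> norm q ^ m" for m
  proof -
    have "m \<le> m\<^sup>2 + 2 * m * k" by (simp add: power2_eq_square trans_le_add1)
    then have "norm q ^ (m\<^sup>2 + 2 * m * k) \<le> norm q ^ m" using q by (intro power_decreasing) auto
    then show ?thesis by (simp add: norm_mult norm_power)
  qed
  show s: "(\<lambda>m. norm ((-1) ^ m * q ^ (m\<^sup>2 + 2 * m * k))) summable_on UNIV"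
    by (rule Infinite_Sum.abs_summable_on_comparison_test'[OF has_sum_imp_summable[OF g] b])
  have "norm (partial_theta k) \<le> (\<Sum>\<^sub>\<infinity>m. norm ((-1) ^ m * q ^ (m\<^sup>2 + 2 * m * k)))"
    unfolding partial_theta_def by (rule norm_infsum_bound[OF s])
  also have "\<dots> \<le> (\<Sum>\<^sub>\<infinity>m. norm q ^ m)" by (rule infsum_mono[OF s has_sum_imp_summable[OF g] b])
  also have "\<dots> = 1 / (1 - norm q)" by (rule infsumI[OF g])
  finally show "norm (partial_theta k) \<le> 1 / (1 - norm q)" .
qed

lemma partial_theta_has_sum: "((\<lambda>m. (-1) ^ m * q ^ (m\<^sup>2 + 2 * m * k)) has_sum partial_theta k) UNIV"
  unfolding partial_theta_def using partial_theta_summable by (intro has_sum_infsum) (rule abs_summable_summable)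

lemma partial_theta_tail_has_sum:
  "((\<lambda>m. (-1) ^ m * q ^ ((m + 1)\<^sup>2 + 2 * (m + 1) * k)) has_sum (1 - partial_theta k)) UNIV"
  and partial_theta_rec: "partial_theta k + q ^ (2 * k + 1) * partial_theta (Suc k) = 1"
proof -
  have e: "(m + 1)\<^sup>2 + 2 * (m + 1) * k = (2 * k + 1) + (m\<^sup>2 + 2 * m * Suc k)" for m
    by (simp add: power2_eq_square algebra_simps)
  have A: "((\<lambda>m. (-1) ^ m * q ^ ((m + 1)\<^sup>2 + 2 * (m + 1) * k)) has_sum (q ^ (2 * k + 1) * partial_theta (Suc k))) UNIV"
    using has_sum_cmult_right[OF partial_theta_has_sum[of "Suc k"], of "q ^ (2 * k + 1)"]
    unfolding e power_add[of q "2 * k + 1"] by (simp add: mult_ac)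
  have "((\<lambda>m. (-1) ^ m * q ^ (m\<^sup>2 + 2 * m * k)) has_sum ((-1) ^ 0 * q ^ (0\<^sup>2 + 2 * 0 * k) + - (q ^ (2 * k + 1) * partial_theta (Suc k)))) UNIV"
    by (rule has_sum_Suc) (use has_sum_uminusI[OF A] in simp)
  from has_sum_unique[OF partial_theta_has_sum this] have *: "partial_theta k = 1 - q ^ (2 * k + 1) * partial_theta (Suc k)" by simp
  then show "partial_theta k + q ^ (2 * k + 1) * partial_theta (Suc k) = 1" by simp
  from * have "q ^ (2 * k + 1) * partial_theta (Suc k) = 1 - partial_theta k" by simp
  with A show "((\<lambda>m. (-1) ^ m * q ^ ((m + 1)\<^sup>2 + 2 * (m + 1) * k)) has_sum (1 - partial_theta k)) UNIV" by simp
qed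

lemma phi_partial_theta: "phi q = 2 * partial_theta 0 - 1"
proof -
  have "((\<lambda>n. (-1) powi n * q powi (n\<^sup>2)) has_sum (partial_theta 0 + - (1 - partial_theta 0))) UNIV"
  proof (rule has_sum_int_split)
    have "(-1) powi int n * q powi ((int n)\<^sup>2) = (-1) ^ n * q ^ (n\<^sup>2 + 2 * n * 0)" for n
      by (simp flip: power_int_of_nat)
    then show "((\<lambda>n. (-1) powi int n * q powi ((int n)\<^sup>2)) has_sum partial_theta 0) UNIV" using partial_theta_has_sum[of 0] by simp
    have "(-1) powi (- int n - 1) * q powi ((- int n - 1)\<^sup>2) = - ((-1) ^ n * q ^ ((n + 1)\<^sup>2 + 2 * (n + 1) * 0))" for n
    proof -
      have "(- int n - 1)\<^sup>2 = int ((n + 1)\<^sup>2)" by (simp add: power2_eq_square algebra_simps)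
      then have "q powi ((- int n - 1)\<^sup>2) = q ^ ((n + 1)\<^sup>2)" by (simp only: power_int_of_nat)
      moreover have "(-1 :: complex) powi (- int n - 1) = - ((-1) ^ n)"
        by (simp add: power_int_diff power_int_minus_one_minus)
      ultimately show ?thesis by simp
    qed
    then show "((\<lambda>n. (-1) powi (- int n - 1) * q powi ((- int n - 1)\<^sup>2)) has_sum - (1 - partial_theta 0)) UNIV"
      using has_sum_uminusI[OF partial_theta_tail_has_sum[of 0]] by simp
  qed
  from has_sum_unique[OF phi_has_sum[OF q] this] show ?thesis by simp
qed

abbreviation "T \<equiv> total_gf q"
abbreviation "M k \<equiv> tail_sum q 1 k"

text \<open>For \<open>k > 1\<close> the recurrence has no extra terms, so the difference of both
  sides is a bounded homogeneous solution and vanishes from 1 on.\<close>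

lemma M_formula: "k > 0 \<Longrightarrow> M (int k) = T * (1 - partial_theta k)"
proof -
  define d where "d = (\<lambda>k. M k - T * (1 - partial_theta (nat k)))"
  obtain D where D: "\<And>k. norm (M k) \<le> D" using tail_sum_bounded[OF q] by blast
  have b: "norm (d k) \<le> D + norm T * (1 + 1 / (1 - norm q))" for k
  proof -
    have "norm (d k) \<le> norm (M k) + norm T * norm (1 - partial_theta (nat k))"
      unfolding d_def by (metis norm_mult norm_triangle_ineq4)
    also have "\<dots> \<le> D + norm T * (1 + 1 / (1 - norm q))"
      using norm_triangle_ineq4[of 1 "partial_theta (nat k)"] norm_partial_theta[of "nat k"]
      by (intro add_mono D mult_left_mono) auto
    finally show ?thesis .
  qed
  have "q powi (2 * k) * d k = - q * d (k - 1)" if "k > 1" for k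
  proof -
    define n where "n = nat (k - 1)"
    have k: "k = int (Suc n)" "nat k = Suc n" "nat (k - 1) = n" using that by (auto simp: n_def)
    have p: "q powi (2 * k) = q * q ^ (2 * n + 1)"
    proof -
      have "2 * k = int (Suc (2 * n + 1))" using k by simp
      then show ?thesis by (metis power_Suc power_int_of_nat)
    qed
    have "q powi (2 * k) * (T - M k) = q * M (k - 1)" using tail_sum_rec[OF q, of k] that by simp
    then have r: "q powi (2 * k) * M k = q powi (2 * k) * T - q * M (k - 1)" by (simp add: algebra_simps)
    have "q powi (2 * k) * partial_theta (Suc n) = q * (1 - partial_theta n)"
      unfolding p using partial_theta_rec[of n] by (metis add_diff_cancel_left' mult.assoc)
    then have "q powi (2 * k) * d k = - (q * M (k - 1)) + T * (q * (1 - partial_theta n))"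
      unfolding d_def k(2) using r by algebra
    then show ?thesis unfolding d_def k(3) by (simp add: algebra_simps)
  qed
  from bounded_recurrence_zero[OF q, of 1 d, OF this _ b] have "d j = 0" if "j \<ge> 1" for j using that by auto
  then show "k > 0 \<Longrightarrow> M (int k) = T * (1 - partial_theta k)" by (force simp: d_def)
qed

lemma M_0: "2 * M 0 = T" using tail_sum_symmetric[OF q, of 0] by simp

text \<open>The extra term \<open>- q\<close> of the recurrence at \<open>k = 1\<close>, together
  with \<open>M 0 = T / 2\<close>, fixes the normalisation.\<close>

lemma T_phi: "T * phi q = 2"
proof -
  have q0: "q \<noteq> 0" using q by auto
  have "q powi 2 * (T - M 1) = q * M 0 - q" using tail_sum_rec[OF q, of 1] by simp
  moreover have "M 1 = T * (1 - partial_theta 1)" using M_formula[of 1] by simp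
  ultimately have "q * (q * (T * partial_theta 1)) = q * (M 0 - 1)"
    by (simp add: algebra_simps power2_eq_square)
  then have "q * (T * partial_theta 1) = M 0 - 1" using q0 by (simp only: mult_cancel_left simp_thms)
  moreover have "q * partial_theta 1 = 1 - partial_theta 0" using partial_theta_rec[of 0] by (simp add: algebra_simps)
  then have "T * (1 - partial_theta 0) = q * (T * partial_theta 1)" by algebra
  ultimately have "T * (1 - partial_theta 0) = M 0 - 1" by simp
  then have "2 * (T * (1 - partial_theta 0)) = T - 2" using M_0 by algebra
  then show ?thesis unfolding phi_partial_theta by (simp add: algebra_simps)
qed

definition lambert_half :: "nat \<Rightarrow> complex" where
  "lambert_half k = (\<Sum>\<^sub>\<infinity>n::nat. (-1) ^ n * q ^ ((n + 1)\<^sup>2 + 2 * (n + 1) * k) / (1 - q ^ (10 * (n + 1))))"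

text \<open>Interchanging the sums over \<open>i\<close> and \<open>n\<close> leaves a geometric
  series in \<open>i\<close> with ratio \<open>q^(10 (n + 1))\<close>.\<close>

lemma lambert_half_has_sum:
  "((\<lambda>i. 1 - partial_theta (5 * i + k)) has_sum lambert_half k) UNIV"
  "((\<lambda>n. (-1) ^ n * q ^ ((n + 1)\<^sup>2 + 2 * (n + 1) * k) / (1 - q ^ (10 * (n + 1)))) has_sum lambert_half k) UNIV"
proof -
  let ?g = "\<lambda>(n, i). (-1) ^ n * q ^ ((n + 1)\<^sup>2 + 2 * (n + 1) * (5 * i + k))"
  have S: "(\<lambda>(n, i). norm (q ^ n * q ^ i)) summable_on (UNIV \<times> UNIV)"
    using has_sum_imp_summable[OF has_sum_geometric[OF q(2)]]
    by (intro has_sum_times(2)) (simp_all only: summable_on_iff_abs_summable_on_complex)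
  have "(\<lambda>p. norm (?g p)) summable_on (UNIV \<times> UNIV)"
  proof (rule Infinite_Sum.abs_summable_on_comparison_test'[OF S])
    fix p :: "nat \<times> nat"
    obtain n i where p: "p = (n, i)" by force
    have "n + i \<le> (n + 1)\<^sup>2 + 2 * (n + 1) * (5 * i + k)" by (simp add: power2_eq_square)
    then have "norm q ^ ((n + 1)\<^sup>2 + 2 * (n + 1) * (5 * i + k)) \<le> norm q ^ (n + i)"
      using q by (intro power_decreasing) auto
    then show "norm (?g p) \<le> (case p of (n, i) \<Rightarrow> norm (q ^ n * q ^ i))"
      by (simp add: p norm_mult norm_power power_add)
  qed
  then have "?g summable_on (UNIV \<times> UNIV)" by (rule abs_summable_summable)
  then obtain A where A: "(?g has_sum A) (UNIV \<times> UNIV)" using summable_on_def by blast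
  have 1: "((\<lambda>n. (-1) ^ n * q ^ ((n + 1)\<^sup>2 + 2 * (n + 1) * k) / (1 - q ^ (10 * (n + 1)))) has_sum A) UNIV"
  proof (rule has_sum_SigmaD[OF A])
    fix n :: nat
    have "norm (q ^ (10 * (n + 1))) < 1" using q by (simp add: norm_power power_less_one_iff del: power_Suc)
    from has_sum_cmult_right[OF has_sum_geometric[OF this], of "(-1) ^ n * q ^ ((n + 1)\<^sup>2 + 2 * (n + 1) * k)"]
    have "((\<lambda>i. (-1) ^ n * q ^ ((n + 1)\<^sup>2 + 2 * (n + 1) * k) * (q ^ (10 * (n + 1))) ^ i) has_sum
      (-1) ^ n * q ^ ((n + 1)\<^sup>2 + 2 * (n + 1) * k) / (1 - q ^ (10 * (n + 1)))) UNIV" by simp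
    moreover have "(-1) ^ n * q ^ ((n + 1)\<^sup>2 + 2 * (n + 1) * k) * (q ^ (10 * (n + 1))) ^ i = ?g (n, i)" for i
    proof -
      have "(n + 1)\<^sup>2 + 2 * (n + 1) * k + 10 * (n + 1) * i = (n + 1)\<^sup>2 + 2 * (n + 1) * (5 * i + k)"
        by (simp add: distrib_left distrib_right mult.assoc mult.left_commute)
      then show ?thesis by (simp only: prod.case power_mult[symmetric] mult.assoc power_add[symmetric])
    qed
    ultimately show "((\<lambda>i. ?g (n, i)) has_sum (-1) ^ n * q ^ ((n + 1)\<^sup>2 + 2 * (n + 1) * k) / (1 - q ^ (10 * (n + 1)))) UNIV"
      by (simp only:)
  qed
  then have AL: "A = lambert_half k" unfolding lambert_half_def by (rule infsumI[symmetric])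
  then show "((\<lambda>n. (-1) ^ n * q ^ ((n + 1)\<^sup>2 + 2 * (n + 1) * k) / (1 - q ^ (10 * (n + 1)))) has_sum lambert_half k) UNIV"
    using 1 by simp
  have "((\<lambda>(i, n). ?g (n, i)) has_sum A) (UNIV \<times> UNIV)"
    using A by (subst has_sum_reindex_bij_witness[of _ prod.swap prod.swap _ ?g _ A]) auto
  then show "((\<lambda>i. 1 - partial_theta (5 * i + k)) has_sum lambert_half k) UNIV"
    unfolding AL
  proof (rule has_sum_SigmaD)
    fix i :: nat
    show "((\<lambda>n. case (i, n) of (i, n) \<Rightarrow> ?g (n, i)) has_sum (1 - partial_theta (5 * i + k))) UNIV"
      using partial_theta_tail_has_sum[of "5 * i + k"] by simp
  qed
qed

text \<open>Positive indices give \<open>- lambert_half k\<close>. For a negative index the fraction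
  is extended by \<open>q^(10 m)\<close> with \<open>m = - n\<close>, which replaces
  \<open>k\<close> by \<open>5 - k\<close>.\<close>

lemma lambert_lambert_half:
  assumes "k \<le> 5"
  shows "lambert (int k) q = lambert_half (5 - k) - lambert_half k"
proof -
  have q0: "q \<noteq> 0" using q by auto
  let ?t = "\<lambda>n. (-1) powi n * q powi (n\<^sup>2 + 2 * int k * n) / (1 - q powi (10 * n))"
  have "(?t has_sum (- lambert_half k + lambert_half (5 - k))) (range (\<lambda>m. int (m + 1)) \<union> range (\<lambda>m. - int (m + 1)))"
  proof (rule has_sum_Un_disjoint)
    have inj: "inj (\<lambda>m. int (m + 1))" "inj (\<lambda>m. - int (m + 1))" by (auto simp: inj_on_def)
    have "?t (int (m + 1)) = - ((-1) ^ m * q ^ ((m + 1)\<^sup>2 + 2 * (m + 1) * k) / (1 - q ^ (10 * (m + 1))))" for m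
    proof -
      have "(int (m + 1))\<^sup>2 + 2 * int k * int (m + 1) = int ((m + 1)\<^sup>2 + 2 * (m + 1) * k)"
        "10 * int (m + 1) = int (10 * (m + 1))" by (simp_all add: algebra_simps)
      then show ?thesis by (simp only: power_int_of_nat) simp
    qed
    then show "(?t has_sum - lambert_half k) (range (\<lambda>m. int (m + 1)))"
      using has_sum_uminusI[OF lambert_half_has_sum(2)[of k]] by (simp only: has_sum_reindex[OF inj(1)] o_def)
    have "?t (- int (m + 1)) = (-1) ^ m * q ^ ((m + 1)\<^sup>2 + 2 * (m + 1) * (5 - k)) / (1 - q ^ (10 * (m + 1)))" for m
    proof -
      let ?x = "q ^ (10 * (m + 1))"
      have x: "?x \<noteq> 0" "1 - ?x \<noteq> 0"
      proof -
        show "?x \<noteq> 0" using q0 by simp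
        have "norm ?x < 1" using q by (simp add: norm_power power_less_one_iff del: power_Suc)
        then show "1 - ?x \<noteq> 0" by auto
      qed
      have "int (5 - k) = 5 - int k" using assms by simp
      then have "int ((m + 1)\<^sup>2 + 2 * (m + 1) * (5 - k)) = (int m + 1)\<^sup>2 + 2 * (int m + 1) * (5 - int k)"
        by (simp only: of_nat_add of_nat_mult of_nat_power of_nat_1 of_nat_numeral)
      then have "(- int (m + 1))\<^sup>2 + 2 * int k * (- int (m + 1)) = int ((m + 1)\<^sup>2 + 2 * (m + 1) * (5 - k)) - int (10 * (m + 1))"
        by (simp add: power2_eq_square algebra_simps)
      then have 1: "q powi ((- int (m + 1))\<^sup>2 + 2 * int k * (- int (m + 1))) = q ^ ((m + 1)\<^sup>2 + 2 * (m + 1) * (5 - k)) / ?x"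
        using q0 by (simp only: power_int_diff power_int_of_nat simp_thms)
      have "10 * (- int (m + 1)) = - int (10 * (m + 1))" by simp
      then have 2: "q powi (10 * (- int (m + 1))) = 1 / ?x"
        by (simp only: power_int_minus power_int_of_nat inverse_eq_divide)
      have 3: "(-1 :: complex) powi (- int (m + 1)) = - ((-1) ^ m)"
        by (simp only: power_int_minus_one_minus power_int_of_nat) simp
      have "- s * (w / ?x) / (1 - 1 / ?x) = s * w / (1 - ?x)" for s w :: complex
        using x by (simp add: divide_simps) (simp add: algebra_simps)
      then show ?thesis unfolding 1 2 3 .
    qed
    then show "(?t has_sum lambert_half (5 - k)) (range (\<lambda>m. - int (m + 1)))"
      using lambert_half_has_sum(2)[of "5 - k"] by (simp only: has_sum_reindex[OF inj(2)] o_def)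
  qed auto
  moreover have "range (\<lambda>m. int (m + 1)) \<union> range (\<lambda>m. - int (m + 1)) = - {0}"
  proof -
    have "n \<in> range (\<lambda>m. int (m + 1)) \<union> range (\<lambda>m. - int (m + 1))" if "n \<noteq> 0" for n :: int
    proof (cases "n > 0")
      case True then have "n = int (nat (n - 1) + 1)" by simp then show ?thesis by blast
    next
      case False then have "n = - int (nat (- n - 1) + 1)" using that by simp then show ?thesis by blast
    qed
    then show ?thesis by auto
  qed
  ultimately have "(?t has_sum (- lambert_half k + lambert_half (5 - k))) (- {0})" by simp
  from infsumI[OF this] show ?thesis by (simp add: lambert_def)
qed

definition class_gf :: "int \<Rightarrow> complex" where "class_gf s = (\<Sum>\<^sub>\<infinity>i. rank_coeff q (5 * i + s))"

lemma class_gf_has_sum: "((\<lambda>i. rank_coeff q (5 * i + s)) has_sum class_gf s) UNIV"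
proof -
  have inj: "inj (\<lambda>i. 5 * i + s)" by (auto simp: inj_on_def)
  have "rank_coeff q summable_on range (\<lambda>i. 5 * i + s)" using abs_summable_summable[OF rank_coeff_summable[OF q]] .
  then have "(\<lambda>i. rank_coeff q (5 * i + s)) summable_on UNIV" by (simp add: summable_on_reindex[OF inj] o_def)
  then show ?thesis unfolding class_gf_def by (rule has_sum_infsum)
qed

text \<open>The weights 1, 2, 2, ... minus the same weights shifted by one leave 1, 1. Tail sums
  therefore see only sums of adjacent ranks; the classes are separated afterwards by
  symmetry.\<close>

lemma rank_coeff_pair: "rank_coeff q k + rank_coeff q (k + 1) = M k - M (k + 1)"
proof -
  have tail: "(\<lambda>i. 2 * rank_coeff q (k + int i)) sums (M k + rank_coeff q k)" for k
  proof -
    have "((\<lambda>i. tail_weight i * rank_coeff q (k + 1 * int i)) has_sum M k) UNIV"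
      unfolding tail_sum_def using tail_sum_terms_summable[OF q, of 1] by (intro has_sum_infsum) (rule abs_summable_summable, simp)
    moreover have "((\<lambda>i::nat. if i = 0 then rank_coeff q k else 0) has_sum rank_coeff q k) UNIV"
      by (rule has_sum_finite_neutralI[of "{0}"]) auto
    ultimately have "((\<lambda>i. tail_weight i * rank_coeff q (k + 1 * int i) + (if i = 0 then rank_coeff q k else 0)) has_sum (M k + rank_coeff q k)) UNIV"
      by (rule has_sum_add)
    also have "(\<lambda>i. tail_weight i * rank_coeff q (k + 1 * int i) + (if i = 0 then rank_coeff q k else 0)) = (\<lambda>i. 2 * rank_coeff q (k + int i))"
      by (auto simp: tail_weight_def fun_eq_iff)
    finally have h: "((\<lambda>i. 2 * rank_coeff q (k + int i)) has_sum (M k + rank_coeff q k)) UNIV" .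
    from h show ?thesis by (rule has_sum_imp_sums)
  qed
  have "(\<lambda>i. 2 * rank_coeff q (k + int (Suc i))) sums (M k + rank_coeff q k - 2 * rank_coeff q (k + int 0))"
    by (rule iffD2[OF sums_Suc_iff]) (use tail[of k] in \<open>simp add: add.commute\<close>)
  moreover have "k + int (Suc i) = k + 1 + int i" for i by simp
  ultimately have "(\<lambda>i. 2 * rank_coeff q (k + 1 + int i)) sums (M k - rank_coeff q k)" by (simp only:) simp
  from sums_unique2[OF this tail[of "k + 1"]] show ?thesis by (simp add: algebra_simps)
qed

text \<open>The antisymmetric part changes sign at each step and is 0 at
  \<open>k = 0\<close>.\<close>

lemma rank_coeff_symmetric: "rank_coeff q (- k) = rank_coeff q k"
proof -
  have step: "rank_coeff q (k + 1) - rank_coeff q (- (k + 1)) = - (rank_coeff q k - rank_coeff q (- k))" for k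
  proof -
    have "rank_coeff q (- (k + 1)) + rank_coeff q (- k) = M (- (k + 1)) - M (- k)" using rank_coeff_pair[of "- (k + 1)"] by simp
    then show ?thesis
      using rank_coeff_pair[of k] tail_sum_symmetric[OF q, of k] tail_sum_symmetric[OF q, of "k + 1"] by algebra
  qed
  have nat: "rank_coeff q (int n) - rank_coeff q (- int n) = 0" for n
  proof (induction n)
    case (Suc n)
    then show ?case using step[of "int n"] by (simp add: add.commute)
  qed simp
  show ?thesis
  proof (cases "k \<ge> 0")
    case True then show ?thesis using nat[of "nat k"] by simp
  next
    case False then show ?thesis using nat[of "nat (- k)"] by simp
  qed
qed

lemma class_gf_3: "class_gf 3 = class_gf 2"
proof -
  have "((\<lambda>i. rank_coeff q (5 * i + 3)) has_sum class_gf 2) UNIV"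
  proof (subst has_sum_reindex_bij_witness[of _ "\<lambda>i. - i - 1" "\<lambda>i. - i - 1" UNIV "\<lambda>i. rank_coeff q (5 * i + 2)" _ "class_gf 2"])
    show "rank_coeff q (5 * (- i - 1) + 2) = rank_coeff q (5 * i + 3)" for i
      using rank_coeff_symmetric[of "5 * i + 3"] by (simp add: algebra_simps)
  qed (use class_gf_has_sum[of 2] in auto)
  from has_sum_unique[OF class_gf_has_sum this] show ?thesis .
qed

text \<open>The indices \<open>i >= 0\<close> yield \<open>A\<close>; for \<open>i = - j - 1\<close>
  the reflection of the tail sums turns the arguments into \<open>5 j + 4 - s\<close> and
  \<open>5 j + 5 - s\<close>, which yields \<open>B\<close>.\<close>

lemma class_gf_pair:
  assumes A: "((\<lambda>i. M (5 * int i + s) - M (5 * int i + t)) has_sum A) UNIV"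
    and B: "((\<lambda>j. M (5 * int j + u) - M (5 * int j + v)) has_sum B) UNIV"
    and t: "t = s + 1" "u = 4 - s" "v = 5 - s"
  shows "class_gf s + class_gf t = A + B"
  unfolding t
proof -
  note assms = A[unfolded t] B[unfolded t]
  have "((\<lambda>i. rank_coeff q (5 * i + s) + rank_coeff q (5 * i + (s + 1))) has_sum (class_gf s + class_gf (s + 1))) UNIV"
    by (intro has_sum_add class_gf_has_sum)
  moreover have "((\<lambda>i. rank_coeff q (5 * i + s) + rank_coeff q (5 * i + (s + 1))) has_sum (A + B)) UNIV"
  proof (rule has_sum_int_split)
    have e: "rank_coeff q (5 * i + s) + rank_coeff q (5 * i + (s + 1)) = M (5 * i + s) - M (5 * i + (s + 1))" for i
      using rank_coeff_pair[of "5 * i + s"] by (simp add: add.assoc)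
    show "((\<lambda>i. rank_coeff q (5 * int i + s) + rank_coeff q (5 * int i + (s + 1))) has_sum A) UNIV"
      unfolding e by (rule assms(1))
    have "M (5 * (- int j - 1) + s) - M (5 * (- int j - 1) + (s + 1)) = M (5 * int j + (4 - s)) - M (5 * int j + (5 - s))" for j
      using tail_sum_symmetric[OF q, of "5 * int j + (5 - s)"] tail_sum_symmetric[OF q, of "5 * int j + (4 - s)"]
      by (simp add: algebra_simps)
    then show "((\<lambda>j. rank_coeff q (5 * (- int j - 1) + s) + rank_coeff q (5 * (- int j - 1) + (s + 1))) has_sum B) UNIV"
      unfolding e using assms(2) by simp
  qed
  ultimately show "class_gf s + class_gf (s + 1) = A + B" by (rule has_sum_unique)
qed

lemma M_lambert_half: "k > 0 \<Longrightarrow> ((\<lambda>i. M (5 * int i + int k)) has_sum T * lambert_half k) UNIV"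
proof -
  assume k: "k > 0"
  have "M (5 * int i + int k) = T * (1 - partial_theta (5 * i + k))" for i
    using M_formula[of "5 * i + k"] k by simp
  then show ?thesis using has_sum_cmult_right[OF lambert_half_has_sum(1)[of k], of T] by simp
qed

lemma M_lambert_half_0: "((\<lambda>i. M (5 * int i)) has_sum (M 0 + T * lambert_half 5)) UNIV"
proof -
  have "((\<lambda>i. M (5 * int (Suc i))) has_sum T * lambert_half 5) UNIV"
    using M_lambert_half[of 5] by (simp add: algebra_simps)
  from has_sum_Suc[OF this] show ?thesis by simp
qed

lemma has_sum_diff':
  fixes f g :: "nat \<Rightarrow> complex"
  shows "(f has_sum a) A \<Longrightarrow> (g has_sum b) A \<Longrightarrow> ((\<lambda>x. f x - g x) has_sum (a - b)) A"
  unfolding diff_conv_add_uminus by (intro has_sum_add has_sum_uminusI)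

lemma class_gf_12: "class_gf 1 - class_gf 2 = T * (lambert_half 1 - 3 * lambert_half 2 + 3 * lambert_half 3 - lambert_half 4)"
  and class_gf_02: "class_gf 0 - class_gf 2 = T / 2 + T * (- 2 * lambert_half 1 + lambert_half 2 - lambert_half 3 + 2 * lambert_half 4)"
proof -
  have 1: "class_gf 1 + class_gf 2 = (T * lambert_half 1 - T * lambert_half 2) + (T * lambert_half 3 - T * lambert_half 4)"
    by (rule class_gf_pair; (use has_sum_diff'[OF M_lambert_half[of 1] M_lambert_half[of 2]] has_sum_diff'[OF M_lambert_half[of 3] M_lambert_half[of 4]] in simp)?)
  have 2: "class_gf 2 + class_gf 3 = (T * lambert_half 2 - T * lambert_half 3) + (T * lambert_half 2 - T * lambert_half 3)"
    by (rule class_gf_pair; (use has_sum_diff'[OF M_lambert_half[of 2] M_lambert_half[of 3]] has_sum_diff'[OF M_lambert_half[of 2] M_lambert_half[of 3]] in simp)?)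
  have 0: "class_gf 0 + class_gf 1 = (M 0 + T * lambert_half 5 - T * lambert_half 1) + (T * lambert_half 4 - T * lambert_half 5)"
    by (rule class_gf_pair; (use has_sum_diff'[OF M_lambert_half_0 M_lambert_half[of 1]] has_sum_diff'[OF M_lambert_half[of 4] M_lambert_half[of 5]] in simp)?)
  \<comment> \<open>Class 3 equals class 2, so the pair (2, 3) determines class 2; then the pair (1,
    2) gives class 1 and the pair (0, 1) gives class 0.\<close>
  have 22: "2 * class_gf 2 = 2 * (T * lambert_half 2 - T * lambert_half 3)" using 2 class_gf_3 by simp
  then have n2: "class_gf 2 = T * lambert_half 2 - T * lambert_half 3" by (simp only: mult_cancel_left) simp
  then have n1: "class_gf 1 = T * lambert_half 1 - T * lambert_half 2 + (T * lambert_half 3 - T * lambert_half 4) - (T * lambert_half 2 - T * lambert_half 3)"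
    using 1 by (metis add_diff_cancel_right')
  then show "class_gf 1 - class_gf 2 = T * (lambert_half 1 - 3 * lambert_half 2 + 3 * lambert_half 3 - lambert_half 4)"
    using n2 by algebra
  have "M 0 = T / 2" using M_0 by (simp add: field_simps)
  then have "class_gf 0 = T / 2 - T * lambert_half 1 + T * lambert_half 4 - class_gf 1"
    using 0 by (simp add: algebra_simps)
  then show "class_gf 0 - class_gf 2 = T / 2 + T * (- 2 * lambert_half 1 + lambert_half 2 - lambert_half 3 + 2 * lambert_half 4)"
    using n1 n2 by algebra
qed

theorem class_gf_lambert_12: "(class_gf 1 - class_gf 2) * phi q = - 2 * lambert 1 q + 6 * lambert 2 q"
proof -
  have "(class_gf 1 - class_gf 2) * phi q = (T * phi q) * (lambert_half 1 - 3 * lambert_half 2 + 3 * lambert_half 3 - lambert_half 4)"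
    unfolding class_gf_12 by simp
  then show ?thesis using lambert_lambert_half[of 1] lambert_lambert_half[of 2] unfolding T_phi by (simp; algebra?)
qed

theorem class_gf_lambert_02: "(class_gf 0 - class_gf 2) * phi q = 1 + 4 * lambert 1 q - 2 * lambert 2 q"
proof -
  have "(class_gf 0 - class_gf 2) * phi q = (T * phi q) / 2 + (T * phi q) * (- 2 * lambert_half 1 + lambert_half 2 - lambert_half 3 + 2 * lambert_half 4)"
    unfolding class_gf_02 by (simp add: algebra_simps)
  then show ?thesis using lambert_lambert_half[of 1] lambert_lambert_half[of 2] unfolding T_phi by (simp; algebra?)
qed

text \<open>Finiteness of the set of overpartitions of \<open>n\<close>, required for
  \<open>card\<close>, is obtained from convergence of the generating function.\<close>

lemma summable_const_imp_finite:
  assumes "(\<lambda>_. c :: complex) summable_on A" "c \<noteq> 0"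
  shows "finite A"
proof (rule ccontr)
  assume inf: "infinite A"
  have s: "(\<lambda>_. norm c) summable_on A" using assms(1) by (simp only: summable_on_iff_abs_summable_on_complex)
  obtain n :: nat where n: "infsum (\<lambda>_. norm c) A / norm c < real n" using reals_Archimedean2 by blast
  obtain F where F: "F \<subseteq> A" "card F = n" "finite F" using infinite_arbitrarily_large[OF inf] by blast
  have "(\<Sum>_\<in>F. norm c) \<le> infsum (\<lambda>_. norm c) A"
    by (rule finite_sum_le_infsum[OF s F(3) F(1)]) auto
  then show False using F(2) n assms(2) by (simp add: field_simps)
qed

text \<open>The correction removes the empty overpartition, which \<open>class_gf\<close> counts
  with rank 0.\<close>

lemma N2_bar_has_sum: "((\<lambda>n. of_nat (N2_bar s 5 n) * q ^ n) has_sum (class_gf s - of_bool (5 dvd s))) UNIV"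
proof -
  have q0: "q \<noteq> 0" using q by auto
  let ?C = "{\<pi> \<in> all_overpartitions. [rank0 \<pi> = s] (mod 5)}"
  let ?D = "{\<pi> \<in> nonempty_overpartitions. [M2_rank \<pi> = s] (mod 5)}"
  let ?f = "\<lambda>\<pi>. q ^ part_sum \<pi>"
  have sOP: "?f summable_on A" if "A \<subseteq> all_overpartitions" for A
    using summable_on_subset_banach[OF has_sum_imp_summable[OF all_overpartitions_has_sum[OF q one_in[OF q]]] that] by simp
  have "((\<lambda>i. rank_coeff q (5 * i + s)) has_sum infsum ?f ?C) UNIV"
  proof (rule has_sum_SigmaD)
    have "(?f has_sum infsum ?f ?C) ?C" by (intro has_sum_infsum sOP) auto
    also have "?this \<longleftrightarrow> ((\<lambda>(i, \<pi>). ?f \<pi>) has_sum infsum ?f ?C) (Sigma UNIV (\<lambda>i. rank_fiber (5 * i + s)))"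
      by (rule has_sum_reindex_bij_witness[of _ snd "\<lambda>\<pi>. ((rank0 \<pi> - s) div 5, \<pi>)"])
        (auto simp: rank_fiber_def cong_iff_dvd_diff cong_def mod_eq_dvd_iff)
    finally show "((\<lambda>(i, \<pi>). ?f \<pi>) has_sum infsum ?f ?C) (Sigma UNIV (\<lambda>i. rank_fiber (5 * i + s)))" .
    show "((\<lambda>\<pi>. case (i, \<pi>) of (i, \<pi>) \<Rightarrow> ?f \<pi>) has_sum rank_coeff q (5 * i + s)) (rank_fiber (5 * i + s))" for i
      unfolding rank_coeff_def using rank_fiber_summable[OF q] by simp
  qed
  from has_sum_unique[OF class_gf_has_sum this] have N: "class_gf s = infsum ?f ?C" .
  have c: "[0 = s] (mod 5) \<longleftrightarrow> 5 dvd s" by (metis cong_0_iff cong_sym_eq)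
  have "?C = (if 5 dvd s then insert ({#}, {}) ?D else ?D)"
  proof (rule set_eqI)
    fix \<pi> :: overpartition
    have n: "fst \<pi> \<noteq> {#}" if "\<pi> \<in> nonempty_overpartitions" using that by (simp add: nonempty_overpartitions_def)
    show "\<pi> \<in> ?C \<longleftrightarrow> \<pi> \<in> (if 5 dvd s then insert ({#}, {}) ?D else ?D)"
    proof (cases "\<pi> = ({#}, {})")
      case True
      then have "\<pi> \<notin> nonempty_overpartitions" "\<pi> \<in> all_overpartitions" "rank0 \<pi> = 0" using n by (auto simp: all_overpartitions_def rank0_def)
      then show ?thesis using True c by simp
    next
      case False
      then have "\<pi> \<in> all_overpartitions \<longleftrightarrow> \<pi> \<in> nonempty_overpartitions" by (simp add: all_overpartitions_def)
      moreover have "rank0 \<pi> = M2_rank \<pi>" if "\<pi> \<in> nonempty_overpartitions" using n[OF that] by (simp add: rank0_def)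
      ultimately show ?thesis using False by auto
    qed
  qed
  moreover have "infsum ?f (insert ({#}, {}) ?D) = 1 + infsum ?f ?D"
    using sOP[of ?D] by (subst infsum_insert) (auto simp: all_overpartitions_def nonempty_overpartitions_def part_sum_def)
  ultimately have D: "infsum ?f ?D = class_gf s - of_bool (5 dvd s)" unfolding N by simp
  have "((\<lambda>n. of_nat (N2_bar s 5 n) * q ^ n) has_sum infsum ?f ?D) UNIV"
  proof (rule has_sum_SigmaD)
    have "(?f has_sum infsum ?f ?D) ?D" by (intro has_sum_infsum sOP) (auto simp: all_overpartitions_def)
    also have "?this \<longleftrightarrow> ((\<lambda>(n, \<pi>). ?f \<pi>) has_sum infsum ?f ?D) (Sigma UNIV (\<lambda>n. {\<pi> \<in> ?D. part_sum \<pi> = n}))"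
      by (rule has_sum_reindex_bij_witness[of _ snd "\<lambda>\<pi>. (part_sum \<pi>, \<pi>)"]) auto
    finally show "((\<lambda>(n, \<pi>). ?f \<pi>) has_sum infsum ?f ?D) (Sigma UNIV (\<lambda>n. {\<pi> \<in> ?D. part_sum \<pi> = n}))" .
    fix n
    let ?E = "{\<pi> \<in> ?D. part_sum \<pi> = n}"
    have "?f summable_on ?E" by (rule sOP) (auto simp: all_overpartitions_def)
    also have "?this \<longleftrightarrow> (\<lambda>_. q ^ n) summable_on ?E" by (rule summable_on_cong) auto
    finally have fin: "finite ?E" by (rule summable_const_imp_finite) (use q0 in simp)
    have "?E = {\<pi>. overpartition_of n \<pi> \<and> fst \<pi> \<noteq> {#} \<and> [M2_rank \<pi> = s] (mod int 5)}"
      by (auto simp: nonempty_overpartitions_def overpartition_of_def part_sum_def)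
    then have "N2_bar s 5 n = card ?E" by (simp add: N2_bar_def)
    then show "((\<lambda>\<pi>. case (n, \<pi>) of (n, \<pi>) \<Rightarrow> ?f \<pi>) has_sum of_nat (N2_bar s 5 n) * q ^ n) ?E"
      using fin by (intro has_sum_finiteI) auto
  qed
  then show ?thesis unfolding D .
qed

end

section \<open>Theta quotient identities\<close>

text \<open>The theta quotients of the theorem in abstract letters: \<open>a1\<close>, ...,
  \<open>a4\<close> stand for the pairs \<open>(q^i, q^(10-i); q^10)\<close>, \<open>a5\<close> for
  \<open>(q^5; q^10)\<close> and \<open>E\<close> for \<open>(q^10; q^10)\<close>. Then
  \<open>(q; q)\<close> is \<open>a1 a2 a3 a4 a5 E\<close>, \<open>(q; q^2)\<close> is
  \<open>a1 a3 a5\<close>, \<open>(q^2; q^2)\<close> is \<open>a2 a4 E\<close> and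
  \<open>(q^5; q^5)\<close> is \<open>a5 E\<close>. Bilateral sums and the constant -1 are kept
  apart.\<close>

definition theta_part_12_0 :: "complex \<Rightarrow> complex \<Rightarrow> complex \<Rightarrow> complex \<Rightarrow> complex \<Rightarrow> complex \<Rightarrow> complex \<Rightarrow> complex" where
  "theta_part_12_0 a1 a2 a3 a4 a5 E q = 10 * (q ^ 2 * E ^ 4 * (a1 * a2) / ((a1 * a2 * a3 * a4 * a5 * E) ^ 3 * (a1 * a3 * a5))) + 2 * (q * (a5 * E) / ((a1 * a3 * a5) ^ 5 * (a3 * a4)))"
definition theta_part_12_1 :: "complex \<Rightarrow> complex \<Rightarrow> complex \<Rightarrow> complex \<Rightarrow> complex \<Rightarrow> complex \<Rightarrow> complex \<Rightarrow> complex" where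
  "theta_part_12_1 a1 a2 a3 a4 a5 E q = 4 * (q * E ^ 2 / ((a1 * a3 * a5) ^ 5 * a4 * (a5 * E))) + 20 * (q ^ 3 * E ^ 7 * a1 ^ 2 * a2 ^ 3 / ((a1 * a2 * a3 * a4 * a5 * E) ^ 4 * (a5 * E) ^ 2))"
definition theta_part_12_2 :: "complex \<Rightarrow> complex \<Rightarrow> complex \<Rightarrow> complex \<Rightarrow> complex \<Rightarrow> complex \<Rightarrow> complex \<Rightarrow> complex" where
  "theta_part_12_2 a1 a2 a3 a4 a5 E q = 10 * (q * E ^ 3 / ((a1 * a2 * a3 * a4 * a5 * E) ^ 2 * a3 ^ 3 * (a1 * a2)))"
definition theta_part_12_3 :: "complex \<Rightarrow> complex \<Rightarrow> complex \<Rightarrow> complex \<Rightarrow> complex \<Rightarrow> complex \<Rightarrow> complex \<Rightarrow> complex" where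
  "theta_part_12_3 a1 a2 a3 a4 a5 E q = 10 * (E ^ 3 / ((a1 * a2 * a3 * a4 * a5 * E) ^ 2 * (a3 * a4) * a1 ^ 3)) + (-8) * ((a5 * E) / ((a1 * a3 * a5) ^ 5 * (a2 * a3)))"
definition theta_part_12_4 :: "complex \<Rightarrow> complex \<Rightarrow> complex \<Rightarrow> complex \<Rightarrow> complex \<Rightarrow> complex \<Rightarrow> complex \<Rightarrow> complex" where
  "theta_part_12_4 a1 a2 a3 a4 a5 E q = 4 * ((a2 * a4 * E) / ((a1 * a3 * a5) ^ 4 * (a2 * a3) ^ 3))"
definition theta_part_02_0 :: "complex \<Rightarrow> complex \<Rightarrow> complex \<Rightarrow> complex \<Rightarrow> complex \<Rightarrow> complex \<Rightarrow> complex \<Rightarrow> complex" where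
  "theta_part_02_0 a1 a2 a3 a4 a5 E q = 1 * ((a5 * E) ^ 6 / ((a1 * a3 * a5) ^ 6 * (a3 * a4) * E ^ 5)) + 1 * (q ^ 2 * (a1 * a2 * a3 * a4 * a5 * E) * E / ((a3 * a4) ^ 3 * (a5 * E))) + 4 * (q * (a5 * E) ^ 2 * a1 / ((a1 * a3 * a5) ^ 6 * (a4 * E))) + (-10) * (q ^ 2 * E ^ 3 / ((a1 * a2 * a3 * a4 * a5 * E) ^ 2 * a2 * a3 ^ 4))"
definition theta_part_02_1 :: "complex \<Rightarrow> complex \<Rightarrow> complex \<Rightarrow> complex \<Rightarrow> complex \<Rightarrow> complex \<Rightarrow> complex \<Rightarrow> complex" where
  "theta_part_02_1 a1 a2 a3 a4 a5 E q = 2 * ((a5 * E) ^ 4 / ((a1 * a3 * a5) ^ 6 * a4 * E ^ 3)) + 2 * (q ^ 2 * (a1 * a2 * a3 * a4 * a5 * E) * E ^ 3 / (a3 ^ 2 * a4 ^ 3 * (a5 * E) ^ 3))"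
definition theta_part_02_2 :: "complex \<Rightarrow> complex \<Rightarrow> complex \<Rightarrow> complex \<Rightarrow> complex \<Rightarrow> complex \<Rightarrow> complex \<Rightarrow> complex" where
  "theta_part_02_2 a1 a2 a3 a4 a5 E q = 4 * (a3 * (a5 * E) ^ 2 / ((a1 * a3 * a5) ^ 6 * (a4 * E))) + (-10) * (q * E ^ 3 / ((a1 * a2 * a3 * a4 * a5 * E) ^ 2 * a3 ^ 3 * (a1 * a2)))"
definition theta_part_02_3 :: "complex \<Rightarrow> complex \<Rightarrow> complex \<Rightarrow> complex \<Rightarrow> complex \<Rightarrow> complex \<Rightarrow> complex \<Rightarrow> complex" where
  "theta_part_02_3 a1 a2 a3 a4 a5 E q = 4 * ((a5 * E) / ((a1 * a3 * a5) ^ 5 * (a2 * a3)))"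
definition theta_part_02_4 :: "complex \<Rightarrow> complex \<Rightarrow> complex \<Rightarrow> complex \<Rightarrow> complex \<Rightarrow> complex \<Rightarrow> complex \<Rightarrow> complex" where
  "theta_part_02_4 a1 a2 a3 a4 a5 E q = (-10) * (E ^ 3 * (a5 * E) * a4 / (a1 * (a1 * a2 * a3 * a4 * a5 * E) ^ 3 * a3)) + (-2) * (E * (a4 / (a2 * a3)) / (q * (a2 / (a1 * a4)) * (a1 * a2))) + 2 * ((a5 * E) ^ 2 * a2 ^ 5 * E ^ 2 / (q * (a1 * a3 * a5) ^ 4 * a1 ^ 4 * (a2 * a4 * E) ^ 3))"

context
  fixes a1 a2 a3 a4 a5 E q :: complex
  assumes nonzero: "a1 \<noteq> 0" "a2 \<noteq> 0" "a3 \<noteq> 0" "a4 \<noteq> 0" "a5 \<noteq> 0" "E \<noteq> 0" "q \<noteq> 0"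
    and rel1: "a2\<^sup>2 * a3 * a5\<^sup>2 = a1 * a3 * a4\<^sup>2 + q * a1\<^sup>2 * a2 * a4"
    and rel2: "a2 * a3\<^sup>2 * a4 = a1 * a4\<^sup>2 * a5\<^sup>2 + q * a1 * a2\<^sup>2 * a3"
    and rel3: "a2 ^ 3 * a4 = a1 * a3 ^ 3 + q * a1 ^ 3 * a5\<^sup>2"
    and rel4: "(a1\<^sup>2 * a2 * a3\<^sup>2 * a4 * a5\<^sup>2)\<^sup>2 = a5 ^ 4 - 4 * q * a1 * a3"
begin

abbreviation "s12_0 \<equiv> theta_part_12_0 a1 a2 a3 a4 a5 E q"
abbreviation "s12_1 \<equiv> theta_part_12_1 a1 a2 a3 a4 a5 E q"
abbreviation "s12_2 \<equiv> theta_part_12_2 a1 a2 a3 a4 a5 E q"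
abbreviation "s12_3 \<equiv> theta_part_12_3 a1 a2 a3 a4 a5 E q"
abbreviation "s12_4 \<equiv> theta_part_12_4 a1 a2 a3 a4 a5 E q"
abbreviation "s02_0 \<equiv> theta_part_02_0 a1 a2 a3 a4 a5 E q"
abbreviation "s02_1 \<equiv> theta_part_02_1 a1 a2 a3 a4 a5 E q"
abbreviation "s02_2 \<equiv> theta_part_02_2 a1 a2 a3 a4 a5 E q"
abbreviation "s02_3 \<equiv> theta_part_02_3 a1 a2 a3 a4 a5 E q"
abbreviation "s02_4 \<equiv> theta_part_02_4 a1 a2 a3 a4 a5 E q"

text \<open>The four relations say that \<open>w1\<close>, \<open>w2\<close>, \<open>w3\<close>, \<open>h\<close> are polynomials in \<open>u\<close>. In every circulant
  equation below, all terms are monomials in \<open>u\<close>, \<open>w1\<close>, \<open>w2\<close>, \<open>w3\<close>, \<open>h\<close> up to a common factor.\<close>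

definition "u = q * a1 * a2 / (a3 * a4)"
definition "w1 = a2 ^ 2 * a5 ^ 2 / (a1 * a4 ^ 2)"
definition "w2 = a1 * a4 * a5 ^ 2 / (a2 * a3 ^ 2)"
definition "w3 = a2 ^ 3 * a4 / (a1 * a3 ^ 3)"
definition "h = a1 ^ 4 * a2 ^ 3 * a3 ^ 2 * a4 * a5 ^ 4"

lemma w1: "w1 = 1 + u"
proof -
  have "a2\<^sup>2 * a5\<^sup>2 * (a3 * a4) = (a3 * a4 + q * a1 * a2) * (a1 * a4\<^sup>2)" using rel1 by algebra
  then show ?thesis using nonzero by (simp add: w1_def u_def divide_simps)
qed

lemma w2: "w2 = 1 - u"
proof -
  have "a1 * a4 * a5\<^sup>2 * (a3 * a4) = (a3 * a4 - q * a1 * a2) * (a2 * a3\<^sup>2)" using rel2 by algebra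
  then show ?thesis using nonzero by (simp add: w2_def u_def divide_simps)
qed

text \<open>\<open>rel3\<close> gives \<open>w3 = 1 + u w2\<close>, and \<open>w2\<close> is already
  linear in \<open>u\<close>.\<close>

lemma w3: "w3 = 1 + u - u\<^sup>2"
proof -
  have "w3 = 1 + u * w2"
    unfolding w3_def u_def w2_def unfolding rel3 by (simp add: divide_simps nonzero) algebra
  then show ?thesis unfolding w2 by algebra
qed

text \<open>\<open>h\<close> is the left side of \<open>rel4\<close>, the square of
  \<open>phi q / E\<close>, made homogeneous by a factor \<open>a2 / (a3^2 a4)\<close>;
  \<open>rel4\<close> then reads \<open>h = w1 w2 - 4 u\<close>.\<close>

lemma h: "h = 1 - 4 * u - u\<^sup>2"
proof -
  have "h * (a4 * a3\<^sup>2) = a2 * (a5 ^ 4 - 4 * q * a1 * a3)" unfolding h_def rel4[symmetric] by algebra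
  then have "h = a2 * (a5 ^ 4 - 4 * q * a1 * a3) / (a4 * a3\<^sup>2)" using nonzero by (simp add: divide_simps)
  also have "\<dots> = w1 * w2 - 4 * u" unfolding w1_def w2_def u_def by (simp add: divide_simps nonzero) algebra
  finally show ?thesis unfolding w1 w2 by algebra
qed

text \<open>Coefficient of \<open>p^0\<close> in \<open>phi p / E\<close> times the sum of
  \<open>p^d s12_d\<close>: products reaching \<open>p^5\<close> wrap around with a factor
  \<open>q\<close>. The right side collects the theta quotients free of \<open>p\<close> in the
  Lambert series. The other nine equations arise likewise; those for \<open>p^1\<close> and
  \<open>p^4\<close> have right side 0.\<close>

lemma circulant_12_0:
  "(a5 ^ 2 * s12_0) - 2 * (q * a3 * s12_4) + 2 * (q * a1 * s12_1) = (-2) * (E * q ^ 2 * a2 ^ 2 / a4 ^ 3) + (-2) * (E * q ^ 2 * a1 / (a4 * a5 ^ 2)) + (-6) * (E * q * a3 / (a2 * a5 ^ 2))"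
proof -
  \<comment> \<open>The common monomial of all terms; the identities in \<open>f\<close> only
    compare exponents. After cancelling it a polynomial identity in \<open>u\<close> is
    left.\<close>
  let ?K = "(E  *  q) / (a1 ^ 4  *  a2 ^ 4  *  a3  *  a4  *  a5 ^ 6)"
  have f: "a5 ^ 2 * (q ^ 2 * E ^ 4 * (a1 * a2) / ((a1 * a2 * a3 * a4 * a5 * E) ^ 3 * (a1 * a3 * a5))) = ?K * (u * w1 * w2)"
    "a5 ^ 2 * (q * (a5 * E) / ((a1 * a3 * a5) ^ 5 * (a3 * a4))) = ?K * (w1 * w2 * w3)"
    "q * a3 * ((a2 * a4 * E) / ((a1 * a3 * a5) ^ 4 * (a2 * a3) ^ 3)) = ?K * (w2 * w3)"
    "q * a1 * (q * E ^ 2 / ((a1 * a3 * a5) ^ 5 * a4 * (a5 * E))) = ?K * (u * w3)"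
    "q * a1 * (q ^ 3 * E ^ 7 * a1 ^ 2 * a2 ^ 3 / ((a1 * a2 * a3 * a4 * a5 * E) ^ 4 * (a5 * E) ^ 2)) = ?K * (u ^ 3)"
    "E * q ^ 2 * a2 ^ 2 / a4 ^ 3 = ?K * (u * w1 * h)"
    "E * q ^ 2 * a1 / (a4 * a5 ^ 2) = ?K * (u * h)"
    "E * q * a3 / (a2 * a5 ^ 2) = ?K * (h)"
    unfolding u_def w1_def w2_def w3_def h_def by (simp add: divide_simps nonzero; algebra?)+
  have "(m0 * (10 * x0 + 2 * x1)) - 2 * (m1 * (4 * x2)) + 2 * (m2 * (4 * x3 + 20 * x4))
    = 10 * (m0 * x0) + 2 * (m0 * x1) + (-8) * (m1 * x2) + 8 * (m2 * x3) + 40 * (m2 * x4)" for m0 m1 m2 x0 x1 x2 x3 x4 :: complex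
    by (simp add: algebra_simps)
  note expand = this
  have "k * (10 * (u * w1 * w2) + 2 * (w1 * w2 * w3) + (-8) * (w2 * w3) + 8 * (u * w3) + 40 * (u ^ 3)) = k * ((-2) * (u * w1 * h) + (-2) * (u * h) + (-6) * (h))" for k :: complex
    unfolding w1 w2 w3 h by algebra
  from this[of ?K] show ?thesis unfolding theta_part_12_0_def theta_part_12_4_def theta_part_12_1_def expand f by (simp only: distrib_left mult.left_commute[of ?K])
qed

lemma circulant_12_1:
  "(a5 ^ 2 * s12_1) - 2 * (a3 * s12_0) + 2 * (q * a1 * s12_2) = 0"
proof -
  let ?K = "(E  *  q) / (a1 ^ 4  *  a2 ^ 3  *  a3 ^ 2  *  a4 ^ 2  *  a5 ^ 4)"
  have f: "a5 ^ 2 * (q * E ^ 2 / ((a1 * a3 * a5) ^ 5 * a4 * (a5 * E))) = ?K * (w3)"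
    "a5 ^ 2 * (q ^ 3 * E ^ 7 * a1 ^ 2 * a2 ^ 3 / ((a1 * a2 * a3 * a4 * a5 * E) ^ 4 * (a5 * E) ^ 2)) = ?K * (u ^ 2)"
    "a3 * (q ^ 2 * E ^ 4 * (a1 * a2) / ((a1 * a2 * a3 * a4 * a5 * E) ^ 3 * (a1 * a3 * a5))) = ?K * (u)"
    "a3 * (q * (a5 * E) / ((a1 * a3 * a5) ^ 5 * (a3 * a4))) = ?K * (w3)"
    "q * a1 * (q * E ^ 3 / ((a1 * a2 * a3 * a4 * a5 * E) ^ 2 * a3 ^ 3 * (a1 * a2))) = ?K * (u * w2)"
    unfolding u_def w1_def w2_def w3_def h_def by (simp add: divide_simps nonzero; algebra?)+
  have "(m0 * (4 * x0 + 20 * x1)) - 2 * (m1 * (10 * x2 + 2 * x3)) + 2 * (m2 * (10 * x4))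
    = 4 * (m0 * x0) + 20 * (m0 * x1) + (-20) * (m1 * x2) + (-4) * (m1 * x3) + 20 * (m2 * x4)" for m0 m1 m2 x0 x1 x2 x3 x4 :: complex
    by (simp add: algebra_simps)
  note expand = this
  have "k * (4 * (w3) + 20 * (u ^ 2) + (-20) * (u) + (-4) * (w3) + 20 * (u * w2)) = 0" for k :: complex
    unfolding w1 w2 w3 h by algebra
  from this[of ?K] show ?thesis unfolding theta_part_12_1_def theta_part_12_0_def theta_part_12_2_def expand f by (simp only: distrib_left mult.left_commute[of ?K])
qed

lemma circulant_12_2:
  "(a5 ^ 2 * s12_2) - 2 * (a3 * s12_1) + 2 * (q * a1 * s12_3) = 6 * (E * q * a3 / (a4 * a5 ^ 2)) + 6 * (E * q ^ 2 * (a1 * a2) / (a4 ^ 2 * a5 ^ 2))"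
proof -
  let ?K = "(E  *  q) / (a1 ^ 4  *  a2 ^ 3  *  a3  *  a4 ^ 2  *  a5 ^ 6)"
  have f: "a5 ^ 2 * (q * E ^ 3 / ((a1 * a2 * a3 * a4 * a5 * E) ^ 2 * a3 ^ 3 * (a1 * a2))) = ?K * (w1 * w2 ^ 2)"
    "a3 * (q * E ^ 2 / ((a1 * a3 * a5) ^ 5 * a4 * (a5 * E))) = ?K * (w3)"
    "a3 * (q ^ 3 * E ^ 7 * a1 ^ 2 * a2 ^ 3 / ((a1 * a2 * a3 * a4 * a5 * E) ^ 4 * (a5 * E) ^ 2)) = ?K * (u ^ 2)"
    "q * a1 * (E ^ 3 / ((a1 * a2 * a3 * a4 * a5 * E) ^ 2 * (a3 * a4) * a1 ^ 3)) = ?K * (w1 * w2)"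
    "q * a1 * ((a5 * E) / ((a1 * a3 * a5) ^ 5 * (a2 * a3))) = ?K * (w2 * w3)"
    "E * q * a3 / (a4 * a5 ^ 2) = ?K * (h)"
    "E * q ^ 2 * (a1 * a2) / (a4 ^ 2 * a5 ^ 2) = ?K * (u * h)"
    unfolding u_def w1_def w2_def w3_def h_def by (simp add: divide_simps nonzero; algebra?)+
  have "(m0 * (10 * x0)) - 2 * (m1 * (4 * x1 + 20 * x2)) + 2 * (m2 * (10 * x3 + (-8) * x4))
    = 10 * (m0 * x0) + (-8) * (m1 * x1) + (-40) * (m1 * x2) + 20 * (m2 * x3) + (-16) * (m2 * x4)" for m0 m1 m2 x0 x1 x2 x3 x4 :: complex
    by (simp add: algebra_simps)
  note expand = this
  have "k * (10 * (w1 * w2 ^ 2) + (-8) * (w3) + (-40) * (u ^ 2) + 20 * (w1 * w2) + (-16) * (w2 * w3)) = k * (6 * (h) + 6 * (u * h))" for k :: complex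
    unfolding w1 w2 w3 h by algebra
  from this[of ?K] show ?thesis unfolding theta_part_12_2_def theta_part_12_1_def theta_part_12_3_def expand f by (simp only: distrib_left mult.left_commute[of ?K])
qed

lemma circulant_12_3:
  "(a5 ^ 2 * s12_3) - 2 * (a3 * s12_2) + 2 * (q * a1 * s12_4) = 2 * (E * (a3 * a4) / (a2 ^ 2 * a5 ^ 2)) + (-2) * (E * q * a1 / (a2 * a5 ^ 2))"
proof -
  let ?K = "(E) / (a1 ^ 4  *  a2 ^ 5  *  a3  *  a5 ^ 6)"
  have f: "a5 ^ 2 * (E ^ 3 / ((a1 * a2 * a3 * a4 * a5 * E) ^ 2 * (a3 * a4) * a1 ^ 3)) = ?K * (w1 ^ 2 * w2)"
    "a5 ^ 2 * ((a5 * E) / ((a1 * a3 * a5) ^ 5 * (a2 * a3))) = ?K * (w1 * w2 * w3)"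
    "a3 * (q * E ^ 3 / ((a1 * a2 * a3 * a4 * a5 * E) ^ 2 * a3 ^ 3 * (a1 * a2))) = ?K * (u * w1 * w2)"
    "q * a1 * ((a2 * a4 * E) / ((a1 * a3 * a5) ^ 4 * (a2 * a3) ^ 3)) = ?K * (u * w2 * w3)"
    "E * (a3 * a4) / (a2 ^ 2 * a5 ^ 2) = ?K * (h)"
    "E * q * a1 / (a2 * a5 ^ 2) = ?K * (u * h)"
    unfolding u_def w1_def w2_def w3_def h_def by (simp add: divide_simps nonzero; algebra?)+
  have "(m0 * (10 * x0 + (-8) * x1)) - 2 * (m1 * (10 * x2)) + 2 * (m2 * (4 * x3))
    = 10 * (m0 * x0) + (-8) * (m0 * x1) + (-20) * (m1 * x2) + 8 * (m2 * x3)" for m0 m1 m2 x0 x1 x2 x3 :: complex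
    by (simp add: algebra_simps)
  note expand = this
  have "k * (10 * (w1 ^ 2 * w2) + (-8) * (w1 * w2 * w3) + (-20) * (u * w1 * w2) + 8 * (u * w2 * w3)) = k * (2 * (h) + (-2) * (u * h))" for k :: complex
    unfolding w1 w2 w3 h by algebra
  from this[of ?K] show ?thesis unfolding theta_part_12_3_def theta_part_12_2_def theta_part_12_4_def expand f by (simp only: distrib_left mult.left_commute[of ?K])
qed

lemma circulant_12_4:
  "(a5 ^ 2 * s12_4) - 2 * (a3 * s12_3) + 2 * (a1 * s12_0) = 0"
proof -
  let ?K = "(E) / (a1 ^ 4  *  a2 ^ 4  *  a3 ^ 2  *  a4  *  a5 ^ 4)"
  have f: "a5 ^ 2 * ((a2 * a4 * E) / ((a1 * a3 * a5) ^ 4 * (a2 * a3) ^ 3)) = ?K * (w2 * w3)"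
    "a3 * (E ^ 3 / ((a1 * a2 * a3 * a4 * a5 * E) ^ 2 * (a3 * a4) * a1 ^ 3)) = ?K * (w1)"
    "a3 * ((a5 * E) / ((a1 * a3 * a5) ^ 5 * (a2 * a3))) = ?K * (w3)"
    "a1 * (q ^ 2 * E ^ 4 * (a1 * a2) / ((a1 * a2 * a3 * a4 * a5 * E) ^ 3 * (a1 * a3 * a5))) = ?K * (u ^ 2)"
    "a1 * (q * (a5 * E) / ((a1 * a3 * a5) ^ 5 * (a3 * a4))) = ?K * (u * w3)"
    unfolding u_def w1_def w2_def w3_def h_def by (simp add: divide_simps nonzero; algebra?)+
  have "(m0 * (4 * x0)) - 2 * (m1 * (10 * x1 + (-8) * x2)) + 2 * (m2 * (10 * x3 + 2 * x4))
    = 4 * (m0 * x0) + (-20) * (m1 * x1) + 16 * (m1 * x2) + 20 * (m2 * x3) + 4 * (m2 * x4)" for m0 m1 m2 x0 x1 x2 x3 x4 :: complex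
    by (simp add: algebra_simps)
  note expand = this
  have "k * (4 * (w2 * w3) + (-20) * (w1) + 16 * (w3) + 20 * (u ^ 2) + 4 * (u * w3)) = 0" for k :: complex
    unfolding w1 w2 w3 h by algebra
  from this[of ?K] show ?thesis unfolding theta_part_12_4_def theta_part_12_3_def theta_part_12_0_def expand f by (simp only: distrib_left mult.left_commute[of ?K])
qed

lemma circulant_02_0:
  "(a5 ^ 2 * s02_0) - 2 * (q * a3 * s02_4) + 2 * (q * a1 * s02_1) = 1 * (E * q ^ 2 * a2 ^ 2 / a4 ^ 3) + 1 * (E * a4 ^ 2 / a2 ^ 3) + 4 * (E * q ^ 2 * a1 / (a4 * a5 ^ 2)) + 2 * (E * q * a3 / (a2 * a5 ^ 2))"
proof -
  let ?K = "(E) / (a1 ^ 5  *  a2 ^ 5  *  a5 ^ 6)"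
  have f: "a5 ^ 2 * ((a5 * E) ^ 6 / ((a1 * a3 * a5) ^ 6 * (a3 * a4) * E ^ 5)) = ?K * (w1 ^ 2 * w2 ^ 2 * w3)"
    "a5 ^ 2 * (q ^ 2 * (a1 * a2 * a3 * a4 * a5 * E) * E / ((a3 * a4) ^ 3 * (a5 * E))) = ?K * (u ^ 2 * w1 * w2 * h)"
    "a5 ^ 2 * (q * (a5 * E) ^ 2 * a1 / ((a1 * a3 * a5) ^ 6 * (a4 * E))) = ?K * (u * w1 * w2 * w3)"
    "a5 ^ 2 * (q ^ 2 * E ^ 3 / ((a1 * a2 * a3 * a4 * a5 * E) ^ 2 * a2 * a3 ^ 4)) = ?K * (u ^ 2 * w1 * w2 ^ 2)"
    "q * a3 * (E ^ 3 * (a5 * E) * a4 / (a1 * (a1 * a2 * a3 * a4 * a5 * E) ^ 3 * a3)) = ?K * (u * w1 * w2)"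
    "q * a3 * (E * (a4 / (a2 * a3)) / (q * (a2 / (a1 * a4)) * (a1 * a2))) = ?K * (w2 * h)"
    "q * a3 * ((a5 * E) ^ 2 * a2 ^ 5 * E ^ 2 / (q * (a1 * a3 * a5) ^ 4 * a1 ^ 4 * (a2 * a4 * E) ^ 3)) = ?K * (w1 ^ 2 * w3)"
    "q * a1 * ((a5 * E) ^ 4 / ((a1 * a3 * a5) ^ 6 * a4 * E ^ 3)) = ?K * (u * w1 * w2 * w3)"
    "q * a1 * (q ^ 2 * (a1 * a2 * a3 * a4 * a5 * E) * E ^ 3 / (a3 ^ 2 * a4 ^ 3 * (a5 * E) ^ 3)) = ?K * (u ^ 3 * h)"
    "E * q ^ 2 * a2 ^ 2 / a4 ^ 3 = ?K * (u ^ 2 * w1 * h)"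
    "E * a4 ^ 2 / a2 ^ 3 = ?K * (w2 * h)"
    "E * q ^ 2 * a1 / (a4 * a5 ^ 2) = ?K * (u ^ 2 * h)"
    "E * q * a3 / (a2 * a5 ^ 2) = ?K * (u * h)"
    unfolding u_def w1_def w2_def w3_def h_def by (simp add: divide_simps nonzero; algebra?)+
  have "(m0 * (1 * x0 + 1 * x1 + 4 * x2 + (-10) * x3)) - 2 * (m1 * ((-10) * x4 + (-2) * x5 + 2 * x6)) + 2 * (m2 * (2 * x7 + 2 * x8))
    = 1 * (m0 * x0) + 1 * (m0 * x1) + 4 * (m0 * x2) + (-10) * (m0 * x3) + 20 * (m1 * x4) + 4 * (m1 * x5) + (-4) * (m1 * x6) + 4 * (m2 * x7) + 4 * (m2 * x8)" for m0 m1 m2 x0 x1 x2 x3 x4 x5 x6 x7 x8 :: complex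
    by (simp add: algebra_simps)
  note expand = this
  have "k * (1 * (w1 ^ 2 * w2 ^ 2 * w3) + 1 * (u ^ 2 * w1 * w2 * h) + 4 * (u * w1 * w2 * w3) + (-10) * (u ^ 2 * w1 * w2 ^ 2) + 20 * (u * w1 * w2) + 4 * (w2 * h) + (-4) * (w1 ^ 2 * w3) + 4 * (u * w1 * w2 * w3) + 4 * (u ^ 3 * h)) = k * (1 * (u ^ 2 * w1 * h) + 1 * (w2 * h) + 4 * (u ^ 2 * h) + 2 * (u * h))" for k :: complex
    unfolding w1 w2 w3 h by algebra
  from this[of ?K] show ?thesis unfolding theta_part_02_0_def theta_part_02_4_def theta_part_02_1_def expand f by (simp only: distrib_left mult.left_commute[of ?K])
qed

lemma circulant_02_1:
  "(a5 ^ 2 * s02_1) - 2 * (a3 * s02_0) + 2 * (q * a1 * s02_2) = 0"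
proof -
  let ?K = "(E) / (a1 ^ 5  *  a2 ^ 4  *  a3  *  a4  *  a5 ^ 4)"
  have f: "a5 ^ 2 * ((a5 * E) ^ 4 / ((a1 * a3 * a5) ^ 6 * a4 * E ^ 3)) = ?K * (w1 * w2 * w3)"
    "a5 ^ 2 * (q ^ 2 * (a1 * a2 * a3 * a4 * a5 * E) * E ^ 3 / (a3 ^ 2 * a4 ^ 3 * (a5 * E) ^ 3)) = ?K * (u ^ 2 * h)"
    "a3 * ((a5 * E) ^ 6 / ((a1 * a3 * a5) ^ 6 * (a3 * a4) * E ^ 5)) = ?K * (w1 * w2 * w3)"
    "a3 * (q ^ 2 * (a1 * a2 * a3 * a4 * a5 * E) * E / ((a3 * a4) ^ 3 * (a5 * E))) = ?K * (u ^ 2 * h)"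
    "a3 * (q * (a5 * E) ^ 2 * a1 / ((a1 * a3 * a5) ^ 6 * (a4 * E))) = ?K * (u * w3)"
    "a3 * (q ^ 2 * E ^ 3 / ((a1 * a2 * a3 * a4 * a5 * E) ^ 2 * a2 * a3 ^ 4)) = ?K * (u ^ 2 * w2)"
    "q * a1 * (a3 * (a5 * E) ^ 2 / ((a1 * a3 * a5) ^ 6 * (a4 * E))) = ?K * (u * w3)"
    "q * a1 * (q * E ^ 3 / ((a1 * a2 * a3 * a4 * a5 * E) ^ 2 * a3 ^ 3 * (a1 * a2))) = ?K * (u ^ 2 * w2)"
    unfolding u_def w1_def w2_def w3_def h_def by (simp add: divide_simps nonzero; algebra?)+
  have "(m0 * (2 * x0 + 2 * x1)) - 2 * (m1 * (1 * x2 + 1 * x3 + 4 * x4 + (-10) * x5)) + 2 * (m2 * (4 * x6 + (-10) * x7))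
    = 2 * (m0 * x0) + 2 * (m0 * x1) + (-2) * (m1 * x2) + (-2) * (m1 * x3) + (-8) * (m1 * x4) + 20 * (m1 * x5) + 8 * (m2 * x6) + (-20) * (m2 * x7)" for m0 m1 m2 x0 x1 x2 x3 x4 x5 x6 x7 :: complex
    by (simp add: algebra_simps)
  note expand = this
  have "k * (2 * (w1 * w2 * w3) + 2 * (u ^ 2 * h) + (-2) * (w1 * w2 * w3) + (-2) * (u ^ 2 * h) + (-8) * (u * w3) + 20 * (u ^ 2 * w2) + 8 * (u * w3) + (-20) * (u ^ 2 * w2)) = 0" for k :: complex
    unfolding w1 w2 w3 h by algebra
  from this[of ?K] show ?thesis unfolding theta_part_02_1_def theta_part_02_0_def theta_part_02_2_def expand f by (simp only: distrib_left mult.left_commute[of ?K])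
qed

lemma circulant_02_2:
  "(a5 ^ 2 * s02_2) - 2 * (a3 * s02_1) + 2 * (q * a1 * s02_3) = (-2) * (E * q * a3 / (a4 * a5 ^ 2)) + (-2) * (E * q ^ 2 * (a1 * a2) / (a4 ^ 2 * a5 ^ 2))"
proof -
  let ?K = "(E) / (a1 ^ 5  *  a2 ^ 4  *  a4  *  a5 ^ 6)"
  have f: "a5 ^ 2 * (a3 * (a5 * E) ^ 2 / ((a1 * a3 * a5) ^ 6 * (a4 * E))) = ?K * (w1 * w2 * w3)"
    "a5 ^ 2 * (q * E ^ 3 / ((a1 * a2 * a3 * a4 * a5 * E) ^ 2 * a3 ^ 3 * (a1 * a2))) = ?K * (u * w1 * w2 ^ 2)"
    "a3 * ((a5 * E) ^ 4 / ((a1 * a3 * a5) ^ 6 * a4 * E ^ 3)) = ?K * (w1 * w2 * w3)"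
    "a3 * (q ^ 2 * (a1 * a2 * a3 * a4 * a5 * E) * E ^ 3 / (a3 ^ 2 * a4 ^ 3 * (a5 * E) ^ 3)) = ?K * (u ^ 2 * h)"
    "q * a1 * ((a5 * E) / ((a1 * a3 * a5) ^ 5 * (a2 * a3))) = ?K * (u * w2 * w3)"
    "E * q * a3 / (a4 * a5 ^ 2) = ?K * (u * h)"
    "E * q ^ 2 * (a1 * a2) / (a4 ^ 2 * a5 ^ 2) = ?K * (u ^ 2 * h)"
    unfolding u_def w1_def w2_def w3_def h_def by (simp add: divide_simps nonzero; algebra?)+
  have "(m0 * (4 * x0 + (-10) * x1)) - 2 * (m1 * (2 * x2 + 2 * x3)) + 2 * (m2 * (4 * x4))
    = 4 * (m0 * x0) + (-10) * (m0 * x1) + (-4) * (m1 * x2) + (-4) * (m1 * x3) + 8 * (m2 * x4)" for m0 m1 m2 x0 x1 x2 x3 x4 :: complex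
    by (simp add: algebra_simps)
  note expand = this
  have "k * (4 * (w1 * w2 * w3) + (-10) * (u * w1 * w2 ^ 2) + (-4) * (w1 * w2 * w3) + (-4) * (u ^ 2 * h) + 8 * (u * w2 * w3)) = k * ((-2) * (u * h) + (-2) * (u ^ 2 * h))" for k :: complex
    unfolding w1 w2 w3 h by algebra
  from this[of ?K] show ?thesis unfolding theta_part_02_2_def theta_part_02_1_def theta_part_02_3_def expand f by (simp only: distrib_left mult.left_commute[of ?K])
qed

lemma circulant_02_3:
  "(a5 ^ 2 * s02_3) - 2 * (a3 * s02_2) + 2 * (q * a1 * s02_4) = (-4) * (E * (a3 * a4) / (a2 ^ 2 * a5 ^ 2)) + 4 * (E * q * a1 / (a2 * a5 ^ 2))"
proof -
  let ?K = "(E) / (a1 ^ 4  *  a2 ^ 5  *  a3  *  a5 ^ 6)"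
  have f: "a5 ^ 2 * ((a5 * E) / ((a1 * a3 * a5) ^ 5 * (a2 * a3))) = ?K * (w1 * w2 * w3)"
    "a3 * (a3 * (a5 * E) ^ 2 / ((a1 * a3 * a5) ^ 6 * (a4 * E))) = ?K * (w1 * w3)"
    "a3 * (q * E ^ 3 / ((a1 * a2 * a3 * a4 * a5 * E) ^ 2 * a3 ^ 3 * (a1 * a2))) = ?K * (u * w1 * w2)"
    "q * a1 * (E ^ 3 * (a5 * E) * a4 / (a1 * (a1 * a2 * a3 * a4 * a5 * E) ^ 3 * a3)) = ?K * (u * w1 * w2)"
    "q * a1 * (E * (a4 / (a2 * a3)) / (q * (a2 / (a1 * a4)) * (a1 * a2))) = ?K * (w2 * h)"
    "q * a1 * ((a5 * E) ^ 2 * a2 ^ 5 * E ^ 2 / (q * (a1 * a3 * a5) ^ 4 * a1 ^ 4 * (a2 * a4 * E) ^ 3)) = ?K * (w1 ^ 2 * w3)"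
    "E * (a3 * a4) / (a2 ^ 2 * a5 ^ 2) = ?K * (h)"
    "E * q * a1 / (a2 * a5 ^ 2) = ?K * (u * h)"
    unfolding u_def w1_def w2_def w3_def h_def by (simp add: divide_simps nonzero; algebra?)+
  have "(m0 * (4 * x0)) - 2 * (m1 * (4 * x1 + (-10) * x2)) + 2 * (m2 * ((-10) * x3 + (-2) * x4 + 2 * x5))
    = 4 * (m0 * x0) + (-8) * (m1 * x1) + 20 * (m1 * x2) + (-20) * (m2 * x3) + (-4) * (m2 * x4) + 4 * (m2 * x5)" for m0 m1 m2 x0 x1 x2 x3 x4 x5 :: complex
    by (simp add: algebra_simps)
  note expand = this
  have "k * (4 * (w1 * w2 * w3) + (-8) * (w1 * w3) + 20 * (u * w1 * w2) + (-20) * (u * w1 * w2) + (-4) * (w2 * h) + 4 * (w1 ^ 2 * w3)) = k * ((-4) * (h) + 4 * (u * h))" for k :: complex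
    unfolding w1 w2 w3 h by algebra
  from this[of ?K] show ?thesis unfolding theta_part_02_3_def theta_part_02_2_def theta_part_02_4_def expand f by (simp only: distrib_left mult.left_commute[of ?K])
qed

lemma circulant_02_4:
  "(a5 ^ 2 * s02_4) - 2 * (a3 * s02_3) + 2 * (a1 * s02_0) = 0"
proof -
  let ?K = "(E) / (a1 ^ 5  *  a2 ^ 5  *  a3  *  a5 ^ 4  *  q)"
  have f: "a5 ^ 2 * (E ^ 3 * (a5 * E) * a4 / (a1 * (a1 * a2 * a3 * a4 * a5 * E) ^ 3 * a3)) = ?K * (u * w1 * w2)"
    "a5 ^ 2 * (E * (a4 / (a2 * a3)) / (q * (a2 / (a1 * a4)) * (a1 * a2))) = ?K * (w2 * h)"
    "a5 ^ 2 * ((a5 * E) ^ 2 * a2 ^ 5 * E ^ 2 / (q * (a1 * a3 * a5) ^ 4 * a1 ^ 4 * (a2 * a4 * E) ^ 3)) = ?K * (w1 ^ 2 * w3)"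
    "a3 * ((a5 * E) / ((a1 * a3 * a5) ^ 5 * (a2 * a3))) = ?K * (u * w3)"
    "a1 * ((a5 * E) ^ 6 / ((a1 * a3 * a5) ^ 6 * (a3 * a4) * E ^ 5)) = ?K * (u * w1 * w2 * w3)"
    "a1 * (q ^ 2 * (a1 * a2 * a3 * a4 * a5 * E) * E / ((a3 * a4) ^ 3 * (a5 * E))) = ?K * (u ^ 3 * h)"
    "a1 * (q * (a5 * E) ^ 2 * a1 / ((a1 * a3 * a5) ^ 6 * (a4 * E))) = ?K * (u ^ 2 * w3)"
    "a1 * (q ^ 2 * E ^ 3 / ((a1 * a2 * a3 * a4 * a5 * E) ^ 2 * a2 * a3 ^ 4)) = ?K * (u ^ 3 * w2)"
    unfolding u_def w1_def w2_def w3_def h_def by (simp add: divide_simps nonzero; algebra?)+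
  have "(m0 * ((-10) * x0 + (-2) * x1 + 2 * x2)) - 2 * (m1 * (4 * x3)) + 2 * (m2 * (1 * x4 + 1 * x5 + 4 * x6 + (-10) * x7))
    = (-10) * (m0 * x0) + (-2) * (m0 * x1) + 2 * (m0 * x2) + (-8) * (m1 * x3) + 2 * (m2 * x4) + 2 * (m2 * x5) + 8 * (m2 * x6) + (-20) * (m2 * x7)" for m0 m1 m2 x0 x1 x2 x3 x4 x5 x6 x7 :: complex
    by (simp add: algebra_simps)
  note expand = this
  have "k * ((-10) * (u * w1 * w2) + (-2) * (w2 * h) + 2 * (w1 ^ 2 * w3) + (-8) * (u * w3) + 2 * (u * w1 * w2 * w3) + 2 * (u ^ 3 * h) + 8 * (u ^ 2 * w3) + (-20) * (u ^ 3 * w2)) = 0" for k :: complex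
    unfolding w1 w2 w3 h by algebra
  from this[of ?K] show ?thesis unfolding theta_part_02_4_def theta_part_02_3_def theta_part_02_0_def expand f by (simp only: distrib_left mult.left_commute[of ?K])
qed

text \<open>The five circulant equations are the coefficients of this product reduced by
  \<open>p^5 = q\<close>.\<close>

lemma dissection_12:
  assumes "p ^ 5 = q"
  shows "(a5 ^ 2 - 2 * p * a3 + 2 * p ^ 4 * a1) * (s12_0 + p * s12_1 + p ^ 2 * s12_2 + p ^ 3 * s12_3 + p ^ 4 * s12_4)
    = ((-2) * (E * q ^ 2 * a2 ^ 2 / a4 ^ 3) + (-2) * (E * q ^ 2 * a1 / (a4 * a5 ^ 2)) + (-6) * (E * q * a3 / (a2 * a5 ^ 2)))
      + p ^ 2 * (6 * (E * q * a3 / (a4 * a5 ^ 2)) + 6 * (E * q ^ 2 * (a1 * a2) / (a4 ^ 2 * a5 ^ 2)))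
      + p ^ 3 * (2 * (E * (a3 * a4) / (a2 ^ 2 * a5 ^ 2)) + (-2) * (E * q * a1 / (a2 * a5 ^ 2)))"
proof -
  have "(b - 2 * p * x + 2 * p ^ 4 * y) * (r0 + p * r1 + p ^ 2 * r2 + p ^ 3 * r3 + p ^ 4 * r4)
    = ((b * r0) - 2 * (p ^ 5 * x * r4) + 2 * (p ^ 5 * y * r1)) + p * ((b * r1) - 2 * (x * r0) + 2 * (p ^ 5 * y * r2))
      + p ^ 2 * ((b * r2) - 2 * (x * r1) + 2 * (p ^ 5 * y * r3)) + p ^ 3 * ((b * r3) - 2 * (x * r2) + 2 * (p ^ 5 * y * r4))
      + p ^ 4 * ((b * r4) - 2 * (x * r3) + 2 * (y * r0))" for b x y r0 r1 r2 r3 r4 :: complex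
    by algebra
  note expand = this[unfolded assms]
  show ?thesis
    unfolding expand circulant_12_0 circulant_12_1 circulant_12_2 circulant_12_3 circulant_12_4 by simp
qed

lemma dissection_02:
  assumes "p ^ 5 = q"
  shows "(a5 ^ 2 - 2 * p * a3 + 2 * p ^ 4 * a1) * (s02_0 + p * s02_1 + p ^ 2 * s02_2 + p ^ 3 * s02_3 + p ^ 4 * s02_4)
    = (1 * (E * q ^ 2 * a2 ^ 2 / a4 ^ 3) + 1 * (E * a4 ^ 2 / a2 ^ 3) + 4 * (E * q ^ 2 * a1 / (a4 * a5 ^ 2)) + 2 * (E * q * a3 / (a2 * a5 ^ 2)))
      + p ^ 2 * ((-2) * (E * q * a3 / (a4 * a5 ^ 2)) + (-2) * (E * q ^ 2 * (a1 * a2) / (a4 ^ 2 * a5 ^ 2)))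
      + p ^ 3 * ((-4) * (E * (a3 * a4) / (a2 ^ 2 * a5 ^ 2)) + 4 * (E * q * a1 / (a2 * a5 ^ 2)))"
proof -
  have "(b - 2 * p * x + 2 * p ^ 4 * y) * (r0 + p * r1 + p ^ 2 * r2 + p ^ 3 * r3 + p ^ 4 * r4)
    = ((b * r0) - 2 * (p ^ 5 * x * r4) + 2 * (p ^ 5 * y * r1)) + p * ((b * r1) - 2 * (x * r0) + 2 * (p ^ 5 * y * r2))
      + p ^ 2 * ((b * r2) - 2 * (x * r1) + 2 * (p ^ 5 * y * r3)) + p ^ 3 * ((b * r3) - 2 * (x * r2) + 2 * (p ^ 5 * y * r4))
      + p ^ 4 * ((b * r4) - 2 * (x * r3) + 2 * (y * r0))" for b x y r0 r1 r2 r3 r4 :: complex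
    by algebra
  note expand = this[unfolded assms]
  show ?thesis
    unfolding expand circulant_02_0 circulant_02_1 circulant_02_2 circulant_02_3 circulant_02_4 by simp
qed

end

section \<open>The generating functions\<close>

context
  fixes q :: complex
  assumes q: "0 < norm q" "norm q < 1"
begin

text \<open>Paired products, so that \<open>J q i = A i * E\<close>; the self-paired index 5 is kept
  unsquared as \<open>A5\<close>, with \<open>J q 5 = A5^2 * E\<close>.\<close>

definition A :: "nat \<Rightarrow> complex" where "A i = qpoch [q ^ i] (q ^ 10) * qpoch [q ^ (10 - i)] (q ^ 10)"
definition A5 :: complex where "A5 = qpoch [q ^ 5] (q ^ 10)"
definition E :: complex where "E = qpoch [q ^ 10] (q ^ 10)"

lemma A_values:
  "A 1 = qpoch [q] (q ^ 10) * qpoch [q ^ 9] (q ^ 10)"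
  "A 2 = qpoch [q ^ 2] (q ^ 10) * qpoch [q ^ 8] (q ^ 10)"
  "A 3 = qpoch [q ^ 3] (q ^ 10) * qpoch [q ^ 7] (q ^ 10)"
  "A 4 = qpoch [q ^ 4] (q ^ 10) * qpoch [q ^ 6] (q ^ 10)"
  by (simp_all add: A_def)

definition H :: "nat \<Rightarrow> complex" where "H n = qpoch [q ^ n] (q ^ 10)"

lemma A_H: "A 1 = H 1 * H 9" "A 2 = H 2 * H 8" "A 3 = H 3 * H 7" "A 4 = H 4 * H 6" "A5 = H 5" "E = H 10"
  by (simp_all add: A_def A5_def E_def H_def)

lemma A_nonzero: "A 1 \<noteq> 0" "A 2 \<noteq> 0" "A 3 \<noteq> 0" "A 4 \<noteq> 0" "A5 \<noteq> 0" "E \<noteq> 0" "q \<noteq> 0"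
  using qpoch_power_nonzero[OF q(2), of _ 10] qpoch_power_nonzero[OF q(2), of 1 10] q by (simp_all add: A_def A5_def E_def del: A_values)

lemma J_A: "J q 1 = A 1 * E" "J q 2 = A 2 * E" "J q 3 = A 3 * E" "J q 4 = A 4 * E" "J q 5 = A5\<^sup>2 * E"
proof -
  have p: "q powi 1 = q ^ 1" "q powi 2 = q ^ 2" "q powi 3 = q ^ 3" "q powi 4 = q ^ 4" "q powi 5 = q ^ 5"
    "q powi (10 - 1) = q ^ (10 - 1)" "q powi (10 - 2) = q ^ (10 - 2)" "q powi (10 - 3) = q ^ (10 - 3)"
    "q powi (10 - 4) = q ^ (10 - 4)" "q powi (10 - 5) = q ^ 5" by simp_all
  show "J q 1 = A 1 * E" "J q 2 = A 2 * E" "J q 3 = A 3 * E" "J q 4 = A 4 * E" "J q 5 = A5\<^sup>2 * E"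
    unfolding J_product[OF q] A_def A5_def E_def p by (simp_all only: power2_eq_square)
qed

lemma qpoch_q: "qpoch [q] q = A 1 * A 2 * A 3 * A 4 * A5 * E"
proof -
  have "qpoch [q] q = (\<Prod>i<10. qpoch [q * q ^ i] (q ^ 10))" by (rule qpoch_dissect[OF q(2)]) simp
  also have "\<dots> = (\<Prod>i<10. H (i + 1))" by (simp add: H_def)
  also have "{..<10} = {0, 1, 2, 3, 4, 5, 6, 7, 8, 9 :: nat}" by auto
  finally show ?thesis unfolding A_H by (simp del: One_nat_def)
qed

lemma qpoch_q_q2: "qpoch [q] (q\<^sup>2) = A 1 * A 3 * A5"
proof -
  have "norm (q\<^sup>2) < 1" using q by (simp add: norm_power power_less_one_iff)
  then have "qpoch [q] (q\<^sup>2) = (\<Prod>i<5. qpoch [q * (q\<^sup>2) ^ i] ((q\<^sup>2) ^ 5))" by (rule qpoch_dissect) simp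
  also have "\<dots> = (\<Prod>i<5. H (2 * i + 1))" by (simp add: H_def power_mult)
  also have "{..<5} = {0, 1, 2, 3, 4 :: nat}" by auto
  finally show ?thesis unfolding A_H by (simp del: One_nat_def)
qed

lemma qpoch_q2: "qpoch [q\<^sup>2] (q\<^sup>2) = A 2 * A 4 * E"
proof -
  have "norm (q\<^sup>2) < 1" using q by (simp add: norm_power power_less_one_iff)
  then have "qpoch [q\<^sup>2] (q\<^sup>2) = (\<Prod>i<5. qpoch [q\<^sup>2 * (q\<^sup>2) ^ i] ((q\<^sup>2) ^ 5))" by (rule qpoch_dissect) simp
  also have "\<dots> = (\<Prod>i<5. H (2 * (i + 1)))"
  proof -
    have "(q\<^sup>2) ^ 5 = q ^ 10" "q\<^sup>2 * (q\<^sup>2) ^ i = q ^ (2 * (i + 1))" for i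
      by (simp, simp only: power_mult Suc_eq_plus1[symmetric] power_Suc)
    then show ?thesis by (simp only: H_def)
  qed
  also have "{..<5} = {0, 1, 2, 3, 4 :: nat}" by auto
  finally show ?thesis unfolding A_H by (simp add: numeral_2_eq_2[symmetric] del: One_nat_def)
qed

lemma qpoch_q5: "qpoch [q ^ i] (q ^ 5) = qpoch [q ^ i] (q ^ 10) * qpoch [q ^ (i + 5)] (q ^ 10)"
proof -
  have "norm (q ^ 5) < 1" using q by (simp add: norm_power power_less_one_iff)
  then have "qpoch [q ^ i] (q ^ 5) = (\<Prod>j<2. qpoch [q ^ i * (q ^ 5) ^ j] ((q ^ 5) ^ 2))" by (rule qpoch_dissect) simp
  also have "\<dots> = qpoch [q ^ i] (q ^ 10) * qpoch [q ^ (i + 5)] (q ^ 10)"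
    by (simp add: numeral_2_eq_2 power_add power_mult[symmetric])
  finally show ?thesis .
qed

text \<open>Negative arguments are removed by
  \<open>(a^2; q^10) = (a; q^5) (-a; q^5)\<close>.\<close>

lemma qpoch_minus_q5:
  assumes "i > 0"
  shows "qpoch [- (q ^ i)] (q ^ 5) = qpoch [q ^ (2 * i)] (q ^ 10) / (qpoch [q ^ i] (q ^ 10) * qpoch [q ^ (i + 5)] (q ^ 10))"
proof -
  have "norm (q ^ 5) < 1" using q by (simp add: norm_power power_less_one_iff)
  from qpoch_square[OF this, of "q ^ i"]
  have "qpoch [q ^ (2 * i)] (q ^ 10) = qpoch [q ^ i] (q ^ 10) * qpoch [q ^ (i + 5)] (q ^ 10) * qpoch [- (q ^ i)] (q ^ 5)"
    unfolding qpoch_q5[symmetric] by (simp add: mult.commute flip: power_mult)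
  moreover have "qpoch [q ^ i] (q ^ 10) \<noteq> 0" "qpoch [q ^ (i + 5)] (q ^ 10) \<noteq> 0"
    using assms by (intro qpoch_power_nonzero q; simp)+
  ultimately show ?thesis by (simp add: field_simps)
qed

lemma qpoch_products:
  "qpoch [q, q ^ 9] (q ^ 10) = A 1"
  "qpoch [q ^ 2, q ^ 8] (q ^ 10) = A 2"
  "qpoch [q ^ 3, q ^ 7] (q ^ 10) = A 3"
  "qpoch [q ^ 4, q ^ 6] (q ^ 10) = A 4"
  "qpoch [q, q ^ 2, q ^ 8, q ^ 9] (q ^ 10) = A 1 * A 2"
  "qpoch [q ^ 3, q ^ 4, q ^ 6, q ^ 7] (q ^ 10) = A 3 * A 4"
  "qpoch [q ^ 2, q ^ 3, q ^ 7, q ^ 8] (q ^ 10) = A 2 * A 3"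
  "qpoch [q ^ 4, q ^ 6, q ^ 10] (q ^ 10) = A 4 * E"
  "qpoch [q ^ 5] (q ^ 5) = A5 * E"
  "qpoch [q ^ 10] (q ^ 10) = E"
  "qpoch [- (q ^ 5)] (q ^ 5) = 1 / A5"
  "qpoch [- (q ^ 2), - (q ^ 3)] (q ^ 5) = A 4 / (A 2 * A 3)"
  "qpoch [- q, - (q ^ 4)] (q ^ 5) = A 2 / (A 1 * A 4)"
proof -
  have n: "norm (q ^ 10) < 1" "norm (q ^ 5) < 1" using q by (simp_all add: norm_power power_less_one_iff)
  note c = qpoch_Cons[OF n(1), of _ "_ # _"] qpoch_Cons[OF n(2), of _ "_ # _"]
  show "qpoch [q, q ^ 9] (q ^ 10) = A 1"
    "qpoch [q ^ 2, q ^ 8] (q ^ 10) = A 2"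
    "qpoch [q ^ 3, q ^ 7] (q ^ 10) = A 3"
    "qpoch [q ^ 4, q ^ 6] (q ^ 10) = A 4"
    "qpoch [q, q ^ 2, q ^ 8, q ^ 9] (q ^ 10) = A 1 * A 2"
    "qpoch [q ^ 3, q ^ 4, q ^ 6, q ^ 7] (q ^ 10) = A 3 * A 4"
    "qpoch [q ^ 2, q ^ 3, q ^ 7, q ^ 8] (q ^ 10) = A 2 * A 3"
    "qpoch [q ^ 4, q ^ 6, q ^ 10] (q ^ 10) = A 4 * E"
    by (simp_all only: c A_values E_def mult.assoc mult.left_commute mult.commute)
  show "qpoch [q ^ 5] (q ^ 5) = A5 * E" "qpoch [q ^ 10] (q ^ 10) = E"
    using qpoch_q5[of 5] by (simp_all add: A5_def E_def)
  show "qpoch [- (q ^ 5)] (q ^ 5) = 1 / A5"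
    using qpoch_minus_q5[of 5] A_nonzero(5,6) by (simp add: A5_def E_def)
  show "qpoch [- (q ^ 2), - (q ^ 3)] (q ^ 5) = A 4 / (A 2 * A 3)"
    using qpoch_minus_q5[of 2] qpoch_minus_q5[of 3] by (simp add: c A_values mult_ac)
  show "qpoch [- q, - (q ^ 4)] (q ^ 5) = A 2 / (A 1 * A 4)"
    using qpoch_minus_q5[of 1] qpoch_minus_q5[of 4] by (simp add: c A_values mult_ac del: One_nat_def)
qed

lemma A_rel1: "(A 2)\<^sup>2 * A 3 * A5\<^sup>2 = A 1 * A 3 * (A 4)\<^sup>2 + q * (A 1)\<^sup>2 * A 2 * A 4"
proof -
  have "E ^ 4 * ((A 2)\<^sup>2 * A 3 * A5\<^sup>2) = E ^ 4 * (A 1 * A 3 * (A 4)\<^sup>2 + q * (A 1)\<^sup>2 * A 2 * A 4)"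
    using J_rel1[OF q] unfolding J_A by algebra
  then show ?thesis using A_nonzero by (simp only: mult_cancel_left) simp
qed

lemma A_rel2: "A 2 * (A 3)\<^sup>2 * A 4 = A 1 * (A 4)\<^sup>2 * A5\<^sup>2 + q * A 1 * (A 2)\<^sup>2 * A 3"
proof -
  have "E ^ 4 * (A 2 * (A 3)\<^sup>2 * A 4) = E ^ 4 * (A 1 * (A 4)\<^sup>2 * A5\<^sup>2 + q * A 1 * (A 2)\<^sup>2 * A 3)"
    using J_rel2[OF q] unfolding J_A by algebra
  then show ?thesis using A_nonzero by (simp only: mult_cancel_left) simp
qed

lemma A_rel3: "A 2 ^ 3 * A 4 = A 1 * A 3 ^ 3 + q * A 1 ^ 3 * A5\<^sup>2"
proof -
  have "E ^ 4 * (A 2 ^ 3 * A 4) = E ^ 4 * (A 1 * A 3 ^ 3 + q * A 1 ^ 3 * A5\<^sup>2)"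
    using J_rel3[OF q] unfolding J_A by algebra
  then show ?thesis using A_nonzero by (simp only: mult_cancel_left) simp
qed

text \<open>\<open>phi_square\<close> with \<open>phi q\<close> replaced by its product over the
  \<open>A i\<close>.\<close>

lemma A_rel4: "((A 1)\<^sup>2 * A 2 * (A 3)\<^sup>2 * A 4 * A5\<^sup>2)\<^sup>2 = A5 ^ 4 - 4 * q * A 1 * A 3"
proof -
  have "E ^ 2 * ((A 1)\<^sup>2 * A 2 * (A 3)\<^sup>2 * A 4 * A5\<^sup>2)\<^sup>2 = E ^ 2 * (A5 ^ 4 - 4 * q * A 1 * A 3)"
    using phi_square[OF q] unfolding J_A phi_product[OF q] qpoch_q_q2 qpoch_q2 by algebra
  then show ?thesis using A_nonzero by (simp only: mult_cancel_left) simp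
qed

lemmas A_dissection_12 = dissection_12[OF A_nonzero A_rel1 A_rel2 A_rel3 A_rel4]
lemmas A_dissection_02 = dissection_02[OF A_nonzero A_rel1 A_rel2 A_rel3 A_rel4]

abbreviation "at_theta \<equiv> (\<lambda>f :: _ \<Rightarrow> _ \<Rightarrow> _ \<Rightarrow> _ \<Rightarrow> _ \<Rightarrow> _ \<Rightarrow> _ \<Rightarrow> complex. f (A 1) (A 2) (A 3) (A 4) A5 E q)"

lemma E3_E: "E3 q = E ^ 3"
  using theta_quotient_1[OF q10[OF q]] by (simp add: E3_def E_def)

section \<open>The classes as polynomials in a fifth root of q\<close>

context
  fixes p :: complex
  assumes p: "0 < norm p" "norm p < 1" and qp: "q = p ^ 5"
begin

lemma phi_p: "phi p = E * (A5\<^sup>2 - 2 * p * A 3 + 2 * p ^ 4 * A 1)"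
  unfolding phi_dissect[OF p qp] J_A by algebra

text \<open>Dictionary between the right sides of the circulant equations and the theta quotients in
  \<open>lambert_1\<close>, \<open>lambert_2\<close> and the relations for
  \<open>logder10\<close>.\<close>

lemma E_terms:
  "E * (E * q ^ 2 * A 2 ^ 2 / A 4 ^ 3) = q ^ 2 * E3 q * J q 2 ^ 2 / J q 4 ^ 3"
  "E * (E * A 4 ^ 2 / A 2 ^ 3) = E3 q * J q 4 ^ 2 / J q 2 ^ 3"
  "E * (E * q ^ 2 * A 1 / (A 4 * A5 ^ 2)) = q ^ 2 * E3 q * J q 1 / (J q 4 * J q 5)"
  "E * (E * q * A 3 / (A 2 * A5 ^ 2)) = q * E3 q * J q 3 / (J q 2 * J q 5)"
  "E * (E * q * A 3 / (A 4 * A5 ^ 2)) = q * E3 q * J q 3 / (J q 4 * J q 5)"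
  "E * (E * q ^ 2 * (A 1 * A 2) / (A 4 ^ 2 * A5 ^ 2)) = q ^ 2 * E3 q * J q 1 * J q 2 / (J q 4 ^ 2 * J q 5)"
  "E * (E * (A 3 * A 4) / (A 2 ^ 2 * A5 ^ 2)) = E3 q * J q 3 * J q 4 / (J q 2 ^ 2 * J q 5)"
  "E * (E * q * A 1 / (A 2 * A5 ^ 2)) = q * E3 q * J q 1 / (J q 2 * J q 5)"
  unfolding E3_E J_A by (simp add: divide_simps A_nonzero; algebra?)+

lemma class_gf_value_12:
  "class_gf p 1 - class_gf p 2 = at_theta theta_part_12_0 + p * (6 * mock_4 q / (q * J q 5) + at_theta theta_part_12_1) + p ^ 2 * at_theta theta_part_12_2
     + p ^ 3 * at_theta theta_part_12_3 + p ^ 4 * (2 * mock_2 q / (q * J q 5) + at_theta theta_part_12_4)"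
proof -
  have nz: "p \<noteq> 0" "J q 5 \<noteq> 0" using p A_nonzero by (auto simp: J_A)
  let ?S = "at_theta theta_part_12_0 + p * at_theta theta_part_12_1 + p ^ 2 * at_theta theta_part_12_2 + p ^ 3 * at_theta theta_part_12_3 + p ^ 4 * at_theta theta_part_12_4"
  let ?x3 = "q * E3 q * J q 3 / (J q 2 * J q 5)"
  have 1: "phi p * ?S
    = ((-2) * (q ^ 2 * E3 q * J q 2 ^ 2 / J q 4 ^ 3) + (-2) * (q ^ 2 * E3 q * J q 1 / (J q 4 * J q 5)) + (-6) * ?x3)
      + p ^ 2 * (6 * (q * E3 q * J q 3 / (J q 4 * J q 5)) + 6 * (q ^ 2 * E3 q * J q 1 * J q 2 / (J q 4 ^ 2 * J q 5)))
      + p ^ 3 * (2 * (E3 q * J q 3 * J q 4 / (J q 2 ^ 2 * J q 5)) + (-2) * (q * E3 q * J q 1 / (J q 2 * J q 5)))"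
    unfolding phi_p mult.assoc[of E] A_dissection_12[OF qp[symmetric]] E_terms[symmetric] by algebra
  \<comment> \<open>The negative powers are rewritten by \<open>1 / p^4 = p / q\<close> and
    \<open>1 / p = p^4 / q\<close>; so \<open>mock_4\<close> belongs to residue 1 and
    \<open>mock_2\<close> to residue 4.\<close>
  have m: "6 * (mock_4 q * phi p / (p ^ 4 * J q 5)) = phi p * (p * (6 * mock_4 q / (q * J q 5)))"
    "2 * (mock_2 q * phi p / (p * J q 5)) = phi p * (p ^ 4 * (2 * mock_2 q / (q * J q 5)))"
    unfolding qp using nz unfolding qp by (simp_all add: field_simps eval_nat_numeral)
  have "(class_gf p 1 - class_gf p 2) * phi p = phi p * (?S + p * (6 * mock_4 q / (q * J q 5)) + p ^ 4 * (2 * mock_2 q / (q * J q 5)))"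
    unfolding class_gf_lambert_12[OF p] lambert_1[OF p qp] lambert_2[OF p qp]
    using logder10_rel2[OF q] m 1 by algebra
  then have "class_gf p 1 - class_gf p 2 = ?S + p * (6 * mock_4 q / (q * J q 5)) + p ^ 4 * (2 * mock_2 q / (q * J q 5))"
    using phi_nonzero[OF p] by simp
  then show ?thesis by algebra
qed

lemma class_gf_value_02:
  "class_gf p 0 - class_gf p 2 = at_theta theta_part_02_0 + p * ((-2) * mock_4 q / (q * J q 5) + at_theta theta_part_02_1) + p ^ 2 * at_theta theta_part_02_2
     + p ^ 3 * at_theta theta_part_02_3 + p ^ 4 * ((-4) * mock_2 q / (q * J q 5) + at_theta theta_part_02_4)"
proof -
  have nz: "p \<noteq> 0" "J q 5 \<noteq> 0" using p A_nonzero by (auto simp: J_A)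
  let ?S = "at_theta theta_part_02_0 + p * at_theta theta_part_02_1 + p ^ 2 * at_theta theta_part_02_2 + p ^ 3 * at_theta theta_part_02_3 + p ^ 4 * at_theta theta_part_02_4"
  let ?x3 = "q * E3 q * J q 3 / (J q 2 * J q 5)"
  have 1: "phi p * ?S
    = (1 * (q ^ 2 * E3 q * J q 2 ^ 2 / J q 4 ^ 3) + 1 * (E3 q * J q 4 ^ 2 / J q 2 ^ 3) + 4 * (q ^ 2 * E3 q * J q 1 / (J q 4 * J q 5)) + 2 * ?x3)
      + p ^ 2 * ((-2) * (q * E3 q * J q 3 / (J q 4 * J q 5)) + (-2) * (q ^ 2 * E3 q * J q 1 * J q 2 / (J q 4 ^ 2 * J q 5)))
      + p ^ 3 * ((-4) * (E3 q * J q 3 * J q 4 / (J q 2 ^ 2 * J q 5)) + 4 * (q * E3 q * J q 1 / (J q 2 * J q 5)))"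
    unfolding phi_p mult.assoc[of E] A_dissection_02[OF qp[symmetric]] E_terms[symmetric] by algebra
  have m: "(-2) * (mock_4 q * phi p / (p ^ 4 * J q 5)) = phi p * (p * ((-2) * mock_4 q / (q * J q 5)))"
    "(-4) * (mock_2 q * phi p / (p * J q 5)) = phi p * (p ^ 4 * ((-4) * mock_2 q / (q * J q 5)))"
    unfolding qp using nz unfolding qp by (simp_all add: field_simps eval_nat_numeral)
  have "(class_gf p 0 - class_gf p 2) * phi p = phi p * (?S + p * ((-2) * mock_4 q / (q * J q 5)) + p ^ 4 * ((-4) * mock_2 q / (q * J q 5)))"
    unfolding class_gf_lambert_02[OF p] lambert_1[OF p qp] lambert_2[OF p qp]
    \<comment> \<open>The constant and logarithmic derivatives are \<open>1 - 4 L2 + 2 L4\<close>,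
      which is minus the left side of \<open>logder10_rel1\<close> plus that of
      \<open>logder10_rel2\<close>.\<close>
    using logder10_rel1[OF q] logder10_rel2[OF q] m 1 by algebra
  then have "class_gf p 0 - class_gf p 2 = ?S + p * ((-2) * mock_4 q / (q * J q 5)) + p ^ 4 * ((-4) * mock_2 q / (q * J q 5))"
    using phi_nonzero[OF p] by simp
  then show ?thesis by algebra
qed

end

text \<open>The subseries and the given values are the coefficients of two polynomials of degree at most 4
  in \<open>p\<close>, which agree at the five fifth roots of \<open>q\<close>.\<close>

lemma five_dissection:
  fixes c f :: "nat \<Rightarrow> complex"
  assumes "\<And>p. 0 < norm p \<Longrightarrow> norm p < 1 \<Longrightarrow> q = p ^ 5 \<Longrightarrow> ((\<lambda>n. c n * p ^ n) has_sum (\<Sum>d<5. p ^ d * f d)) UNIV"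
    and "d < 5"
  shows "(\<lambda>n. c (5 * n + d) * q ^ n) sums f d"
proof -
  have root: "0 < norm p" "norm p < 1" if "p ^ 5 = q" for p
  proof -
    have "norm p ^ 5 = norm q" using that by (metis norm_power)
    then have "norm p ^ 5 < 1" "p \<noteq> 0" using q by auto
    then show "0 < norm p" "norm p < 1" by (auto simp: power_less_one_iff)
  qed
  define g where "g = (\<lambda>d. \<Sum>\<^sub>\<infinity>n. c (5 * n + d) * q ^ n)"
  have card: "card {p. p ^ 5 = q} = 5" using card_nth_roots[of q 5] A_nonzero(7) by simp
  have inj: "inj (\<lambda>n. 5 * n + d)" for d :: nat by (auto simp: inj_on_def)
  \<comment> \<open>Convergence of each subseries is inherited from the full series at one fifth
    root \<open>p\<close>, after division by \<open>p^d\<close>.\<close>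
  have split: "((\<lambda>n. c (5 * n + d) * q ^ n) has_sum g d) UNIV" for d
  proof -
    have "{p. p ^ 5 = q} \<noteq> {}" using card by force
    then obtain p where p: "p ^ 5 = q" by blast
    have "(\<lambda>n. c n * p ^ n) summable_on range (\<lambda>n. 5 * n + d)"
      by (rule summable_on_subset_banach[OF has_sum_imp_summable[OF assms(1)[OF root[OF p] p[symmetric]]]]) simp
    then have "(\<lambda>n. c (5 * n + d) * p ^ (5 * n + d)) summable_on UNIV"
      by (simp only: summable_on_reindex[OF inj] o_def)
    then have "(\<lambda>n. inverse (p ^ d) * (c (5 * n + d) * p ^ (5 * n + d))) summable_on UNIV"
      by (rule summable_on_cmult_right)
    also have "(\<lambda>n. inverse (p ^ d) * (c (5 * n + d) * p ^ (5 * n + d))) = (\<lambda>n. c (5 * n + d) * q ^ n)"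
      using root[OF p] by (auto simp: power_add power_mult p)
    finally show ?thesis unfolding g_def by (rule has_sum_infsum)
  qed
  have eq: "(\<Sum>d<5. p ^ d * g d) = (\<Sum>d<5. p ^ d * f d)" if p: "p ^ 5 = q" for p
  proof -
    have "((\<lambda>n. c n * p ^ n) has_sum (\<Sum>d<5. p ^ d * g d)) (\<Union>d\<in>{..<5}. range (\<lambda>n. 5 * n + d))"
    proof (rule sum_has_sum)
      fix d :: nat
      have "((\<lambda>n. p ^ d * (c (5 * n + d) * q ^ n)) has_sum (p ^ d * g d)) UNIV"
        by (rule has_sum_cmult_right[OF split])
      also have "(\<lambda>n. p ^ d * (c (5 * n + d) * q ^ n)) = (\<lambda>n. c n * p ^ n) \<circ> (\<lambda>n. 5 * n + d)"
        by (auto simp: power_add power_mult p)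
      finally show "((\<lambda>n. c n * p ^ n) has_sum (p ^ d * g d)) (range (\<lambda>n. 5 * n + d))"
        by (simp only: has_sum_reindex[OF inj])
    next
      fix r s :: nat assume "r \<in> {..<5}" "s \<in> {..<5}" "r \<noteq> s"
      then show "range (\<lambda>n. 5 * n + r) \<inter> range (\<lambda>n. 5 * n + s) = {}" by auto presburger
    qed auto
    moreover have "n \<in> (\<Union>d\<in>{..<5}. range (\<lambda>n. 5 * n + d))" for n :: nat
    proof -
      have "n = 5 * (n div 5) + n mod 5" "n mod 5 < 5" by simp_all
      then show ?thesis by blast
    qed
    then have "(\<Union>d\<in>{..<5}. range (\<lambda>n. 5 * n + d)) = (UNIV :: nat set)" by blast
    ultimately have "((\<lambda>n. c n * p ^ n) has_sum (\<Sum>d<5. p ^ d * g d)) UNIV" by simp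
    from has_sum_unique[OF this assms(1)[OF root[OF p] p[symmetric]]] show ?thesis .
  qed
  define P where "P = (\<Sum>d<5. monom (g d - f d) d)"
  have "P = 0"
  proof (rule ccontr)
    assume P: "P \<noteq> 0"
    have "{p. p ^ 5 = q} \<subseteq> {x. poly P x = 0}"
      using eq by (auto simp: P_def poly_sum poly_monom algebra_simps sum_subtractf)
    then have "5 \<le> card {x. poly P x = 0}"
      using card_mono[OF poly_roots_finite[OF P]] card by metis
    also have "\<dots> \<le> degree P" by (rule card_poly_roots_bound[OF P])
    also have "degree P \<le> 4" unfolding P_def by (rule degree_sum_le) (auto intro: order_trans[OF degree_monom_le])
    finally show False by simp
  qed
  then have "coeff P d = 0" by simp
  then have "g d = f d" using assms(2) by (simp add: P_def coeff_sum if_distrib)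
  then show ?thesis using has_sum_imp_sums[OF split[of d]] by simp
qed

end

theorem theorem1p2:
  fixes q :: complex
  assumes "0 < norm q" and "norm q < 1"
  shows
    "fps_value (R 1 2 0) q
       (10 * q^2 * qpoch [q^10] (q^10) ^ 4 * qpoch [q, q^2, q^8, q^9] (q^10)
          / (qpoch [q] q ^ 3 * qpoch [q] (q^2))
        + 2 * q * qpoch [q^5] (q^5)
          / (qpoch [q] (q^2) ^ 5 * qpoch [q^3, q^4, q^6, q^7] (q^10)))
   \<and> fps_value (R 1 2 1) q
       ((-6) * q^3 * qpoch [-(q^5)] (q^5) / qpoch [q^5] (q^5) * bilateral_sum 4 q
        + 4 * q * qpoch [q^10] (q^10) ^ 2
          / (qpoch [q] (q^2) ^ 5 * qpoch [q^4, q^6] (q^10) * qpoch [q^5] (q^5))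
        + 20 * q^3 * qpoch [q^10] (q^10) ^ 7 * qpoch [q, q^9] (q^10) ^ 2
            * qpoch [q^2, q^8] (q^10) ^ 3
          / (qpoch [q] q ^ 4 * qpoch [q^5] (q^5) ^ 2))
   \<and> fps_value (R 1 2 2) q
       (10 * q * qpoch [q^10] (q^10) ^ 3
          / (qpoch [q] q ^ 2 * qpoch [q^3, q^7] (q^10) ^ 3 * qpoch [q, q^2, q^8, q^9] (q^10)))
   \<and> fps_value (R 1 2 3) q
       (10 * qpoch [q^10] (q^10) ^ 3
          / (qpoch [q] q ^ 2 * qpoch [q^3, q^4, q^6, q^7] (q^10) * qpoch [q, q^9] (q^10) ^ 3)
        - 8 * qpoch [q^5] (q^5)
          / (qpoch [q] (q^2) ^ 5 * qpoch [q^2, q^3, q^7, q^8] (q^10)))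
   \<and> fps_value (R 1 2 4) q
       ((-2) * q * qpoch [-(q^5)] (q^5) / qpoch [q^5] (q^5) * bilateral_sum 2 q
        + 4 * qpoch [q^2] (q^2)
          / (qpoch [q] (q^2) ^ 4 * qpoch [q^2, q^3, q^7, q^8] (q^10) ^ 3))
   \<and> fps_value (R 0 2 0) q
       ((-1)
        + qpoch [q^5] (q^5) ^ 6
          / (qpoch [q] (q^2) ^ 6 * qpoch [q^3, q^4, q^6, q^7] (q^10) * qpoch [q^10] (q^10) ^ 5)
        + q^2 * qpoch [q] q * qpoch [q^10] (q^10)
          / (qpoch [q^3, q^4, q^6, q^7] (q^10) ^ 3 * qpoch [q^5] (q^5))
        + 4 * q * qpoch [q^5] (q^5) ^ 2 * qpoch [q, q^9] (q^10)
          / (qpoch [q] (q^2) ^ 6 * qpoch [q^4, q^6, q^10] (q^10))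
        - 10 * q^2 * qpoch [q^10] (q^10) ^ 3
          / (qpoch [q] q ^ 2 * qpoch [q^2, q^8] (q^10) * qpoch [q^3, q^7] (q^10) ^ 4))
   \<and> fps_value (R 0 2 1) q
       (2 * q^3 * qpoch [-(q^5)] (q^5) / qpoch [q^5] (q^5) * bilateral_sum 4 q
        + 2 * qpoch [q^5] (q^5) ^ 4
          / (qpoch [q] (q^2) ^ 6 * qpoch [q^4, q^6] (q^10) * qpoch [q^10] (q^10) ^ 3)
        + 2 * q^2 * qpoch [q] q * qpoch [q^10] (q^10) ^ 3
          / (qpoch [q^3, q^7] (q^10) ^ 2 * qpoch [q^4, q^6] (q^10) ^ 3 * qpoch [q^5] (q^5) ^ 3))
   \<and> fps_value (R 0 2 2) q
       (4 * qpoch [q^3, q^7] (q^10) * qpoch [q^5] (q^5) ^ 2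
          / (qpoch [q] (q^2) ^ 6 * qpoch [q^4, q^6, q^10] (q^10))
        - 10 * q * qpoch [q^10] (q^10) ^ 3
          / (qpoch [q] q ^ 2 * qpoch [q^3, q^7] (q^10) ^ 3 * qpoch [q, q^2, q^8, q^9] (q^10)))
   \<and> fps_value (R 0 2 3) q
       (4 * qpoch [q^5] (q^5)
          / (qpoch [q] (q^2) ^ 5 * qpoch [q^2, q^3, q^7, q^8] (q^10)))
   \<and> fps_value (R 0 2 4) q
       (4 * q * qpoch [-(q^5)] (q^5) / qpoch [q^5] (q^5) * bilateral_sum 2 q
        - 10 * qpoch [q^10] (q^10) ^ 3 * qpoch [q^5] (q^5) * qpoch [q^4, q^6] (q^10)
          / (qpoch [q, q^9] (q^10) * qpoch [q] q ^ 3 * qpoch [q^3, q^7] (q^10))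
        - 2 * qpoch [q^10] (q^10) * qpoch [-(q^2), -(q^3)] (q^5)
          / (q * qpoch [-q, -(q^4)] (q^5) * qpoch [q, q^2, q^8, q^9] (q^10))
        + 2 * qpoch [q^5] (q^5) ^ 2 * qpoch [q^2, q^8] (q^10) ^ 5 * qpoch [q^10] (q^10) ^ 2
          / (q * qpoch [q] (q^2) ^ 4 * qpoch [q, q^9] (q^10) ^ 4 * qpoch [q^2] (q^2) ^ 3))"
proof -
  note q = assms
  let ?r = "\<lambda>f :: _ \<Rightarrow> _ \<Rightarrow> _ \<Rightarrow> _ \<Rightarrow> _ \<Rightarrow> _ \<Rightarrow> _ \<Rightarrow> complex. f (A q 1) (A q 2) (A q 3) (A q 4) (A5 q) (E q) q"
  note nz = A_nonzero[OF q]
  have five: "(\<Sum>d<5. h d) = h 0 + h 1 + h 2 + h 3 + h 4" for h :: "nat \<Rightarrow> complex"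
  proof -
    have "{..<5} = {0, 1, 2, 3, 4 :: nat}" by auto
    then show ?thesis by (simp add: add.assoc)
  qed
  define v12 where "v12 = (\<lambda>d. [?r theta_part_12_0, 6 * mock_4 q / (q * J q 5) + ?r theta_part_12_1, ?r theta_part_12_2, ?r theta_part_12_3, 2 * mock_2 q / (q * J q 5) + ?r theta_part_12_4] ! d)"
  \<comment> \<open>The -1 in residue 0 is the empty overpartition: it has rank 0 in
    \<open>class_gf\<close> and is absent from \<open>N2_bar\<close>.\<close>
  define v02 where "v02 = (\<lambda>d. [- 1 + ?r theta_part_02_0, (-2) * mock_4 q / (q * J q 5) + ?r theta_part_02_1, ?r theta_part_02_2, ?r theta_part_02_3, (-4) * mock_2 q / (q * J q 5) + ?r theta_part_02_4] ! d)"
  have v12: "fps_value (R 1 2 d) q (v12 d)" if "d < 5" for d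
    unfolding fps_value_def R_def fps_nth_Abs_fps
  proof (rule five_dissection[OF q _ that])
    fix p :: complex assume p: "0 < norm p" "norm p < 1" and qp: "q = p ^ 5"
    have "((\<lambda>n. of_nat (N2_bar 1 5 n) * p ^ n + - (of_nat (N2_bar 2 5 n) * p ^ n)) has_sum ((class_gf p 1 - of_bool (5 dvd (1 :: int))) + - (class_gf p 2 - of_bool (5 dvd (2 :: int))))) UNIV"
      by (intro has_sum_add has_sum_uminusI N2_bar_has_sum[OF p])
    moreover have "(\<Sum>d<5. p ^ d * v12 d) = (class_gf p 1 - of_bool (5 dvd (1 :: int))) + - (class_gf p 2 - of_bool (5 dvd (2 :: int)))"
      using class_gf_value_12[OF q p qp] by (simp add: five v12_def algebra_simps)
    ultimately show "((\<lambda>n. (of_nat (N2_bar 1 5 n) - of_nat (N2_bar 2 5 n)) * p ^ n) has_sum (\<Sum>d<5. p ^ d * v12 d)) UNIV"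
      by (simp add: left_diff_distrib)
  qed
  have v02: "fps_value (R 0 2 d) q (v02 d)" if "d < 5" for d
    unfolding fps_value_def R_def fps_nth_Abs_fps
  proof (rule five_dissection[OF q _ that])
    fix p :: complex assume p: "0 < norm p" "norm p < 1" and qp: "q = p ^ 5"
    have "((\<lambda>n. of_nat (N2_bar 0 5 n) * p ^ n + - (of_nat (N2_bar 2 5 n) * p ^ n)) has_sum ((class_gf p 0 - of_bool (5 dvd (0 :: int))) + - (class_gf p 2 - of_bool (5 dvd (2 :: int))))) UNIV"
      by (intro has_sum_add has_sum_uminusI N2_bar_has_sum[OF p])
    moreover have "(\<Sum>d<5. p ^ d * v02 d) = (class_gf p 0 - of_bool (5 dvd (0 :: int))) + - (class_gf p 2 - of_bool (5 dvd (2 :: int)))"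
      using class_gf_value_02[OF q p qp] by (simp add: five v02_def algebra_simps)
    ultimately show "((\<lambda>n. (of_nat (N2_bar 0 5 n) - of_nat (N2_bar 2 5 n)) * p ^ n) has_sum (\<Sum>d<5. p ^ d * v02 d)) UNIV"
      by (simp add: left_diff_distrib)
  qed
  \<comment> \<open>The prefactor \<open>(-q^5; q^5) / (q^5; q^5)\<close> equals
    \<open>1 / J q 5\<close>, and \<open>bilateral_4\<close>, \<open>bilateral_2\<close> convert the
    sums into \<open>mock_4\<close> and \<open>mock_2\<close>.\<close>
  have m: "c * q ^ 3 * (1 / A5 q) / (A5 q * E q) * bilateral_sum 4 q = - c * mock_4 q / (q * J q 5)"
    "c * q * (1 / A5 q) / (A5 q * E q) * bilateral_sum 2 q = - c * mock_2 q / (q * J q 5)" for c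
  proof -
    have "mock_4 q = - (q ^ 4 * bilateral_sum 4 q)" "mock_2 q = - (q ^ 2 * bilateral_sum 2 q)"
      using bilateral_4[OF q] bilateral_2[OF q] by simp_all
    then show "c * q ^ 3 * (1 / A5 q) / (A5 q * E q) * bilateral_sum 4 q = - c * mock_4 q / (q * J q 5)"
      "c * q * (1 / A5 q) / (A5 q * E q) * bilateral_sum 2 q = - c * mock_2 q / (q * J q 5)"
      using nz by (simp_all add: J_A[OF q] field_simps eval_nat_numeral)
  qed
  show ?thesis
    unfolding qpoch_products[OF q] qpoch_q[OF q] qpoch_q_q2[OF q] qpoch_q2[OF q] m
    apply (intro conjI)
    subgoal using v12[of 0] by (simp add: v12_def theta_part_12_0_def nz algebra_simps del: One_nat_def)
    subgoal using v12[of 1] by (simp add: v12_def theta_part_12_1_def nz algebra_simps del: One_nat_def)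
    subgoal using v12[of 2] by (simp add: v12_def theta_part_12_2_def nz algebra_simps del: One_nat_def)
    subgoal using v12[of 3] by (simp add: v12_def theta_part_12_3_def nz algebra_simps del: One_nat_def)
    subgoal using v12[of 4] by (simp add: v12_def theta_part_12_4_def nz algebra_simps del: One_nat_def)
    subgoal using v02[of 0] by (simp add: v02_def theta_part_02_0_def nz algebra_simps del: One_nat_def)
    subgoal using v02[of 1] by (simp add: v02_def theta_part_02_1_def nz algebra_simps del: One_nat_def)
    subgoal using v02[of 2] by (simp add: v02_def theta_part_02_2_def nz algebra_simps del: One_nat_def)
    subgoal using v02[of 3] by (simp add: v02_def theta_part_02_3_def nz algebra_simps del: One_nat_def)
    subgoal using v02[of 4] by (simp add: v02_def theta_part_02_4_def nz algebra_simps del: One_nat_def)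
    done
qed

end
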